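(* There is a randomized (random linear network coding based) algorithm that solves the $k$-token dissemination problem in a dynamic network with $n$ nodes, using messages of size $O(b)$ bits and tokens of size $d$ bits, in $$O\Big(\min\Big\{ \frac{1}{b} \cdot \frac{nkd}{b} + nb,\ \frac{\log n}{b} \cdot \frac{nkd}{b} + n \log n\Big\}\Big)$$ rounds with high probability.
   Context: Dynamic network model: there are $n$ nodes with unique identifiers of $O(\log n)$ bits, and all nodes know $n$ up to a factor of 2. Computation proceeds in synchronous rounds. In each round $t$ an adversary chooses a connected undirected graph $G(t)$ on the nodes. At the beginning of a round each node chooses a message of $O(b)$ bits (where $b\ge \log n$) without knowing its neighbors in $G(t)$ (anonymous broadcast); then every node receives the messages of all its neighbors in $G(t)$. Local computation is unrestricted. The adversary is adaptive: $G(t)$ may depend on all past actions and the current state of the nodes, but not on the random choices nodes make in round $t$. $k$-token dissemination: $k\le n$ tokens of $d\le b$ bits each are distributed to the nodes by the adversary before the first round; the goal is that all nodes learn all $k$ tokens and then terminate (algorithms are Las Vegas, always correct on termination). "With high probability" means with probability at least $1-n^{-c}$ for a constant $c>0$. A network coding algorithm is one whose messages may contain linear combinations of tokens (viewed as vectors over a finite field) together with coefficient headers, rather than individual tokens only. *)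

theory Defs
  imports "HOL-Probability.Probability" "HOL-Library.Z2" "HOL-Library.More_List"
begin

section \<open>Messages\<close>

text \<open>
  Bit strings are lists over the two-element field, so that a token is at the same time a vector
  over this field. Nodes are identified with their unique identifiers.
\<close>

type_synonym bitstring = "bit list"
type_synonym uid = bitstring
type_synonym token = bitstring

text \<open>
  A coded packet carries a linear combination of the blocks of some generation (a list of blocks of
  tokens that are coded together): the name of the generation, the coefficient header and the
  combined vector.
\<close>

datatype packet = Packet (generation: bitstring) (coeffs: "bit list") (payload: "bit list")

text \<open>A message may contain control information, individual tokens and coded packets.\<close>

datatype message = Message (control: bitstring) (plain: "token list") (coded: "packet list")

text \<open>
  The summands 1 charge for delimiters: without them, empty components could carry information
  for free. With them there are at most exponentially many messages of a given size, so the size is,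
  up to a constant factor, the length of a binary encoding.
\<close>

definition message_size :: "message \<Rightarrow> nat" where
  "message_size m = length (control m) + (\<Sum>t\<leftarrow>plain m. 1 + length t)
     + (\<Sum>p\<leftarrow>coded m. 1 + length (generation p) + length (coeffs p) + length (payload p))"

section \<open>Algorithms and executions\<close>

text \<open>
  Local states are encoded as natural numbers; this is no restriction, since a node handles only
  finitely many bits in each round.

  \<^item> \<open>start\<close> gives the initial state from the own identifier, the own estimate of the number of
    nodes and the set of tokens initially held;
  \<^item> \<open>send\<close> randomly chooses the message of the round, together with an intermediate state;
  \<^item> \<open>receive\<close> updates the intermediate state with the multiset of the messages of all neighbours,
    which does not reveal the senders;
  \<^item> \<open>result\<close> is \<open>None\<close> while the node is running and \<open>Some S\<close> if it has terminated with
    output \<open>S\<close>.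
\<close>

record algorithm =
  start :: "uid \<Rightarrow> nat \<Rightarrow> token set \<Rightarrow> nat"
  send :: "nat \<Rightarrow> (message \<times> nat) pmf"
  receive :: "nat \<Rightarrow> message multiset \<Rightarrow> nat"
  result :: "nat \<Rightarrow> token set option"

type_synonym config = "uid \<Rightarrow> nat"
type_synonym graph = "(uid \<times> uid) set"

text \<open>The choices of the nodes in a round: message (if any) and intermediate state.\<close>

type_synonym choice = "uid \<Rightarrow> message option \<times> nat"

text \<open>Per round: configuration at the beginning, choices of the nodes, communication graph.\<close>

type_synonym history = "(config \<times> choice \<times> graph) list"

definition halted :: "algorithm \<Rightarrow> nat \<Rightarrow> bool" where
  "halted A s \<longleftrightarrow> result A s \<noteq> None"

text \<open>A terminated node is silent and keeps its state.\<close>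

definition choices :: "algorithm \<Rightarrow> uid set \<Rightarrow> config \<Rightarrow> choice pmf" where
  "choices A V s = Pi_pmf V (None, 0)
     (\<lambda>v. if halted A (s v) then return_pmf (None, s v)
          else map_pmf (\<lambda>(m, s'). (Some m, s')) (send A (s v)))"

definition inbox :: "choice \<Rightarrow> graph \<Rightarrow> uid \<Rightarrow> message multiset" where
  "inbox x E v = image_mset (\<lambda>u. the (fst (x u))) (mset_set {u. (u, v) \<in> E \<and> fst (x u) \<noteq> None})"

definition deliver :: "algorithm \<Rightarrow> uid set \<Rightarrow> config \<Rightarrow> choice \<Rightarrow> graph \<Rightarrow> config" where
  "deliver A V s x E =
     (\<lambda>v. if v \<in> V \<and> \<not> halted A (s v) then receive A (snd (x v)) (inbox x E v) else s v)"

text \<open>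
  An undirected simple graph is a symmetric irreflexive edge relation. The adversary is a function
  of the complete past and of the current configuration; the graph of a round is therefore
  independent of the random choices made in that round.
\<close>

definition connected_graph :: "uid set \<Rightarrow> graph \<Rightarrow> bool" where
  "connected_graph V E \<longleftrightarrow>
     E \<subseteq> V \<times> V \<and> sym E \<and> irrefl E \<and> (\<forall>u\<in>V. \<forall>v\<in>V. (u, v) \<in> E\<^sup>*)"

type_synonym adversary = "history \<Rightarrow> config \<Rightarrow> graph"

definition is_adversary :: "uid set \<Rightarrow> adversary \<Rightarrow> bool" where
  "is_adversary V adv \<longleftrightarrow> (\<forall>h s. connected_graph V (adv h s))"

primrec execution ::
  "algorithm \<Rightarrow> uid set \<Rightarrow> adversary \<Rightarrow> config \<Rightarrow> nat \<Rightarrow> (history \<times> config) pmf" where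
  "execution A V adv s0 0 = return_pmf ([], s0)"
| "execution A V adv s0 (Suc t) =
     bind_pmf (execution A V adv s0 t) (\<lambda>(h, s).
       map_pmf (\<lambda>x. (h @ [(s, x, adv h s)], deliver A V s x (adv h s))) (choices A V s))"

definition initial :: "algorithm \<Rightarrow> (uid \<Rightarrow> nat) \<Rightarrow> (uid \<Rightarrow> token set) \<Rightarrow> config" where
  "initial A est I = (\<lambda>v. start A v (est v) (I v))"

definition all_halted :: "algorithm \<Rightarrow> uid set \<Rightarrow> config \<Rightarrow> bool" where
  "all_halted A V s \<longleftrightarrow> (\<forall>v\<in>V. halted A (s v))"

section \<open>Token dissemination\<close>

text \<open>
  The identifiers have at most \<open>a * log 2 n\<close> bits, and every node \<open>v\<close> has its own estimate
  \<open>est v\<close> of \<open>n\<close>, correct up to a factor of 2. The \<open>k\<close> tokens are distinct strings of \<open>d\<close> bits;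
  a node may initially hold any number of them, and a token may be held by several nodes.
\<close>

definition dissemination_instance ::
  "real \<Rightarrow> nat \<Rightarrow> nat \<Rightarrow> nat \<Rightarrow> nat \<Rightarrow> uid set \<Rightarrow> (uid \<Rightarrow> nat) \<Rightarrow> (uid \<Rightarrow> token set) \<Rightarrow> bool" where
  "dissemination_instance a n k b d V est I \<longleftrightarrow>
     1 \<le> n \<and> finite V \<and> card V = n \<and> (\<forall>v\<in>V. real (length v) \<le> a * log 2 (real n)) \<and>
     (\<forall>v\<in>V. n \<le> 2 * est v \<and> est v \<le> 2 * n) \<and>
     log 2 (real n) \<le> real b \<and> d \<le> b \<and> k \<le> n \<and>
     (\<forall>v\<in>V. \<forall>t\<in>I v. length t = d) \<and> card (\<Union>v\<in>V. I v) = k"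

definition messages_bounded ::
  "algorithm \<Rightarrow> uid set \<Rightarrow> (uid \<Rightarrow> nat) \<Rightarrow> (uid \<Rightarrow> token set) \<Rightarrow> adversary \<Rightarrow> real \<Rightarrow> bool" where
  "messages_bounded A V est I adv B \<longleftrightarrow>
     (\<forall>t. \<forall>(h, s)\<in>set_pmf (execution A V adv (initial A est I) t).
        \<forall>(s', x, E)\<in>set h. \<forall>v\<in>V. \<forall>m. fst (x v) = Some m \<longrightarrow> real (message_size m) \<le> B)"

text \<open>
  Las Vegas: in every execution, a node that has terminated has output exactly the set of all
  tokens; and all nodes terminate almost surely.
\<close>

definition solves_dissemination ::
  "algorithm \<Rightarrow> uid set \<Rightarrow> (uid \<Rightarrow> nat) \<Rightarrow> (uid \<Rightarrow> token set) \<Rightarrow> adversary \<Rightarrow> bool" where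
  "solves_dissemination A V est I adv \<longleftrightarrow>
     (\<forall>t. \<forall>(h, s)\<in>set_pmf (execution A V adv (initial A est I) t).
        \<forall>v\<in>V. \<forall>S. result A (s v) = Some S \<longrightarrow> S = (\<Union>u\<in>V. I u)) \<and>
     (\<lambda>t. measure_pmf.prob (execution A V adv (initial A est I) t) {(h, s). all_halted A V s})
       \<longlonglongrightarrow> 1"

section \<open>Network coding\<close>

text \<open>
  \<open>src g\<close> is the list of blocks of generation \<open>g\<close>. A block is a list of tokens; as a vector it is
  their concatenation, padded with zeros to the length of the payload.
\<close>

type_synonym blocks = "bitstring \<Rightarrow> token list list"

definition is_combination :: "token list list \<Rightarrow> bit list \<Rightarrow> bit list \<Rightarrow> bool" where
  "is_combination Bs c p \<longleftrightarrow>
     length c = length Bs \<and> (\<forall>B\<in>set Bs. length (concat B) \<le> length p) \<and>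
     (\<forall>j<length p. p ! j = (\<Sum>i<length Bs. c ! i * nth_default 0 (concat (Bs ! i)) j))"

definition heard_headers :: "message set \<Rightarrow> bitstring \<Rightarrow> bit list set" where
  "heard_headers M g = {c. \<exists>m\<in>M. \<exists>p. Packet g c p \<in> set (coded m)}"

text \<open>
  The tokens learned by a node that initially holds \<open>S\<close> and has received the messages \<open>M\<close>: those
  held initially, those received individually, and those obtained by decoding. Block \<open>i\<close> can be
  decoded if some linear combination of the received headers agrees with the \<open>i\<close>-th unit vector
  in every coordinate except possibly those of blocks already known, which can be subtracted.
\<close>

inductive_set learned :: "blocks \<Rightarrow> token set \<Rightarrow> message set \<Rightarrow> token set"
  for src :: blocks and S :: "token set" and M :: "message set" where
  own: "t \<in> S \<Longrightarrow> t \<in> learned src S M"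
| received: "m \<in> M \<Longrightarrow> t \<in> set (plain m) \<Longrightarrow> t \<in> learned src S M"
| decoded: "i < length (src g) \<Longrightarrow>
    \<forall>j<length (src g). (\<Sum>c\<in>heard_headers M g. w c * c ! j) = (if j = i then 1 else 0)
       \<or> (\<forall>t'\<in>set (src g ! j). t' \<in> learned src S M) \<Longrightarrow>
    t \<in> set (src g ! i) \<Longrightarrow> t \<in> learned src S M"

text \<open>
  The combinations that a node can form: linear combinations of packets it has received and of
  blocks it knows.
\<close>

definition can_combine :: "blocks \<Rightarrow> token set \<Rightarrow> message set \<Rightarrow> bitstring \<Rightarrow> bit list \<Rightarrow> bool" where
  "can_combine src S M g c \<longleftrightarrow>
     (\<exists>w. \<forall>j<length (src g). (\<Sum>c'\<in>heard_headers M g. w c' * c' ! j) = c ! j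
        \<or> set (src g ! j) \<subseteq> learned src S M)"

definition heard :: "history \<Rightarrow> uid \<Rightarrow> message set" where
  "heard h v = {m. \<exists>(s, x, E)\<in>set h. \<exists>u. (u, v) \<in> E \<and> fst (x u) = Some m}"

text \<open>
  Every token sent individually has been learned by its sender; every coded packet is the linear
  combination, with the coefficients in its header, of blocks of tokens, and is formed by its sender
  from received packets and known blocks; and nodes only output tokens they have learned in this
  way. Only the control part of messages is unrestricted. Pure token forwarding is the special case
  without coded packets.
\<close>

definition network_coding ::
  "algorithm \<Rightarrow> uid set \<Rightarrow> (uid \<Rightarrow> nat) \<Rightarrow> (uid \<Rightarrow> token set) \<Rightarrow> adversary \<Rightarrow> bool" where
  "network_coding A V est I adv \<longleftrightarrow>
     (\<forall>t. \<forall>(h, s)\<in>set_pmf (execution A V adv (initial A est I) t). \<exists>src.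
        (\<forall>g. \<forall>B\<in>set (src g). set B \<subseteq> (\<Union>u\<in>V. I u)) \<and>
        (\<forall>r<length h. \<forall>v\<in>V. \<forall>m. fst (fst (snd (h ! r)) v) = Some m \<longrightarrow>
           set (plain m) \<subseteq> learned src (I v) (heard (take r h) v) \<and>
           (\<forall>g c p. Packet g c p \<in> set (coded m) \<longrightarrow>
              is_combination (src g) c p \<and> can_combine src (I v) (heard (take r h) v) g c)) \<and>
        (\<forall>v\<in>V. \<forall>S. result A (s v) = Some S \<longrightarrow> S \<subseteq> learned src (I v) (heard h v)))"

end

theory Submission
  imports Defs "HOL-Library.Log_Nat"
begin

text \<open>
  The nodes first agree on an upper bound \<open>N = O(n)\<close> and then proceed in cycles of \<open>O(n)\<close> rounds. A
  token is active until all nodes are known to have it. In a cycle, a generation of \<open>O(b)\<close> blocks of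
  \<open>b div d\<close> active tokens is nominated: up to \<open>b\<close> blocks of a leader, a node with most active tokens,
  and \<open>b div log n\<close> random blocks, chosen by flooding maximal random priorities. It is broadcast by
  random linear network coding, since each vector orthogonal to all headers that a node has received
  disappears with constant probability at a node on the boundary of the set of nodes that already see
  it. A verification makes the algorithm Las Vegas.

  In every second group of \<open>R = O(log n)\<close> cycles, each cycle begins with a gathering phase in which
  the nodes broadcast random blocks of their active tokens. It spreads the tokens, whatever the
  adversary does: either they have many holders afterwards or some nodes have many tokens.

  There are two ways to bound the number of cycles. A gathering phase provides, with constant
  probability, a leader with \<open>min (sqrt (k m)) k / 4\<close> of the \<open>k\<close> active tokens, \<open>m\<close> being the number
  of tokens in a block; by summation, this gives \<open>O(k / (b m) + b)\<close> cycles in expectation. On the other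
  hand, a full gathering group makes all tokens so frequent that the \<open>R\<close> following cycles
  remove \<open>b m\<close> tokens by means of random blocks with high probability: this gives
  \<open>O(log n (k / (b m) + 1))\<close> cycles. All estimates are drift arguments for potentials
  along the Markov chain of histories, so that the adaptivity of the adversary is harmless.
\<close>

text \<open>A packet saves communication only if its sender knows whole blocks, but an adaptive
  adversary can defeat any attempt to collect tokens at a prescribed node. The leader bound
  therefore needs no target. If no node had more than M tokens, every holder would send a given
  token with probability about m / M; since each round has a boundary edge, O(n) rounds would give
  each of the k tokens about n m / M holders. Once M^2 < k m, this exceeds the total capacity n M.
  Hence the sqrt (k m). Removing that many tokens per cycle takes about the sum of 1 / sqrt (j m)
  over j up to k, that is, sqrt (k / m) cycles, and the arithmetic-geometric mean turns this into k
  / (b m) + b.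

  The logarithm in the other bound comes from the register: each nomination costs O(log n) bits, so
  only b / log n independent random blocks can be nominated in one message.

  A phase has 64 N rounds since coding needs a union bound over up to 2^(2 N) vectors, and the
  potential of one vector is at most 2^n; a round gains a factor 3/4.\<close>

declare add_bit_eq_xor [simp del] mult_bit_eq_and [simp del]

section \<open>Encodings\<close>

primrec bin :: "nat \<Rightarrow> nat \<Rightarrow> bitstring" where
  "bin 0 x = []"
| "bin (Suc w) x = of_bool (odd x) # bin w (x div 2)"

primrec val :: "bitstring \<Rightarrow> nat" where
  "val [] = 0"
| "val (c # cs) = of_bool (c = 1) + 2 * val cs"

lemma length_bin [simp]: "length (bin w x) = w"
  by (induction w arbitrary: x) auto

lemma val_bin: "x < 2 ^ w \<Longrightarrow> val (bin w x) = x"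
proof (induction w arbitrary: x)
  case (Suc w)
  then have "val (bin w (x div 2)) = x div 2" by simp
  then show ?case by simp
qed simp

text \<open>The empty string has code 1, so a leading one marks the end of the string: strings of
  different lengths get different codes, and 0 is left free to mean that nothing is
  nominated.\<close>

primrec code :: "uid \<Rightarrow> nat" where
  "code [] = 1"
| "code (c # cs) = of_bool (c = 1) + 2 * code cs"

lemma code_pos: "0 < code u"
  by (induction u) auto

lemma code_less: "code u < 2 ^ Suc (length u)"
  by (induction u) auto

lemma inj_code: "inj code"
proof (rule injI)
  show "code u = code v \<Longrightarrow> u = v" for u v
  proof (induction u arbitrary: v)
    case Nil
    then show ?case using code_pos[of "tl v"] by (cases v) (auto simp: of_bool_def split: if_splits)
  next
    case (Cons c cs)
    show ?case
    proof (cases v)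
      case Nil
      then show ?thesis using Cons.prems code_pos[of cs] by (auto simp: of_bool_def split: if_splits)
    next
      case (Cons e es)
      have "code cs = code es \<and> (c = 1 \<longleftrightarrow> e = 1)"
        using Cons.prems Cons by (auto simp: of_bool_def split: if_splits) presburger+
      then show ?thesis using Cons.IH Cons by (cases c; cases e) auto
    qed
  qed
qed

text \<open>Node states are encoded as natural numbers and must form a countable type; finite sets
  are therefore stored as lists in an arbitrary fixed order.\<close>

definition lst :: "'a set \<Rightarrow> 'a list" where
  "lst S = (SOME xs. set xs = S \<and> distinct xs)"

lemma lst: "finite S \<Longrightarrow> set (lst S) = S \<and> distinct (lst S)"
  unfolding lst_def by (rule someI_ex) (rule finite_distinct_list)

lemmas set_lst [simp] = lst[THEN conjunct1] and distinct_lst [simp] = lst[THEN conjunct2]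

section \<open>Linear combinations over the two-element field\<close>

definition lincomb :: "nat \<Rightarrow> bit list \<Rightarrow> bit list list \<Rightarrow> bit list" where
  "lincomb l w cs = map (\<lambda>j. \<Sum>i<length cs. w ! i * (cs ! i) ! j) [0..<l]"

definition unit_vec :: "nat \<Rightarrow> nat \<Rightarrow> bit list" where
  "unit_vec h i = map (\<lambda>j. of_bool (j = i)) [0..<h]"

definition dot :: "nat \<Rightarrow> bit list \<Rightarrow> bit list \<Rightarrow> bit" where
  "dot h c u = (\<Sum>j<h. c ! j * u ! j)"

lemma length_lincomb [simp]: "length (lincomb l w cs) = l"
  by (simp add: lincomb_def)

lemma nth_lincomb: "j < l \<Longrightarrow> lincomb l w cs ! j = (\<Sum>i<length cs. w ! i * (cs ! i) ! j)"
  by (simp add: lincomb_def)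

lemma length_unit_vec [simp]: "length (unit_vec h i) = h"
  by (simp add: unit_vec_def)

lemma nth_unit_vec [simp]: "j < h \<Longrightarrow> unit_vec h i ! j = of_bool (j = i)"
  by (simp add: unit_vec_def)

lemma dot_unit_vec: "i < h \<Longrightarrow> dot h (unit_vec h i) u = u ! i"
  by (simp add: dot_def of_bool_def if_distrib[where f = "\<lambda>x. x * _"] cong: if_cong)

lemma dot_lincomb: "dot h (lincomb h w cs) u = (\<Sum>i<length cs. w ! i * dot h (cs ! i) u)"
  unfolding dot_def
  by (simp add: nth_lincomb sum_distrib_left sum_distrib_right mult.assoc) (rule sum.swap)

lemma bit_add_self [simp]: "(x::bit) + x = 0"
  by (cases x) auto

text \<open>Duality: a vector outside the span of \<open>cs\<close> is separated from it by a functional. Adding a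
  vector \<open>c\<close> to \<open>cs\<close>, one combines the functionals separating \<open>e\<close> and \<open>e + c\<close>.\<close>

lemma separation:
  assumes "\<And>c. c \<in> set cs \<Longrightarrow> length c = h" "length e = h"
  shows "(\<exists>w. length w = length cs \<and> lincomb h w cs = e) \<or>
         (\<exists>u. length u = h \<and> (\<forall>c\<in>set cs. dot h c u = 0) \<and> dot h e u = 1)"
  using assms
proof (induction cs arbitrary: e)
  case Nil
  show ?case
  proof (cases "e = replicate h 0")
    case True
    then have "lincomb h [] [] = e" by (simp add: lincomb_def map_replicate_const)
    then show ?thesis by fastforce
  next
    case False
    then obtain i where i: "i < h" "e ! i \<noteq> 0"
      using Nil.prems(2) by (metis length_replicate nth_equalityI nth_replicate)
    have "dot h e (unit_vec h i) = e ! i"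
      using i by (simp add: dot_def of_bool_def if_distrib[where f = "\<lambda>x. _ * x"] cong: if_cong)
    then show ?thesis using i by (intro disjI2 exI[of _ "unit_vec h i"]) auto
  qed
next
  case (Cons c cs)
  define e' where "e' = map (\<lambda>j. e ! j + c ! j) [0..<h]"
  have dot_e': "dot h e' u = dot h e u + dot h c u" for u
    by (simp add: dot_def e'_def distrib_right sum.distrib)
  have ext: "lincomb h (x # w) (c # cs) = map (\<lambda>j. x * c ! j + lincomb h w cs ! j) [0..<h]" for x w
    by (simp add: lincomb_def sum.lessThan_Suc_shift del: sum.lessThan_Suc)
  have lc: "length c = h" "\<And>c. c \<in> set cs \<Longrightarrow> length c = h" "length e = h" "length e' = h"
    using Cons.prems by (auto simp: e'_def)
  consider w where "length w = length cs" "lincomb h w cs = e"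
    | w where "length w = length cs" "lincomb h w cs = e'"
    | u u' where "length u = h" "\<forall>c\<in>set cs. dot h c u = 0" "dot h e u = 1"
        "length u' = h" "\<forall>c\<in>set cs. dot h c u' = 0" "dot h e' u' = 1"
    using Cons.IH[OF lc(2) lc(3)] Cons.IH[OF lc(2) lc(4)] by blast
  then show ?case
  proof cases
    case 1
    have "lincomb h (0 # w) (c # cs) = e"
      unfolding ext 1(2) by (rule nth_equalityI) (use lc in auto)
    then show ?thesis using 1 by (intro disjI1 exI[of _ "0 # w"]) auto
  next
    case 2
    have "lincomb h (1 # w) (c # cs) = e"
      unfolding ext 2(2) by (rule nth_equalityI) (use lc in \<open>auto simp: e'_def algebra_simps\<close>)
    then show ?thesis using 2 by (intro disjI1 exI[of _ "1 # w"]) auto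
  next
    case 3
    \<comment> \<open>Here \<open>u\<close> separates \<open>e\<close> and \<open>u'\<close>
      separates \<open>e + c\<close>. If \<open>u\<close> does not vanish on \<open>c\<close>, then
      either \<open>u'\<close> vanishes on \<open>c\<close> and separates \<open>e\<close>, or
      neither vanishes on \<open>c\<close> and their sum does the job.\<close>
    define v where "v = map (\<lambda>j. u ! j + u' ! j) [0..<h]"
    have dv: "dot h x v = dot h x u + dot h x u'" for x
      by (simp add: dot_def v_def distrib_left sum.distrib)
    have "\<exists>y\<in>{u, u', v}. dot h c y = 0 \<and> dot h e y = 1"
      using 3(3,6) dv[of c] dv[of e] dot_e'[of u']
      by (cases "dot h c u"; cases "dot h c u'"; cases "dot h e u'") auto
    moreover have "\<forall>y\<in>{u, u', v}. length y = h \<and> (\<forall>c\<in>set cs. dot h c y = 0)"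
      using 3 by (auto simp: v_def[symmetric] dv) (simp add: v_def)
    ultimately show ?thesis by (intro disjI2) auto
  qed
qed

lemma card_bit_lists: "finite {w :: bit list. length w = l}" "card {w :: bit list. length w = l} = 2 ^ l"
proof -
  have U: "(UNIV :: bit set) = {0, 1}" using bit.exhaust by blast
  have "{w :: bit list. length w = l} = {xs. set xs \<subseteq> UNIV \<and> length xs = l}" by auto
  moreover have "finite (UNIV :: bit set)" "card (UNIV :: bit set) = 2"
    unfolding U by (simp_all add: card_insert_if)
  ultimately show "finite {w :: bit list. length w = l}" "card {w :: bit list. length w = l} = 2 ^ l"
    using finite_lists_length_eq[of "UNIV :: bit set" l] card_lists_length_eq[of "UNIV :: bit set" l]
    by simp_all
qed

text \<open>Flipping the coefficient of a vector seen by \<open>u\<close> flips the value of \<open>u\<close> on the combination.\<close>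

lemma prob_lincomb:
  assumes "c \<in> set cs" "dot h c u = 1"
  shows "measure_pmf.prob (pmf_of_set {w. length w = length cs}) {w. dot h (lincomb h w cs) u = 1} = 1 / 2"
proof -
  let ?W = "{w :: bit list. length w = length cs}"
  obtain i where i: "i < length cs" "cs ! i = c" using assms(1) by (auto simp: in_set_conv_nth)
  define flip where "flip w = w[i := w ! i + 1]" for w :: "bit list"
  have fl: "dot h (lincomb h (flip w) cs) u = dot h (lincomb h w cs) u + 1" if "w \<in> ?W" for w
  proof -
    have "dot h (lincomb h (flip w) cs) u = (\<Sum>j<length cs. w ! j * dot h (cs ! j) u + of_bool (j = i))"
      unfolding dot_lincomb
      by (rule sum.cong) (use that i assms(2) in \<open>auto simp: flip_def nth_list_update distrib_right\<close>)
    then show ?thesis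
      using i(1) by (simp add: sum.distrib dot_lincomb of_bool_def)
  qed
  have ff: "flip (flip w) = w" if "w \<in> ?W" for w
  proof -
    have "w ! i + 1 + 1 = w ! i" by (cases "w ! i") auto
    then show ?thesis using that i by (simp add: flip_def del: add.assoc)
  qed
  define P where "P = {w \<in> ?W. dot h (lincomb h w cs) u = 1}"
  define Q where "Q = {w \<in> ?W. dot h (lincomb h w cs) u = 0}"
  have "bij_betw flip P Q"
    by (rule bij_betwI[where g = flip]) (auto simp: P_def Q_def fl ff, auto simp: flip_def)
  then have "card P = card Q" by (rule bij_betw_same_card)
  moreover have "?W = P \<union> Q" "P \<inter> Q = {}" by (auto simp: P_def Q_def)
  moreover have "finite P" "finite Q" using card_bit_lists(1) by (auto simp: P_def Q_def)
  ultimately have c: "card ?W = 2 * card P" by (metis card_Un_disjoint mult_2)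
  have "0 < card ?W" unfolding card_bit_lists by simp
  then have "0 < card P" "?W \<noteq> {}" using c by (auto simp only: card.empty)
  moreover have "?W \<inter> {w. dot h (lincomb h w cs) u = 1} = P" by (auto simp: P_def)
  ultimately show ?thesis
    using card_bit_lists(1) c by (simp add: measure_pmf_of_set del: card_bit_lists)
qed

section \<open>Drift of adaptive processes\<close>

primrec run :: "('z \<Rightarrow> 'z pmf) \<Rightarrow> nat \<Rightarrow> 'z \<Rightarrow> 'z pmf" where
  "run K 0 z = return_pmf z"
| "run K (Suc j) z = bind_pmf (run K j z) K"

lemma run_add: "run K (i + j) z = bind_pmf (run K i z) (run K j)"
  by (induction j) (simp_all add: bind_assoc_pmf bind_return_pmf')

lemma nn_integral_mono_pmf:
  "(\<And>x. x \<in> set_pmf M \<Longrightarrow> f x \<le> g x) \<Longrightarrow> (\<integral>\<^sup>+x. f x \<partial>measure_pmf M) \<le> (\<integral>\<^sup>+x. g x \<partial>measure_pmf M)"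
  by (rule nn_integral_mono_AE) (simp add: AE_measure_pmf_iff)

text \<open>Conditioning on one reachable state at a time leaves no independence to be assumed, and
  with values in \<open>ennreal\<close> the induction needs no integrability.\<close>

lemma drift:
  assumes "\<And>j z'. j < J \<Longrightarrow> z' \<in> set_pmf (run K j z) \<Longrightarrow>
    (\<integral>\<^sup>+z''. f (Suc j) z'' \<partial>K z') \<le> r * f j z'"
  shows "(\<integral>\<^sup>+z'. f J z' \<partial>run K J z) \<le> (r::ennreal) ^ J * f 0 z"
  using assms
proof (induction J)
  case (Suc J)
  have "(\<integral>\<^sup>+z'. f (Suc J) z' \<partial>run K (Suc J) z) \<le> (\<integral>\<^sup>+z'. r * f J z' \<partial>run K J z)"
    using Suc.prems by (auto intro!: nn_integral_mono_pmf)
  also have "\<dots> = r * (\<integral>\<^sup>+z'. f J z' \<partial>run K J z)" by (simp add: nn_integral_cmult)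
  also have "\<dots> \<le> r * (r ^ J * f 0 z)"
    using Suc by (intro mult_left_mono) auto
  finally show ?case by (simp add: mult.assoc)
qed simp

lemma nn_integral_two_valued:
  assumes "0 \<le> x" "0 \<le> y"
  shows "(\<integral>\<^sup>+z. ennreal (if z \<in> G then x else y) \<partial>measure_pmf M)
    = ennreal (x * measure_pmf.prob M G + y * (1 - measure_pmf.prob M G))"
proof -
  have "(\<integral>\<^sup>+z. ennreal (if z \<in> G then x else y) \<partial>measure_pmf M)
      = (\<integral>\<^sup>+z. ennreal x * indicator G z + ennreal y * indicator (- G) z \<partial>measure_pmf M)"
    by (intro nn_integral_cong) (auto split: split_indicator)
  also have "\<dots> = ennreal x * measure_pmf.prob M G + ennreal y * measure_pmf.prob M (- G)"
    by (simp add: nn_integral_add nn_integral_cmult measure_pmf.emeasure_eq_measure)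
  also have "measure_pmf.prob M (- G) = 1 - measure_pmf.prob M G"
    using measure_pmf.prob_compl[of G M] by (simp add: Compl_eq_Diff_UNIV)
  finally show ?thesis
    using assms by (simp add: ennreal_mult[symmetric] ennreal_plus[symmetric] del: ennreal_plus)
qed

lemma boundary_edge:
  assumes "connected_graph V E" "S \<subseteq> V" "S \<noteq> {}" "S \<noteq> V"
  obtains u v where "u \<in> S" "v \<in> V - S" "(u, v) \<in> E"
proof -
  obtain u v where uv: "u \<in> S" "v \<in> V - S" using assms by blast
  then have "(u, v) \<in> E\<^sup>*" using assms unfolding connected_graph_def by blast
  then have "v \<notin> S \<Longrightarrow> \<exists>u\<in>S. \<exists>v'. v' \<notin> S \<and> (u, v') \<in> E"
    by (induction rule: rtrancl_induct) (use uv in blast)+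
  then show ?thesis using that uv assms unfolding connected_graph_def by blast
qed

text \<open>The potential of a set of informed nodes with \<open>c\<close> elements, \<open>n0\<close> being the target size.\<close>

definition gap :: "nat \<Rightarrow> nat \<Rightarrow> ennreal" where
  "gap n0 c = (if n0 \<le> c then 0 else 2 ^ (n0 - c))"

lemma gap_antimono: "c \<le> c' \<Longrightarrow> gap n0 c' \<le> gap n0 c"
  by (auto simp: gap_def intro!: power_increasing)

lemma gap_ge_1: "c < n0 \<Longrightarrow> 1 \<le> gap n0 c"
  by (simp add: gap_def)

lemma gap_le: "gap n0 c \<le> 2 ^ n0"
  by (auto simp: gap_def intro!: power_increasing)

lemma gap_Suc: "gap n0 (Suc c) \<le> ennreal (1 / 2) * gap n0 c"
proof (cases "n0 \<le> Suc c")
  case False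
  then have "n0 - c = Suc (n0 - Suc c)" by simp
  moreover have "ennreal (1 / 2) * (2 * z) = z" for z :: ennreal
  proof -
    have "ennreal (1 / 2) * 2 = ennreal (1 / 2) * ennreal 2" by simp
    also have "\<dots> = 1" by (subst ennreal_mult[symmetric]) auto
    finally show ?thesis by (simp add: mult.assoc[symmetric])
  qed
  ultimately show ?thesis using False by (simp add: gap_def)
qed (simp add: gap_def)

lemma prob_Pi_pmf_component:
  assumes "finite V" "u \<in> V"
  shows "measure_pmf.prob (Pi_pmf V dflt ps) {y. y u \<in> G} = measure_pmf.prob (ps u) G"
proof -
  have "measure_pmf.prob (ps u) G = measure_pmf.prob (map_pmf (\<lambda>y. y u) (Pi_pmf V dflt ps)) G"
    using assms by (simp add: Pi_pmf_component)
  then show ?thesis by (simp add: vimage_def)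
qed

text \<open>The graph is fixed before the random choices, so one boundary edge can be chosen in
  advance. With probability at least \<open>p\<close> its informed end sends something useful, the
  set grows, and the potential is halved; otherwise it does not increase. This gives the factor
  \<open>1 - p / 2\<close>.\<close>

lemma spread_step:
  assumes "finite V" "connected_graph V E" "S \<subseteq> V" "S \<noteq> {}" "n0 \<le> card V"
    and p: "\<And>u. u \<in> S \<Longrightarrow> p \<le> measure_pmf.prob (ps u) (good u)" "0 \<le> p" "p \<le> 1"
    and S': "\<And>y. y \<in> set_pmf (Pi_pmf V dflt ps) \<Longrightarrow> S \<subseteq> S' y \<and> finite (S' y)"
      "\<And>y u v. y \<in> set_pmf (Pi_pmf V dflt ps) \<Longrightarrow> u \<in> S \<Longrightarrow> v \<in> V \<Longrightarrow> (u, v) \<in> E \<Longrightarrow> y u \<in> good u \<Longrightarrow> v \<in> S' y"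
  shows "(\<integral>\<^sup>+y. gap n0 (card (S' y)) \<partial>Pi_pmf V dflt ps) \<le> ennreal (1 - p / 2) * gap n0 (card S)"
proof (cases "n0 \<le> card S")
  case True
  have "(\<integral>\<^sup>+y. gap n0 (card (S' y)) \<partial>Pi_pmf V dflt ps) \<le> (\<integral>\<^sup>+y. gap n0 (card S) \<partial>Pi_pmf V dflt ps)"
    by (intro nn_integral_mono_pmf gap_antimono card_mono) (use S' in auto)
  then show ?thesis using True by (simp add: gap_def)
next
  case False
  then have "S \<noteq> V" using assms(5) by auto
  then obtain u v where uv: "u \<in> S" "v \<in> V - S" "(u, v) \<in> E"
    using boundary_edge assms by metis
  let ?M = "Pi_pmf V dflt ps"
  let ?G = "{y. y u \<in> good u}"
  have "(\<integral>\<^sup>+y. gap n0 (card (S' y)) \<partial>?M) \<le> (\<integral>\<^sup>+y. ennreal (if y \<in> ?G then 1 / 2 else 1) * gap n0 (card S) \<partial>?M)"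
  proof (rule nn_integral_mono_pmf)
    fix y assume y: "y \<in> set_pmf ?M"
    show "gap n0 (card (S' y)) \<le> ennreal (if y \<in> ?G then 1 / 2 else 1) * gap n0 (card S)"
    proof (cases "y \<in> ?G")
      case True
      then have "insert v S \<subseteq> S' y" using S'(1)[OF y] S'(2)[OF y] uv by blast
      then have "card (insert v S) \<le> card (S' y)" using S'(1)[OF y] by (intro card_mono) auto
      moreover have "card (insert v S) = Suc (card S)"
        using uv assms(1,3) by (subst card_insert_disjoint) (auto intro: finite_subset)
      ultimately have "gap n0 (card (S' y)) \<le> gap n0 (Suc (card S))" by (simp add: gap_antimono)
      then show ?thesis using gap_Suc True order.trans by fastforce
    next
      case False
      then show ?thesis using S'(1)[OF y] by (simp add: gap_antimono card_mono)
    qed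
  qed
  also have "\<dots> = ennreal (1 / 2 * measure_pmf.prob ?M ?G + 1 * (1 - measure_pmf.prob ?M ?G)) * gap n0 (card S)"
    by (subst nn_integral_multc) (simp_all add: nn_integral_two_valued del: mem_Collect_eq)
  also have "\<dots> \<le> ennreal (1 - p / 2) * gap n0 (card S)"
    using p(1)[OF uv(1)] uv assms(3) prob_Pi_pmf_component[OF assms(1), of u dflt ps "good u"]
    by (intro mult_right_mono ennreal_leI) auto
  finally show ?thesis .
qed

section \<open>Sampling a block by maximal random priority\<close>

lemma prob_two_components:
  assumes "finite V" "u \<in> V" "v \<in> V" "u \<noteq> v"
  shows "measure_pmf.prob (Pi_pmf V dflt ps) {y. y u \<in> A \<and> y v \<in> C}
    = measure_pmf.prob (ps u) A * measure_pmf.prob (ps v) C"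
proof -
  let ?B = "\<lambda>x. if x = u then A else if x = v then C else UNIV"
  have "{y. y u \<in> A \<and> y v \<in> C} = Pi V ?B" using assms by (auto simp: Pi_def)
  also have "measure_pmf.prob (Pi_pmf V dflt ps) \<dots> = (\<Prod>x\<in>V. measure_pmf.prob (ps x) (?B x))"
    using assms(1) by (rule measure_Pi_pmf_Pi)
  also have "\<dots> = (\<Prod>x\<in>{u, v}. measure_pmf.prob (ps x) (?B x))"
    using assms by (intro prod.mono_neutral_right) auto
  finally show ?thesis using assms(4) by simp
qed

text \<open>Node \<open>u\<close> draws a priority below \<open>P\<close> and an index below \<open>N\<close>; it takes part if the index belongs
  to one of its \<open>B u\<close> blocks. A given block wins if its priority is among the \<open>x\<close> largest and no other
  node takes part with such a priority; the latter is bounded by the union bound.\<close>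

lemma prob_winner_threshold:
  fixes V :: "'v set" and B :: "'v \<Rightarrow> nat"
  assumes "finite V" "S \<subseteq> V" "\<And>v. v \<in> V \<Longrightarrow> B v \<le> N" "\<And>u. u \<in> S \<Longrightarrow> idx u < B u"
    and "x \<le> P" "0 < N" "0 < P" "2 * x * (\<Sum>v\<in>V. B v) \<le> P * N"
  shows "real (card S) * x / (2 * P * N) \<le>
    measure_pmf.prob (Pi_pmf V dflt (\<lambda>_. pmf_of_set ({..<P} \<times> {..<N})))
      {y. \<exists>u\<in>S. snd (y u) = idx u \<and> (\<forall>v\<in>V - {u}. snd (y v) < B v \<longrightarrow> fst (y v) < fst (y u))}"
    (is "_ \<le> measure_pmf.prob ?M ?E")
proof -
  have fS: "finite S" using assms finite_subset by blast
  let ?U = "pmf_of_set ({..<P} \<times> {..<N})"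
  define A where "A u = {P - x..<P} \<times> {idx u}" for u
  define C where "C v = {P - x..<P} \<times> {..<B v}" for v
  have ne: "{..<P} \<times> {..<N} \<noteq> {}" using assms by auto
  have pA: "measure_pmf.prob ?U (A u) = x / (P * N)" if "u \<in> S" for u
  proof -
    have "{..<P} \<times> {..<N} \<inter> A u = A u"
      using that assms(2-5) unfolding A_def by (force simp: less_le_trans)
    then show ?thesis using ne assms(5) by (simp add: measure_pmf_of_set A_def)
  qed
  have pC: "measure_pmf.prob ?U (C v) = x * B v / (P * N)" if "v \<in> V" for v
  proof -
    have "{..<P} \<times> {..<N} \<inter> C v = C v"
      using that assms(3) unfolding C_def by (force simp: less_le_trans)
    then show ?thesis using ne assms(5) by (simp add: measure_pmf_of_set C_def)
  qed
  have sub: "A u \<subseteq> C u" if "u \<in> S" for u using assms(4)[OF that] by (auto simp: A_def C_def)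
  define ev where "ev u = {y :: 'v \<Rightarrow> nat \<times> nat. y u \<in> A u}" for u
  define cl where "cl u v = {y :: 'v \<Rightarrow> nat \<times> nat. y u \<in> A u \<and> y v \<in> C v}" for u v
  \<comment> \<open>A pointwise Bonferroni inequality. With a clean winner, no other event
    \<open>ev u'\<close> can occur and the sum is at most 1; without one, every \<open>ev u\<close>
    that occurs is cancelled by some clash \<open>cl u v\<close>.\<close>
  have point: "(\<Sum>u\<in>S. indicat_real (ev u) y - (\<Sum>v\<in>V - {u}. indicat_real (cl u v) y)) \<le> indicat_real ?E y"
    if y: "y \<in> set_pmf ?M" for y
  proof (cases "\<exists>u\<in>S. y \<in> ev u \<and> (\<forall>v\<in>V - {u}. y v \<notin> C v)")
    case True
    then obtain u where u: "u \<in> S" "y \<in> ev u" "\<forall>v\<in>V - {u}. y v \<notin> C v" by blast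
    have yV: "y v \<in> {..<P} \<times> {..<N}" if "v \<in> V" for v
    proof -
      have "y v \<in> set_pmf ?U"
        using y assms(1) that by (simp add: set_Pi_pmf PiE_dflt_def del: set_pmf_of_set)
      then show ?thesis using ne by simp
    qed
    have "y \<in> ?E"
    proof (clarsimp, intro bexI conjI ballI impI)
      show "u \<in> S" "snd (y u) = idx u" using u by (auto simp: ev_def A_def)
      fix v assume v: "v \<in> V - {u}" "snd (y v) < B v"
      then have "y v \<notin> C v" "y v \<in> {..<P} \<times> {..<N}" using u yV by auto
      then show "fst (y v) < fst (y u)"
        using v u(2) by (auto simp: C_def ev_def A_def mem_Times_iff)
    qed
    moreover have "y \<notin> ev u'" if "u' \<in> S" "u' \<noteq> u" for u'
      using u(3) that sub assms(2) by (auto simp: ev_def)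
    then have "(\<Sum>u'\<in>S. indicat_real (ev u') y) = (\<Sum>u'\<in>S. if u' = u then 1 else 0)"
      using u by (intro sum.cong) auto
    moreover have "\<dots> = 1" using u fS by simp
    moreover have "(\<Sum>u\<in>S. indicat_real (ev u) y - (\<Sum>v\<in>V - {u}. indicat_real (cl u v) y))
        \<le> (\<Sum>u'\<in>S. indicat_real (ev u') y)"
      by (intro sum_mono) (simp add: sum_nonneg)
    ultimately show ?thesis by simp
  next
    case False
    have "indicat_real (ev u) y - (\<Sum>v\<in>V - {u}. indicat_real (cl u v) y) \<le> 0" if u: "u \<in> S" for u
    proof (cases "y \<in> ev u")
      case True
      then obtain v where v: "v \<in> V - {u}" "y \<in> cl u v" using False u by (auto simp: cl_def ev_def)
      have "indicat_real (cl u v) y \<le> (\<Sum>v\<in>V - {u}. indicat_real (cl u v) y)"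
        using v assms(1) by (intro member_le_sum) auto
      moreover have "indicat_real (ev u) y = 1" "indicat_real (cl u v) y = 1" using True v by auto
      ultimately show ?thesis by linarith
    qed (simp add: sum_nonneg)
    then have "(\<Sum>u\<in>S. indicat_real (ev u) y - (\<Sum>v\<in>V - {u}. indicat_real (cl u v) y)) \<le> 0"
      by (intro sum_nonpos)
    then show ?thesis by (meson indicator_pos_le order.trans)
  qed
  have int: "integrable ?M (indicat_real X)"
      "integrable ?M (\<lambda>y. \<Sum>v\<in>V - {u}. indicat_real (cl u v) y)"
      "integrable ?M (\<lambda>y. indicat_real (ev u) y - (\<Sum>v\<in>V - {u}. indicat_real (cl u v) y))"
      "integrable ?M (\<lambda>y. \<Sum>u\<in>S. indicat_real (ev u) y - (\<Sum>v\<in>V - {u}. indicat_real (cl u v) y))" for X u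
  proof -
    show 1: "integrable ?M (indicat_real X)" for X
      by (rule measure_pmf.integrable_const_bound[where B = 1]) auto
    show 2: "integrable ?M (\<lambda>y. \<Sum>v\<in>V - {u}. indicat_real (cl u v) y)" for u
      by (intro Bochner_Integration.integrable_sum 1)
    show 3: "integrable ?M (\<lambda>y. indicat_real (ev u) y - (\<Sum>v\<in>V - {u}. indicat_real (cl u v) y))" for u
      by (intro Bochner_Integration.integrable_diff 1 2)
    show "integrable ?M (\<lambda>y. \<Sum>u\<in>S. indicat_real (ev u) y - (\<Sum>v\<in>V - {u}. indicat_real (cl u v) y))"
      by (intro Bochner_Integration.integrable_sum 3)
  qed
  have "real (card S) * x / (2 * P * N) \<le> (\<Sum>u\<in>S. x / (P * N) - (\<Sum>v\<in>V - {u}. x / (P * N) * (x * B v / (P * N))))"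
  proof -
    have "x / (2 * P * N) \<le> x / (P * N) - (\<Sum>v\<in>V - {u}. x / (P * N) * (x * B v / (P * N)))" for u
    proof -
      have "(\<Sum>v\<in>V - {u}. x * B v / (P * N)) \<le> (\<Sum>v\<in>V. x * B v / (P * N))"
        using assms(1) by (intro sum_mono2) auto
      also have "\<dots> = x * real (\<Sum>v\<in>V. B v) / (P * N)"
        by (simp add: sum_distrib_left sum_divide_distrib)
      also have "\<dots> \<le> 1 / 2"
      proof -
        have "real (2 * x * (\<Sum>v\<in>V. B v)) \<le> real (P * N)" using assms(8) of_nat_le_iff by blast
        then show ?thesis using assms(6,7) by (simp add: field_simps)
      qed
      finally have "x / (P * N) * (\<Sum>v\<in>V - {u}. x * B v / (P * N)) \<le> x / (P * N) * (1 / 2)"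
        by (intro mult_left_mono) auto
      moreover have "(\<Sum>v\<in>V - {u}. x / (P * N) * (x * B v / (P * N)))
          = x / (P * N) * (\<Sum>v\<in>V - {u}. x * B v / (P * N))" by (simp only: sum_distrib_left)
      moreover have "real x / (2 * P * N) = x / (P * N) * (1 / 2)" by (simp add: field_simps)
      moreover have "c * (1 / 2) \<le> c - y" if "y \<le> c * (1 / 2)" for c y :: real
        using that by simp
      ultimately show ?thesis by (simp only:)
    qed
    then have "(\<Sum>u\<in>S. x / (2 * P * N)) \<le> (\<Sum>u\<in>S. x / (P * N) - (\<Sum>v\<in>V - {u}. x / (P * N) * (x * B v / (P * N))))"
      by (intro sum_mono) simp
    then show ?thesis by simp
  qed
  also have "\<dots> = (\<Sum>u\<in>S. measure_pmf.prob ?M (ev u) - (\<Sum>v\<in>V - {u}. measure_pmf.prob ?M (cl u v)))"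
  proof (intro sum.cong refl arg_cong2[where f = "(-)"])
    fix u assume u: "u \<in> S"
    show "x / (P * N) = measure_pmf.prob ?M (ev u)"
      using u assms pA by (subst ev_def, subst prob_Pi_pmf_component) auto
    fix v assume "v \<in> V - {u}"
    then show "x / (P * N) * (x * B v / (P * N)) = measure_pmf.prob ?M (cl u v)"
      using u assms pA pC by (subst cl_def, subst prob_two_components) auto
  qed
  also have "\<dots> = measure_pmf.expectation ?M (\<lambda>y. \<Sum>u\<in>S. indicat_real (ev u) y - (\<Sum>v\<in>V - {u}. indicat_real (cl u v) y))"
    by (simp add: Bochner_Integration.integral_sum Bochner_Integration.integral_diff int)
  also have "\<dots> \<le> measure_pmf.expectation ?M (indicat_real ?E)"
    by (intro integral_mono_AE int(1) int(4)) (simp_all add: AE_measure_pmf_iff point del: indicator_simps)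
  also have "\<dots> = measure_pmf.prob ?M ?E" by simp
  finally show ?thesis .
qed

text \<open>Up to a constant, a token held by the nodes in \<open>S\<close> wins with probability
  \<open>card S\<close> over the total number of competing blocks. The threshold \<open>x\<close> is
  the largest one that the union bound permits; adding \<open>N\<close> to the total keeps it below
  \<open>P\<close>, and rounding costs a factor 2.\<close>

lemma prob_winner:
  fixes V :: "'v set" and B :: "'v \<Rightarrow> nat"
  assumes "finite V" "S \<subseteq> V" "\<And>v. v \<in> V \<Longrightarrow> B v \<le> N" "\<And>u. u \<in> S \<Longrightarrow> idx u < B u"
    and "0 < N" "2 * (N + (\<Sum>v\<in>V. B v)) \<le> P * N"
  shows "real (card S) / (8 * (N + (\<Sum>v\<in>V. B v))) \<le>
    measure_pmf.prob (Pi_pmf V dflt (\<lambda>_. pmf_of_set ({..<P} \<times> {..<N})))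
      {y. \<exists>u\<in>S. snd (y u) = idx u \<and> (\<forall>v\<in>V - {u}. snd (y v) < B v \<longrightarrow> fst (y v) < fst (y u))}"
    (is "_ \<le> ?p")
proof -
  define D where "D = N + (\<Sum>v\<in>V. B v)"
  define x where "x = P * N div (2 * D)"
  have D: "0 < D" "N \<le> D" using assms by (auto simp: D_def)
  have x1: "1 \<le> x" using assms(6) D by (simp add: x_def D_def[symmetric] div_greater_zero_iff Suc_le_eq)
  have x2: "x * (2 * D) \<le> P * N" by (simp add: x_def)
  have "P * N < (x + 1) * (2 * D)" using D by (simp add: x_def dividend_less_div_times add.commute[of _ 1] )
  then have x3: "P * N \<le> x * (4 * D)"
  proof -
    have "(x + 1) * (2 * D) \<le> (2 * x) * (2 * D)" using x1 by (intro mult_right_mono) auto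
    also have "\<dots> = x * (4 * D)" by simp
    finally show ?thesis using \<open>P * N < (x + 1) * (2 * D)\<close> by linarith
  qed
  have P: "0 < P" using assms(5,6) D by (cases P) (auto simp: D_def)
  have xP: "x \<le> P"
  proof -
    have "x * N \<le> x * (2 * D)" using D by simp
    then show ?thesis using x2 assms(5) by (meson le_trans mult_le_cancel2)
  qed
  have "2 * x * (\<Sum>v\<in>V. B v) \<le> x * (2 * D)" by (simp add: D_def algebra_simps)
  then have x4: "2 * x * (\<Sum>v\<in>V. B v) \<le> P * N" using x2 by linarith
  have "real (card S) / (8 * D) \<le> real (card S) * x / (2 * P * N)"
  proof -
    have "real (P * N) \<le> real (x * (4 * D))" using x3 of_nat_le_iff by blast
    then have "1 / (8 * D) \<le> real x / (2 * P * N)" using P assms(5) D by (simp add: field_simps)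
    then have "real (card S) * (1 / (8 * D)) \<le> real (card S) * (real x / (2 * P * N))"
      by (intro mult_left_mono) auto
    then show ?thesis by simp
  qed
  also have "\<dots> \<le> ?p" by (rule prob_winner_threshold) (use assms P xP x4 in auto)
  finally show ?thesis by (simp add: D_def)
qed

text \<open>A node draws for all slots at once. After transposition the slots are independent
  experiments, so that their failure probabilities can be multiplied in
  \<open>prob_covered\<close>.\<close>

lemma map_Pi_pmf_swap:
  assumes "finite V" "finite Q"
  shows "map_pmf (\<lambda>f j v. f v j) (Pi_pmf V (\<lambda>_. e) (\<lambda>v. Pi_pmf Q e (ps v)))
    = Pi_pmf Q (\<lambda>_. e) (\<lambda>j. Pi_pmf V e (\<lambda>v. ps v j))"
proof (rule pmf_eqI)
  fix g :: "'b \<Rightarrow> 'a \<Rightarrow> 'c"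
  have "inj (\<lambda>f j v. f v j :: 'c)" by (intro injI ext) (metis)
  then have "pmf (map_pmf (\<lambda>f j v. f v j) (Pi_pmf V (\<lambda>_. e) (\<lambda>v. Pi_pmf Q e (ps v)))) g
      = pmf (Pi_pmf V (\<lambda>_. e) (\<lambda>v. Pi_pmf Q e (ps v))) (\<lambda>v j. g j v)"
    by (subst pmf_map_inj'[of "\<lambda>f j v. f v j" _ "\<lambda>v j. g j v", symmetric]) simp_all
  also have "\<dots> = pmf (Pi_pmf Q (\<lambda>_. e) (\<lambda>j. Pi_pmf V e (\<lambda>v. ps v j))) g"
  proof (cases "\<forall>v j. v \<notin> V \<or> j \<notin> Q \<longrightarrow> g j v = e")
    case True
    then have "(\<forall>v. v \<notin> V \<longrightarrow> (\<lambda>j. g j v) = (\<lambda>_. e))" "(\<forall>j. j \<notin> Q \<longrightarrow> g j = (\<lambda>_. e))" by auto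
    then show ?thesis using assms True by (simp add: pmf_Pi prod.swap[of _ V])
  next
    case False
    then obtain v j where vj: "v \<notin> V \<or> j \<notin> Q" "g j v \<noteq> e" by blast
    have z: "(\<Prod>x\<in>A. F x) = (0::real)" if "finite A" "a \<in> A" "F a = 0" for A :: "'z set" and F a
      using that by (meson prod_zero)
    have "pmf (Pi_pmf V (\<lambda>_. e) (\<lambda>v. Pi_pmf Q e (ps v))) (\<lambda>v j. g j v) = 0"
    proof (cases "v \<in> V")
      case True
      then have "pmf (Pi_pmf Q e (ps v)) (\<lambda>j. g j v) = 0" using vj assms by (intro pmf_Pi_outside) auto
      then have "(\<Prod>x\<in>V. pmf (Pi_pmf Q e (ps x)) (\<lambda>j. g j x)) = 0"
        using True assms by (meson prod_zero)
      then show ?thesis using assms by (simp add: pmf_Pi)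
    next
      case False
      then show ?thesis using vj assms by (intro pmf_Pi_outside) (auto simp: fun_eq_iff)
    qed
    moreover have "pmf (Pi_pmf Q (\<lambda>_. e) (\<lambda>j. Pi_pmf V e (\<lambda>v. ps v j))) g = 0"
    proof (cases "j \<in> Q")
      case True
      then have "pmf (Pi_pmf V e (\<lambda>v. ps v j)) (g j) = 0" using vj assms by (intro pmf_Pi_outside) auto
      then have "(\<Prod>x\<in>Q. pmf (Pi_pmf V e (\<lambda>v. ps v x)) (g x)) = 0"
        using True assms by (meson prod_zero)
      then show ?thesis using assms by (simp add: pmf_Pi)
    next
      case False
      then show ?thesis using vj assms by (intro pmf_Pi_outside) (auto simp: fun_eq_iff)
    qed
    ultimately show ?thesis by simp
  qed
  finally show "pmf (map_pmf (\<lambda>f j v. f v j) (Pi_pmf V (\<lambda>_. e) (\<lambda>v. Pi_pmf Q e (ps v)))) g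
      = pmf (Pi_pmf Q (\<lambda>_. e) (\<lambda>j. Pi_pmf V e (\<lambda>v. ps v j))) g" .
qed

section \<open>The algorithm\<close>

text \<open>\<open>top\<close> is the largest estimate seen, \<open>reg\<close> the register of
  nominations and \<open>pks\<close> the packets of the current generation. \<open>vreg\<close> has
  two entries, both flooded by maximum: whether some node failed to decode, and the code of an
  active token. \<open>dec\<close> keeps the decoded tokens until the verification has
  ended.\<close>

record node =
  nid :: uid
  clk :: nat
  top :: nat
  known :: "token list"
  act :: "token list"
  reg :: "nat list"
  vreg :: "nat list"
  pks :: "(bit list \<times> bit list) list"
  dec :: "token list"
  fin :: bool

instance bit :: countable
  by (rule countable_classI[of "\<lambda>x. if x = 0 then 0 else 1"]) (auto split: if_splits)

instance node_ext :: (countable) countable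
  by (rule countable_classI[of "\<lambda>s. to_nat (nid s, clk s, top s, known s, act s, reg s, vreg s, pks s, dec s, fin s, node.more s)"])
    (rule node.equality, auto)

text \<open>A list of active tokens is cut into blocks of \<open>m\<close> tokens, the last one being completed
  cyclically so that all blocks have the same length.\<close>

definition nblocks :: "nat \<Rightarrow> nat \<Rightarrow> nat" where
  "nblocks m l = (l + m - 1) div m"

definition block :: "nat \<Rightarrow> token list \<Rightarrow> nat \<Rightarrow> token list" where
  "block m xs i = map (\<lambda>j. xs ! ((i * m + j) mod length xs)) [0..<m]"

definition chop :: "nat \<Rightarrow> nat \<Rightarrow> bit list \<Rightarrow> token list" where
  "chop m d p = map (\<lambda>j. take d (drop (j * d) p)) [0..<m]"

definition hear :: "message set \<Rightarrow> token set" where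
  "hear M = (\<Union>m\<in>M. set (plain m))"

definition span :: "nat \<Rightarrow> nat \<Rightarrow> (bit list \<times> bit list) list \<Rightarrow> (bit list \<times> bit list) set" where
  "span h l P = {(lincomb h w (map fst P), lincomb l w (map snd P)) | w. length w = length P}"

definition merge :: "nat list \<Rightarrow> nat list set \<Rightarrow> nat list" where
  "merge r R = map (\<lambda>j. Max (insert (r ! j) ((\<lambda>r'. r' ! j) ` R))) [0..<length r]"

abbreviation lg :: "nat \<Rightarrow> nat" where "lg \<equiv> floorlog 2"

text \<open>
  The parameters: \<open>A\<close> bounds the length of identifiers in multiples of \<open>log n\<close>. As long as
  \<open>clk < 2 * top\<close>, a node floods the largest estimate \<open>top\<close>; since \<open>2 * top\<close> is an upper bound for
  \<open>n\<close> for the own estimate already, all nodes stop doing so at the same time, with the common value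
  \<open>N = 2 * top\<close>. Then the time is divided into cycles of four phases:
  \<^enum> in the first cycles of each epoch, random blocks of active tokens are spread;
  \<^enum> generations are nominated: the first slot of the register finds a node with most active tokens,
    the other slots random blocks;
  \<^enum> the nominated blocks are broadcast by random linear network coding;
  \<^enum> the nodes find out whether all of them could decode, in which case the tokens are no longer
    active. An active token is also flooded in plain, so that the number of cycles is bounded.
\<close>

locale protocol =
  fixes A b d :: nat
begin

text \<open>For \<open>d = 0\<close> the quotient is 0; the maximum keeps blocks nonempty.\<close>

definition msize :: nat where "msize = max 1 (b div d)"
text \<open>The cap \<open>N\<close> keeps a generation at no more than \<open>2 * N\<close> blocks,
  hence the number of vectors in the union bound for coding below 2^(2 N) + 1. It costs nothing, as
  no node has more than \<open>N\<close> blocks.\<close>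

definition lead :: "nat \<Rightarrow> nat" where "lead N = min b N"
text \<open>A register entry has O(lg N) bits, and the register has to fit into O(b) bits. At least
  one slot is affordable because \<open>lg N\<close> is at most \<open>4 * b\<close>.\<close>

definition slots :: "nat \<Rightarrow> nat" where "slots N = max 1 (lead N div lg N)"
text \<open>The factor 64 makes (3/4)^T smaller than 2^(-21 N), which beats the initial value 2^(3
  N) of the coding potential.\<close>

definition rounds :: "nat \<Rightarrow> nat" where "rounds N = 64 * N"
text \<open>With a drift of 149/150 per cycle, 2000 lg N cycles gain a factor exp (-13 lg
  N).\<close>

definition reps :: "nat \<Rightarrow> nat" where "reps N = 2000 * lg N"
definition width :: "nat \<Rightarrow> nat" where "width N = (A + 8) * lg N"
definition idbase :: "nat \<Rightarrow> nat" where "idbase N = 2 ^ (A * lg N + 1)"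
definition prios :: "nat \<Rightarrow> nat" where "prios N = 2 ^ (2 * lg N + 4)"

abbreviation bigN :: "node \<Rightarrow> nat" where "bigN s \<equiv> 2 * top s"
definition tau :: "node \<Rightarrow> nat" where "tau s = clk s - bigN s"
definition phase :: "node \<Rightarrow> nat" where "phase s = tau s div rounds (bigN s) mod 4"
definition offset :: "node \<Rightarrow> nat" where "offset s = tau s mod rounds (bigN s)"
definition cycle :: "node \<Rightarrow> nat" where "cycle s = tau s div (4 * rounds (bigN s))"
definition final :: "node \<Rightarrow> bool" where "final s \<longleftrightarrow> Suc (offset s) = rounds (bigN s)"
definition gathering :: "nat \<Rightarrow> nat \<Rightarrow> bool" where
  "gathering N c \<longleftrightarrow> c mod (2 * reps N) < reps N"

definition name :: "nat \<Rightarrow> nat \<Rightarrow> bitstring" where "name N c = bin (lg N) c"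

text \<open>Register entries are numbers to base \<open>idbase N\<close>: the last digit is the code
  of the nominating node, the rest is its load or its priority with a block index. The numerical
  maximum thus compares loads or priorities first and identifies its author.\<close>

definition lead_blocks :: "nat \<Rightarrow> nat \<Rightarrow> (uid \<times> nat) list" where
  "lead_blocks N x = (if x = 0 then [] else
     map (Pair (inv code (x mod idbase N))) [0..<min (lead N) (nblocks msize (x div idbase N))])"

definition slot_block :: "nat \<Rightarrow> nat \<Rightarrow> (uid \<times> nat) list" where
  "slot_block N x = (if x = 0 then [] else [(inv code (x mod idbase N), x div idbase N mod N)])"

definition gens :: "nat \<Rightarrow> nat list \<Rightarrow> (uid \<times> nat) list" where
  "gens N r = lead_blocks N (r ! 0) @ concat (map (\<lambda>j. slot_block N (r ! Suc j)) [0..<slots N])"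

definition nominate :: "node \<Rightarrow> (nat \<Rightarrow> nat \<times> nat) \<Rightarrow> nat list" where
  "nominate s f = (let N = bigN s; l = length (act s) in
     (if l = 0 then 0 else l * idbase N + code (nid s)) #
     map (\<lambda>j. if snd (f j) < nblocks msize l
              then (fst (f j) * N + snd (f j)) * idbase N + code (nid s) else 0) [0..<slots N])"

text \<open>The index is drawn below the common bound \<open>N\<close> and not below the node's own
  number of blocks. Every block in the network then has the same chance, without anybody knowing the
  total number.\<close>

definition draws :: "nat \<Rightarrow> (nat \<Rightarrow> nat \<times> nat) pmf" where
  "draws N = Pi_pmf {..<slots N} (0, 0) (\<lambda>_. pmf_of_set ({..<prios N} \<times> {..<N}))"

definition put_reg :: "nat \<Rightarrow> nat list \<Rightarrow> message" where
  "put_reg N r = Message (concat (map (bin (width N)) r)) [] []"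

definition get_reg :: "nat \<Rightarrow> message \<Rightarrow> nat list" where
  "get_reg N m = map (\<lambda>j. val (take (width N) (drop (j * width N) (control m)))) [0..<Suc (slots N)]"

text \<open>The token travels in the plain part rather than as a code in the control part, so that
  its receivers count as having learned it.\<close>

definition put_vreg :: "nat list \<Rightarrow> message" where
  "put_vreg r = Message [of_bool (r ! 0 = 1)] (if r ! 1 = 0 then [] else [from_nat (r ! 1 - 1)]) []"

definition get_vreg :: "message \<Rightarrow> nat list" where
  "get_vreg m = [of_bool (control m = [1]), case plain m of [] \<Rightarrow> 0 | t # _ \<Rightarrow> Suc (to_nat t)]"

definition gen_size :: "node \<Rightarrow> nat" where "gen_size s = length (gens (bigN s) (reg s))"

definition combination :: "node \<Rightarrow> bit list \<Rightarrow> message" where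
  "combination s w = Message [] [] [Packet (name (bigN s) (cycle s))
     (lincomb (gen_size s) w (map fst (pks s))) (lincomb (msize * d) w (map snd (pks s)))]"

definition node_send :: "node \<Rightarrow> (message \<times> node) pmf" where
  "node_send s =
    (if clk s < bigN s then return_pmf (Message (bin (lg (top s)) (top s)) [] [], s)
     else if phase s = 0 then
       (if gathering (bigN s) (cycle s) \<and> act s \<noteq> []
        then map_pmf (\<lambda>i. (Message [] (block msize (act s) i) [], s))
               (pmf_of_set {..<nblocks msize (length (act s))})
        else return_pmf (Message [] [] [], s))
     else if phase s = 1 then
       (if offset s = 0
        then map_pmf (\<lambda>f. (put_reg (bigN s) (nominate s f), s\<lparr>reg := nominate s f\<rparr>)) (draws (bigN s))
        else return_pmf (put_reg (bigN s) (reg s), s))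
     else if phase s = 2 then
       map_pmf (\<lambda>w. (combination s w, s)) (pmf_of_set {w. length w = length (pks s)})
     else return_pmf (put_vreg (vreg s), s))"

definition own_packets :: "node \<Rightarrow> (bit list \<times> bit list) set" where
  "own_packets s = {(unit_vec (gen_size s) i, concat (block msize (act s) x)) | i x.
     i < gen_size s \<and> gens (bigN s) (reg s) ! i = (nid s, x)}"

definition packets :: "message set \<Rightarrow> (bit list \<times> bit list) set" where
  "packets M = {(c, p). \<exists>m\<in>M. \<exists>g. Packet g c p \<in> set (coded m)}"

definition full :: "node \<Rightarrow> bool" where
  "full s \<longleftrightarrow> (\<forall>i<gen_size s. \<exists>p. (unit_vec (gen_size s) i, p) \<in> span (gen_size s) (msize * d) (pks s))"

definition decode :: "node \<Rightarrow> token set" where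
  "decode s = (if full s then \<Union>i<gen_size s. set (chop msize d
     (SOME p. (unit_vec (gen_size s) i, p) \<in> span (gen_size s) (msize * d) (pks s))) else {})"

definition start_verify :: "node \<Rightarrow> node" where
  "start_verify s = s\<lparr>dec := lst (decode s), known := lst (set (known s) \<union> decode s),
     vreg := [of_bool (\<not> full s), if act s = [] then 0 else Suc (to_nat (act s ! 0))]\<rparr>"

definition end_verify :: "node \<Rightarrow> node" where
  "end_verify s = s\<lparr>act := lst (set (act s) - ((if vreg s ! 0 = 0 then set (dec s) else {}) \<union>
     {from_nat (vreg s ! 1 - 1)}))\<rparr>"

definition tick :: "node \<Rightarrow> token set \<Rightarrow> node" where
  "tick s S = s\<lparr>clk := Suc (clk s), known := lst (set (known s) \<union> S)\<rparr>"

text \<open>At the end of the second phase all registers agree, and entry 0 is zero only if no node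
  has an active token. Every token is then known everywhere, so all nodes may halt, and they do so
  in the same round.\<close>

definition node_receive :: "node \<Rightarrow> message set \<Rightarrow> node" where
  "node_receive s M =
    (if clk s < bigN s
     then s\<lparr>clk := Suc (clk s), top := Max (insert (top s) ((val \<circ> control) ` M))\<rparr>
     else if phase s = 0 then (tick s (hear M))\<lparr>act := lst (set (act s) \<union> hear M)\<rparr>
     else if phase s = 1 then
       (let s' = (tick s (hear M))\<lparr>reg := merge (reg s) (get_reg (bigN s) ` M)\<rparr> in
        if final s then if reg s' ! 0 = 0 then s'\<lparr>fin := True\<rparr> else s'\<lparr>pks := lst (own_packets s')\<rparr>
        else s')
     else if phase s = 2 then
       (let s' = (tick s (hear M))\<lparr>pks := lst (set (pks s) \<union> packets M)\<rparr> in
        if final s then start_verify s' else s')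
     else
       (let s' = (tick s (hear M))\<lparr>vreg := merge (vreg s) (get_vreg ` M)\<rparr> in
        if final s then end_verify s' else s'))"

text \<open>For \<open>b = 0\<close> the condition \<open>log 2 n \<le> b\<close> forces a single
  node, which holds all tokens and may halt at once.\<close>

definition node_start :: "uid \<Rightarrow> nat \<Rightarrow> token set \<Rightarrow> node" where
  "node_start v e S = \<lparr>nid = v, clk = 0, top = e, known = lst S, act = lst S, reg = [], vreg = [],
     pks = [], dec = [], fin = (b = 0)\<rparr>"

definition alg :: algorithm where
  "alg = \<lparr>start = \<lambda>v e S. to_nat (node_start v e S),
     send = \<lambda>s. map_pmf (\<lambda>(m, s'). (m, to_nat s')) (node_send (from_nat s)),
     receive = \<lambda>s M. to_nat (node_receive (from_nat s) (set_mset M)),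
     result = \<lambda>s. if fin (from_nat s :: node) then Some (set (known (from_nat s :: node))) else None\<rparr>"

end

section \<open>Executions of the algorithm\<close>

lemma map_Pi_pmf_dflt:
  assumes "finite V"
  shows "Pi_pmf V e' (\<lambda>v. map_pmf f (p v)) = map_pmf (\<lambda>y v. if v \<in> V then f (y v) else e') (Pi_pmf V e p)"
proof -
  have "Pi_pmf V e' (\<lambda>v. map_pmf f (p v))
      = map_pmf (\<lambda>g x. if x \<in> V then g x else e') (Pi_pmf V (f e) (\<lambda>v. map_pmf f (p v)))"
    using assms by (simp add: Pi_pmf_default_swap)
  also have "Pi_pmf V (f e) (\<lambda>v. map_pmf f (p v)) = map_pmf (\<lambda>g. f \<circ> g) (Pi_pmf V e p)"
    using assms by (rule Pi_pmf_map) simp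
  finally show ?thesis by (simp add: pmf.map_comp o_def cong: if_cong)
qed

lemma set_Pi_pmf_D: "finite V \<Longrightarrow> y \<in> set_pmf (Pi_pmf V e p) \<Longrightarrow> v \<in> V \<Longrightarrow> y v \<in> set_pmf (p v)"
  by (auto simp: set_Pi_pmf PiE_dflt_def)

lemma less_two_power_lg: "x < 2 ^ lg x"
  using floorlog_bounds[of x 2] by (cases "x = 0") auto

locale dynamic = protocol A b d for A b d +
  fixes a :: real and n k V est I adv
  assumes inst: "dissemination_instance a n k b d V est I"
    and adv: "is_adversary V adv"
    and b_pos: "0 < b" and A: "a \<le> real A"
begin

definition N where "N = 2 * Max (est ` V)"
abbreviation T where "T \<equiv> rounds N"
definition toks where "toks = (\<Union>v\<in>V. I v)"

lemma fin_V: "finite V" and card_V: "card V = n" and n_pos: "0 < n" and V_ne: "V \<noteq> {}"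
  using inst by (auto simp: dissemination_instance_def)

lemma k_le: "k \<le> n" and card_toks: "card toks = k"
  using inst by (auto simp: dissemination_instance_def toks_def)

lemma length_I: "v \<in> V \<Longrightarrow> t \<in> I v \<Longrightarrow> length t = d" and length_toks: "t \<in> toks \<Longrightarrow> length t = d"
  using inst by (auto simp: dissemination_instance_def toks_def)

lemma fin_toks: "finite toks"
proof -
  have "toks \<subseteq> {w. length w = d}" using length_toks by auto
  then show ?thesis using card_bit_lists(1) finite_subset by blast
qed

lemma fin_I: "v \<in> V \<Longrightarrow> finite (I v)"
  using fin_toks by (rule finite_subset[rotated]) (auto simp: toks_def)

lemma est_le: "v \<in> V \<Longrightarrow> 2 * est v \<le> N"
  using fin_V by (simp add: N_def)

lemma n_le_est: "v \<in> V \<Longrightarrow> n \<le> 2 * est v"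
  using inst by (simp add: dissemination_instance_def)

lemma n_le_N: "n \<le> N"
  using V_ne n_le_est est_le by (meson all_not_in_conv le_trans)

lemma N_le: "N \<le> 4 * n"
proof -
  have "Max (est ` V) \<in> est ` V" using fin_V V_ne by (intro Max_in) auto
  then show ?thesis using inst by (auto simp: dissemination_instance_def N_def)
qed

lemma N_pos: "2 \<le> N"
  using n_le_N n_pos by (auto simp: N_def)

lemma T_pos: "0 < T" and n_le_T: "n \<le> T" "N \<le> T"
  using N_pos n_le_N by (auto simp: rounds_def)

lemma lg_pos: "1 \<le> lg N"
  using less_two_power_lg[of N] N_pos by (cases "lg N") auto

lemma lg_le: "lg N \<le> b + 3" "lg N \<le> 4 * b"
proof -
  have "2 ^ (lg N - 1) \<le> N" using floorlog_bounds[of N 2] N_pos by simp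
  also have "\<dots> \<le> 4 * n" by (rule N_le)
  finally have "2 powr (lg N - 1) \<le> real (4 * n)"
    using of_nat_mono[of "2 ^ (lg N - 1)" "4 * n", where ?'a = real] by (simp add: powr_realpow)
  then have "real (lg N - 1) \<le> log 2 (4 * real n)"
    using n_pos by (subst le_log_iff) auto
  also have "\<dots> = 2 + log 2 n" using n_pos log_mult[of 2 4 "real n"]
      by (simp add: log_def ln_realpow[of 2 2, simplified])
  also have "log 2 n \<le> real b" using inst by (simp add: dissemination_instance_def)
  finally show "lg N \<le> b + 3" by linarith
  then show "lg N \<le> 4 * b" using b_pos by linarith
qed

lemma lg_N: "log 2 n \<le> lg N" "n < 2 ^ lg N" "N < 2 ^ lg N"
proof -
  show "N < 2 ^ lg N" by (rule less_two_power_lg)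
  then show n: "n < 2 ^ lg N" using n_le_N by linarith
  then have "real n < 2 ^ lg N" by (metis of_nat_less_iff of_nat_numeral of_nat_power)
  then show "log 2 n \<le> lg N" using n_pos by (subst log_le_iff) (auto simp: powr_realpow)
qed

lemma code_V: "v \<in> V \<Longrightarrow> code v < idbase N"
proof -
  assume v: "v \<in> V"
  have "real (length v) \<le> a * log 2 n" using v inst by (simp add: dissemination_instance_def)
  also have "\<dots> \<le> real A * lg N" using A lg_N n_pos by (intro mult_mono) auto
  finally have "length v \<le> A * lg N" by (metis of_nat_le_iff of_nat_mult)
  then have "2 ^ Suc (length v) \<le> (2::nat) ^ (A * lg N + 1)" by (intro power_increasing) auto
  with code_less[of v] show ?thesis unfolding idbase_def by (rule less_le_trans)
qed

definition s0 where "s0 = initial alg est I"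

type_synonym state = "history \<times> config"

definition st :: "state \<Rightarrow> uid \<Rightarrow> node" where "st z v = from_nat (snd z v)"
definition time :: "state \<Rightarrow> nat" where "time z = length (fst z)"
definition net :: "state \<Rightarrow> graph" where "net z = adv (fst z) (snd z)"

text \<open>With the whole history in the state, the adversary is a part of the transition kernel,
  and an execution is a homogeneous Markov chain.\<close>

definition kern :: "state \<Rightarrow> state pmf" where
  "kern z = map_pmf (\<lambda>x. (fst z @ [(snd z, x, net z)], deliver alg V (snd z) x (net z))) (choices alg V (snd z))"

lemma execution_eq: "execution alg V adv s0 t = run kern t ([], s0)"
  by (induction t) (simp_all add: kern_def net_def case_prod_beta')

definition reach :: "state \<Rightarrow> bool" where "reach z \<longleftrightarrow> z \<in> set_pmf (run kern (time z) ([], s0))"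

lemma time_run: "z' \<in> set_pmf (run kern j z) \<Longrightarrow> time z' = time z + j"
  by (induction j arbitrary: z') (auto simp: kern_def time_def)

lemma reach_run: "reach z \<Longrightarrow> z' \<in> set_pmf (run kern j z) \<Longrightarrow> reach z'"
  unfolding reach_def using time_run[of z' j z] by (force simp: run_add)

lemma reach_iff: "z \<in> set_pmf (run kern t ([], s0)) \<longleftrightarrow> reach z \<and> time z = t"
  using time_run[of z t "([], s0)"] by (auto simp: reach_def time_def)

lemma reach_kern: "reach z \<Longrightarrow> z' \<in> set_pmf (kern z) \<Longrightarrow> reach z'"
  using reach_run[of z z' "Suc 0"] by (simp add: bind_return_pmf)

lemma time_kern: "z' \<in> set_pmf (kern z) \<Longrightarrow> time z' = Suc (time z)"
  by (auto simp: kern_def time_def)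

lemma reach_induct [consumes 1, case_names init step]:
  assumes "reach z" "P ([], s0)" "\<And>z z'. reach z \<Longrightarrow> P z \<Longrightarrow> z' \<in> set_pmf (kern z) \<Longrightarrow> P z'"
  shows "P z"
proof -
  have "z \<in> set_pmf (run kern t ([], s0)) \<Longrightarrow> P z" for t z
    by (induction t arbitrary: z) (auto simp: assms(2) reach_iff intro: assms(3))
  then show ?thesis using assms(1) by (auto simp: reach_def)
qed

lemma net: "connected_graph V (net z)"
  using adv by (simp add: is_adversary_def net_def)

lemma net_V: "(u, v) \<in> net z \<Longrightarrow> u \<in> V \<and> v \<in> V"
  using net unfolding connected_graph_def by blast

lemma fin_nbrs: "finite {u. (u, v) \<in> net z}"
  using fin_V by (rule finite_subset[rotated]) (use net_V in blast)

lemma st_init: "v \<in> V \<Longrightarrow> st ([], s0) v = node_start v (est v) (I v)"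
  by (simp add: st_def s0_def initial_def alg_def)

definition running :: "state \<Rightarrow> bool" where "running z \<longleftrightarrow> (\<forall>v\<in>V. \<not> fin (st z v))"

definition moves :: "state \<Rightarrow> (uid \<Rightarrow> message \<times> node) pmf" where
  "moves z = Pi_pmf V undefined (\<lambda>v. node_send (st z v))"

definition choice_of :: "(uid \<Rightarrow> message \<times> node) \<Rightarrow> choice" where
  "choice_of y = (\<lambda>v. if v \<in> V then (Some (fst (y v)), to_nat (snd (y v))) else (None, 0))"

definition nxt :: "state \<Rightarrow> (uid \<Rightarrow> message \<times> node) \<Rightarrow> state" where
  "nxt z y = (fst z @ [(snd z, choice_of y, net z)], deliver alg V (snd z) (choice_of y) (net z))"

definition inb :: "state \<Rightarrow> (uid \<Rightarrow> message \<times> node) \<Rightarrow> uid \<Rightarrow> message set" where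
  "inb z y v = (\<lambda>u. fst (y u)) ` {u. (u, v) \<in> net z}"

lemma fin_inb: "finite (inb z y v)"
  by (simp add: inb_def fin_nbrs)

lemma inb_I: "(u, v) \<in> net z \<Longrightarrow> fst (y u) \<in> inb z y v"
  by (auto simp: inb_def)

lemma halted_alg: "halted alg (snd z v) \<longleftrightarrow> fin (st z v)"
  by (simp add: halted_def alg_def st_def)

lemma kern_running: "running z \<Longrightarrow> kern z = map_pmf (nxt z) (moves z)"
proof -
  assume r: "running z"
  let ?f = "\<lambda>p. (Some (fst p), to_nat (snd p :: node))"
  have nh: "\<not> halted alg (snd z v)" if "v \<in> V" for v using r that by (simp add: halted_alg running_def)
  have snd: "send alg (snd z v) = map_pmf (\<lambda>(m, s'). (m, to_nat s')) (node_send (st z v))" for v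
    by (simp add: alg_def st_def)
  have "choices alg V (snd z) = Pi_pmf V (None, 0) (\<lambda>v. map_pmf ?f (node_send (st z v)))"
    unfolding choices_def using fin_V
    by (intro Pi_pmf_cong) (simp_all add: nh snd pmf.map_comp o_def case_prod_beta')
  also have "\<dots> = map_pmf choice_of (moves z)"
    using fin_V by (subst map_Pi_pmf_dflt[where e = undefined]) (simp_all add: moves_def choice_of_def[abs_def])
  finally show ?thesis by (simp add: kern_def nxt_def[abs_def] pmf.map_comp o_def)
qed

lemma moves_D: "y \<in> set_pmf (moves z) \<Longrightarrow> v \<in> V \<Longrightarrow> y v \<in> set_pmf (node_send (st z v))"
  using fin_V unfolding moves_def by (rule set_Pi_pmf_D)

lemma st_nxt: "running z \<Longrightarrow> v \<in> V \<Longrightarrow> st (nxt z y) v = node_receive (snd (y v)) (inb z y v)"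
proof -
  assume "running z" "v \<in> V"
  moreover have "set_mset (inbox (choice_of y) (net z) v) = inb z y v"
  proof -
    have "{u. (u, v) \<in> net z \<and> fst (choice_of y u) \<noteq> None} = {u. (u, v) \<in> net z}"
      using net_V[of _ v z] by (auto simp: choice_of_def)
    then have "set_mset (inbox (choice_of y) (net z) v) = (\<lambda>u. the (fst (choice_of y u))) ` {u. (u, v) \<in> net z}"
      using fin_nbrs[of v z] by (simp add: inbox_def)
    also have "\<dots> = inb z y v"
      unfolding inb_def using net_V[of _ v z] by (intro image_cong) (auto simp: choice_of_def)
    finally show ?thesis .
  qed
  ultimately show ?thesis
    by (simp add: running_def st_def nxt_def deliver_def halted_def alg_def choice_of_def)
qed

lemma time_nxt [simp]: "time (nxt z y) = Suc (time z)"
  by (simp add: time_def nxt_def)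

lemma kern_halted:
  assumes "\<forall>v\<in>V. fin (st z v)"
  shows "\<exists>x. kern z = return_pmf (fst z @ [(snd z, x, net z)], snd z) \<and> (\<forall>v. fst (x v) = None)"
proof -
  have "choices alg V (snd z) = Pi_pmf V (None, 0) (\<lambda>v. return_pmf (None, snd z v))"
    unfolding choices_def using fin_V by (intro Pi_pmf_cong) (use assms in \<open>auto simp: halted_alg\<close>)
  also have "\<dots> = return_pmf (\<lambda>v. if v \<in> V then (None, snd z v) else (None, 0))"
    using fin_V by (simp add: Pi_pmf_return_pmf)
  finally have "kern z = return_pmf (fst z @ [(snd z, \<lambda>v. if v \<in> V then (None, snd z v) else (None, 0), net z)], snd z)"
    using assms by (auto simp: kern_def deliver_def halted_alg fun_eq_iff)
  then show ?thesis by (intro exI[of _ "\<lambda>v. if v \<in> V then (None, snd z v) else (None, 0)"]) simp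
qed

lemma heard_append: "heard (h @ [(s, x, E)]) v = heard h v \<union> {m. \<exists>u. (u, v) \<in> E \<and> fst (x u) = Some m}"
  unfolding heard_def by auto

lemma heard_nxt: "heard (fst (nxt z y)) v = heard (fst z) v \<union> inb z y v"
proof -
  have "fst (choice_of y u) = Some m \<longleftrightarrow> fst (y u) = m" if "(u, v) \<in> net z" for u m
    using net_V[OF that] by (simp add: choice_of_def)
  then have "{m. \<exists>u. (u, v) \<in> net z \<and> fst (choice_of y u) = Some m} = inb z y v"
    by (auto simp: inb_def)
  then show ?thesis by (simp add: nxt_def heard_append)
qed

section \<open>Flooding\<close>

text \<open>The flooding invariant: in each coordinate the maximum \<open>M ! j\<close> has reached
  at least \<open>i + 1\<close> nodes, or all of them. Connectivity adds a node per round and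
  coordinate, so flooding ends after \<open>n\<close> rounds whatever the adversary does.\<close>

definition spreads :: "(uid \<Rightarrow> nat list) \<Rightarrow> nat list \<Rightarrow> nat \<Rightarrow> bool" where
  "spreads r M i \<longleftrightarrow> (\<forall>v\<in>V. length (r v) = length M) \<and>
     (\<forall>j<length M. (\<forall>v\<in>V. r v ! j \<le> M ! j) \<and> min n (Suc i) \<le> card {v\<in>V. r v ! j = M ! j})"

definition gmax :: "(uid \<Rightarrow> nat list) \<Rightarrow> nat list" where
  "gmax r = map (\<lambda>j. Max ((\<lambda>v. r v ! j) ` V)) [0..<length (r (SOME v. v \<in> V))]"

lemma some_V: "(SOME v. v \<in> V) \<in> V"
  using V_ne by (simp add: some_in_eq)

lemma spreads_init:
  assumes "\<And>v. v \<in> V \<Longrightarrow> length (r v) = l"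
  shows "spreads r (gmax r) 0"
proof -
  have "length (gmax r) = l" using assms some_V by (simp add: gmax_def)
  moreover have "(\<forall>v\<in>V. r v ! j \<le> gmax r ! j) \<and> min n (Suc 0) \<le> card {v\<in>V. r v ! j = gmax r ! j}"
      if "j < l" for j
  proof -
    have g: "gmax r ! j = Max ((\<lambda>v. r v ! j) ` V)" using that assms some_V by (simp add: gmax_def)
    have "Max ((\<lambda>v. r v ! j) ` V) \<in> (\<lambda>v. r v ! j) ` V" using fin_V V_ne by (intro Max_in) auto
    then have "{v\<in>V. r v ! j = gmax r ! j} \<noteq> {}" using g by auto
    then have "0 < card {v\<in>V. r v ! j = gmax r ! j}" using fin_V by (simp add: card_gt_0_iff)
    moreover have "\<forall>v\<in>V. r v ! j \<le> gmax r ! j" using g fin_V by auto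
    ultimately show ?thesis by simp
  qed
  ultimately show ?thesis using assms by (simp add: spreads_def)
qed

lemma spreads_attained:
  assumes "spreads r M i" "j < length M"
  obtains v where "v \<in> V" "r v ! j = M ! j"
proof -
  have "0 < card {v\<in>V. r v ! j = M ! j}" using assms n_pos by (force simp: spreads_def)
  then show thesis using that by (auto simp: card_gt_0_iff)
qed

lemma spreads_unique: "spreads r M i \<Longrightarrow> M = gmax r"
proof (rule nth_equalityI)
  assume s: "spreads r M i"
  then show l: "length M = length (gmax r)" using some_V by (simp add: gmax_def spreads_def)
  fix j assume j: "j < length M"
  obtain v where v: "v \<in> V" "r v ! j = M ! j" using spreads_attained[OF s j] .
  have "Max ((\<lambda>v. r v ! j) ` V) = M ! j"
    using v s j fin_V by (intro Max_eqI) (auto simp: spreads_def intro: rev_image_eqI)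
  then show "M ! j = gmax r ! j" using j l by (simp add: gmax_def)
qed

lemma spreads_done: "spreads r M i \<Longrightarrow> n \<le> Suc i \<Longrightarrow> v \<in> V \<Longrightarrow> r v = M"
proof (rule nth_equalityI)
  assume s: "spreads r M i" and i: "n \<le> Suc i" and v: "v \<in> V"
  then show "length (r v) = length M" by (simp add: spreads_def)
  fix j assume "j < length (r v)"
  then have "card V \<le> card {v\<in>V. r v ! j = M ! j}" using s i v card_V by (auto simp: spreads_def)
  then have "{v\<in>V. r v ! j = M ! j} = V" using fin_V by (intro card_seteq) auto
  then show "r v ! j = M ! j" using v by auto
qed

lemma length_merge [simp]: "length (merge r R) = length r"
  by (simp add: merge_def)

lemma spreads_step:
  assumes s: "spreads r M i" and r': "\<And>v. v \<in> V \<Longrightarrow> r' v = merge (r v) (r ` {u. (u, v) \<in> net z})"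
  shows "spreads r' M (Suc i)"
  unfolding spreads_def
proof (intro conjI ballI allI impI)
  show "length (r' v) = length M" if "v \<in> V" for v using s r'[OF that] that by (simp add: spreads_def)
  fix j assume j: "j < length M"
  have e: "r' v ! j = Max (insert (r v ! j) ((\<lambda>u. r u ! j) ` {u. (u, v) \<in> net z}))" if "v \<in> V" for v
    using s r'[OF that] that j by (simp add: merge_def spreads_def image_image)
  show le: "r' v ! j \<le> M ! j" if "v \<in> V" for v
    using s e[OF that] that j fin_nbrs net_V by (auto simp: spreads_def)
  let ?S = "{v\<in>V. r v ! j = M ! j}" and ?S' = "{v\<in>V. r' v ! j = M ! j}"
  have eq: "v \<in> ?S'" if "v \<in> V" "u \<in> insert v {u. (u, v) \<in> net z}" "r u ! j = M ! j" for u v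
  proof -
    have "r u ! j \<le> r' v ! j" unfolding e[OF that(1)] using that(2) fin_nbrs by (intro Max_ge) blast+
    then show ?thesis using le[OF that(1)] that by simp
  qed
  then have sub: "?S \<subseteq> ?S'" by auto
  show "min n (Suc (Suc i)) \<le> card ?S'"
  proof (cases "?S = V")
    case True
    then have "?S' = V" using sub by auto
    then show ?thesis using card_V by simp
  next
    case False
    have "?S \<noteq> {}" using spreads_attained[OF s j] by blast
    then obtain u v where uv: "u \<in> ?S" "v \<in> V - ?S" "(u, v) \<in> net z"
      using boundary_edge[OF net, of ?S z] False by auto
    then have "insert v ?S \<subseteq> ?S'" using sub eq[of v u] by auto
    then have "card (insert v ?S) \<le> card ?S'" using fin_V by (intro card_mono) auto
    moreover have "card (insert v ?S) = Suc (card ?S)" using uv fin_V by (subst card_insert_disjoint) auto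
    moreover have "min n (Suc i) \<le> card ?S" using s j by (simp add: spreads_def)
    ultimately show ?thesis by linarith
  qed
qed

section \<open>Positions in the schedule\<close>

definition gtau where "gtau t = t - N"
definition gph where "gph t = gtau t div T mod 4"
definition goff where "goff t = gtau t mod T"
definition gcyc where "gcyc t = gtau t div (4 * T)"

lemma goff_less: "goff t < T"
  using T_pos by (simp add: goff_def)

lemma position_start: "gph N = 0" "goff N = 0" "gcyc N = 0"
  by (simp_all add: gtau_def gph_def goff_def gcyc_def)

lemma position_inside:
  assumes "N \<le> t" "Suc (goff t) < T"
  shows "gph (Suc t) = gph t" "goff (Suc t) = Suc (goff t)" "gcyc (Suc t) = gcyc t"
proof -
  have g: "gtau (Suc t) = Suc (gtau t)" using assms by (simp add: gtau_def)
  have m: "Suc (gtau t) mod T = Suc (goff t)" using assms(2) by (simp add: goff_def mod_Suc)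
  have q: "Suc (gtau t) div T = gtau t div T" using assms(2) by (simp add: goff_def div_Suc mod_Suc)
  show "gph (Suc t) = gph t" "goff (Suc t) = Suc (goff t)"
      by (simp_all add: gph_def g q goff_def[of "Suc t"] m)
  show "gcyc (Suc t) = gcyc t" by (simp add: gcyc_def g q div_mult2_eq mult.commute[of 4])
qed

lemma position_end:
  assumes "N \<le> t" "Suc (goff t) = T"
  shows "gph (Suc t) = (gph t + 1) mod 4" "goff (Suc t) = 0"
    "gcyc (Suc t) = (if gph t = 3 then Suc (gcyc t) else gcyc t)"
proof -
  have g: "gtau (Suc t) = Suc (gtau t)" using assms by (simp add: gtau_def)
  have q: "Suc (gtau t) div T = Suc (gtau t div T)" using assms(2) by (simp add: goff_def div_Suc mod_Suc)
  show "goff (Suc t) = 0" using assms(2) by (simp add: goff_def g mod_Suc)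
  show "gph (Suc t) = (gph t + 1) mod 4" by (simp add: gph_def g q mod_Suc)
  have "Suc x div 4 = (if x mod 4 = 3 then Suc (x div 4) else x div 4)" for x
    by (simp add: div_Suc mod_Suc)
  then show "gcyc (Suc t) = (if gph t = 3 then Suc (gcyc t) else gcyc t)"
    by (simp add: gcyc_def gph_def g q div_mult2_eq mult.commute[of 4])
qed

end

section \<open>Messages and blocks\<close>

lemma take_drop_concat:
  "\<forall>B\<in>set Bs. length B = l \<Longrightarrow> j < length Bs \<Longrightarrow> take l (drop (j * l) (concat Bs)) = Bs ! j"
proof (induction Bs arbitrary: j)
  case (Cons B Bs)
  then show ?case by (cases j) auto
qed simp

lemma chop_concat: "\<forall>B\<in>set Bs. length B = d \<Longrightarrow> length Bs = m \<Longrightarrow> chop m d (concat Bs) = Bs"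
  by (rule nth_equalityI) (auto simp: chop_def take_drop_concat)

lemma length_concat_const: "\<forall>B\<in>set Bs. length B = l \<Longrightarrow> length (concat Bs) = length Bs * l"
  by (induction Bs) auto

lemma length_block [simp]: "length (block m xs i) = m"
  by (simp add: block_def)

lemma set_block: "xs \<noteq> [] \<Longrightarrow> set (block m xs i) \<subseteq> set xs"
  by (auto simp: block_def)

lemma nblocks_0 [simp]: "0 < m \<Longrightarrow> nblocks m 0 = 0"
  by (simp add: nblocks_def)

lemma nblocks_pos: "0 < m \<Longrightarrow> 0 < l \<Longrightarrow> 0 < nblocks m l"
  by (simp add: nblocks_def div_greater_zero_iff)

lemma nblocks_le: "0 < m \<Longrightarrow> nblocks m l \<le> l"
proof -
  assume m: "0 < m"
  show ?thesis
  proof (cases l)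
    case (Suc l')
    have "l + m - 1 = l' + m" using Suc by simp
    then have "nblocks m l = Suc (l' div m)" using m by (simp add: nblocks_def)
    then show ?thesis using Suc div_le_dividend[of l' m] by simp
  qed (simp add: m)
qed

lemma nblocks_real: "0 < m \<Longrightarrow> real (nblocks m l) \<le> l / m + 1"
proof -
  assume m: "0 < m"
  have "nblocks m l * m \<le> l + m - 1" by (simp add: nblocks_def)
  then have "real (nblocks m l * m) \<le> real (l + m - 1)" by (rule of_nat_mono)
  then have "real (nblocks m l) \<le> real (l + m - 1) / real m" using m by (simp add: field_simps)
  also have "\<dots> \<le> (real l + real m) / real m" using m by (intro divide_right_mono) auto
  also have "\<dots> = l / m + 1" using m by (simp add: field_simps)
  finally show ?thesis .
qed

lemma nblocks_mono: "l \<le> l' \<Longrightarrow> nblocks m l \<le> nblocks m l'"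
  by (simp add: nblocks_def div_le_mono)

lemma nblocks_mult: "0 < m \<Longrightarrow> l \<le> nblocks m l * m"
proof -
  assume m: "0 < m"
  have "l + m - 1 = (l + m - 1) div m * m + (l + m - 1) mod m" by simp
  moreover have "(l + m - 1) mod m \<le> m - 1" using m by (simp add: less_Suc_eq_le[symmetric])
  ultimately show ?thesis using m unfolding nblocks_def by linarith
qed

lemma in_block:
  assumes "0 < m" "pos < length xs"
  shows "pos div m < nblocks m (length xs)" "xs ! pos \<in> set (block m xs (pos div m))"
proof -
  have "pos < nblocks m (length xs) * m" using nblocks_mult[OF assms(1), of "length xs"] assms(2)
      by linarith
  then show "pos div m < nblocks m (length xs)" by (simp add: less_mult_imp_div_less)
  have "xs ! ((pos div m * m + pos mod m) mod length xs) = xs ! pos" using assms by simp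
  moreover have "pos mod m < m" using assms by simp
  ultimately show "xs ! pos \<in> set (block m xs (pos div m))" by (force simp: block_def)
qed

lemma code_div: "c < X \<Longrightarrow> (h * X + c) div X = (h::nat)" and code_mod: "c < X \<Longrightarrow>
    (h * X + c) mod X = (c::nat)"
  by auto

lemma inv_code [simp]: "inv code (code u) = u"
  using inj_code by simp

context protocol
begin

lemma msize_pos: "0 < msize"
  by (simp add: msize_def)

lemma get_put_reg:
  assumes "length r = Suc (slots M)" "\<forall>x\<in>set r. x < 2 ^ width M"
  shows "get_reg M (put_reg M r) = r"
proof (rule nth_equalityI)
  fix j assume "j < length (get_reg M (put_reg M r))"
  then have j: "j < length r" using assms by (simp add: get_reg_def)
  have "take (width M) (drop (j * width M) (concat (map (bin (width M)) r))) = bin (width M) (r ! j)"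
    using j by (subst take_drop_concat) auto
  then show "get_reg M (put_reg M r) ! j = r ! j"
    using j assms by (simp add: get_reg_def put_reg_def val_bin del: upt_Suc)
qed (simp add: get_reg_def assms)

definition vreg_ok :: "nat list \<Rightarrow> bool" where
  "vreg_ok r \<longleftrightarrow> length r = 2 \<and> r ! 0 \<le> 1 \<and> (r ! 1 = 0 \<or> (\<exists>x :: token. r ! 1 = Suc (to_nat x)))"

lemma get_put_vreg: "vreg_ok r \<Longrightarrow> get_vreg (put_vreg r) = r"
  by (rule nth_equalityI) (auto simp: vreg_ok_def get_vreg_def put_vreg_def less_Suc_eq numeral_2_eq_2 le_Suc_eq)

lemma lincomb_combination:
  assumes "\<forall>(c, p)\<in>set P. is_combination Bs c p \<and> length p = l" "length Bs = h" "\<forall>B\<in>set Bs. length (concat B) \<le> l"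
  shows "is_combination Bs (lincomb h w (map fst P)) (lincomb l w (map snd P))"
proof -
  have P: "is_combination Bs (fst (P ! i)) (snd (P ! i))" "length (snd (P ! i)) = l" if "i < length P"
      for i
    using assms(1) nth_mem[OF that] by (auto simp: case_prod_beta')
  have "lincomb l w (map snd P) ! j =
      (\<Sum>i<length Bs. lincomb h w (map fst P) ! i * nth_default 0 (concat (Bs ! i)) j)" if j: "j < l" for j
  proof -
    have "lincomb l w (map snd P) ! j = (\<Sum>i<length P. w ! i * snd (P ! i) ! j)"
      using j by (simp add: nth_lincomb)
    also have "\<dots> = (\<Sum>i<length P. w ! i * (\<Sum>x<length Bs. fst (P ! i) ! x * nth_default 0 (concat (Bs ! x)) j))"
      using P j by (intro sum.cong) (auto simp: is_combination_def)
    also have "\<dots> = (\<Sum>x<length Bs. \<Sum>i<length P. w ! i * fst (P ! i) ! x * nth_default 0 (concat (Bs ! x)) j)"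
      by (subst sum.swap) (simp add: sum_distrib_left mult.assoc)
    also have "\<dots> = (\<Sum>x<length Bs. lincomb h w (map fst P) ! x * nth_default 0 (concat (Bs ! x)) j)"
      using assms(2) by (intro sum.cong) (auto simp: nth_lincomb sum_distrib_right)
    finally show ?thesis .
  qed
  then show ?thesis using assms by (auto simp: is_combination_def)
qed

lemma unit_combination:
  assumes "is_combination Bs (unit_vec h i) p" "i < h" "length (concat (Bs ! i)) = length p"
  shows "p = concat (Bs ! i)"
proof (rule nth_equalityI)
  fix j assume j: "j < length p"
  have h: "length Bs = h" using assms(1) by (simp add: is_combination_def)
  have "p ! j = (\<Sum>x<h. unit_vec h i ! x * nth_default 0 (concat (Bs ! x)) j)"
    using assms(1) j h by (simp add: is_combination_def)
  also have "\<dots> = (\<Sum>x<h. if x = i then nth_default 0 (concat (Bs ! i)) j else 0)"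
    by (intro sum.cong) auto
  also have "\<dots> = concat (Bs ! i) ! j" using assms(2,3) j by (simp add: nth_default_nth)
  finally show "p ! j = concat (Bs ! i) ! j" .
qed (simp add: assms)

lemma combination_unit:
  assumes "\<forall>B\<in>set Bs. length (concat B) = l" "i < length Bs"
  shows "is_combination Bs (unit_vec (length Bs) i) (concat (Bs ! i))"
proof -
  have l: "length (concat (Bs ! i)) = l" using assms nth_mem by blast
  have "concat (Bs ! i) ! j = (\<Sum>x<length Bs. unit_vec (length Bs) i ! x * nth_default 0 (concat (Bs ! x)) j)"
    if j: "j < l" for j
  proof -
    have "(\<Sum>x<length Bs. unit_vec (length Bs) i ! x * nth_default 0 (concat (Bs ! x)) j)
        = (\<Sum>x<length Bs. if x = i then nth_default 0 (concat (Bs ! i)) j else 0)"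
      by (intro sum.cong) auto
    then show ?thesis using j l assms(2) by (simp add: nth_default_nth)
  qed
  then show ?thesis using assms l by (auto simp: is_combination_def)
qed

end

section \<open>Agreed registers and the generations they describe\<close>

context dynamic
begin

definition acts :: "state \<Rightarrow> uid \<Rightarrow> token list" where "acts z v = act (st z v)"
definition actv :: "state \<Rightarrow> uid \<Rightarrow> token set" where "actv z v = set (acts z v)"

text \<open>The deterministic facts about an elected register. Safety rests on these alone; the
  distribution of the winners enters only in \<open>prob_covered\<close>.\<close>

definition regs_ok :: "(uid \<Rightarrow> token list) \<Rightarrow> nat list \<Rightarrow> bool" where
  "regs_ok ac M \<longleftrightarrow> length M = Suc (slots N) \<and>
    (M ! 0 = 0 \<longrightarrow> (\<forall>v\<in>V. ac v = [])) \<and>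
    (M ! 0 \<noteq> 0 \<longrightarrow> (\<exists>u\<in>V. ac u \<noteq> [] \<and> (\<forall>v\<in>V. length (ac v) \<le> length (ac u)) \<and>
       M ! 0 = length (ac u) * idbase N + code u)) \<and>
    (\<forall>j<slots N. M ! Suc j \<noteq> 0 \<longrightarrow> (\<exists>u\<in>V. \<exists>r i. i < nblocks msize (length (ac u)) \<and> i < N \<and>
       M ! Suc j = (r * N + i) * idbase N + code u))"

definition GB :: "(uid \<Rightarrow> token list) \<Rightarrow> nat list \<Rightarrow> token list list" where
  "GB ac M = map (\<lambda>(u, i). block msize (ac u) i) (gens N M)"

lemma lead_block_code: "u \<in> V \<Longrightarrow> lead_blocks N (l * idbase N + code u) =
    map (Pair u) [0..<min (lead N) (nblocks msize l)]"
  using code_V[of u] code_pos[of u] by (simp add: lead_blocks_def code_div code_mod)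

lemma slot_block_code: "u \<in> V \<Longrightarrow> i < N \<Longrightarrow> slot_block N ((r * N + i) * idbase N + code u) = [(u, i)]"
  using code_V[of u] code_pos[of u] by (simp add: slot_block_def code_div code_mod)

lemma gens_ok:
  assumes "regs_ok ac M" "(u, i) \<in> set (gens N M)"
  shows "u \<in> V \<and> i < nblocks msize (length (ac u)) \<and> ac u \<noteq> []"
proof -
  have "u \<in> V \<and> i < nblocks msize (length (ac u))"
    using assms(2) unfolding gens_def set_append Un_iff
  proof
    assume l: "(u, i) \<in> set (lead_blocks N (M ! 0))"
    then have "M ! 0 \<noteq> 0" by (auto simp: lead_blocks_def split: if_splits)
    then obtain u' where u': "u' \<in> V" "M ! 0 = length (ac u') * idbase N + code u'"
      using assms(1) by (auto simp: regs_ok_def)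
    then show ?thesis using l by (auto simp: lead_block_code)
  next
    assume "(u, i) \<in> set (concat (map (\<lambda>j. slot_block N (M ! Suc j)) [0..<slots N]))"
    then obtain j where j: "j < slots N" "(u, i) \<in> set (slot_block N (M ! Suc j))" by auto
    then have "M ! Suc j \<noteq> 0" by (auto simp: slot_block_def split: if_splits)
    then obtain u' r i' where u': "u' \<in> V" "i' < nblocks msize (length (ac u'))" "i' < N"
        "M ! Suc j = (r * N + i') * idbase N + code u'"
      using assms(1) j(1) unfolding regs_ok_def by blast
    then show ?thesis using j slot_block_code[of u' i' r] by simp
  qed
  then show ?thesis using msize_pos by (cases "ac u") auto
qed

lemma GB_props:
  assumes "regs_ok ac M" "\<And>v. v \<in> V \<Longrightarrow> set (ac v) \<subseteq> toks" "B \<in> set (GB ac M)"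
  shows "length B = msize" "set B \<subseteq> toks" "\<forall>t\<in>set B. length t = d" "length (concat B) = msize * d"
proof -
  obtain u i where ui: "(u, i) \<in> set (gens N M)" "B = block msize (ac u) i" using assms(3)
      by (auto simp: GB_def)
  then have u: "u \<in> V" "ac u \<noteq> []" using gens_ok[OF assms(1)] by auto
  show l: "length B = msize" using ui by simp
  have "set B \<subseteq> set (ac u)" using ui u set_block by auto
  then show s: "set B \<subseteq> toks" using assms(2) u by blast
  then show d: "\<forall>t\<in>set B. length t = d" using length_toks by blast
  then show "length (concat B) = msize * d" using l length_concat_const by metis
qed

lemma nominate_ok:
  assumes "\<And>v. v \<in> V \<Longrightarrow> nid (ss v) = v \<and> bigN (ss v) = N \<and> r v = nominate (ss v) (f v) \<and> f v \<in> set_pmf (draws N)"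
    and "\<And>v. v \<in> V \<Longrightarrow> length (act (ss v)) \<le> n"
  shows "regs_ok (\<lambda>v. act (ss v)) (gmax r)" "\<forall>v\<in>V. length (r v) = Suc (slots N) \<and> (\<forall>x\<in>set (r v). x < 2 ^ width N)"
proof -
  let ?X = "idbase N" and ?L = "\<lambda>v. length (act (ss v))"
  have nth0: "r v ! 0 = (if act (ss v) = [] then 0 else ?L v * ?X + code v)" if "v \<in> V" for v
    using assms(1)[OF that] by (simp add: nominate_def Let_def)
  have nthS: "r v ! Suc j = (if snd (f v j) < nblocks msize (?L v)
      then (fst (f v j) * N + snd (f v j)) * ?X + code v else 0)" if "v \<in> V" "j < slots N" for v j
    using assms(1)[OF that(1)] that(2) by (simp add: nominate_def Let_def)
  have len: "length (r v) = Suc (slots N)" if "v \<in> V" for v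
    using assms(1)[OF that] by (simp add: nominate_def Let_def)
  have f: "fst (f v j) < prios N" "snd (f v j) < N" if "v \<in> V" "j < slots N" for v j
  proof -
    have "(0, 0) \<in> {..<prios N} \<times> {..<N}" using N_pos by (simp add: prios_def)
    then have ne: "{..<prios N} \<times> {..<N} \<noteq> {}" by blast
    have "f v j \<in> set_pmf (pmf_of_set ({..<prios N} \<times> {..<N}))"
      using assms(1)[OF that(1)] that(2) set_Pi_pmf_D[of "{..<slots N}" "f v"] unfolding draws_def
          by blast
    then have "f v j \<in> {..<prios N} \<times> {..<N}"
        by (simp only: set_pmf_of_set[OF ne] finite_cartesian_product finite_lessThan)
    then show "fst (f v j) < prios N" "snd (f v j) < N" by (simp_all add: mem_Times_iff)
  qed
  have s: "spreads r (gmax r) 0" using len by (rule spreads_init)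
  then have lM: "length (gmax r) = Suc (slots N)" using len some_V by (force simp: spreads_def)
  have le: "r v ! j \<le> gmax r ! j" if "v \<in> V" "j < Suc (slots N)" for v j
    using s that lM by (auto simp: spreads_def)
  show "regs_ok (\<lambda>v. act (ss v)) (gmax r)"
    unfolding regs_ok_def
  proof (intro conjI impI allI)
    show "length (gmax r) = Suc (slots N)" by (rule lM)
    obtain u where u: "u \<in> V" "r u ! 0 = gmax r ! 0" using spreads_attained[OF s, of 0] lM by auto
    show "\<forall>v\<in>V. act (ss v) = []" if "gmax r ! 0 = 0"
    proof
      fix v assume v: "v \<in> V"
      then have "r v ! 0 = 0" using le[of v 0] that by simp
      then show "act (ss v) = []" using nth0[OF v] code_pos[of v] by (auto split: if_splits)
    qed
    show "\<exists>u\<in>V. act (ss u) \<noteq> [] \<and> (\<forall>v\<in>V. ?L v \<le> ?L u) \<and> gmax r ! 0 = ?L u * ?X + code u"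
      if "gmax r ! 0 \<noteq> 0"
    proof (intro bexI[of _ u] conjI ballI)
      show ne: "act (ss u) \<noteq> []" and eq: "gmax r ! 0 = ?L u * ?X + code u"
        using u nth0[OF u(1)] that by (auto split: if_splits)
      fix v assume v: "v \<in> V"
      show "?L v \<le> ?L u"
      proof (cases "act (ss v) = []")
        case False
        then have "?L v * ?X + code v \<le> ?L u * ?X + code u" using le[OF v, of 0] nth0[OF v] eq by simp
        then have "(?L v * ?X + code v) div ?X \<le> (?L u * ?X + code u) div ?X" by (rule div_le_mono)
        then show ?thesis using code_V u v by (simp add: code_div)
      qed simp
    qed (use u in simp)
    fix j assume j: "j < slots N" "gmax r ! Suc j \<noteq> 0"
    obtain w where w: "w \<in> V" "r w ! Suc j = gmax r ! Suc j" using spreads_attained[OF s, of "Suc j"] lM j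
        by auto
    then show "\<exists>u\<in>V. \<exists>p i. i < nblocks msize (?L u) \<and> i < N \<and> gmax r ! Suc j = (p * N + i) * ?X + code u"
      using nthS[OF w(1) j(1)] f[OF w(1) j(1)] j(2)
      by (intro bexI[of _ w] exI[of _ "fst (f w j)"] exI[of _ "snd (f w j)"]) (auto split: if_splits)
  qed
  \<comment> \<open>The digits of an entry: \<open>2 * lg N + 4\<close> bits of priority,
    \<open>lg N\<close> bits of index and \<open>A * lg N + 1\<close> bits of identifier, together
    at most \<open>width N\<close> because \<open>lg N \<ge> 1\<close>. A load also fits, being at
    most \<open>N\<close>.\<close>
  have bound: "h * ?X + code v < 2 ^ width N" if "h < prios N * N" "v \<in> V" for h v
  proof -
    have "h * ?X + code v < Suc h * ?X" using code_V[OF that(2)] by simp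
    also have "\<dots> \<le> (prios N * N) * ?X" using that(1) by (intro mult_right_mono) auto
    also have "\<dots> \<le> (2 ^ (2 * lg N + 4) * 2 ^ lg N) * 2 ^ (A * lg N + 1)"
      unfolding prios_def idbase_def using lg_N(3) by (intro mult_right_mono mult_left_mono) auto
    also have "\<dots> = 2 ^ (2 * lg N + 4 + lg N + (A * lg N + 1))" by (simp only: power_add)
    also have "\<dots> \<le> 2 ^ width N"
      using lg_pos by (intro power_increasing) (auto simp: width_def algebra_simps)
    finally show ?thesis .
  qed
  have "1 < prios N" unfolding prios_def by (intro one_less_power) auto
  then have pN: "N < prios N * N" using N_pos by simp
  show "\<forall>v\<in>V. length (r v) = Suc (slots N) \<and> (\<forall>x\<in>set (r v). x < 2 ^ width N)"
  proof (intro ballI conjI)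
    fix v x assume v: "v \<in> V" and "x \<in> set (r v)"
    then obtain j where j: "j < Suc (slots N)" "x = r v ! j" using len by (auto simp: in_set_conv_nth)
    show "x < 2 ^ width N"
    proof (cases j)
      case 0
      have "?L v < prios N * N" using assms(2)[OF v] n_le_N pN by linarith
      then show ?thesis using j 0 nth0[OF v] bound[OF _ v] by auto
    next
      case (Suc j')
      then have j': "j' < slots N" using j by simp
      have "fst (f v j') * N + snd (f v j') < Suc (fst (f v j')) * N" using f(2)[OF v j'] by simp
      also have "\<dots> \<le> prios N * N" using f(1)[OF v j'] by (intro mult_right_mono) auto
      finally show ?thesis using j Suc nthS[OF v] bound[OF _ v] by auto
    qed
  qed (rule len)
qed

end

section \<open>Safety\<close>

context dynamic
begin

text \<open>The second conjunct makes termination correct: a token active nowhere is known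
  everywhere. The last one is a clock: each cycle retires at least one token, so at most
  \<open>k\<close> cycles are completed, and as \<open>k \<le> N\<close> the names of the
  generations stay distinct.\<close>

definition base :: "state \<Rightarrow> bool" where
  "base z \<longleftrightarrow>
    (\<forall>v\<in>V. \<not> fin (st z v) \<and> nid (st z v) = v \<and> clk (st z v) = time z \<and> bigN (st z v) = N \<and>
       distinct (acts z v) \<and> actv z v \<subseteq> set (known (st z v)) \<and> set (known (st z v)) \<subseteq> toks) \<and>
    (\<forall>x\<in>toks. (\<forall>v\<in>V. x \<in> set (known (st z v))) \<or> (\<exists>v\<in>V. x \<in> actv z v)) \<and>
    gcyc (time z) + card (\<Union>v\<in>V. actv z v) \<le> k"

definition nominating :: "state \<Rightarrow> bool" where
  "nominating z \<longleftrightarrow> (\<exists>M. spreads (\<lambda>v. reg (st z v)) M (goff (time z)) \<and>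
     (\<forall>v\<in>V. \<forall>x\<in>set (reg (st z v)). x < 2 ^ width N) \<and> regs_ok (acts z) M)"

definition generation :: "state \<Rightarrow> nat list \<Rightarrow> bool" where
  "generation z M \<longleftrightarrow> (\<forall>v\<in>V. reg (st z v) = M) \<and> regs_ok (acts z) M \<and> M ! 0 \<noteq> 0 \<and>
     (\<forall>v\<in>V. own_packets (st z v) \<subseteq> set (pks (st z v)) \<and>
       (\<forall>(c, p)\<in>set (pks (st z v)). is_combination (GB (acts z) M) c p \<and> length p = msize * d))"

definition verifying :: "state \<Rightarrow> bool" where
  "verifying z \<longleftrightarrow> (\<exists>W. spreads (\<lambda>v. vreg (st z v)) W (goff (time z)) \<and> length W = 2 \<and>
     (\<forall>v\<in>V. vreg_ok (vreg (st z v))) \<and> (W ! 0 = 0 \<longleftrightarrow> (\<forall>v\<in>V. full (st z v))) \<and>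
     (\<forall>v\<in>V. set (dec (st z v)) = decode (st z v) \<and> decode (st z v) \<subseteq> set (known (st z v))) \<and>
     (\<exists>u\<in>V. \<exists>x\<in>actv z u. W ! 1 = Suc (to_nat x)) \<and>
     (\<forall>v\<in>V. vreg (st z v) ! 1 \<noteq> 0 \<longrightarrow> from_nat (vreg (st z v) ! 1 - 1) \<in> set (known (st z v))))"

definition syncing :: "state \<Rightarrow> bool" where
  "syncing z \<longleftrightarrow>
    (\<forall>v\<in>V. \<not> fin (st z v) \<and> nid (st z v) = v \<and> clk (st z v) = time z \<and> est v \<le> top (st z v) \<and>
       set (known (st z v)) = I v \<and> actv z v = I v \<and> distinct (acts z v)) \<and>
    spreads (\<lambda>v. [top (st z v)]) [Max (est ` V)] (time z)"

definition active_run :: "state \<Rightarrow> bool" where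
  "active_run z \<longleftrightarrow> base z \<and> (gph (time z) = 1 \<longrightarrow> goff (time z) \<noteq> 0 \<longrightarrow> nominating z) \<and>
     (gph (time z) \<in> {2, 3} \<longrightarrow> (\<exists>M. generation z M)) \<and> (gph (time z) = 3 \<longrightarrow> verifying z)"

definition finished :: "state \<Rightarrow> bool" where
  "finished z \<longleftrightarrow> (\<forall>v\<in>V. fin (st z v) \<and> set (known (st z v)) = toks \<and> acts z v = [])"

text \<open>There is never a mixture of halted and running nodes. This matters since a halted node
  is silent and could cut off the others, which would ruin all flooding arguments.\<close>

definition safe :: "state \<Rightarrow> bool" where
  "safe z \<longleftrightarrow> (if time z < N then syncing z else active_run z \<or> finished z)"

lemma base_running: "base z \<Longrightarrow> running z"
  by (simp add: base_def running_def)

lemma baseD: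
  assumes "base z" "v \<in> V"
  shows "nid (st z v) = v" "clk (st z v) = time z" "2 * top (st z v) = N"
    "distinct (acts z v)" "actv z v \<subseteq> set (known (st z v))" "set (known (st z v)) \<subseteq> toks"
  using assms by (auto simp: base_def)

lemma base_position:
  assumes "base z" "N \<le> time z" "v \<in> V"
  shows "phase (st z v) = gph (time z)" "offset (st z v) = goff (time z)" "cycle (st z v) = gcyc (time z)"
    "final (st z v) \<longleftrightarrow> Suc (goff (time z)) = T" "\<not> clk (st z v) < N"
  using baseD[OF assms(1,3)] assms(2)
  by (simp_all add: phase_def offset_def cycle_def final_def tau_def gph_def goff_def gcyc_def gtau_def)

lemma fin_actv: "finite (actv z v)"
  by (simp add: actv_def)

lemma fin_active: "finite (\<Union>v\<in>V. actv z v)"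
  using fin_V fin_actv by simp

lemma actv_toks: "base z \<Longrightarrow> v \<in> V \<Longrightarrow> actv z v \<subseteq> toks"
  using baseD(5,6) by blast

lemma length_acts: "base z \<Longrightarrow> v \<in> V \<Longrightarrow> length (acts z v) = card (actv z v)"
  using baseD(4) by (simp add: distinct_card actv_def)

lemma card_actv_le: "base z \<Longrightarrow> v \<in> V \<Longrightarrow> card (actv z v) \<le> n"
  using card_mono[OF fin_toks actv_toks, of z v] card_toks k_le by simp

lemma st_gather:
  assumes "base z" "N \<le> time z" "gph (time z) = 0" "y \<in> set_pmf (moves z)" "v \<in> V"
  shows "st (nxt z y) v = (tick (st z v) (hear (inb z y v)))\<lparr>act := lst (actv z v \<union> hear (inb z y v))\<rparr>"
    and "\<exists>ts. fst (y v) = Message [] ts [] \<and> set ts \<subseteq> actv z v \<and> (ts = [] \<or> ts \<in> range (block msize (acts z v)))"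
    and "(gathering N (gcyc (time z)) \<and> acts z v \<noteq> [] \<longrightarrow>
          y v \<in> (\<lambda>i. (Message [] (block msize (acts z v) i) [], st z v)) ` {..<nblocks msize (length (acts z v))}) \<and>
         (\<not> gathering N (gcyc (time z)) \<longrightarrow> fst (y v) = Message [] [] [])"
proof -
  note p = base_position[OF assms(1,2,5)] and bd = baseD[OF assms(1,5)]
  have y: "y v \<in> set_pmf (node_send (st z v))" using moves_D assms by blast
  have ne: "{..<nblocks msize (length (acts z v))} \<noteq> {}" if "acts z v \<noteq> []"
    using nblocks_pos[OF msize_pos, of "length (acts z v)"] that
        by (metis lessThan_iff emptyE length_greater_0_conv)
  have s: "node_send (st z v) = (if gathering N (gcyc (time z)) \<and> acts z v \<noteq> []
      then map_pmf (\<lambda>i. (Message [] (block msize (acts z v) i) [], st z v)) (pmf_of_set {..<nblocks msize (length (acts z v))})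
      else return_pmf (Message [] [] [], st z v))"
    using p bd assms(3) by (simp add: node_send_def acts_def)
  have snd: "snd (y v) = st z v" using y unfolding s by (auto split: if_splits)
  then show "st (nxt z y) v = (tick (st z v) (hear (inb z y v)))\<lparr>act := lst (actv z v \<union> hear (inb z y v))\<rparr>"
    using p bd assms(3,5) base_running[OF assms(1)]
        by (simp add: st_nxt node_receive_def acts_def actv_def)
  show "(gathering N (gcyc (time z)) \<and> acts z v \<noteq> [] \<longrightarrow>
          y v \<in> (\<lambda>i. (Message [] (block msize (acts z v) i) [], st z v)) ` {..<nblocks msize (length (acts z v))}) \<and>
         (\<not> gathering N (gcyc (time z)) \<longrightarrow> fst (y v) = Message [] [] [])"
    using y ne unfolding s by auto
  then show "\<exists>ts. fst (y v) = Message [] ts [] \<and> set ts \<subseteq> actv z v \<and> (ts = [] \<or> ts \<in> range (block msize (acts z v)))"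
  proof (cases "gathering N (gcyc (time z)) \<and> acts z v \<noteq> []")
    case True
    then obtain i where "y v = (Message [] (block msize (acts z v) i) [], st z v)" using y ne unfolding s
        by auto
    then show ?thesis using True set_block[of "acts z v" msize i] by (auto simp: actv_def)
  next
    case False
    then show ?thesis using y unfolding s by auto
  qed
qed

lemma st_nominate:
  assumes "base z" "N \<le> time z" "gph (time z) = 1" "y \<in> set_pmf (moves z)" "v \<in> V"
  defines "s' \<equiv> (tick (snd (y v)) (hear (inb z y v)))\<lparr>reg := merge (reg (snd (y v))) (get_reg N ` inb z y v)\<rparr>"
  shows "fst (y v) = put_reg N (reg (snd (y v)))" "hear (inb z y v) = {}"
    "\<exists>r. snd (y v) = (st z v)\<lparr>reg := r\<rparr> \<and> (goff (time z) \<noteq> 0 \<longrightarrow> r = reg (st z v)) \<and>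
       (goff (time z) = 0 \<longrightarrow> (\<exists>f\<in>set_pmf (draws N). r = nominate (st z v) f))"
    "st (nxt z y) v = (if Suc (goff (time z)) = T then if reg s' ! 0 = 0 then s'\<lparr>fin := True\<rparr>
       else s'\<lparr>pks := lst (own_packets s')\<rparr> else s')"
proof -
  have all: "fst (y v) = put_reg N (reg (snd (y v))) \<and> (\<exists>r. snd (y v) = (st z v)\<lparr>reg := r\<rparr> \<and>
       (goff (time z) \<noteq> 0 \<longrightarrow> r = reg (st z v)) \<and>
       (goff (time z) = 0 \<longrightarrow> (\<exists>f\<in>set_pmf (draws N). r = nominate (st z v) f)))" if v: "v \<in> V" for v
  proof -
    note p = base_position[OF assms(1,2) v] and bd = baseD[OF assms(1) v]
    have y: "y v \<in> set_pmf (node_send (st z v))" using moves_D assms v by blast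
    have "node_send (st z v) = (if goff (time z) = 0
        then map_pmf (\<lambda>f. (put_reg N (nominate (st z v) f), (st z v)\<lparr>reg := nominate (st z v) f\<rparr>)) (draws N)
        else return_pmf (put_reg N (reg (st z v)), st z v))"
      using p bd assms(3) by (simp add: node_send_def)
    then show ?thesis using y by (auto split: if_splits)
  qed
  then show "fst (y v) = put_reg N (reg (snd (y v)))" and
    ex: "\<exists>r. snd (y v) = (st z v)\<lparr>reg := r\<rparr> \<and> (goff (time z) \<noteq> 0 \<longrightarrow> r = reg (st z v)) \<and>
       (goff (time z) = 0 \<longrightarrow> (\<exists>f\<in>set_pmf (draws N). r = nominate (st z v) f))" using assms(5) by blast+
  show "hear (inb z y v) = {}" using all net_V[of _ v z] by (auto simp: hear_def inb_def put_reg_def)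
  note p = base_position[OF assms(1,2,5)] and bd = baseD[OF assms(1,5)]
  from ex obtain r where r: "snd (y v) = (st z v)\<lparr>reg := r\<rparr>" by blast
  have "phase (snd (y v)) = 1" "final (snd (y v)) \<longleftrightarrow> Suc (goff (time z)) = T" "\<not> clk (snd (y v)) < N"
    "2 * top (snd (y v)) = N"
    using p bd assms(3) unfolding r by (simp_all add: phase_def final_def offset_def tau_def)
  then show "st (nxt z y) v = (if Suc (goff (time z)) = T then if reg s' ! 0 = 0 then s'\<lparr>fin := True\<rparr>
       else s'\<lparr>pks := lst (own_packets s')\<rparr> else s')"
    using assms(5) base_running[OF assms(1)] unfolding s'_def
        by (simp add: st_nxt node_receive_def Let_def)
qed

lemma st_code:
  assumes "base z" "N \<le> time z" "gph (time z) = 2" "y \<in> set_pmf (moves z)" "v \<in> V"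
  defines "s' \<equiv> (tick (st z v) {})\<lparr>pks := lst (set (pks (st z v)) \<union> packets (inb z y v))\<rparr>"
  shows "\<exists>w. length w = length (pks (st z v)) \<and> y v = (combination (st z v) w, st z v)"
    "hear (inb z y v) = {}"
    "st (nxt z y) v = (if Suc (goff (time z)) = T then start_verify s' else s')"
proof -
  have all: "\<exists>w. length w = length (pks (st z v)) \<and> y v = (combination (st z v) w, st z v)" if v: "v \<in> V"
      for v
  proof -
    note p = base_position[OF assms(1,2) v] and bd = baseD[OF assms(1) v]
    have y: "y v \<in> set_pmf (node_send (st z v))" using moves_D assms v by blast
    have "node_send (st z v) = map_pmf (\<lambda>w. (combination (st z v) w, st z v)) (pmf_of_set {w. length w = length (pks (st z v))})"
      using p bd assms(3) by (simp add: node_send_def)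
    moreover have "{w :: bit list. length w = length (pks (st z v))} \<noteq> {}" using Ex_list_of_length by auto
    ultimately show ?thesis using y card_bit_lists(1) by auto
  qed
  then show "\<exists>w. length w = length (pks (st z v)) \<and> y v = (combination (st z v) w, st z v)" using assms(5)
      by blast
  have "plain (fst (y u)) = []" if "(u, v) \<in> net z" for u
    using all[of u] net_V[OF that] by (auto simp: combination_def)
  then show h: "hear (inb z y v) = {}" by (auto simp: hear_def inb_def)
  note p = base_position[OF assms(1,2,5)] and bd = baseD[OF assms(1,5)]
  have "snd (y v) = st z v" using all[OF assms(5)] by auto
  then show "st (nxt z y) v = (if Suc (goff (time z)) = T then start_verify s' else s')"
    using p bd assms(3,5) base_running[OF assms(1)] h unfolding s'_def
    by (simp add: st_nxt node_receive_def Let_def)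
qed

lemma st_verify:
  assumes "base z" "N \<le> time z" "gph (time z) = 3" "y \<in> set_pmf (moves z)" "v \<in> V"
  defines "s' \<equiv> (tick (st z v) (hear (inb z y v)))\<lparr>vreg := merge (vreg (st z v)) (get_vreg ` inb z y v)\<rparr>"
  shows "y v = (put_vreg (vreg (st z v)), st z v)"
    "st (nxt z y) v = (if Suc (goff (time z)) = T then end_verify s' else s')"
    "inb z y v = (\<lambda>u. put_vreg (vreg (st z u))) ` {u. (u, v) \<in> net z}"
proof -
  have all: "y v = (put_vreg (vreg (st z v)), st z v)" if v: "v \<in> V" for v
  proof -
    note p = base_position[OF assms(1,2) v] and bd = baseD[OF assms(1) v]
    have y: "y v \<in> set_pmf (node_send (st z v))" using moves_D assms v by blast
    have "node_send (st z v) = return_pmf (put_vreg (vreg (st z v)), st z v)"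
      using p bd assms(3) by (simp add: node_send_def)
    then show ?thesis using y by auto
  qed
  then show "y v = (put_vreg (vreg (st z v)), st z v)" using assms(5) by blast
  then show "st (nxt z y) v = (if Suc (goff (time z)) = T then end_verify s' else s')"
    using base_position[OF assms(1,2,5)] baseD[OF assms(1,5)] assms(3,5) base_running[OF assms(1)]
        unfolding s'_def
    by (simp add: st_nxt node_receive_def Let_def)
  show "inb z y v = (\<lambda>u. put_vreg (vreg (st z u))) ` {u. (u, v) \<in> net z}"
    unfolding inb_def by (intro image_cong refl) (use all net_V[of _ v z] in auto)
qed

end

lemma merge_nth: "j < length r \<Longrightarrow> merge r R ! j = Max (insert (r ! j) ((\<lambda>r'. r' ! j) ` R))"
  by (simp add: merge_def)

context dynamic
begin

lemma own_packets_update [simp]: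
  "own_packets (s\<lparr>pks := P\<rparr>) = own_packets s" "own_packets (s\<lparr>dec := D\<rparr>) = own_packets s"
  "own_packets (s\<lparr>known := L\<rparr>) = own_packets s" "own_packets (s\<lparr>clk := x\<rparr>) = own_packets s"
  "own_packets (s\<lparr>vreg := r\<rparr>) = own_packets s" "own_packets (tick s S) = own_packets s"
  by (simp_all add: own_packets_def gen_size_def tick_def)

lemma tick_simps [simp]:
  "nid (tick s S) = nid s" "clk (tick s S) = Suc (clk s)" "top (tick s S) = top s" "act (tick s S) = act s"
  "reg (tick s S) = reg s" "vreg (tick s S) = vreg s" "pks (tick s S) = pks s" "dec (tick s S) = dec s"
  "fin (tick s S) = fin s" "known (tick s S) = lst (set (known s) \<union> S)"
  by (simp_all add: tick_def)

lemma full_update [simp]: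
  "full (s\<lparr>dec := D\<rparr>) = full s" "full (s\<lparr>known := L\<rparr>) = full s" "full (s\<lparr>vreg := r\<rparr>) = full s"
  "full (tick s S) = full s" "full (s\<lparr>act := a'\<rparr>) = full s"
  by (simp_all add: full_def gen_size_def tick_def)

lemma decode_update [simp]:
  "decode (s\<lparr>dec := D\<rparr>) = decode s" "decode (s\<lparr>known := L\<rparr>) = decode s" "decode (s\<lparr>vreg := r\<rparr>) = decode s"
  "decode (tick s S) = decode s"
  by (simp_all only: decode_def full_update, simp_all add: gen_size_def)

lemma base_step:
  assumes "base z" "time z' = Suc (time z)"
    and "\<And>v. v \<in> V \<Longrightarrow> \<not> fin (st z' v) \<and> nid (st z' v) = nid (st z v) \<and> clk (st z' v) = Suc (clk (st z v)) \<and>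
       top (st z' v) = top (st z v) \<and> distinct (acts z' v) \<and> actv z' v \<subseteq> set (known (st z' v)) \<and>
       set (known (st z v)) \<subseteq> set (known (st z' v)) \<and> set (known (st z' v)) \<subseteq> toks"
    and "\<And>x v. v \<in> V \<Longrightarrow> x \<in> actv z v \<Longrightarrow> (\<forall>v\<in>V. x \<in> set (known (st z' v))) \<or> (\<exists>v\<in>V. x \<in> actv z' v)"
    and "gcyc (Suc (time z)) + card (\<Union>v\<in>V. actv z' v) \<le> k"
  shows "base z'"
  unfolding base_def
proof (intro conjI ballI)
  fix x assume "x \<in> toks"
  then consider "\<forall>v\<in>V. x \<in> set (known (st z v))" | v where "v \<in> V" "x \<in> actv z v"
    using assms(1) unfolding base_def by blast
  then show "(\<forall>v\<in>V. x \<in> set (known (st z' v))) \<or> (\<exists>v\<in>V. x \<in> actv z' v)"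
    using assms(3,4) by cases blast+
qed (use assms baseD[OF assms(1)] in auto)

lemma sync_step:
  assumes "syncing z" "time z < N" "y \<in> set_pmf (moves z)"
  shows "safe (nxt z y)"
    "v \<in> V \<Longrightarrow> \<exists>x. y v = (Message (bin (lg x) x) [] [], st z v) \<and> x \<le> Max (est ` V)"
    "v \<in> V \<Longrightarrow> set (known (st (nxt z y) v)) = I v"
proof -
  let ?E = "Max (est ` V)"
  have r: "running z" using assms(1) by (simp add: syncing_def running_def)
  have sp: "spreads (\<lambda>v. [top (st z v)]) [?E] (time z)" using assms(1) by (simp add: syncing_def)
  have sy: "\<not> fin (st z v)" "nid (st z v) = v" "clk (st z v) = time z" "est v \<le> top (st z v)"
     "set (known (st z v)) = I v" "actv z v = I v" "distinct (acts z v)" if "v \<in> V" for v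
    using assms(1) that by (auto simp: syncing_def)
  \<comment> \<open>No node leaves the initial phase early: while fewer than \<open>n\<close> rounds
    have passed, the own estimate already gives \<open>bigN \<ge> n\<close>; afterwards the maximum
    has arrived and \<open>bigN = N\<close>.\<close>
  have lt: "clk (st z v) < bigN (st z v)" if v: "v \<in> V" for v
  proof (cases "n \<le> Suc (time z)")
    case True
    then have "[top (st z v)] = [?E]" using spreads_done[OF sp _ v] by simp
    then show ?thesis using sy(3)[OF v] assms(2) by (simp add: N_def)
  next
    case False
    then show ?thesis using sy(3,4)[OF v] n_le_est[OF v] by linarith
  qed
  have y: "y v = (Message (bin (lg (top (st z v))) (top (st z v))) [] [], st z v)" if "v \<in> V" for v
    using moves_D[OF assms(3) that] lt[OF that] by (simp add: node_send_def)
  have tE: "top (st z v) \<le> ?E" if "v \<in> V" for v using sp that by (auto simp: spreads_def)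
  show "v \<in> V \<Longrightarrow> \<exists>x. y v = (Message (bin (lg x) x) [] [], st z v) \<and> x \<le> Max (est ` V)"
    using y tE by blast
  have st': "st (nxt z y) v = (st z v)\<lparr>clk := Suc (time z), top := Max (insert (top (st z v)) ((\<lambda>u. top (st z u)) ` {u. (u, v) \<in> net z}))\<rparr>"
    if v: "v \<in> V" for v
  proof -
    have "(val \<circ> control) ` inb z y v = (\<lambda>u. top (st z u)) ` {u. (u, v) \<in> net z}"
      unfolding inb_def image_image
      by (intro image_cong refl) (use y net_V[of _ v z] less_two_power_lg in \<open>auto simp: val_bin\<close>)
    then show ?thesis using st_nxt[OF r v] y[OF v] lt[OF v] sy(3)[OF v] by (simp add: node_receive_def)
  qed
  show "v \<in> V \<Longrightarrow> set (known (st (nxt z y) v)) = I v" using st' sy by simp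
  have sp': "spreads (\<lambda>v. [top (st (nxt z y) v)]) [?E] (Suc (time z))"
    by (rule spreads_step[OF sp]) (simp add: st' merge_def image_image)
  have act': "acts (nxt z y) v = acts z v" "actv (nxt z y) v = actv z v" if "v \<in> V" for v
    using st'[OF that] by (simp_all add: acts_def actv_def)
  show "safe (nxt z y)"
  proof (cases "Suc (time z) < N")
    case True
    have "est v \<le> top (st (nxt z y) v)" if v: "v \<in> V" for v
    proof -
      have "top (st z v) \<le> top (st (nxt z y) v)" using st'[OF v] fin_nbrs by simp
      then show ?thesis using sy(4)[OF v] by simp
    qed
    then have "syncing (nxt z y)"
      unfolding syncing_def using sp' sy act' st' by (simp add: syncing_def)
    then show ?thesis using True by (simp add: safe_def)
  next
    case False
    then have N: "Suc (time z) = N" using assms(2) by simp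
    have "2 * top (st (nxt z y) v) = N" if v: "v \<in> V" for v
    proof -
      have "[top (st (nxt z y) v)] = [?E]"
        using spreads_done[OF sp' _ v] N n_le_N by simp
      then show ?thesis by (simp add: N_def)
    qed
    moreover have "(\<Union>v\<in>V. actv (nxt z y) v) = toks" using act' sy by (simp add: toks_def)
    moreover have "\<exists>v\<in>V. x \<in> actv (nxt z y) v" if "x \<in> toks" for x
      using that act' sy by (auto simp: toks_def)
    ultimately have "base (nxt z y)"
      unfolding base_def using sy act' st' N position_start card_toks by (auto simp: toks_def)
    then show ?thesis using N position_start by (simp add: safe_def active_run_def)
  qed
qed

lemma position_cases:
  assumes "N \<le> t"
  obtains "Suc (goff t) < T" "gph (Suc t) = gph t" "goff (Suc t) = Suc (goff t)" "gcyc (Suc t) = gcyc t"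
  | "Suc (goff t) = T" "gph (Suc t) = (gph t + 1) mod 4" "goff (Suc t) = 0"
      "gcyc (Suc t) = (if gph t = 3 then Suc (gcyc t) else gcyc t)"
  using position_inside[OF assms] position_end[OF assms] goff_less[of t]
      by (cases "Suc (goff t) < T") (auto)

lemma gph_less: "gph t < 4"
  by (simp add: gph_def)

lemma base_countD: "base z \<Longrightarrow> gcyc (time z) + card (\<Union>v\<in>V. actv z v) \<le> k"
  by (simp add: base_def)

lemma gather_hear:
  assumes "base z" "N \<le> time z" "gph (time z) = 0" "y \<in> set_pmf (moves z)"
  shows "hear (inb z y v) \<subseteq> (\<Union>v\<in>V. actv z v)" "\<not> gathering N (gcyc (time z)) \<Longrightarrow> hear (inb z y v) = {}"
proof -
  have "plain (fst (y u)) = ts \<Longrightarrow> set ts \<subseteq> actv z u" if "(u, v) \<in> net z" for u ts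
    using st_gather(2)[OF assms, of u] net_V[OF that] by auto
  then show "hear (inb z y v) \<subseteq> (\<Union>v\<in>V. actv z v)"
    using net_V[of _ v z] by (fastforce simp: hear_def inb_def)
  assume "\<not> gathering N (gcyc (time z))"
  then have "plain (fst (y u)) = []" if "(u, v) \<in> net z" for u
    using st_gather(3)[OF assms, of u] net_V[OF that] by auto
  then show "hear (inb z y v) = {}" by (auto simp: hear_def inb_def)
qed

lemma gather_step:
  assumes "base z" "N \<le> time z" "gph (time z) = 0" "y \<in> set_pmf (moves z)"
  shows "active_run (nxt z y)" "v \<in> V \<Longrightarrow> actv (nxt z y) v = actv z v \<union> hear (inb z y v)"
proof -
  note s = st_gather(1)[OF assms] and h = gather_hear(1)[OF assms]
  have sub: "hear (inb z y v) \<subseteq> toks" for v using h actv_toks[OF assms(1)] by blast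
  have fin: "finite (hear (inb z y v))" for v using h fin_active finite_subset by blast
  show act: "actv (nxt z y) v = actv z v \<union> hear (inb z y v)" if "v \<in> V" for v
    using s[OF that] fin fin_actv by (simp add: actv_def acts_def)
  have U: "(\<Union>v\<in>V. actv (nxt z y) v) = (\<Union>v\<in>V. actv z v)"
    using act by (auto dest!: subsetD[OF h])
  have pos: "gph (Suc (time z)) = 0 \<or> gph (Suc (time z)) = 1 \<and> goff (Suc (time z)) = 0"
      "gcyc (Suc (time z)) = gcyc (time z)"
    using assms(2,3) by (auto elim!: position_cases[of "time z"])
  have "base (nxt z y)"
  proof (rule base_step[OF assms(1)])
    fix v assume v: "v \<in> V"
    show "\<not> fin (st (nxt z y) v) \<and> nid (st (nxt z y) v) = nid (st z v) \<and> clk (st (nxt z y) v) = Suc (clk (st z v)) \<and>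
       top (st (nxt z y) v) = top (st z v) \<and> distinct (acts (nxt z y) v) \<and> actv (nxt z y) v \<subseteq> set (known (st (nxt z y) v)) \<and>
       set (known (st z v)) \<subseteq> set (known (st (nxt z y) v)) \<and> set (known (st (nxt z y) v)) \<subseteq> toks"
      using s[OF v] fin fin_actv baseD[OF assms(1) v] sub base_running[OF assms(1)] v act[OF v]
      by (auto simp: acts_def running_def)
  qed (use act U pos base_countD[OF assms(1)] in auto)
  then show "active_run (nxt z y)" using pos by (auto simp: active_run_def)
qed

text \<open>In the first round of the phase the registers sent are fresh nominations, which are not
  yet in \<open>st z\<close>. Speaking of the intermediate states \<open>snd (y v)\<close> covers
  this round and the later ones alike.\<close>

lemma nominate_spreads:
  assumes "base z" "N \<le> time z" "gph (time z) = 1" "goff (time z) \<noteq> 0 \<longrightarrow> nominating z" "y \<in> set_pmf (moves z)"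
  defines "r \<equiv> \<lambda>v. reg (snd (y v))"
  shows "spreads r (gmax r) (goff (time z))" "\<forall>v\<in>V. length (r v) = Suc (slots N) \<and> (\<forall>x\<in>set (r v). x < 2 ^ width N)"
    "regs_ok (acts z) (gmax r)"
proof -
  have "spreads r (gmax r) (goff (time z)) \<and> (\<forall>v\<in>V. length (r v) = Suc (slots N) \<and> (\<forall>x\<in>set (r v). x < 2 ^ width N)) \<and>
    regs_ok (acts z) (gmax r)"
  proof (cases "goff (time z) = 0")
    case True
    then have "\<forall>v\<in>V. \<exists>f\<in>set_pmf (draws N). r v = nominate (st z v) f"
      using st_nominate(3)[OF assms(1-3,5)] unfolding r_def by fastforce
    then obtain f where f: "\<And>v. v \<in> V \<Longrightarrow> f v \<in> set_pmf (draws N) \<and> r v = nominate (st z v) (f v)" by metis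
    have ok: "regs_ok (\<lambda>v. act (st z v)) (gmax r)" "\<forall>v\<in>V. length (r v) = Suc (slots N) \<and> (\<forall>x\<in>set (r v). x < 2 ^ width N)"
      using nominate_ok[of "st z" r f] f baseD[OF assms(1)] length_acts[OF assms(1)] card_actv_le[OF assms(1)]
      by (auto simp: acts_def)
    moreover have "(\<lambda>v. act (st z v)) = acts z" by (simp add: acts_def fun_eq_iff)
    ultimately show ?thesis using spreads_init[of r "Suc (slots N)"] True by auto
  next
    case False
    then obtain M where M: "spreads (\<lambda>v. reg (st z v)) M (goff (time z))"
       "\<forall>v\<in>V. \<forall>x\<in>set (reg (st z v)). x < 2 ^ width N" "regs_ok (acts z) M"
      using assms(4) by (auto simp: nominating_def)
    have e: "r v = reg (st z v)" if "v \<in> V" for v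
      using st_nominate(3)[OF assms(1-3,5) that] False unfolding r_def by fastforce
    then have "spreads r M (goff (time z))" using M(1) by (simp add: spreads_def cong: conj_cong)
    moreover then have "M = gmax r" by (rule spreads_unique)
    ultimately show ?thesis using M e by (auto simp: spreads_def regs_ok_def)
  qed
  then show "spreads r (gmax r) (goff (time z))" "\<forall>v\<in>V. length (r v) = Suc (slots N) \<and> (\<forall>x\<in>set (r v). x < 2 ^ width N)"
    "regs_ok (acts z) (gmax r)" by blast+
qed

lemma nominate_step:
  assumes "base z" "N \<le> time z" "gph (time z) = 1" "goff (time z) \<noteq> 0 \<longrightarrow> nominating z" "y \<in> set_pmf (moves z)"
  defines "r \<equiv> \<lambda>v. reg (snd (y v))"
  shows "active_run (nxt z y) \<or> finished (nxt z y)" "v \<in> V \<Longrightarrow> acts (nxt z y) v = acts z v"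
    "gmax (\<lambda>v. reg (st (nxt z y) v)) = gmax r" "v \<in> V \<Longrightarrow>
        set (known (st (nxt z y) v)) = set (known (st z v))"
    "Suc (goff (time z)) = T \<Longrightarrow> \<forall>v\<in>V. acts z v = [] \<Longrightarrow> finished (nxt z y)"
proof -
  note sp = nominate_spreads[OF assms(1-5), folded r_def]
  let ?M = "gmax r"
  note sn = st_nominate[OF assms(1-3,5)]
  have u: "\<exists>r'. snd (y v) = (st z v)\<lparr>reg := r'\<rparr>" if "v \<in> V" for v using sn(3)[OF that] by blast
  have mg: "merge (r v) (get_reg N ` inb z y v) = merge (r v) (r ` {u. (u, v) \<in> net z})" for v
  proof -
    have "get_reg N (fst (y w)) = r w" if "(w, v) \<in> net z" for w
      using sn(1)[of w] net_V[OF that] sp(2) get_put_reg[of "r w" N] by (auto simp: r_def)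
    then have "get_reg N ` inb z y v = r ` {u. (u, v) \<in> net z}"
      by (force simp: inb_def image_image)
    then show ?thesis by simp
  qed
  define r' where "r' v = reg (st (nxt z y) v)" for v
  have r': "r' v = merge (r v) (r ` {u. (u, v) \<in> net z})" if v: "v \<in> V" for v
    using sn(4)[OF v] sn(2)[OF v] mg[of v] by (auto simp: r'_def r_def split: if_splits)
  have sp': "spreads r' ?M (Suc (goff (time z)))" using sp(1) r' by (rule spreads_step)
  then show gm: "gmax (\<lambda>v. reg (st (nxt z y) v)) = gmax r"
    using spreads_unique[OF sp'] by (simp add: r'_def[abs_def])
  have un: "act (st (nxt z y) v) = act (st z v) \<and> set (known (st (nxt z y) v)) = set (known (st z v)) \<and>
     nid (st (nxt z y) v) = nid (st z v) \<and> clk (st (nxt z y) v) = Suc (clk (st z v)) \<and> top (st (nxt z y) v) = top (st z v) \<and>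
     (fin (st (nxt z y) v) \<longleftrightarrow> Suc (goff (time z)) = T \<and> r' v ! 0 = 0)" if v: "v \<in> V" for v
  proof -
    obtain q where q: "snd (y v) = (st z v)\<lparr>reg := q\<rparr>" using u[OF v] by blast
    have "\<not> fin (st z v)" using base_running[OF assms(1)] v by (simp add: running_def)
    then show ?thesis
      using sn(4)[OF v] sn(2)[OF v] mg[of v] r'[OF v] q by (auto simp: r_def)
  qed
  then show ac: "acts (nxt z y) v = acts z v" if "v \<in> V" for v using that by (simp add: acts_def)
  then have av: "actv (nxt z y) v = actv z v" if "v \<in> V" for v using that by (simp add: actv_def)
  show kn: "set (known (st (nxt z y) v)) = set (known (st z v))" if "v \<in> V" for v using un that by simp
  have rok: "regs_ok (acts (nxt z y)) ?M" using sp(3) ac by (simp add: regs_ok_def)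
  have U: "(\<Union>v\<in>V. actv (nxt z y) v) = (\<Union>v\<in>V. actv z v)" using av by simp
  have cy: "gcyc (Suc (time z)) = gcyc (time z)"
    using assms(2,3) by (auto elim!: position_cases[of "time z"])
  have bs: "base (nxt z y)" if nf: "\<forall>v\<in>V. \<not> fin (st (nxt z y) v)"
  proof (rule base_step[OF assms(1)])
    fix v assume v: "v \<in> V"
    show "\<not> fin (st (nxt z y) v) \<and> nid (st (nxt z y) v) = nid (st z v) \<and> clk (st (nxt z y) v) = Suc (clk (st z v)) \<and>
       top (st (nxt z y) v) = top (st z v) \<and> distinct (acts (nxt z y) v) \<and> actv (nxt z y) v \<subseteq> set (known (st (nxt z y) v)) \<and>
       set (known (st z v)) \<subseteq> set (known (st (nxt z y) v)) \<and> set (known (st (nxt z y) v)) \<subseteq> toks"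
      using nf v un[OF v] baseD[OF assms(1) v] ac[OF v] av[OF v] by auto
  qed (use av U cy base_countD[OF assms(1)] in auto)
  have M0: "\<forall>v\<in>V. acts z v = [] \<Longrightarrow> ?M ! 0 = 0" using sp(3) by (auto simp: regs_ok_def)
  have fin: "finished (nxt z y)" if e: "Suc (goff (time z)) = T" "?M ! 0 = 0"
  proof -
    have "r' v = ?M" if "v \<in> V" for v using spreads_done[OF sp' _ that] e n_le_T by simp
    moreover have a: "acts z v = []" if "v \<in> V" for v using sp(3) e that by (auto simp: regs_ok_def)
    moreover have "set (known (st z v)) = toks" if "v \<in> V" for v
      using assms(1) a that unfolding base_def actv_def by fastforce
    ultimately show ?thesis using un e ac by (auto simp: finished_def)
  qed
  then show "Suc (goff (time z)) = T \<Longrightarrow> \<forall>v\<in>V. acts z v = [] \<Longrightarrow> finished (nxt z y)" using M0 by metis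
  show "active_run (nxt z y) \<or> finished (nxt z y)"
    using assms(2)
  proof (cases rule: position_cases)
    case 1
    then have b: "base (nxt z y)" using bs un by simp
    have "\<forall>v\<in>V. \<forall>x\<in>set (r' v). x < 2 ^ width N"
    proof (intro ballI)
      fix v x assume v: "v \<in> V" and "x \<in> set (r' v)"
      then obtain j where j: "j < length ?M" "x = r' v ! j" using sp'
          by (auto simp: in_set_conv_nth spreads_def)
      obtain w where w: "w \<in> V" "r w ! j = ?M ! j" using spreads_attained[OF sp(1) j(1)] .
      have "j < length (r w)" using sp(1) w j by (simp add: spreads_def)
      then have "r w ! j \<in> set (r w)" by simp
      then have "r w ! j < 2 ^ width N" using sp(2) w(1) unfolding r_def by blast
      then have "?M ! j < 2 ^ width N" using w(2) by simp
      moreover have "x \<le> ?M ! j" using sp' v j by (simp add: spreads_def)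
      ultimately show "x < 2 ^ width N" by simp
    qed
    then have "nominating (nxt z y)"
      using sp' rok 1 unfolding nominating_def r'_def by (intro exI[of _ ?M]) auto
    then show ?thesis using b 1 assms(3) by (simp add: active_run_def)
  next
    case 2
    show ?thesis
    proof (cases "?M ! 0 = 0")
      case True
      then show ?thesis using fin 2 by blast
    next
      case False
      have rM: "r' v = ?M" if "v \<in> V" for v using spreads_done[OF sp' _ that] 2 n_le_T by simp
      then have b: "base (nxt z y)" using bs un False by simp
      have "generation (nxt z y) ?M"
        unfolding generation_def
      proof (intro conjI ballI)
        fix v assume v: "v \<in> V"
        show "reg (st (nxt z y) v) = ?M" using rM[OF v] by (simp add: r'_def)
        obtain s' where s': "st (nxt z y) v = s'\<lparr>pks := lst (own_packets s')\<rparr>"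
          using sn(4)[OF v] 2(1) sn(2)[OF v] mg[of v] r'[OF v] rM[OF v] False by (auto simp: r_def)
        have own: "own_packets s' = own_packets (st (nxt z y) v)" using s' by simp
        have sub: "own_packets (st (nxt z y) v) \<subseteq> (\<lambda>i. (unit_vec (length (GB (acts (nxt z y)) ?M)) i,
            concat (GB (acts (nxt z y)) ?M ! i))) ` {..<length (GB (acts (nxt z y)) ?M)}"
          using baseD[OF b v] \<open>reg (st (nxt z y) v) = ?M\<close>
          by (auto simp: own_packets_def gen_size_def GB_def acts_def)
        have f: "finite (own_packets s')" unfolding own by (rule finite_subset[OF sub]) simp
        have "pks (st (nxt z y) v) = lst (own_packets s')" unfolding s' by simp
        then have P: "set (pks (st (nxt z y) v)) = own_packets (st (nxt z y) v)"
          using set_lst[OF f] own by (simp only:)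
        then show "own_packets (st (nxt z y) v) \<subseteq> set (pks (st (nxt z y) v))" by simp
        have gb: "\<forall>B\<in>set (GB (acts (nxt z y)) ?M). length (concat B) = msize * d"
          using GB_props(4)[OF rok] actv_toks[OF b] by (simp add: actv_def)
        fix cp assume "cp \<in> set (pks (st (nxt z y) v))"
        then obtain i where "i < length (GB (acts (nxt z y)) ?M)"
          "cp = (unit_vec (length (GB (acts (nxt z y)) ?M)) i, concat (GB (acts (nxt z y)) ?M ! i))"
          using sub P by auto
        then show "case cp of (c, p) \<Rightarrow> is_combination (GB (acts (nxt z y)) ?M) c p \<and> length p = msize * d"
          using combination_unit[OF gb] gb by simp
      qed (use rok False in auto)
      then show ?thesis using b 2 assms(3) by (auto simp: active_run_def)
    qed
  qed
qed

lemma generation_gen_size: "base z \<Longrightarrow> generation z M \<Longrightarrow> v \<in> V \<Longrightarrow> gen_size (st z v) = length (GB (acts z) M)"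
  using baseD(3) by (simp add: generation_def gen_size_def GB_def)

lemma generation_GB:
  assumes "base z" "generation z M" "B \<in> set (GB (acts z) M)"
  shows "length B = msize" "set B \<subseteq> toks" "\<forall>t\<in>set B. length t = d" "length (concat B) = msize * d"
  using GB_props[of "acts z" M B] assms actv_toks[OF assms(1)] by (auto simp: generation_def actv_def)

lemma span_combination:
  assumes "base z" "generation z M" "v \<in> V" "(c, p) \<in> span (gen_size (st z v)) (msize * d) (pks (st z v))"
  shows "is_combination (GB (acts z) M) c p" "length p = msize * d"
proof -
  obtain w where w: "c = lincomb (gen_size (st z v)) w (map fst (pks (st z v)))"
      "p = lincomb (msize * d) w (map snd (pks (st z v)))" using assms(4) by (auto simp: span_def)
  have "\<forall>B\<in>set (GB (acts z) M). length (concat B) \<le> msize * d" using generation_GB[OF assms(1,2)] by simp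
  then show "is_combination (GB (acts z) M) c p"
    unfolding w using assms(2,3) generation_gen_size[OF assms(1-3)]
    by (intro lincomb_combination) (auto simp: generation_def)
  show "length p = msize * d" by (simp add: w)
qed

text \<open>All packets are true combinations of the blocks, so a payload with a unit header can
  only be the block itself. The choice by \<open>SOME\<close> is therefore harmless.\<close>

lemma decode_eq:
  assumes h: "gen_size s = length Bs"
    and P: "\<forall>(c, p)\<in>set (pks s). is_combination Bs c p \<and> length p = msize * d"
    and B: "\<And>B. B \<in> set Bs \<Longrightarrow> length B = msize \<and> (\<forall>t\<in>set B. length t = d)"
  shows "decode s = (if full s then \<Union>(set ` set Bs) else {})"
proof (cases "full s")
  case True
  have Bl: "length (concat B) = msize * d" if "B \<in> set Bs" for B
    using B[OF that] length_concat_const by metis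
  have "chop msize d (SOME p. (unit_vec (length Bs) i, p) \<in> span (length Bs) (msize * d) (pks s)) = Bs ! i"
    if i: "i < length Bs" for i
  proof -
    let ?p = "SOME p. (unit_vec (length Bs) i, p) \<in> span (length Bs) (msize * d) (pks s)"
    have "(unit_vec (length Bs) i, ?p) \<in> span (length Bs) (msize * d) (pks s)"
      using True i h unfolding full_def by (metis (mono_tags, lifting) someI_ex)
    then obtain w where w: "unit_vec (length Bs) i = lincomb (length Bs) w (map fst (pks s))"
      "?p = lincomb (msize * d) w (map snd (pks s))" by (auto simp: span_def)
    have "is_combination Bs (lincomb (length Bs) w (map fst (pks s))) (lincomb (msize * d) w (map snd (pks s)))"
      using P Bl by (intro lincomb_combination) auto
    then have "is_combination Bs (unit_vec (length Bs) i) ?p" by (subst w(2), subst w(1))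
    moreover have iB: "Bs ! i \<in> set Bs" using i by simp
    moreover have "length ?p = msize * d" using w(2) by simp
    ultimately have "?p = concat (Bs ! i)" using i Bl[OF iB] by (intro unit_combination) auto
    then show ?thesis using B[OF iB] by (simp add: chop_concat)
  qed
  then have "decode s = (\<Union>i<length Bs. set (Bs ! i))" using True h by (simp add: decode_def)
  also have "\<dots> = \<Union>(set ` set Bs)" unfolding set_conv_nth[of Bs] by auto
  finally show ?thesis using True by simp
qed (simp add: decode_def)

lemma decode_full:
  assumes "base z" "generation z M" "v \<in> V"
  shows "decode (st z v) = (if full (st z v) then \<Union>(set ` set (GB (acts z) M)) else {})"
  using generation_gen_size[OF assms] generation_GB[OF assms(1,2)] assms(2,3)
  by (intro decode_eq) (auto simp: generation_def)

lemma code_step: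
  assumes "base z" "N \<le> time z" "gph (time z) = 2" "generation z M" "y \<in> set_pmf (moves z)"
  shows "active_run (nxt z y)" "generation (nxt z y) M" "v \<in> V \<Longrightarrow> acts (nxt z y) v = acts z v"
    "v \<in> V \<Longrightarrow> set (pks (st (nxt z y) v)) = set (pks (st z v)) \<union> packets (inb z y v)"
    "v \<in> V \<Longrightarrow> (c, p) \<in> packets (inb z y v) \<Longrightarrow>
      \<exists>u. (u, v) \<in> net z \<and> (c, p) \<in> span (gen_size (st z u)) (msize * d) (pks (st z u)) \<and>
        coded (fst (y u)) = [Packet (name N (gcyc (time z))) c p]"
    "v \<in> V \<Longrightarrow> set (known (st (nxt z y) v)) = set (known (st z v)) \<or>
       full (st (nxt z y) v) \<and> set (known (st (nxt z y) v)) = set (known (st z v)) \<union> \<Union>(set ` set (GB (acts z) M))"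
proof -
  note sc = st_code[OF assms(1-3,5)]
  let ?Bs = "GB (acts z) M"
  have pk: "\<exists>u. (u, v) \<in> net z \<and> (c, p) \<in> span (gen_size (st z u)) (msize * d) (pks (st z u)) \<and>
        coded (fst (y u)) = [Packet (name N (gcyc (time z))) c p]"
    if v: "v \<in> V" and cp: "(c, p) \<in> packets (inb z y v)" for v c p
  proof -
    obtain u g where u: "(u, v) \<in> net z" "Packet g c p \<in> set (coded (fst (y u)))"
      using cp by (auto simp: packets_def inb_def)
    then have uV: "u \<in> V" using net_V by blast
    obtain w where w: "length w = length (pks (st z u))" "y u = (combination (st z u) w, st z u)"
      using sc(1)[OF uV] by blast
    have "2 * top (st z u) = N" "cycle (st z u) = gcyc (time z)"
      using baseD(3)[OF assms(1) uV] base_position(3)[OF assms(1,2) uV] by auto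
    then show ?thesis using u w by (intro exI[of _ u]) (auto simp: combination_def span_def)
  qed
  then show "v \<in> V \<Longrightarrow> (c, p) \<in> packets (inb z y v) \<Longrightarrow>
      \<exists>u. (u, v) \<in> net z \<and> (c, p) \<in> span (gen_size (st z u)) (msize * d) (pks (st z u)) \<and>
        coded (fst (y u)) = [Packet (name N (gcyc (time z))) c p]" by blast
  have pkc: "is_combination ?Bs c p \<and> length p = msize * d" if "v \<in> V" "(c, p) \<in> packets (inb z y v)"
      for v c p
    using pk[OF that] net_V span_combination[OF assms(1,4)] by blast
  have fp: "finite (packets (inb z y v))" for v
  proof -
    have "packets (inb z y v) \<subseteq> (\<Union>m\<in>inb z y v. (\<lambda>q. (coeffs q, payload q)) ` set (coded m))"
      by (force simp: packets_def)
    then show ?thesis using fin_inb finite_subset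
        by (metis (no_types, lifting) List.finite_set finite_UN finite_imageI)
  qed
  define s' where "s' v = (tick (st z v) {})\<lparr>pks := lst (set (pks (st z v)) \<union> packets (inb z y v))\<rparr>" for v
  have st': "st (nxt z y) v = (if Suc (goff (time z)) = T then start_verify (s' v) else s' v)" if "v \<in> V"
      for v
    using sc(3)[OF that] by (simp add: s'_def)
  have own: "own_packets (st (nxt z y) v) = own_packets (st z v)" if "v \<in> V" for v
    using st'[OF that] by (simp add: s'_def start_verify_def)
  show pks: "set (pks (st (nxt z y) v)) = set (pks (st z v)) \<union> packets (inb z y v)" if "v \<in> V" for v
    using st'[OF that] fp by (simp add: s'_def start_verify_def)
  show ac: "acts (nxt z y) v = acts z v" if "v \<in> V" for v
    using st'[OF that] by (simp add: s'_def start_verify_def acts_def)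
  then have av: "actv (nxt z y) v = actv z v" if "v \<in> V" for v using that by (simp add: actv_def)
  have gV: "fst x \<in> V" if "x \<in> set (gens N M)" for x
    using gens_ok[of "acts z" M "fst x" "snd x"] assms(4) that by (simp add: generation_def)
  have GBe: "GB (acts (nxt z y)) M = ?Bs"
    unfolding GB_def by (intro map_cong refl) (use ac gV in \<open>auto simp: case_prod_beta'\<close>)
  show gen: "generation (nxt z y) M"
    unfolding generation_def GBe
  proof (intro conjI ballI)
    show "regs_ok (acts (nxt z y)) M" "M ! 0 \<noteq> 0" using assms(4) ac
        by (auto simp: generation_def regs_ok_def)
    fix v assume v: "v \<in> V"
    show "reg (st (nxt z y) v) = M" using st'[OF v] assms(4) v
        by (simp add: generation_def s'_def start_verify_def)
    show "own_packets (st (nxt z y) v) \<subseteq> set (pks (st (nxt z y) v))"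
      using own[OF v] pks[OF v] assms(4) v by (auto simp: generation_def)
    fix cp assume "cp \<in> set (pks (st (nxt z y) v))"
    then show "case cp of (c, p) \<Rightarrow> is_combination ?Bs c p \<and> length p = msize * d"
      using pks[OF v] pkc[OF v] assms(4) v unfolding generation_def by auto
  qed
  have kn: "set (known (st (nxt z y) v)) = (if Suc (goff (time z)) = T then set (known (st z v)) \<union> decode (st (nxt z y) v)
      else set (known (st z v)))"
    if v: "v \<in> V" and dt: "finite (decode (st (nxt z y) v))" for v
  proof -
    have "decode (st (nxt z y) v) = decode (s' v)" using st'[OF v] by (simp add: start_verify_def)
    moreover have "known (s' v) = lst (set (known (st z v)))" by (simp add: s'_def)
    ultimately show ?thesis using st'[OF v] dt by (simp add: start_verify_def)
  qed
  have U: "(\<Union>v\<in>V. actv (nxt z y) v) = (\<Union>v\<in>V. actv z v)" using av by simp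
  have cy: "gcyc (Suc (time z)) = gcyc (time z)"
    using assms(2,3) by (auto elim!: position_cases[of "time z"])
  have gs: "gen_size (st (nxt z y) v) = length ?Bs" if v: "v \<in> V" for v
    using generation_gen_size[OF assms(1,4) v] st'[OF v]
    by (simp add: gen_size_def s'_def start_verify_def)
  have dec: "decode (st (nxt z y) v) = (if full (st (nxt z y) v) then \<Union>(set ` set ?Bs) else {})"
      if v: "v \<in> V" for v
    using gs[OF v] gen v generation_GB[OF assms(1,4)]
    by (intro decode_eq) (auto simp: generation_def GBe)
  have df: "finite (decode (st (nxt z y) v))" if "v \<in> V" for v using dec[OF that] by simp
  have dt: "decode (st (nxt z y) v) \<subseteq> toks" if "v \<in> V" for v
    using dec[OF that] generation_GB(2)[OF assms(1,4)] by auto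
  show "v \<in> V \<Longrightarrow> set (known (st (nxt z y) v)) = set (known (st z v)) \<or>
       full (st (nxt z y) v) \<and> set (known (st (nxt z y) v)) = set (known (st z v)) \<union> \<Union>(set ` set ?Bs)"
    using kn df dec by (cases "full (st (nxt z y) v)") (auto split: if_splits)
  have b: "base (nxt z y)"
  proof (rule base_step[OF assms(1)])
    fix v assume v: "v \<in> V"
    show "\<not> fin (st (nxt z y) v) \<and> nid (st (nxt z y) v) = nid (st z v) \<and> clk (st (nxt z y) v) = Suc (clk (st z v)) \<and>
       top (st (nxt z y) v) = top (st z v) \<and> distinct (acts (nxt z y) v) \<and> actv (nxt z y) v \<subseteq> set (known (st (nxt z y) v)) \<and>
       set (known (st z v)) \<subseteq> set (known (st (nxt z y) v)) \<and> set (known (st (nxt z y) v)) \<subseteq> toks"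
      using st'[OF v] baseD[OF assms(1) v] ac[OF v] av[OF v] kn[OF v df[OF v]] dt[OF v]
        base_running[OF assms(1)] v
      by (auto simp: running_def s'_def start_verify_def)
  qed (use av U cy base_countD[OF assms(1)] in auto)
  show "active_run (nxt z y)"
    using assms(2)
  proof (cases rule: position_cases)
    case 1
    then show ?thesis using b gen assms(3) by (auto simp: active_run_def)
  next
    case 2
    define r where "r v = vreg (st (nxt z y) v)" for v
    have r: "r v = [of_bool (\<not> full (st (nxt z y) v)), if acts z v = [] then 0 else Suc (to_nat (acts z v ! 0))]"
      if "v \<in> V" for v
      using st'[OF that] 2 by (simp add: r_def s'_def start_verify_def acts_def)
    have sp: "spreads r (gmax r) 0" by (rule spreads_init[of r 2]) (simp add: r)
    have l2: "length (gmax r) = 2" using r some_V by (simp add: gmax_def)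
    have le: "r v ! j \<le> gmax r ! j" if "v \<in> V" "j < 2" for v j using sp that l2
        by (auto simp: spreads_def)
    obtain v0 where v0: "v0 \<in> V" "r v0 ! 0 = gmax r ! 0" using spreads_attained[OF sp, of 0] l2 by auto
    obtain v1 where v1: "v1 \<in> V" "r v1 ! 1 = gmax r ! 1" using spreads_attained[OF sp, of 1] l2 by auto
    have "verifying (nxt z y)"
      unfolding verifying_def
    proof (intro exI[of _ "gmax r"] conjI ballI impI)
      show "spreads (\<lambda>v. vreg (st (nxt z y) v)) (gmax r) (goff (time (nxt z y)))" using sp 2
          by (simp add: r_def[abs_def])
      show "length (gmax r) = 2" by (rule l2)
      show "gmax r ! 0 = 0 \<longleftrightarrow> (\<forall>v\<in>V. full (st (nxt z y) v))"
      proof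
        assume g: "gmax r ! 0 = 0"
        show "\<forall>v\<in>V. full (st (nxt z y) v)"
        proof
          fix v assume "v \<in> V"
          then show "full (st (nxt z y) v)" using le[of v 0] r[of v] g
              by (auto simp: of_bool_def split: if_splits)
        qed
      qed (use v0 r in auto)
      show "vreg_ok (vreg (st (nxt z y) v))" if "v \<in> V" for v
        using r[OF that] by (auto simp: vreg_ok_def r_def)
      show "set (dec (st (nxt z y) v)) = decode (st (nxt z y) v)" if "v \<in> V" for v
        using st'[OF that] 2 df[OF that] by (simp add: start_verify_def)
      show "decode (st (nxt z y) v) \<subseteq> set (known (st (nxt z y) v))" if "v \<in> V" for v
        using kn[OF that df[OF that]] 2 by simp
      obtain u where u: "u \<in> V" "acts z u \<noteq> []" using assms(4) by (auto simp: generation_def regs_ok_def)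
      then have "0 < gmax r ! 1" using le[of u 1] r[of u] by simp
      then have "acts z v1 \<noteq> []" "gmax r ! 1 = Suc (to_nat (acts z v1 ! 0))" using v1 r[of v1]
          by (auto split: if_splits)
      moreover have "acts z v1 ! 0 \<in> actv (nxt z y) v1" using calculation(1) av[OF v1(1)]
          by (simp add: actv_def)
      ultimately show "\<exists>u\<in>V. \<exists>x\<in>actv (nxt z y) u. gmax r ! 1 = Suc (to_nat x)" using v1 by blast
      show "from_nat (vreg (st (nxt z y) v) ! 1 - 1) \<in> set (known (st (nxt z y) v))"
        if v: "v \<in> V" and "vreg (st (nxt z y) v) ! 1 \<noteq> 0" for v
      proof -
        have "acts z v \<noteq> []" "vreg (st (nxt z y) v) ! 1 = Suc (to_nat (acts z v ! 0))"
          using r[OF v] that by (auto simp: r_def split: if_splits)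
        moreover have "acts z v ! 0 \<in> actv (nxt z y) v" using calculation(1) av[OF v]
            by (simp add: actv_def)
        ultimately show ?thesis using baseD(5)[OF b v] by auto
      qed
    qed
    then show ?thesis using b gen 2 assms(3) by (auto simp: active_run_def)
  qed
qed

lemma verify_hear:
  assumes "base z" "N \<le> time z" "gph (time z) = 3" "verifying z" "y \<in> set_pmf (moves z)"
  shows "hear (inb z y v) = {from_nat (vreg (st z u) ! 1 - 1) | u. (u, v) \<in> net z \<and> vreg (st z u) ! 1 \<noteq> 0}"
    "hear (inb z y v) \<subseteq> toks" "finite (hear (inb z y v))"
proof -
  note e = st_verify(3)[OF assms(1-3,5)]
  show h: "hear (inb z y v) = {from_nat (vreg (st z u) ! 1 - 1) | u. (u, v) \<in> net z \<and> vreg (st z u) ! 1 \<noteq> 0}"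
  proof (cases "v \<in> V")
    case True
    show ?thesis unfolding hear_def e[OF True] by (auto simp: put_vreg_def split: if_splits)
  next
    case False
    then have "{u. (u, v) \<in> net z} = {}" using net_V by blast
    then show ?thesis by (auto simp: hear_def inb_def)
  qed
  have k: "from_nat (vreg (st z u) ! 1 - 1) \<in> set (known (st z u))" if "u \<in> V" "vreg (st z u) ! 1 \<noteq> 0"
      for u
    using assms(4) that by (auto simp: verifying_def)
  show "hear (inb z y v) \<subseteq> toks"
  proof
    fix x assume "x \<in> hear (inb z y v)"
    then obtain u where u: "(u, v) \<in> net z" "vreg (st z u) ! 1 \<noteq> 0" "x = from_nat (vreg (st z u) ! 1 - 1)"
      using h by blast
    then have "u \<in> V" using net_V by blast
    then show "x \<in> toks" using k[of u] u baseD(6)[OF assms(1), of u] by blast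
  qed
  then show "finite (hear (inb z y v))" using fin_toks finite_subset by blast
qed

lemma verify_step:
  assumes "base z" "N \<le> time z" "gph (time z) = 3" "generation z M" "verifying z" "y \<in> set_pmf (moves z)"
  shows "active_run (nxt z y)"
    "Suc (goff (time z)) < T \<Longrightarrow> v \<in> V \<Longrightarrow> acts (nxt z y) v = acts z v \<and> pks (st (nxt z y) v) = pks (st z v)"
    "Suc (goff (time z)) < T \<Longrightarrow> generation (nxt z y) M"
    "Suc (goff (time z)) = T \<Longrightarrow> \<exists>D. (\<forall>v\<in>V. actv (nxt z y) v = actv z v - D) \<and>
       ((\<forall>v\<in>V. full (st z v)) \<longrightarrow> \<Union>(set ` set (GB (acts z) M)) \<subseteq> D)"
    "v \<in> V \<Longrightarrow> set (known (st (nxt z y) v)) = set (known (st z v)) \<union> hear (inb z y v)"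
proof -
  note sv = st_verify[OF assms(1-3,6)] and hr = verify_hear[OF assms(1-3,5,6)]
  let ?Bs = "GB (acts z) M"
  define r where "r v = vreg (st z v)" for v
  obtain W where W0: "spreads (\<lambda>v. vreg (st z v)) W (goff (time z))" and W': "length W = 2"
      "W ! 0 = 0 \<longleftrightarrow> (\<forall>v\<in>V. full (st z v))" "\<exists>u\<in>V. \<exists>x\<in>actv z u. W ! 1 = Suc (to_nat x)"
    and vok0: "\<forall>v\<in>V. vreg_ok (vreg (st z v))"
    and dec0: "\<forall>v\<in>V. set (dec (st z v)) = decode (st z v) \<and> decode (st z v) \<subseteq> set (known (st z v))"
    and vk0: "\<forall>v\<in>V. vreg (st z v) ! 1 \<noteq> 0 \<longrightarrow> from_nat (vreg (st z v) ! 1 - 1) \<in> set (known (st z v))"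
    using assms(5) unfolding verifying_def by (elim exE conjE) (rule that)
  have W: "spreads r W (goff (time z))" "length W = 2" "W ! 0 = 0 \<longleftrightarrow> (\<forall>v\<in>V. full (st z v))"
    "\<exists>u\<in>V. \<exists>x\<in>actv z u. W ! 1 = Suc (to_nat x)"
    using W0 W' by (simp_all add: r_def[abs_def])
  have vok: "\<And>v. v \<in> V \<Longrightarrow> vreg_ok (r v)"
    and dec: "\<And>v. v \<in> V \<Longrightarrow> set (dec (st z v)) = decode (st z v) \<and> decode (st z v) \<subseteq> set (known (st z v))"
    and vk: "\<And>v. v \<in> V \<Longrightarrow> r v ! 1 \<noteq> 0 \<Longrightarrow> from_nat (r v ! 1 - 1) \<in> set (known (st z v))"
    using vok0 dec0 vk0 by (simp_all add: r_def)
  define s' where "s' v = (tick (st z v) (hear (inb z y v)))\<lparr>vreg := merge (r v) (r ` {u. (u, v) \<in> net z})\<rparr>" for v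
  have st': "st (nxt z y) v = (if Suc (goff (time z)) = T then end_verify (s' v) else s' v)" if v: "v \<in> V"
      for v
  proof -
    have "get_vreg (put_vreg (r u)) = r u" if "(u, v) \<in> net z" for u
      using get_put_vreg vok net_V[OF that] by blast
    then have "get_vreg ` inb z y v = r ` {u. (u, v) \<in> net z}"
      unfolding sv(3)[OF v] image_image r_def by (intro image_cong) auto
    then show ?thesis using sv(2)[OF v] by (simp add: s'_def r_def)
  qed
  define r' where "r' v = vreg (st (nxt z y) v)" for v
  have r': "r' v = merge (r v) (r ` {u. (u, v) \<in> net z})" if "v \<in> V" for v
    using st'[OF that] by (simp add: r'_def s'_def end_verify_def)
  have sp': "spreads r' W (Suc (goff (time z)))" using W(1) r' by (rule spreads_step)
  have attained: "\<exists>u\<in>insert v {u. (u, v) \<in> net z}. r' v ! j = r u ! j" if "v \<in> V" "j < 2" for v j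
  proof -
    have "j < length (r v)" using vok[OF that(1)] that by (simp add: vreg_ok_def)
    then have "r' v ! j = Max ((\<lambda>u. r u ! j) ` insert v {u. (u, v) \<in> net z})"
      using r'[OF that(1)] by (simp add: merge_nth image_image)
    moreover have "\<dots> \<in> (\<lambda>u. r u ! j) ` insert v {u. (u, v) \<in> net z}" using fin_nbrs by (intro Max_in) auto
    ultimately show ?thesis by auto
  qed
  show kn: "set (known (st (nxt z y) v)) = set (known (st z v)) \<union> hear (inb z y v)" if "v \<in> V" for v
    using st'[OF that] hr(3) by (simp add: s'_def end_verify_def)
  have vk': "from_nat (r' v ! 1 - 1) \<in> set (known (st (nxt z y) v))" if v: "v \<in> V" and nz: "r' v ! 1 \<noteq> 0"
      for v
  proof -
    obtain u where u: "u \<in> insert v {u. (u, v) \<in> net z}" "r' v ! 1 = r u ! 1" using attained[OF v, of 1]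
        by auto
    then show ?thesis
    proof (cases "u = v")
      case True
      then show ?thesis using u vk[OF v] nz kn[OF v] by auto
    next
      case False
      then have "from_nat (r u ! 1 - 1) \<in> hear (inb z y v)" using u nz hr(1)[of v] by (auto simp: r_def)
      then show ?thesis using u kn[OF v] by auto
    qed
  qed
  have kt: "set (known (st (nxt z y) v)) \<subseteq> toks" if "v \<in> V" for v
    using kn[OF that] hr(2) baseD(6)[OF assms(1) that] by blast
  have inside: "active_run (nxt z y)" "acts (nxt z y) v = acts z v \<and> pks (st (nxt z y) v) = pks (st z v)"
      "generation (nxt z y) M"
    if lt: "Suc (goff (time z)) < T" and "v \<in> V" for v
  proof -
    note pos = position_inside[OF assms(2) lt]
    have st'': "st (nxt z y) v = s' v" if "v \<in> V" for v using st'[OF that] lt by simp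
    have ac: "acts (nxt z y) v = acts z v" "actv (nxt z y) v = actv z v" if "v \<in> V" for v
      using st''[OF that] by (simp_all add: acts_def actv_def s'_def)
    then show "acts (nxt z y) v = acts z v \<and> pks (st (nxt z y) v) = pks (st z v)"
      using st'' that(2) by (simp add: s'_def)
    have U: "(\<Union>v\<in>V. actv (nxt z y) v) = (\<Union>v\<in>V. actv z v)" using ac by simp
    have b: "base (nxt z y)"
    proof (rule base_step[OF assms(1)])
      fix v assume v: "v \<in> V"
      show "\<not> fin (st (nxt z y) v) \<and> nid (st (nxt z y) v) = nid (st z v) \<and> clk (st (nxt z y) v) = Suc (clk (st z v)) \<and>
       top (st (nxt z y) v) = top (st z v) \<and> distinct (acts (nxt z y) v) \<and> actv (nxt z y) v \<subseteq> set (known (st (nxt z y) v)) \<and>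
       set (known (st z v)) \<subseteq> set (known (st (nxt z y) v)) \<and> set (known (st (nxt z y) v)) \<subseteq> toks"
        using st''[OF v] baseD[OF assms(1) v] ac[OF v] kn[OF v] kt[OF v] base_running[OF assms(1)] v
        by (auto simp: running_def s'_def)
    qed (use ac U pos base_countD[OF assms(1)] in auto)
    have gV: "fst x \<in> V" if "x \<in> set (gens N M)" for x
      using gens_ok[of "acts z" M "fst x" "snd x"] assms(4) that by (simp add: generation_def)
    have GBe: "GB (acts (nxt z y)) M = ?Bs"
      unfolding GB_def by (intro map_cong refl) (use ac gV in \<open>auto simp: case_prod_beta'\<close>)
    show gen: "generation (nxt z y) M"
      using assms(4) st'' ac unfolding generation_def GBe by (simp add: regs_ok_def s'_def)
    have fu: "full (st (nxt z y) v) = full (st z v)" "decode (st (nxt z y) v) = decode (st z v)"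
        "dec (st (nxt z y) v) = dec (st z v)" if "v \<in> V" for v
      using st''[OF that] by (simp_all add: s'_def)
    have "verifying (nxt z y)"
      unfolding verifying_def
    proof (intro exI[of _ W] conjI ballI impI)
      show "spreads (\<lambda>v. vreg (st (nxt z y) v)) W (goff (time (nxt z y)))" using sp' pos
          by (simp add: r'_def[abs_def])
      show "length W = 2" by fact
      show "(W ! 0 = 0) = (\<forall>v\<in>V. full (st (nxt z y) v))" using W(3) fu by simp
      show "\<exists>u\<in>V. \<exists>x\<in>actv (nxt z y) u. W ! 1 = Suc (to_nat x)" using W(4) ac by simp
      fix v assume v: "v \<in> V"
      show "set (dec (st (nxt z y) v)) = decode (st (nxt z y) v)" "decode (st (nxt z y) v) \<subseteq> set (known (st (nxt z y) v))"
        using fu[OF v] dec[OF v] kn[OF v] by auto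
      show "vreg_ok (vreg (st (nxt z y) v))"
      proof -
        obtain u0 where u0: "u0 \<in> V" "r' v ! 0 = r u0 ! 0" using attained[OF v, of 0] net_V[of _ v z] v
            by auto
        obtain u1 where u1: "u1 \<in> V" "r' v ! 1 = r u1 ! 1" using attained[OF v, of 1] net_V[of _ v z] v
            by auto
        show ?thesis using vok[OF u0(1)] vok[OF u1(1)] vok[OF v] u0 u1 r'[OF v]
            by (simp add: vreg_ok_def r'_def[symmetric])
      qed
      show "from_nat (vreg (st (nxt z y) v) ! 1 - 1) \<in> set (known (st (nxt z y) v))"
        if "vreg (st (nxt z y) v) ! 1 \<noteq> 0" using vk'[OF v] that by (simp add: r'_def)
    qed
    then show "active_run (nxt z y)" using b gen pos assms(3) by (auto simp: active_run_def)
  qed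
  obtain x where x: "x \<in> (\<Union>v\<in>V. actv z v)" "W ! 1 = Suc (to_nat x)" using W(4) by blast
  \<comment> \<open>Besides the decoded generation, \<open>D\<close> always contains the flooded
    token \<open>x\<close>. It is active and by now known to all nodes, so the active set shrinks
    even if decoding failed; this drives the clock in \<open>base\<close>.\<close>
  define D where "D = insert x (if W ! 0 = 0 then \<Union>(set ` set ?Bs) else {})"
  have fin: "active_run (nxt z y)" "\<forall>v\<in>V. actv (nxt z y) v = actv z v - D" if e: "Suc (goff (time z)) = T"
  proof -
    note pos = position_end[OF assms(2) e]
    have rW: "r' v = W" if "v \<in> V" for v using spreads_done[OF sp' _ that] e n_le_T by simp
    have dD: "set (dec (st z v)) = \<Union>(set ` set ?Bs)" if "v \<in> V" "W ! 0 = 0" for v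
      using dec[OF that(1)] W(3) that decode_full[OF assms(1,4) that(1)] by simp
    have aD: "actv (nxt z y) v = actv z v - D" if v: "v \<in> V" for v
    proof -
      have "vreg (s' v) = W" using r'[OF v] rW[OF v] by (simp add: s'_def)
      moreover have "act (s' v) = act (st z v)" "dec (s' v) = dec (st z v)" by (simp_all add: s'_def)
      ultimately have "act (st (nxt z y) v) = lst (actv z v - D)"
        using st'[OF v] e dD[OF v] x(2) by (simp add: end_verify_def D_def actv_def acts_def)
      then show ?thesis using fin_actv by (simp add: actv_def acts_def)
    qed
    then show "\<forall>v\<in>V. actv (nxt z y) v = actv z v - D" by blast
    have Dk: "D \<subseteq> set (known (st (nxt z y) v))" if v: "v \<in> V" for v
    proof -
      have "x \<in> set (known (st (nxt z y) v))" using vk'[OF v] rW[OF v] x(2) by simp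
      moreover have "\<Union>(set ` set ?Bs) \<subseteq> set (known (st (nxt z y) v))" if "W ! 0 = 0"
        using dD[OF v that] dec[OF v] kn[OF v] by blast
      ultimately show ?thesis by (auto simp: D_def)
    qed
    have "card (\<Union>v\<in>V. actv (nxt z y) v) < card (\<Union>v\<in>V. actv z v)"
      using aD x(1) fin_active by (intro psubset_card_mono) (auto simp: D_def)
    then have cnt: "gcyc (Suc (time z)) + card (\<Union>v\<in>V. actv (nxt z y) v) \<le> k"
      using base_countD[OF assms(1)] pos assms(3) by simp
    have "base (nxt z y)"
    proof (rule base_step[OF assms(1) time_nxt])
      fix v assume v: "v \<in> V"
      have "distinct (acts (nxt z y) v)"
        using st'[OF v] e by (simp add: acts_def end_verify_def)
      then show "\<not> fin (st (nxt z y) v) \<and> nid (st (nxt z y) v) = nid (st z v) \<and> clk (st (nxt z y) v) = Suc (clk (st z v)) \<and>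
       top (st (nxt z y) v) = top (st z v) \<and> distinct (acts (nxt z y) v) \<and> actv (nxt z y) v \<subseteq> set (known (st (nxt z y) v)) \<and>
       set (known (st z v)) \<subseteq> set (known (st (nxt z y) v)) \<and> set (known (st (nxt z y) v)) \<subseteq> toks"
        using st'[OF v] e baseD[OF assms(1) v] kn[OF v] kt[OF v] base_running[OF assms(1)] v aD[OF v]
        by (auto simp: running_def s'_def end_verify_def)
    next
      fix x' v assume "v \<in> V" "x' \<in> actv z v"
      then show "(\<forall>v\<in>V. x' \<in> set (known (st (nxt z y) v))) \<or> (\<exists>v\<in>V. x' \<in> actv (nxt z y) v)"
        using aD Dk by blast
    qed (rule cnt)
    then show "active_run (nxt z y)" using pos assms(3) by (simp add: active_run_def)
  qed
  show "active_run (nxt z y)" using inside(1) fin(1) V_ne goff_less[of "time z"]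
      by (metis all_not_in_conv linorder_neqE_nat not_less_eq Suc_leI not_le)
  show "Suc (goff (time z)) < T \<Longrightarrow> v \<in> V \<Longrightarrow> acts (nxt z y) v = acts z v \<and> pks (st (nxt z y) v) = pks (st z v)"
    using inside(2) by blast
  show "Suc (goff (time z)) < T \<Longrightarrow> generation (nxt z y) M" using inside(3) V_ne by blast
  show "Suc (goff (time z)) = T \<Longrightarrow> \<exists>D. (\<forall>v\<in>V. actv (nxt z y) v = actv z v - D) \<and>
       ((\<forall>v\<in>V. full (st z v)) \<longrightarrow> \<Union>(set ` set ?Bs) \<subseteq> D)"
    using fin(2) W(3) by (intro exI[of _ D]) (auto simp: D_def)
qed

end

section \<open>Network coding\<close>

lemma finite_heard_headers: "finite M \<Longrightarrow> finite (heard_headers M g)"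
proof -
  assume M: "finite M"
  have "heard_headers M g \<subseteq> (\<Union>m\<in>M. coeffs ` set (coded m))" by (force simp: heard_headers_def)
  moreover have "finite (\<Union>m\<in>M. coeffs ` set (coded m))" using M by simp
  ultimately show ?thesis by (rule finite_subset)
qed

lemma heard_headers_mono: "M \<subseteq> M' \<Longrightarrow> heard_headers M g \<subseteq> heard_headers M' g"
  by (auto simp: heard_headers_def)

text \<open>Generations are entered into \<open>src\<close> as they arise, and earlier derivations
  must survive. A decoding stays valid if headers heard later get the coefficient zero.\<close>

lemma learned_mono:
  assumes "\<And>g. src g \<noteq> [] \<Longrightarrow> src' g = src g" "M \<subseteq> M'" "finite M'"
  shows "learned src S M \<subseteq> learned src' S M'"
proof
  fix t assume "t \<in> learned src S M"
  then show "t \<in> learned src' S M'"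
  proof induction
    case (own t)
    then show ?case by (rule learned.own)
  next
    case (received m t)
    then show ?case using assms(2) by (intro learned.received[of m]) auto
  next
    case (decoded i g w t)
    have e: "src' g = src g" using decoded(1) by (intro assms(1)) auto
    let ?w = "\<lambda>c. if c \<in> heard_headers M g then w c else 0"
    have s: "(\<Sum>c\<in>heard_headers M' g. ?w c * c ! j) = (\<Sum>c\<in>heard_headers M g. w c * c ! j)" for j
      using heard_headers_mono[OF assms(2)] finite_heard_headers[OF assms(3)]
      by (intro sum.mono_neutral_cong_right) auto
    show ?case
      by (rule learned.decoded[where i = i and g = g and w = ?w]) (use decoded e s in auto)
  qed
qed

text \<open>Coefficients of packets with the same header are added up. A packet that was not heard
  has a unit header of a known block, hence vanishes in every coordinate of an unknown
  block.\<close>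

lemma can_combine_span:
  assumes P: "\<And>c p. (c, p) \<in> set P \<Longrightarrow> c \<in> heard_headers M g \<or>
      (\<exists>i<length (src g). c = unit_vec (length (src g)) i \<and> set (src g ! i) \<subseteq> learned src S M)"
    and M: "finite M"
  shows "can_combine src S M g (lincomb (length (src g)) w (map fst P))"
  unfolding can_combine_def
proof (intro exI allI impI)
  let ?H = "heard_headers M g"
  fix j assume j: "j < length (src g)"
  show "(\<Sum>c'\<in>?H. (\<Sum>i<length P. if fst (P ! i) = c' then w ! i else 0) * c' ! j)
      = lincomb (length (src g)) w (map fst P) ! j \<or> set (src g ! j) \<subseteq> learned src S M"
  proof (cases "set (src g ! j) \<subseteq> learned src S M")
    case False
    have "(\<Sum>c'\<in>?H. (\<Sum>i<length P. if fst (P ! i) = c' then w ! i else 0) * c' ! j)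
        = (\<Sum>i<length P. \<Sum>c'\<in>?H. if fst (P ! i) = c' then w ! i * c' ! j else 0)"
      by (subst sum.swap) (intro sum.cong refl, auto simp: sum_distrib_right intro!: sum.cong)
    also have "\<dots> = (\<Sum>i<length P. if fst (P ! i) \<in> ?H then w ! i * fst (P ! i) ! j else 0)"
      using finite_heard_headers[OF M] by (intro sum.cong refl) simp
    also have "\<dots> = (\<Sum>i<length P. w ! i * fst (P ! i) ! j)"
    proof (intro sum.cong refl)
      fix i assume "i \<in> {..<length P}"
      then have "(fst (P ! i), snd (P ! i)) \<in> set P" by simp
      from P[OF this] show "(if fst (P ! i) \<in> ?H then w ! i * fst (P ! i) ! j else 0) = w ! i * fst (P ! i) ! j"
        using False j by auto
    qed
    also have "\<dots> = lincomb (length (src g)) w (map fst P) ! j" using j by (simp add: nth_lincomb)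
    finally show ?thesis by simp
  qed simp
qed

section \<open>Reachable states are safe; message sizes and the ledger of generations\<close>

context dynamic
begin

lemma safe_init: "safe ([], s0)"
proof -
  have "gmax (\<lambda>v. [est v]) = [Max (est ` V)]" by (simp add: gmax_def)
  then have sp: "spreads (\<lambda>v. [est v]) [Max (est ` V)] 0" using spreads_init[of "\<lambda>v. [est v]" 1] by simp
  have "spreads (\<lambda>v. [top (st ([], s0) v)]) [Max (est ` V)] 0"
    using sp unfolding spreads_def by (auto simp: st_init node_start_def cong: conj_cong)
  then have "syncing ([], s0)"
    using b_pos fin_I
    by (simp add: syncing_def st_init node_start_def time_def actv_def acts_def)
  then show ?thesis using N_pos by (simp add: safe_def time_def)
qed

lemma finished_kern: "finished z \<Longrightarrow> z' \<in> set_pmf (kern z) \<Longrightarrow>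
    st z' = st z \<and> heard (fst z') v = heard (fst z) v"
proof -
  assume f: "finished z" and z': "z' \<in> set_pmf (kern z)"
  from f have "\<forall>v\<in>V. fin (st z v)" by (simp add: finished_def)
  then obtain x where x: "z' = (fst z @ [(snd z, x, net z)], snd z)" "\<forall>v. fst (x v) = None"
    using kern_halted[of z] z' by auto
  then show ?thesis by (simp add: st_def[abs_def] heard_append)
qed

lemma st_cong: "st z' = st z \<Longrightarrow> finished z \<Longrightarrow> finished z'"
  by (simp add: finished_def acts_def)

lemma syncing_running: "syncing z \<Longrightarrow> running z"
  by (simp add: syncing_def running_def)

lemma running_kern: "running z \<Longrightarrow> z' \<in> set_pmf (kern z) \<Longrightarrow> \<exists>y\<in>set_pmf (moves z). z' = nxt z y"
  by (auto simp: kern_running)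

lemma active_step:
  assumes "active_run z" "N \<le> time z" "y \<in> set_pmf (moves z)"
  shows "active_run (nxt z y) \<or> finished (nxt z y)"
proof -
  have b: "base z" using assms(1) by (simp add: active_run_def)
  consider "gph (time z) = 0" | "gph (time z) = 1" | "gph (time z) = 2" | "gph (time z) = 3"
    using gph_less[of "time z"] by linarith
  then show ?thesis
  proof cases
    case 1
    then show ?thesis using gather_step(1)[OF b assms(2) _ assms(3)] by blast
  next
    case 2
    then show ?thesis using nominate_step(1)[OF b assms(2) _ _ assms(3)] assms(1)
        by (auto simp: active_run_def)
  next
    case 3
    then show ?thesis using code_step(1)[OF b assms(2) _ _ assms(3)] assms(1)
        by (auto simp: active_run_def)
  next
    case 4
    then show ?thesis using verify_step(1)[OF b assms(2) _ _ _ assms(3)] assms(1)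
        by (auto simp: active_run_def)
  qed
qed

lemma reach_safe: "reach z \<Longrightarrow> safe z"
proof (induction z rule: reach_induct)
  case init
  show ?case by (rule safe_init)
next
  case (step z z')
  note t = time_kern[OF step.hyps(2)]
  show ?case
  proof (cases "time z < N")
    case True
    then have s: "syncing z" using step.IH by (simp add: safe_def)
    then show ?thesis using sync_step(1)[OF s True] running_kern[OF syncing_running[OF s] step.hyps(2)]
        by blast
  next
    case False
    show ?thesis
    proof (cases "finished z")
      case True
      then show ?thesis using finished_kern[OF True step.hyps(2)] st_cong[of z' z] t False
          by (simp add: safe_def)
    next
      case f: False
      then have a: "active_run z" using step.IH False by (simp add: safe_def)
      then have "running z" by (simp add: active_run_def base_running)
      then obtain y where "y \<in> set_pmf (moves z)" "z' = nxt z y" using running_kern[OF _ step.hyps(2)]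
          by blast
      then show ?thesis using active_step[OF a] False t by (simp add: safe_def)
    qed
  qed
qed

lemma finite_heard: "reach z \<Longrightarrow> finite (heard (fst z) v)"
proof (induction z rule: reach_induct)
  case init
  show ?case by (simp add: heard_def)
next
  case (step z z')
  from step.hyps(2) obtain x where z': "fst z' = fst z @ [(snd z, x, net z)]" by (auto simp: kern_def)
  have "{m. \<exists>u. (u, v) \<in> net z \<and> fst (x u) = Some m} \<subseteq> (\<lambda>u. the (fst (x u))) ` {u. (u, v) \<in> net z}"
      by force
  then have "finite {m. \<exists>u. (u, v) \<in> net z \<and> fst (x u) = Some m}"
    using fin_nbrs finite_surj by blast
  then show ?case using step.IH by (simp add: z' heard_append)
qed

text \<open>The largest messages are registers: at most \<open>2 * slots N\<close> entries of
  \<open>(A + 8) * lg N\<close> bits, where \<open>slots N * lg N \<le> 4 * b\<close>.\<close>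

definition size_bound :: nat where "size_bound = 8 * (A + 8) * b"

text \<open>The requirement \<open>src g \<noteq> []\<close> makes the property stable when further
  generations are entered under names whose list is still empty.\<close>

definition msg_ok :: "blocks \<Rightarrow> token set \<Rightarrow> message set \<Rightarrow> message \<Rightarrow> bool" where
  "msg_ok src S H m \<longleftrightarrow> message_size m \<le> size_bound \<and> set (plain m) \<subseteq> learned src S H \<and>
     (\<forall>g c p. Packet g c p \<in> set (coded m) \<longrightarrow>
        src g \<noteq> [] \<and> is_combination (src g) c p \<and> can_combine src S H g c)"

definition hist_ok :: "blocks \<Rightarrow> history \<Rightarrow> bool" where
  "hist_ok src h \<longleftrightarrow> (\<forall>r<length h. \<forall>v\<in>V. \<forall>m. fst (fst (snd (h ! r)) v) = Some m \<longrightarrow>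
     msg_ok src (I v) (heard (take r h) v) m)"

definition headers_ok :: "blocks \<Rightarrow> bitstring \<Rightarrow> state \<Rightarrow> bool" where
  "headers_ok src g z \<longleftrightarrow> (\<forall>v\<in>V. \<forall>(c, p)\<in>set (pks (st z v)). c \<in> heard_headers (heard (fst z) v) g \<or>
     (\<exists>i<length (src g). c = unit_vec (length (src g)) i \<and> set (src g ! i) \<subseteq> set (known (st z v))))"

text \<open>The definition of network coding asks for a single \<open>src\<close> that explains a
  whole history. Here it is a ledger: only names of past cycles, and of the current one once its
  generation is agreed on, are in use, so the next name is free.\<close>

definition coding :: "state \<Rightarrow> blocks \<Rightarrow> bool" where
  "coding z src \<longleftrightarrow> (\<forall>g. \<forall>B\<in>set (src g). set B \<subseteq> toks) \<and> hist_ok src (fst z) \<and>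
     (\<forall>v\<in>V. set (known (st z v)) \<subseteq> learned src (I v) (heard (fst z) v)) \<and>
     (time z \<le> N \<longrightarrow> src = (\<lambda>_. [])) \<and>
     (N \<le> time z \<longrightarrow> \<not> finished z \<longrightarrow>
       (\<forall>g. src g \<noteq> [] \<longrightarrow> (\<exists>c. g = name N c \<and> (c < gcyc (time z) \<or> c = gcyc (time z) \<and> gph (time z) \<in> {2, 3}))) \<and>
       (gph (time z) \<in> {2, 3} \<longrightarrow> (\<exists>M. generation z M \<and> src (name N (gcyc (time z))) = GB (acts z) M \<and>
          (gph (time z) = 2 \<longrightarrow> headers_ok src (name N (gcyc (time z))) z))))"

lemma msg_ok_mono:
  assumes "\<And>g. src g \<noteq> [] \<Longrightarrow> src' g = src g" "finite H" "msg_ok src S H m"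
  shows "msg_ok src' S H m"
proof -
  have l: "learned src S H \<subseteq> learned src' S H" 
    by (rule learned_mono) (use assms(1,2) in auto)
  have "can_combine src' S H g c" if g: "src g \<noteq> []" and c: "can_combine src S H g c" for g c
  proof -
    obtain w where "\<forall>j<length (src g). (\<Sum>c'\<in>heard_headers H g. w c' * c' ! j) = c ! j \<or>
        set (src g ! j) \<subseteq> learned src S H" using c by (auto simp: can_combine_def)
    then show ?thesis unfolding can_combine_def assms(1)[OF g] using l by (intro exI[of _ w]) blast
  qed
  then have "src' g \<noteq> [] \<and> is_combination (src' g) c p \<and> can_combine src' S H g c"
    if "Packet g c p \<in> set (coded m)" for g c p
    using assms(1,3) that unfolding msg_ok_def by simp
  then show ?thesis using assms(3) l unfolding msg_ok_def by blast
qed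

lemma finite_heard_take:
  assumes "reach z"
  shows "finite (heard (take r (fst z)) v)"
proof -
  have "heard (take r h) v \<subseteq> heard h v" for h unfolding heard_def by (auto dest: in_set_takeD)
  then show ?thesis using finite_heard[OF assms] finite_subset by blast
qed

lemma hist_ok_nxt:
  assumes "reach z" "\<And>g. src g \<noteq> [] \<Longrightarrow> src' g = src g" "hist_ok src (fst z)"
    "\<And>v. v \<in> V \<Longrightarrow> msg_ok src' (I v) (heard (fst z) v) (fst (y v))"
  shows "hist_ok src' (fst (nxt z y))"
  unfolding hist_ok_def
proof (intro allI impI ballI)
  fix r v m assume r: "r < length (fst (nxt z y))" and v: "v \<in> V" and m: "fst (fst (snd (fst (nxt z y) ! r)) v) = Some m"
  show "msg_ok src' (I v) (heard (take r (fst (nxt z y))) v) m"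
  proof (cases "r < length (fst z)")
    case True
    then have "msg_ok src (I v) (heard (take r (fst z)) v) m"
      using assms(3) v m unfolding hist_ok_def by (simp add: nxt_def nth_append)
    then have "msg_ok src' (I v) (heard (take r (fst z)) v) m"
      using assms(2) finite_heard_take[OF assms(1)] by (rule msg_ok_mono[rotated 2])
    then show ?thesis using True by (simp add: nxt_def)
  next
    case False
    then have "r = length (fst z)" using r by (simp add: nxt_def)
    then show ?thesis using m v assms(4)[OF v] by (simp add: nxt_def choice_of_def)
  qed
qed

lemma lead_le: "lead N \<le> b" "lead N \<le> N" "1 \<le> lead N"
  using b_pos N_pos by (auto simp: lead_def)

lemma slots_le: "slots N \<le> lead N" "1 \<le> slots N"
  using lead_le by (auto simp: slots_def)

lemma slots_lg_le: "slots N * lg N \<le> 4 * b"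
proof (cases "lead N div lg N \<le> 1")
  case True
  then show ?thesis using lg_le by (simp add: slots_def)
next
  case False
  then have "slots N * lg N \<le> lead N" by (simp add: slots_def)
  then show ?thesis using lead_le by linarith
qed

lemma msize_d: "msize * d \<le> b" "msize * (1 + d) \<le> 2 * b"
proof -
  have "d \<le> b" using inst by (simp add: dissemination_instance_def)
  show 1: "msize * d \<le> b"
  proof (cases "b div d = 0")
    case True
    then show ?thesis using \<open>d \<le> b\<close> by (simp add: msize_def)
  next
    case False
    then show ?thesis by (simp add: msize_def max_def)
  qed
  show "msize * (1 + d) \<le> 2 * b"
  proof (cases "d = 0")
    case True
    have "msize = 1" using True unfolding msize_def by simp
    then show ?thesis using True b_pos by simp
  next
    case False
    then have "msize * 1 \<le> msize * d" by (intro mult_left_mono) auto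
    then have "msize \<le> msize * d" by (simp only: mult_1_right)
    then show ?thesis using 1 unfolding distrib_left mult_1_right by linarith
  qed
qed

lemma sum_list_bin: "sum_list (map (length \<circ> bin w) r) = length r * w"
  by (induction r) auto

lemma size_put_reg: "length r = Suc (slots N) \<Longrightarrow> message_size (put_reg N r) \<le> size_bound"
proof -
  assume l: "length r = Suc (slots N)"
  have "length r * width N \<le> 2 * slots N * ((A + 8) * lg N)"
    unfolding l width_def using slots_le by (intro mult_right_mono) auto
  also have "\<dots> = 2 * (A + 8) * (slots N * lg N)" by simp
  also have "\<dots> \<le> 2 * (A + 8) * (4 * b)" using slots_lg_le by (intro mult_left_mono) auto
  also have "\<dots> = size_bound" by (simp add: size_bound_def)
  finally show ?thesis by (simp add: message_size_def put_reg_def length_concat sum_list_bin)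
qed

lemma size_bound_ge: "64 * b \<le> size_bound"
proof -
  have "64 * b \<le> 8 * (A + 8) * b" by (intro mult_right_mono) auto
  then show ?thesis by (simp add: size_bound_def)
qed

lemma size_plain: "\<forall>t\<in>set ts. length t = d \<Longrightarrow> length ts \<le> msize \<Longrightarrow>
    message_size (Message [] ts []) \<le> size_bound"
proof -
  assume d: "\<forall>t\<in>set ts. length t = d" and l: "length ts \<le> msize"
  have "(\<Sum>t\<leftarrow>ts. 1 + length t) = length ts * (1 + d)" using d by (induction ts) auto
  also have "\<dots> \<le> msize * (1 + d)" using l by (rule mult_right_mono) simp
  also have "\<dots> \<le> 2 * b" by (rule msize_d)
  finally show ?thesis using size_bound_ge by (simp add: message_size_def)
qed

lemma size_gens: "length (gens N M) \<le> 2 * lead N"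
proof -
  have "length (concat (map (\<lambda>j. slot_block N (M ! Suc j)) xs)) \<le> length xs" for xs
    by (induction xs) (auto simp: slot_block_def)
  from this[of "[0..<slots N]"] have "length (gens N M) \<le> lead N + slots N"
    by (auto simp: gens_def lead_blocks_def)
  then show ?thesis using slots_le by linarith
qed

lemma name_inj: "c \<le> N \<Longrightarrow> c' \<le> N \<Longrightarrow> name N c = name N c' \<Longrightarrow> c = c'"
  using val_bin lg_N(3) unfolding name_def by (metis le_less_trans)

lemma gcyc_le: "base z \<Longrightarrow> gcyc (time z) \<le> N"
  using base_countD k_le n_le_N by fastforce

lemma hear_learned: "inb z y v \<subseteq> M \<Longrightarrow> hear (inb z y v) \<subseteq> learned src S M"
  by (auto simp: hear_def intro: learned.received)

lemma known_learned:
  assumes "reach z" "\<And>g. src g \<noteq> [] \<Longrightarrow> src' g = src g" "v \<in> V"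
    "set (known (st z v)) \<subseteq> learned src (I v) (heard (fst z) v)"
    "set (known (st (nxt z y) v)) \<subseteq> set (known (st z v)) \<union> hear (inb z y v)"
  shows "set (known (st (nxt z y) v)) \<subseteq> learned src' (I v) (heard (fst (nxt z y)) v)"
proof -
  have "learned src (I v) (heard (fst z) v) \<subseteq> learned src' (I v) (heard (fst (nxt z y)) v)"
    by (rule learned_mono) (use assms(1,2) finite_heard fin_inb in \<open>auto simp: heard_nxt\<close>)
  moreover have "hear (inb z y v) \<subseteq> learned src' (I v) (heard (fst (nxt z y)) v)"
    by (rule hear_learned) (simp add: heard_nxt)
  ultimately show ?thesis using assms(4,5) by blast
qed

lemma coding_init: "coding ([], s0) (\<lambda>_. [])"
  using N_pos fin_I
  by (auto simp: coding_def hist_ok_def time_def st_init node_start_def intro: learned.own)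

lemma coding_same:
  assumes "reach z" "coding z src" "y \<in> set_pmf (moves z)" "N \<le> time (nxt z y)"
    and ok: "\<And>v. v \<in> V \<Longrightarrow> msg_ok src (I v) (heard (fst z) v) (fst (y v))"
    and kn: "\<And>v. v \<in> V \<Longrightarrow> set (known (st (nxt z y) v)) \<subseteq> set (known (st z v)) \<union> hear (inb z y v)"
    and ph: "time (nxt z y) = N \<longrightarrow> src = (\<lambda>_. [])"
      "\<not> finished (nxt z y) \<longrightarrow>
       (\<forall>g. src g \<noteq> [] \<longrightarrow> (\<exists>c. g = name N c \<and> (c < gcyc (Suc (time z)) \<or> c = gcyc (Suc (time z)) \<and> gph (Suc (time z)) \<in> {2, 3}))) \<and>
       (gph (Suc (time z)) \<in> {2, 3} \<longrightarrow> (\<exists>M. generation (nxt z y) M \<and> src (name N (gcyc (Suc (time z)))) = GB (acts (nxt z y)) M \<and>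
          (gph (Suc (time z)) = 2 \<longrightarrow> headers_ok src (name N (gcyc (Suc (time z)))) (nxt z y))))"
  shows "coding (nxt z y) src"
  unfolding coding_def
proof (intro conjI)
  show "\<forall>g. \<forall>B\<in>set (src g). set B \<subseteq> toks" using assms(2) by (simp add: coding_def)
  show "hist_ok src (fst (nxt z y))"
    using assms(2) by (intro hist_ok_nxt[OF assms(1)] ok) (auto simp: coding_def)
  show "\<forall>v\<in>V. set (known (st (nxt z y) v)) \<subseteq> learned src (I v) (heard (fst (nxt z y)) v)"
    using assms(2) by (intro ballI known_learned[OF assms(1)] kn) (auto simp: coding_def)
  show "time (nxt z y) \<le> N \<longrightarrow> src = (\<lambda>_. [])" using ph(1) assms(4) by auto
qed (use ph(2) in simp)

lemma GB_acts_cong: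
  assumes "generation z M" "\<And>v. v \<in> V \<Longrightarrow> acts z' v = acts z v"
  shows "GB (acts z') M = GB (acts z) M"
proof -
  have "fst x \<in> V" if "x \<in> set (gens N M)" for x
    using gens_ok[of "acts z" M "fst x" "snd x"] assms(1) that by (simp add: generation_def)
  then show ?thesis
    unfolding GB_def by (intro map_cong refl) (use assms(2) in \<open>auto simp: case_prod_beta'\<close>)
qed

lemma gens_ne:
  assumes "regs_ok (acts z) M" "M ! 0 \<noteq> 0"
  shows "gens N M \<noteq> []"
proof -
  obtain u where u: "u \<in> V" "acts z u \<noteq> []" "M ! 0 = length (acts z u) * idbase N + code u"
    using assms by (auto simp: regs_ok_def)
  then have "0 < nblocks msize (length (acts z u))" using nblocks_pos msize_pos by simp
  then show ?thesis using u lead_le by (auto simp: gens_def lead_block_code)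
qed

lemma coding_sync:
  assumes "reach z" "syncing z" "time z < N" "coding z src" "y \<in> set_pmf (moves z)"
  shows "coding (nxt z y) src"
proof -
  have src: "src = (\<lambda>_. [])" using assms(3,4) by (simp add: coding_def)
  note ss = sync_step[OF assms(2,3,5)]
  have ok: "msg_ok src S H (fst (y v))" if v: "v \<in> V" for S H v
  proof -
    obtain x where x: "y v = (Message (bin (lg x) x) [] [], st z v)" "x \<le> Max (est ` V)" using ss(2)[OF v]
        by blast
    then have "lg x \<le> lg N" by (intro floorlog_mono) (simp add: N_def)
    then have "lg x \<le> size_bound" using lg_le size_bound_ge by linarith
    then show ?thesis using x by (simp add: msg_ok_def message_size_def)
  qed
  show ?thesis
    unfolding coding_def
  proof (intro conjI)
    show "hist_ok src (fst (nxt z y))"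
      using assms(4) by (intro hist_ok_nxt[OF assms(1)] ok) (auto simp: coding_def)
    show "\<forall>v\<in>V. set (known (st (nxt z y) v)) \<subseteq> learned src (I v) (heard (fst (nxt z y)) v)"
      using ss(3) by (auto intro: learned.own)
    show "N \<le> time (nxt z y) \<longrightarrow> \<not> finished (nxt z y) \<longrightarrow>
       (\<forall>g. src g \<noteq> [] \<longrightarrow> (\<exists>c. g = name N c \<and> (c < gcyc (time (nxt z y)) \<or> c = gcyc (time (nxt z y)) \<and> gph (time (nxt z y)) \<in> {2, 3}))) \<and>
       (gph (time (nxt z y)) \<in> {2, 3} \<longrightarrow> (\<exists>M. generation (nxt z y) M \<and> src (name N (gcyc (time (nxt z y)))) = GB (acts (nxt z y)) M \<and>
          (gph (time (nxt z y)) = 2 \<longrightarrow> headers_ok src (name N (gcyc (time (nxt z y)))) (nxt z y))))"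
      using src assms(3) position_start by (auto dest!: le_neq_implies_less)
  qed (use src in simp_all)
qed

lemma coding_gather:
  assumes "reach z" "base z" "N \<le> time z" "gph (time z) = 0" "coding z src" "\<not> finished z" "y \<in> set_pmf (moves z)"
  shows "coding (nxt z y) src"
proof -
  note sg = st_gather[OF assms(2-4,7)]
  have kl: "set (known (st z v)) \<subseteq> learned src (I v) (heard (fst z) v)" if "v \<in> V" for v
    using assms(5) that by (simp add: coding_def)
  have pos: "gph (Suc (time z)) = 0 \<or> gph (Suc (time z)) = 1" "gcyc (Suc (time z)) = gcyc (time z)"
    using assms(3,4) by (auto elim!: position_cases[of "time z"])
  show ?thesis
  proof (rule coding_same[OF assms(1,5,7)])
    fix v assume v: "v \<in> V"
    obtain ts where ts: "fst (y v) = Message [] ts []" "set ts \<subseteq> actv z v" "ts = [] \<or> ts \<in> range (block msize (acts z v))"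
      using sg(2)[OF v] by blast
    have "length ts \<le> msize" using ts(3) by auto
    moreover have "\<forall>t\<in>set ts. length t = d" using ts(2) actv_toks[OF assms(2) v] length_toks by blast
    ultimately have "message_size (fst (y v)) \<le> size_bound" using size_plain ts(1) by simp
    moreover have "set ts \<subseteq> learned src (I v) (heard (fst z) v)"
      using ts(2) baseD(5)[OF assms(2) v] kl[OF v] by blast
    ultimately show "msg_ok src (I v) (heard (fst z) v) (fst (y v))" using ts(1) by (simp add: msg_ok_def)
    have "finite (hear (inb z y v))" using gather_hear(1)[OF assms(2-4,7)] fin_active finite_subset
        by blast
    then show "set (known (st (nxt z y) v)) \<subseteq> set (known (st z v)) \<union> hear (inb z y v)"
      using sg(1)[OF v] by simp
  qed (use assms pos in \<open>auto simp: coding_def\<close>)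
qed

lemma coding_verify:
  assumes "reach z" "active_run z" "N \<le> time z" "gph (time z) = 3" "coding z src" "\<not> finished z" "y \<in> set_pmf (moves z)"
  shows "coding (nxt z y) src"
proof -
  have b: "base z" and ver: "verifying z" using assms(2,4) by (auto simp: active_run_def)
  obtain M where M: "generation z M" "src (name N (gcyc (time z))) = GB (acts z) M"
    using assms(3-6) by (auto simp: coding_def)
  note vs = verify_step[OF b assms(3,4) M(1) ver assms(7)] and sv = st_verify[OF b assms(3,4,7)]
  show ?thesis
  proof (rule coding_same[OF assms(1,5,7)])
    fix v assume v: "v \<in> V"
    have kl: "set (known (st z v)) \<subseteq> learned src (I v) (heard (fst z) v)"
      using assms(5) v by (simp add: coding_def)
    have "set (plain (fst (y v))) \<subseteq> set (known (st z v))"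
      using ver v sv(1)[OF v] by (auto simp: put_vreg_def verifying_def)
    moreover have "message_size (fst (y v)) \<le> size_bound"
    proof -
      have "\<forall>t\<in>set (plain (fst (y v))). length t = d" using calculation baseD(6)[OF b v] length_toks
          by blast
      then have "message_size (fst (y v)) \<le> 2 + d" using sv(1)[OF v]
          by (auto simp: put_vreg_def message_size_def split: if_splits)
      moreover have "d \<le> b" using inst by (simp add: dissemination_instance_def)
      ultimately show ?thesis using size_bound_ge b_pos by linarith
    qed
    ultimately show "msg_ok src (I v) (heard (fst z) v) (fst (y v))"
      using kl sv(1)[OF v] by (auto simp: msg_ok_def put_vreg_def)
    show "set (known (st (nxt z y) v)) \<subseteq> set (known (st z v)) \<union> hear (inb z y v)" using vs(5)[OF v]
        by simp
  next
    show "\<not> finished (nxt z y) \<longrightarrow>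
       (\<forall>g. src g \<noteq> [] \<longrightarrow> (\<exists>c. g = name N c \<and> (c < gcyc (Suc (time z)) \<or> c = gcyc (Suc (time z)) \<and> gph (Suc (time z)) \<in> {2, 3}))) \<and>
       (gph (Suc (time z)) \<in> {2, 3} \<longrightarrow> (\<exists>M. generation (nxt z y) M \<and> src (name N (gcyc (Suc (time z)))) = GB (acts (nxt z y)) M \<and>
          (gph (Suc (time z)) = 2 \<longrightarrow> headers_ok src (name N (gcyc (Suc (time z)))) (nxt z y))))"
      (is "_ \<longrightarrow> ?A \<and> ?B")
    proof (rule impI, rule conjI)
      have old: "\<forall>g. src g \<noteq> [] \<longrightarrow> (\<exists>c. g = name N c \<and> c \<le> gcyc (time z))"
        using assms(3,5,6) unfolding coding_def by (metis less_imp_le order_refl)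
      show ?A
        using assms(3) by (cases rule: position_cases) (use old assms(4) le_neq_implies_less in \<open>fastforce simp: less_Suc_eq_le\<close>)+
      show ?B
        using assms(3)
      proof (cases rule: position_cases)
        case 1
        have "GB (acts (nxt z y)) M = GB (acts z) M" using vs(2)[OF 1(1)]
            by (intro GB_acts_cong[OF M(1)]) simp
        then show ?thesis using vs(3)[OF 1(1)] M(2) 1 assms(4) by auto
      next
        case 2
        then show ?thesis using assms(4) by simp
      qed
    qed
  qed (use assms in auto)
qed

lemma coding_nominate:
  assumes "reach z" "active_run z" "N \<le> time z" "gph (time z) = 1" "coding z src" "\<not> finished z" "y \<in> set_pmf (moves z)"
  shows "\<exists>src'. coding (nxt z y) src'"
proof -
  have b: "base z" and nm: "goff (time z) \<noteq> 0 \<longrightarrow> nominating z" using assms(2,4)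
      by (auto simp: active_run_def)
  note ns = nominate_step[OF b assms(3,4) nm assms(7)] and sn = st_nominate[OF b assms(3,4,7)]
    and sp = nominate_spreads[OF b assms(3,4) nm assms(7)]
  have old: "\<forall>g. src g \<noteq> [] \<longrightarrow> (\<exists>c. g = name N c \<and> c < gcyc (time z))"
    using assms(3-6) unfolding coding_def by auto
  have ok: "msg_ok src' S H (fst (y v))" if v: "v \<in> V" for src' S H v
  proof -
    have "message_size (put_reg N (reg (snd (y v)))) \<le> size_bound" using sp(2) v
        by (intro size_put_reg) blast
    then show ?thesis using sn(1)[OF v] by (simp add: msg_ok_def put_reg_def)
  qed
  have kn: "set (known (st (nxt z y) v)) \<subseteq> set (known (st z v)) \<union> hear (inb z y v)" if "v \<in> V" for v
    using ns(4)[OF that] by simp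
  have cy: "gcyc (Suc (time z)) = gcyc (time z)"
    using assms(3,4) by (auto elim!: position_cases[of "time z"])
  show ?thesis
  proof (cases "Suc (goff (time z)) = T \<and> \<not> finished (nxt z y)")
    case False
    have "coding (nxt z y) src"
    proof (rule coding_same[OF assms(1,5,7) _ ok kn])
      show "\<not> finished (nxt z y) \<longrightarrow>
       (\<forall>g. src g \<noteq> [] \<longrightarrow> (\<exists>c. g = name N c \<and> (c < gcyc (Suc (time z)) \<or> c = gcyc (Suc (time z)) \<and> gph (Suc (time z)) \<in> {2, 3}))) \<and>
       (gph (Suc (time z)) \<in> {2, 3} \<longrightarrow> (\<exists>M. generation (nxt z y) M \<and> src (name N (gcyc (Suc (time z)))) = GB (acts (nxt z y)) M \<and>
          (gph (Suc (time z)) = 2 \<longrightarrow> headers_ok src (name N (gcyc (Suc (time z)))) (nxt z y))))"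
        using old cy False assms(3,4) by (auto elim!: position_cases[of "time z"])
    qed (use assms in auto)
    then show ?thesis by blast
  next
    case True
    then have e: "Suc (goff (time z)) = T" and nf: "\<not> finished (nxt z y)" by auto
    note pos = position_end[OF assms(3) e]
    have ac: "active_run (nxt z y)" using ns(1) nf by blast
    then have b': "base (nxt z y)" by (simp add: active_run_def)
    have "gph (time (nxt z y)) \<in> {2, 3}" using pos(1) assms(4) by simp
    then obtain M where M: "generation (nxt z y) M" using ac by (auto simp: active_run_def)
    let ?g = "name N (gcyc (time z))"
    define src' where "src' = src(?g := GB (acts (nxt z y)) M)"
    \<comment> \<open>All entries belong to smaller cycle numbers, and \<open>name N\<close> is
      injective up to \<open>N\<close>.\<close>
    have fresh: "src ?g = []"
    proof (rule ccontr)
      assume "src ?g \<noteq> []"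
      then obtain c where "?g = name N c" "c < gcyc (time z)" using old by blast
      then show False using name_inj[of "gcyc (time z)" c] gcyc_le[OF b] by simp
    qed
    then have ext: "src g \<noteq> [] \<Longrightarrow> src' g = src g" for g by (auto simp: src'_def)
    have "coding (nxt z y) src'"
      unfolding coding_def
    proof (intro conjI)
      show "\<forall>g. \<forall>B\<in>set (src' g). set B \<subseteq> toks"
        using assms(5) generation_GB(2)[OF b' M] by (simp add: coding_def src'_def)
      show "hist_ok src' (fst (nxt z y))"
        using assms(5) by (intro hist_ok_nxt[OF assms(1) ext] ok) (auto simp: coding_def)
      show "\<forall>v\<in>V. set (known (st (nxt z y) v)) \<subseteq> learned src' (I v) (heard (fst (nxt z y)) v)"
        using assms(5) by (intro ballI known_learned[OF assms(1) ext] kn) (auto simp: coding_def)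
      have hd: "headers_ok src' ?g (nxt z y)"
        unfolding headers_ok_def
      proof (intro ballI)
        fix v cp assume v: "v \<in> V" and cp: "cp \<in> set (pks (st (nxt z y) v))"
        have rM: "reg (st (nxt z y) v) = M" using M v by (simp add: generation_def)
        have pk: "set (pks (st (nxt z y) v)) = own_packets (st (nxt z y) v)"
        proof -
          have r0: "M ! 0 \<noteq> 0" using M by (simp add: generation_def)
          obtain s' where s': "st (nxt z y) v = s'\<lparr>pks := lst (own_packets s')\<rparr>"
            using sn(4)[OF v] e rM r0 by (auto simp: Let_def split: if_splits)
          have own: "own_packets s' = own_packets (st (nxt z y) v)" unfolding s' by simp
          have "own_packets (st (nxt z y) v) \<subseteq> set (pks (st (nxt z y) v))" using M v
              by (simp add: generation_def)
          then have f: "finite (own_packets s')" unfolding own by (rule finite_subset) simp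
          have "pks (st (nxt z y) v) = lst (own_packets s')" unfolding s' by simp
          then show ?thesis using set_lst[OF f] own by (simp only:)
        qed
        then obtain i x where ix: "cp = (unit_vec (gen_size (st (nxt z y) v)) i, concat (block msize (acts (nxt z y) v) x))"
          "i < gen_size (st (nxt z y) v)" "gens N M ! i = (v, x)"
          using cp baseD[OF b' v] rM by (auto simp: own_packets_def acts_def)
        have h: "gen_size (st (nxt z y) v) = length (src' ?g)"
          using generation_gen_size[OF b' M v] by (simp add: src'_def)
        have l: "i < length (gens N M)" using ix(2) h by (simp add: src'_def GB_def)
        have "(v, x) \<in> set (gens N M)" using l ix(3) nth_mem by metis
        then have "acts (nxt z y) v \<noteq> []" using gens_ok[of "acts (nxt z y)" M v x] M
            by (simp add: generation_def)
        then have "set (src' ?g ! i) \<subseteq> actv (nxt z y) v"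
          using l ix(3) set_block by (simp add: src'_def GB_def actv_def)
        then have "set (src' ?g ! i) \<subseteq> set (known (st (nxt z y) v))" using baseD(5)[OF b' v] by blast
        then show "case cp of (c, p) \<Rightarrow> c \<in> heard_headers (heard (fst (nxt z y)) v) ?g \<or>
           (\<exists>i<length (src' ?g). c = unit_vec (length (src' ?g)) i \<and> set (src' ?g ! i) \<subseteq> set (known (st (nxt z y) v)))"
          using ix h by auto
      qed
      have "\<exists>c. g = name N c \<and> (c < gcyc (time z) \<or> c = gcyc (time z))" if "src' g \<noteq> []" for g
        using old that by (cases "g = ?g") (auto simp: src'_def)
      then show "N \<le> time (nxt z y) \<longrightarrow> \<not> finished (nxt z y) \<longrightarrow>
       (\<forall>g. src' g \<noteq> [] \<longrightarrow> (\<exists>c. g = name N c \<and> (c < gcyc (time (nxt z y)) \<or> c = gcyc (time (nxt z y)) \<and> gph (time (nxt z y)) \<in> {2, 3}))) \<and>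
       (gph (time (nxt z y)) \<in> {2, 3} \<longrightarrow> (\<exists>M. generation (nxt z y) M \<and> src' (name N (gcyc (time (nxt z y)))) = GB (acts (nxt z y)) M \<and>
          (gph (time (nxt z y)) = 2 \<longrightarrow> headers_ok src' (name N (gcyc (time (nxt z y)))) (nxt z y))))"
        using M hd pos assms(4) cy by (auto simp: src'_def)
      show "time (nxt z y) \<le> N \<longrightarrow> src' = (\<lambda>_. [])" using assms(3) by simp
    qed
    then show ?thesis by blast
  qed
qed

lemma coding_code:
  assumes "reach z" "active_run z" "N \<le> time z" "gph (time z) = 2" "coding z src" "\<not> finished z" "y \<in> set_pmf (moves z)"
  shows "coding (nxt z y) src"
proof -
  have b: "base z" using assms(2) by (simp add: active_run_def)
  let ?g = "name N (gcyc (time z))"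
  obtain M where M: "generation z M" "src ?g = GB (acts z) M" "headers_ok src ?g z"
    using assms(3-6) by (auto simp: coding_def)
  note cs = code_step[OF b assms(3,4) M(1) assms(7)] and sc = st_code[OF b assms(3,4,7)]
  let ?z = "nxt z y"
  have ne: "src ?g \<noteq> []"
    using gens_ne[of z M] M by (simp add: generation_def GB_def)
  have kl: "set (known (st z v)) \<subseteq> learned src (I v) (heard (fst z) v)" if "v \<in> V" for v
    using assms(5) that by (simp add: coding_def)
  have gs: "gen_size (st z v) = length (src ?g)" if "v \<in> V" for v
    using generation_gen_size[OF b M(1) that] M(2) by simp
  have cc: "can_combine src (I v) (heard (fst z) v) ?g c"
    if v: "v \<in> V" and cp: "(c, p) \<in> span (gen_size (st z v)) (msize * d) (pks (st z v))" for v c p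
  proof -
    obtain w where c: "c = lincomb (length (src ?g)) w (map fst (pks (st z v)))"
      using cp gs[OF v] by (auto simp: span_def)
    show ?thesis unfolding c
    proof (rule can_combine_span)
      fix c p assume "(c, p) \<in> set (pks (st z v))"
      then show "c \<in> heard_headers (heard (fst z) v) ?g \<or> (\<exists>i<length (src ?g). c = unit_vec (length (src ?g)) i \<and>
          set (src ?g ! i) \<subseteq> learned src (I v) (heard (fst z) v))"
        using M(3) v kl[OF v] unfolding headers_ok_def by blast
    qed (rule finite_heard[OF assms(1)])
  qed
  have ok: "msg_ok src (I v) (heard (fst z) v) (fst (y v))" if v: "v \<in> V" for v
  proof -
    obtain w where w: "length w = length (pks (st z v))" "y v = (combination (st z v) w, st z v)"
        using sc(1)[OF v] by blast
    let ?c = "lincomb (gen_size (st z v)) w (map fst (pks (st z v)))"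
    let ?p = "lincomb (msize * d) w (map snd (pks (st z v)))"
    have m: "fst (y v) = Message [] [] [Packet ?g ?c ?p]"
      using w(2) baseD(3)[OF b v] base_position(3)[OF b assms(3) v] by (simp add: combination_def)
    have s: "(?c, ?p) \<in> span (gen_size (st z v)) (msize * d) (pks (st z v))" using w(1)
        by (auto simp: span_def)
    have "message_size (fst (y v)) \<le> 1 + lg N + 2 * lead N + msize * d"
      using gs[OF v] M(2) size_gens[of M] by (simp add: m message_size_def name_def GB_def)
    also have "\<dots> \<le> 64 * b" using lg_le lead_le msize_d b_pos by linarith
    finally have "message_size (fst (y v)) \<le> size_bound" using size_bound_ge by linarith
    then show ?thesis
      using span_combination[OF b M(1) v s] cc[OF v s] M(2) ne by (auto simp: m msg_ok_def)
  qed
  have heard': "packets (inb z y v) \<subseteq> {(c, p). c \<in> heard_headers (heard (fst ?z) v) ?g}" if v: "v \<in> V"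
      for v
  proof clarify
    fix c p assume "(c, p) \<in> packets (inb z y v)"
    from cs(5)[OF v this] obtain u where u: "(u, v) \<in> net z" "coded (fst (y u)) = [Packet ?g c p]"
        by blast
    then have "fst (y u) \<in> heard (fst ?z) v" using inb_I by (simp add: heard_nxt)
    then show "c \<in> heard_headers (heard (fst ?z) v) ?g" using u(2) by (force simp: heard_headers_def)
  qed
  \<comment> \<open>Owned blocks are measured by what \<open>v\<close> knew before this round.
    Otherwise the tokens decoded in this round would be used to justify their own decoding.\<close>
  have hd: "\<forall>(c, p)\<in>set (pks (st ?z v)). c \<in> heard_headers (heard (fst ?z) v) ?g \<or>
     (\<exists>i<length (src ?g). c = unit_vec (length (src ?g)) i \<and> set (src ?g ! i) \<subseteq> set (known (st z v)))" if v: "v \<in> V" for v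
  proof clarify
    fix c p assume "(c, p) \<in> set (pks (st ?z v))"
      and nu: "\<not> (\<exists>i<length (src ?g). c = unit_vec (length (src ?g)) i \<and> set (src ?g ! i) \<subseteq> set (known (st z v)))"
    then consider "(c, p) \<in> set (pks (st z v))" | "(c, p) \<in> packets (inb z y v)" using cs(4)[OF v]
        by blast
    then show "c \<in> heard_headers (heard (fst ?z) v) ?g"
    proof cases
      case 1
      then have "c \<in> heard_headers (heard (fst z) v) ?g" using M(3) v nu unfolding headers_ok_def by blast
      then show ?thesis using heard_headers_mono[of "heard (fst z) v" "heard (fst ?z) v" ?g]
          by (auto simp: heard_nxt)
    next
      case 2
      then show ?thesis using heard'[OF v] by blast
    qed
  qed
  have kl': "set (known (st z v)) \<subseteq> learned src (I v) (heard (fst ?z) v)" if v: "v \<in> V" for v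
  proof -
    have "learned src (I v) (heard (fst z) v) \<subseteq> learned src (I v) (heard (fst ?z) v)"
      by (rule learned_mono) (use assms(1) finite_heard fin_inb in \<open>auto simp: heard_nxt\<close>)
    then show ?thesis using kl[OF v] by blast
  qed
  have dk: "\<Union>(set ` set (GB (acts z) M)) \<subseteq> learned src (I v) (heard (fst ?z) v)"
      if v: "v \<in> V" and fu: "full (st ?z v)" for v
  proof -
    have gs': "gen_size (st ?z v) = length (src ?g)"
      using generation_gen_size[OF _ cs(2) v] cs(1,3) M(2) GB_acts_cong[OF M(1), of ?z]
          by (simp add: active_run_def)
    have "set (src ?g ! i) \<subseteq> learned src (I v) (heard (fst ?z) v)" if i: "i < length (src ?g)" for i
    proof -
      obtain w where w: "unit_vec (length (src ?g)) i = lincomb (length (src ?g)) w (map fst (pks (st ?z v)))"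
        using fu i gs' by (auto simp: full_def span_def)
      have "can_combine src (I v) (heard (fst ?z) v) ?g (unit_vec (length (src ?g)) i)"
        unfolding w
      proof (rule can_combine_span)
        fix c p assume "(c, p) \<in> set (pks (st ?z v))"
        then show "c \<in> heard_headers (heard (fst ?z) v) ?g \<or> (\<exists>i<length (src ?g). c = unit_vec (length (src ?g)) i \<and>
            set (src ?g ! i) \<subseteq> learned src (I v) (heard (fst ?z) v))"
          using hd[OF v] kl'[OF v] by blast
      next
        show "finite (heard (fst ?z) v)" using finite_heard[OF assms(1)] fin_inb by (simp add: heard_nxt)
      qed
      then obtain w' where w': "\<forall>j<length (src ?g). (\<Sum>c'\<in>heard_headers (heard (fst ?z) v) ?g. w' c' * c' ! j)
          = unit_vec (length (src ?g)) i ! j \<or> set (src ?g ! j) \<subseteq> learned src (I v) (heard (fst ?z) v)"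
        by (auto simp: can_combine_def)
      show ?thesis
      proof
        fix t assume t: "t \<in> set (src ?g ! i)"
        show "t \<in> learned src (I v) (heard (fst ?z) v)"
          by (rule learned.decoded[where i = i and g = ?g and w = w' and src = src])
            (use i t w' in \<open>auto simp: of_bool_def subset_eq\<close>)
      qed
    qed
    then show ?thesis unfolding M(2)[symmetric] set_conv_nth[of "src ?g"] by auto
  qed
  have cy: "gcyc (Suc (time z)) = gcyc (time z)"
    using assms(3,4) by (auto elim!: position_cases[of "time z"])
  have p23: "gph (Suc (time z)) \<in> {2, 3}"
    using assms(3,4) by (auto elim!: position_cases[of "time z"])
  have gb: "GB (acts ?z) M = GB (acts z) M" using cs(3) by (intro GB_acts_cong[OF M(1)]) simp
  have kn: "set (known (st z v)) \<subseteq> set (known (st ?z v))" if "v \<in> V" for v using cs(6)[OF that] by auto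
  show ?thesis
    unfolding coding_def
  proof (intro conjI)
    show "\<forall>g. \<forall>B\<in>set (src g). set B \<subseteq> toks" using assms(5) by (simp add: coding_def)
    show "hist_ok src (fst ?z)"
      using assms(5) by (intro hist_ok_nxt[OF assms(1)] ok) (auto simp: coding_def)
    show "\<forall>v\<in>V. set (known (st ?z v)) \<subseteq> learned src (I v) (heard (fst ?z) v)"
      using cs(6) kl' dk by (metis Un_least)
    have "headers_ok src ?g ?z"
      unfolding headers_ok_def using hd kn by (fastforce dest: bspec)
    then show "N \<le> time ?z \<longrightarrow> \<not> finished ?z \<longrightarrow>
       (\<forall>g. src g \<noteq> [] \<longrightarrow> (\<exists>c. g = name N c \<and> (c < gcyc (time ?z) \<or> c = gcyc (time ?z) \<and> gph (time ?z) \<in> {2, 3}))) \<and>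
       (gph (time ?z) \<in> {2, 3} \<longrightarrow> (\<exists>M. generation ?z M \<and> src (name N (gcyc (time ?z))) = GB (acts ?z) M \<and>
          (gph (time ?z) = 2 \<longrightarrow> headers_ok src (name N (gcyc (time ?z))) ?z)))"
      using cs(2) M(2) gb cy p23 assms(3,5,6) unfolding coding_def by fastforce
    show "time ?z \<le> N \<longrightarrow> src = (\<lambda>_. [])" using assms(3) by simp
  qed
qed

lemma reach_coding: "reach z \<Longrightarrow> \<exists>src. coding z src"
proof (induction z rule: reach_induct)
  case init
  show ?case using coding_init by blast
next
  case (step z z')
  from step.IH obtain src where src: "coding z src" by blast
  note sf = reach_safe[OF step.hyps(1)]
  show ?case
  proof (cases "time z < N")
    case True
    then have s: "syncing z" using sf by (simp add: safe_def)
    then obtain y where y: "y \<in> set_pmf (moves z)" "z' = nxt z y"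
      using running_kern[OF syncing_running step.hyps(2)] by blast
    then show ?thesis using coding_sync[OF step.hyps(1) s True src] by blast
  next
    case lt: False
    show ?thesis
    proof (cases "finished z")
      case True
      then have st': "st z' = st z" "heard (fst z') v = heard (fst z) v" for v
        using finished_kern[OF True step.hyps(2)] by auto
      obtain x where x: "z' = (fst z @ [(snd z, x, net z)], snd z)" "\<forall>v. fst (x v) = None"
        using kern_halted[of z] True step.hyps(2) by (auto simp: finished_def)
      have "hist_ok src (fst z')"
        unfolding hist_ok_def
      proof (intro allI impI ballI)
        fix r v m assume r: "r < length (fst z')" and v: "v \<in> V" and m: "fst (fst (snd (fst z' ! r)) v) = Some m"
        then have "r < length (fst z)" using x by (cases "r = length (fst z)") auto
        then show "msg_ok src (I v) (heard (take r (fst z')) v) m"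
          using src v m x(1) unfolding coding_def hist_ok_def by (auto simp: nth_append)
      qed
      then have "coding z' src"
        using src st' st_cong[OF st'(1) True] lt time_kern[OF step.hyps(2)] unfolding coding_def by simp
      then show ?thesis by blast
    next
      case f: False
      have N: "N \<le> time z" using lt by simp
      have a: "active_run z" using sf lt f by (simp add: safe_def)
      then have b: "base z" by (simp add: active_run_def)
      obtain y where y: "y \<in> set_pmf (moves z)" "z' = nxt z y"
          using running_kern[OF base_running[OF b] step.hyps(2)] by blast
      consider "gph (time z) = 0" | "gph (time z) = 1" | "gph (time z) = 2" | "gph (time z) = 3"
        using gph_less[of "time z"] by linarith
      then show ?thesis
      proof cases
        case 1
        then show ?thesis using coding_gather[OF step.hyps(1) b N _ src f y(1)] y(2) by blast
      next
        case 2
        then show ?thesis using coding_nominate[OF step.hyps(1) a N _ src f y(1)] y(2) by blast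
      next
        case 3
        then show ?thesis using coding_code[OF step.hyps(1) a N _ src f y(1)] y(2) by blast
      next
        case 4
        then show ?thesis using coding_verify[OF step.hyps(1) a N _ src f y(1)] y(2) by blast
      qed
    qed
  qed
qed

lemma result_alg: "result alg (snd z v) = (if fin (st z v) then Some (set (known (st z v))) else None)"
  by (simp add: alg_def st_def)

lemma reach_result:
  assumes "reach z" "v \<in> V" "result alg (snd z v) = Some S"
  shows "S = toks" "S = set (known (st z v))"
proof -
  have f: "fin (st z v)" "S = set (known (st z v))" using assms(3)
      by (auto simp: result_alg split: if_splits)
  then have "\<not> running z" using assms(2) by (auto simp: running_def)
  then have "finished z"
    using reach_safe[OF assms(1)] syncing_running[of z] base_running[of z]
        by (auto simp: safe_def active_run_def split: if_splits)
  then show "S = toks" "S = set (known (st z v))" using f assms(2) by (simp_all add: finished_def)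
qed

lemma network_coding_alg: "network_coding alg V est I adv"
  unfolding network_coding_def
proof (intro allI ballI, clarify)
  fix t h s assume "(h, s) \<in> set_pmf (execution alg V adv (initial alg est I) t)"
  then have r: "reach (h, s)" by (simp add: execution_eq s0_def[symmetric] reach_iff)
  then obtain src where src: "coding (h, s) src" using reach_coding by blast
  show "\<exists>src. (\<forall>g. \<forall>B\<in>set (src g). set B \<subseteq> (\<Union>u\<in>V. I u)) \<and>
        (\<forall>r<length h. \<forall>v\<in>V. \<forall>m. fst (fst (snd (h ! r)) v) = Some m \<longrightarrow>
           set (plain m) \<subseteq> learned src (I v) (heard (take r h) v) \<and>
           (\<forall>g c p. Packet g c p \<in> set (coded m) \<longrightarrow>
              is_combination (src g) c p \<and> can_combine src (I v) (heard (take r h) v) g c)) \<and>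
        (\<forall>v\<in>V. \<forall>S. result alg (s v) = Some S \<longrightarrow> S \<subseteq> learned src (I v) (heard h v))"
  proof (intro exI[of _ src] conjI ballI allI impI)
    fix v S assume v: "v \<in> V" and "result alg (s v) = Some S"
    then have "S = set (known (st (h, s) v))" using reach_result(2)[OF r v, of S] by simp
    then show "S \<subseteq> learned src (I v) (heard h v)" using src v by (simp add: coding_def)
  qed (use src in \<open>auto simp: coding_def hist_ok_def msg_ok_def toks_def\<close>)
qed

lemma messages_bounded_alg: "messages_bounded alg V est I adv (real (8 * (A + 8)) * real b)"
  unfolding messages_bounded_def
proof (intro allI ballI, clarify)
  fix t h s s' x E v m
  assume "(h, s) \<in> set_pmf (execution alg V adv (initial alg est I) t)" and e: "(s', x, E) \<in> set h"
    and v: "v \<in> V" and m: "fst (x v) = Some m"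
  then have "reach (h, s)" by (simp add: execution_eq s0_def[symmetric] reach_iff)
  then obtain src where "coding (h, s) src" using reach_coding by blast
  then have ho: "hist_ok src h" by (simp add: coding_def)
  obtain r where r: "r < length h" "h ! r = (s', x, E)" using e by (auto simp: in_set_conv_nth)
  then have "message_size m \<le> size_bound" using ho v m unfolding hist_ok_def msg_ok_def by fastforce
  then have "real (message_size m) \<le> real size_bound" by (rule of_nat_mono)
  then show "real (message_size m) \<le> real (8 * (A + 8)) * real b" by (simp add: size_bound_def)
qed

end

section \<open>Progress in a cycle\<close>

lemma run_invariant:
  assumes "z' \<in> set_pmf (run K J z)" "P 0 z"
    "\<And>j x x'. j < J \<Longrightarrow> P j x \<Longrightarrow> x' \<in> set_pmf (K x) \<Longrightarrow> P (Suc j) x'"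
  shows "P J z'"
proof -
  have "j \<le> J \<Longrightarrow> x \<in> set_pmf (run K j z) \<Longrightarrow> P j x" for j x
    by (induction j arbitrary: x) (use assms(2,3) in \<open>auto simp: Suc_le_eq\<close>)
  then show ?thesis using assms(1) by blast
qed

context dynamic
begin

text \<open>Empty outside \<open>V\<close>, so that the effect of a cycle can be written as an
  equation between functions.\<close>

definition av :: "state \<Rightarrow> uid \<Rightarrow> token set" where "av z v = (if v \<in> V then actv z v else {})"
definition holders :: "state \<Rightarrow> token \<Rightarrow> uid set" where "holders z x = {v\<in>V. x \<in> actv z v}"
definition active :: "state \<Rightarrow> token set" where "active z = (\<Union>v\<in>V. actv z v)"
text \<open>Flooding does not change the maximum of the registers. Hence the generation is
  determined from the first nominating round on, long before the nodes agree on it;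
  \<open>selection\<close> can thus treat that round as the only random choice of the
  generation.\<close>

definition GM :: "state \<Rightarrow> nat list" where "GM z = gmax (\<lambda>v. reg (st z v))"
definition GT :: "state \<Rightarrow> token set" where "GT z = \<Union>(set ` set (GB (acts z) (GM z)))"

lemma active_av: "active z = (\<Union>v\<in>V. av z v)" and holders_av: "holders z x = {v\<in>V. x \<in> av z v}"
  by (auto simp: active_def holders_def av_def)

lemma holders_ne: "holders z x \<noteq> {} \<longleftrightarrow> x \<in> active z"
  by (auto simp: holders_def active_def)

lemma fin_holders: "finite (holders z x)"
  using fin_V by (simp add: holders_def)

lemma holders_le: "card (holders z x) \<le> n"
  using fin_V card_V by (metis (no_types, lifting) card_mono holders_def mem_Collect_eq subsetI)

lemma finished_av: "finished z \<Longrightarrow> av z = (\<lambda>_. {})"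
  by (auto simp: finished_def av_def actv_def fun_eq_iff)

lemma av_cong: "(\<And>v. v \<in> V \<Longrightarrow> actv z' v = actv z v) \<Longrightarrow> av z' = av z"
  by (auto simp: av_def fun_eq_iff)

lemma position_at:
  assumes "p < 4" "i < T"
  shows "gph (N + c * (4 * T) + p * T + i) = p" "goff (N + c * (4 * T) + p * T + i) = i"
    "gcyc (N + c * (4 * T) + p * T + i) = c"
proof -
  have g: "gtau (N + c * (4 * T) + p * T + i) = i + (c * 4 + p) * T" by (simp add: gtau_def algebra_simps)
  have d: "(i + (c * 4 + p) * T) div T = c * 4 + p" using assms(2) by simp
  show "goff (N + c * (4 * T) + p * T + i) = i" using assms(2) unfolding goff_def g by simp
  show "gph (N + c * (4 * T) + p * T + i) = p" using assms(1) unfolding gph_def g d by simp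
  have "(i + (c * 4 + p) * T) div (T * 4) = (c * 4 + p) div 4" unfolding div_mult2_eq d ..
  then show "gcyc (N + c * (4 * T) + p * T + i) = c" using assms(1) unfolding gcyc_def g
      by (simp add: mult.commute)
qed

lemma late_cases:
  assumes "reach z" "N \<le> time z"
  obtains "finished z" | "active_run z" "base z"
proof -
  have "active_run z \<or> finished z" using reach_safe[OF assms(1)] assms(2) by (simp add: safe_def)
  moreover have "active_run z \<Longrightarrow> base z" by (simp add: active_run_def)
  ultimately show thesis using that by blast
qed

lemma late_step:
  assumes "reach z" "N \<le> time z" "z' \<in> set_pmf (kern z)"
  shows "finished z \<and> finished z' \<and> av z' = av z \<or>
    active_run z \<and> base z \<and> (\<exists>y\<in>set_pmf (moves z). z' = nxt z y)"
  using assms(1,2)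
proof (cases rule: late_cases)
  case 1
  then have "finished z'" using finished_kern[OF 1 assms(3)] st_cong by blast
  then show ?thesis using 1 finished_av by simp
next
  case 2
  then show ?thesis using running_kern[OF base_running assms(3)] by blast
qed

lemma quiet_step:
  assumes "reach z" "N \<le> time z" "z' \<in> set_pmf (kern z)"
    "gph (time z) \<in> {1, 2} \<or> gph (time z) = 3 \<and> Suc (goff (time z)) < T \<or>
     gph (time z) = 0 \<and> \<not> gathering N (gcyc (time z))"
  shows "av z' = av z"
proof -
  consider "finished z \<and> finished z' \<and> av z' = av z" | y where "active_run z" "base z" "y \<in> set_pmf (moves z)" "z' = nxt z y"
    using late_step[OF assms(1-3)] by blast
  then show ?thesis
  proof cases
    case (2 y)
    consider "gph (time z) = 1" | "gph (time z) = 2" | "gph (time z) = 3" "Suc (goff (time z)) < T" |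
      "gph (time z) = 0" "\<not> gathering N (gcyc (time z))" using assms(4) by auto
    then show ?thesis
    proof cases
      case 1
      then show ?thesis
        using nominate_step(2)[OF 2(2) assms(2) 1 _ 2(3)] 2
            by (intro av_cong) (simp add: actv_def active_run_def)
    next
      case b: 2
      then obtain M where "generation z M" using 2(1) by (auto simp: active_run_def)
      then show ?thesis using code_step(3)[OF 2(2) assms(2) b _ 2(3)] 2
          by (intro av_cong) (simp add: actv_def)
    next
      case 3
      then obtain M where "generation z M" "verifying z" using 2(1) by (auto simp: active_run_def)
      then show ?thesis using verify_step(2)[OF 2(2) assms(2) 3(1) _ _ 2(3) 3(2)] 2
          by (intro av_cong) (simp add: actv_def)
    next
      case 4
      then show ?thesis
        using gather_step(2)[OF 2(2) assms(2) 4(1) 2(3)] gather_hear(2)[OF 2(2) assms(2) 4(1) 2(3)] 2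
        by (intro av_cong) simp
    qed
  qed simp
qed

lemma removal_step:
  assumes "reach z" "N \<le> time z" "z' \<in> set_pmf (kern z)" "gph (time z) = 3"
  shows "\<exists>D. av z' = (\<lambda>v. av z v - D)"
proof (cases "Suc (goff (time z)) < T")
  case True
  then have "av z' = av z" using quiet_step[OF assms(1-3)] assms(4) by simp
  then show ?thesis by (intro exI[of _ "{}"]) simp
next
  case False
  then have e: "Suc (goff (time z)) = T" using goff_less[of "time z"] by simp
  consider "finished z \<and> finished z' \<and> av z' = av z" | y where "active_run z" "base z" "y \<in> set_pmf (moves z)" "z' = nxt z y"
    using late_step[OF assms(1-3)] by blast
  then show ?thesis
  proof cases
    case 1
    then show ?thesis by (intro exI[of _ "{}"]) simp
  next
    case (2 y)
    then obtain M where g: "generation z M" and v: "verifying z" using assms(4)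
        by (auto simp: active_run_def)
    from verify_step(4)[OF 2(2) assms(2,4) g v 2(3) e]
    obtain D where "\<forall>v\<in>V. actv z' v = actv z v - D" unfolding 2(4) by (elim exE conjE)
    then show ?thesis by (intro exI[of _ D]) (auto simp: av_def fun_eq_iff)
  qed
qed

lemma growth_step:
  assumes "reach z" "N \<le> time z" "z' \<in> set_pmf (kern z)" "gph (time z) = 0"
  shows "av z v \<subseteq> av z' v" "active z' = active z"
proof -
  have "(\<forall>v. av z v \<subseteq> av z' v) \<and> active z' = active z"
  proof -
    consider "finished z \<and> finished z' \<and> av z' = av z" | y where "active_run z" "base z" "y \<in> set_pmf (moves z)" "z' = nxt z y"
      using late_step[OF assms(1-3)] by blast
    then show ?thesis
    proof cases
      case (2 y)
      have e: "actv z' v = actv z v \<union> hear (inb z y v)" if "v \<in> V" for v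
        using gather_step(2)[OF 2(2) assms(2,4) 2(3) that] 2 by simp
      have h: "hear (inb z y v) \<subseteq> active z" for v
        using gather_hear(1)[OF 2(2) assms(2,4) 2(3)] by (simp add: active_def)
      then have "active z \<union> (\<Union>v\<in>V. hear (inb z y v)) = active z" by blast
      moreover have "active z' = active z \<union> (\<Union>v\<in>V. hear (inb z y v))"
        unfolding active_def using e by (simp add: UN_Un_distrib)
      ultimately have "active z' = active z" by simp
      then show ?thesis using e by (simp add: av_def)
    qed (simp add: active_av)
  qed
  then show "av z v \<subseteq> av z' v" "active z' = active z" by blast+
qed

lemma active_decreasing:
  assumes "reach z" "N \<le> time z" "z' \<in> set_pmf (kern z)"
  shows "active z' \<subseteq> active z"
proof -
  consider "gph (time z) = 0" | "gph (time z) \<in> {1, 2}" | "gph (time z) = 3" using gph_less[of "time z"]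
      by force
  then show ?thesis
  proof cases
    case 1
    then show ?thesis using growth_step(2)[OF assms] by simp
  next
    case 2
    then have "av z' = av z" using quiet_step[OF assms] by blast
    then show ?thesis by (simp add: active_av)
  next
    case 3
    then obtain D where "av z' = (\<lambda>v. av z v - D)" using removal_step[OF assms] by blast
    then show ?thesis by (auto simp: active_av)
  qed
qed

lemma active_toks: "reach z \<Longrightarrow> N \<le> time z \<Longrightarrow> active z \<subseteq> toks"
  by (erule (1) late_cases) (use actv_toks[of z] in \<open>auto simp: active_def finished_def actv_def\<close>)

lemma fin_active': "finite (active z)"
  using fin_active by (simp add: active_def)

text \<open>No token becomes active again, so the nomination of this cycle finds a zero in entry 0
  and all nodes halt after two phases.\<close>

lemma finish:
  assumes z: "reach z" "time z = N + c * (4 * T)" "active z = {}"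
    and z': "z' \<in> set_pmf (run kern (4 * T) z)"
  shows "finished z'"
proof -
  have "reach z' \<and> time z' = time z + 4 * T \<and> active z' = {} \<and> (2 * T \<le> 4 * T \<longrightarrow> finished z')"
    using z'
  proof (rule run_invariant[where P = "\<lambda>j x. reach x \<and> time x = time z + j \<and> active x = {} \<and> (2 * T \<le> j \<longrightarrow> finished x)"])
    show "reach z \<and> time z = time z + 0 \<and> active z = {} \<and> (2 * T \<le> 0 \<longrightarrow> finished z)"
      using z T_pos by simp
  next
    fix j x x'
    assume j: "j < 4 * T" and P: "reach x \<and> time x = time z + j \<and> active x = {} \<and> (2 * T \<le> j \<longrightarrow> finished x)"
      and x': "x' \<in> set_pmf (kern x)"
    have N: "N \<le> time x" using P z(2) by simp
    have a: "active x' = {}" using active_decreasing[OF _ N x'] P by blast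
    have "finished x'" if "2 * T \<le> Suc j"
    proof (cases "finished x")
      case True
      then show ?thesis using late_step[OF _ N x'] P finished_kern[OF True x'] st_cong by blast
    next
      case False
      then have e: "Suc j = 2 * T" using P that by simp
      have tx: "time x = N + c * (4 * T) + 1 * T + (T - 1)" using P z(2) e T_pos by simp
      have pos: "gph (time x) = 1" "goff (time x) = T - 1" unfolding tx using T_pos
          by (intro position_at; simp)+
      obtain y where y: "active_run x" "base x" "y \<in> set_pmf (moves x)" "x' = nxt x y"
        using late_step[OF _ N x'] P False by blast
      have "\<forall>v\<in>V. acts x v = []" using P by (auto simp: active_def actv_def)
      then show ?thesis
        using nominate_step(5)[OF y(2) N pos(1) _ y(3)] y pos T_pos by (simp add: active_run_def)
    qed
    then show "reach x' \<and> time x' = time z + Suc j \<and> active x' = {} \<and> (2 * T \<le> Suc j \<longrightarrow> finished x')"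
      using reach_kern[OF _ x'] time_kern[OF x'] P a by simp
  qed
  then show ?thesis by simp
qed

lemma GM_generation: "generation z M \<Longrightarrow> GM z = M"
proof -
  assume g: "generation z M"
  have "{v\<in>V. reg (st z v) ! j = M ! j} = V" for j using g by (auto simp: generation_def)
  then have "spreads (\<lambda>v. reg (st z v)) M (n - 1)"
    using g card_V unfolding spreads_def generation_def by simp
  then show ?thesis using spreads_unique by (simp add: GM_def)
qed

lemma GB_cong:
  assumes "regs_ok ac M" "\<And>v. v \<in> V \<Longrightarrow> ac' v = ac v"
  shows "GB ac' M = GB ac M"
proof -
  have "fst x \<in> V" if "x \<in> set (gens N M)" for x
    using gens_ok[of ac M "fst x" "snd x"] assms(1) that by simp
  then show ?thesis
    unfolding GB_def by (intro map_cong refl) (use assms(2) in \<open>auto simp: case_prod_beta'\<close>)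
qed

section \<open>Random linear network coding within a cycle\<close>

definition cut :: "(uid \<Rightarrow> token set) \<Rightarrow> token set \<Rightarrow> uid \<Rightarrow> token set" where "cut f D v = f v - D"

text \<open>By duality, a node can decode everything as soon as it knows all nonzero vectors \<open>u\<close>, that is, it
  has received a header that is not orthogonal to \<open>u\<close>.\<close>

definition knows :: "nat \<Rightarrow> bit list \<Rightarrow> state \<Rightarrow> uid set" where
  "knows h u z = {v\<in>V. \<exists>(c, p)\<in>set (pks (st z v)). dot h c u = 1}"

text \<open>A union bound over all nonzero vectors, written as a potential. It is at least 1 as long
  as some node cannot decode, so its expectation bounds the probability of failure. The zero vector
  is left out since no header is ever seen by it.\<close>

definition unknown :: "state \<Rightarrow> ennreal" where
  "unknown z = (let h = length (gens N (GM z)) in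
     \<Sum>u\<in>{u. length u = h \<and> (\<exists>i<h. u ! i = 1)}. gap n (card (knows h u z)))"

lemma fin_vectors: "finite {u :: bit list. length u = h \<and> (\<exists>i<h. u ! i = 1)}"
  using card_bit_lists(1)[of h] by (rule finite_subset[rotated]) auto

lemma unknown_le: "unknown z \<le> 2 ^ (3 * N)"
proof -
  define h where "h = length (gens N (GM z))"
  let ?U = "{u :: bit list. length u = h \<and> (\<exists>i<h. u ! i = 1)}"
  have "h \<le> 2 * N" using size_gens[of "GM z"] lead_le by (simp add: h_def)
  have "card ?U \<le> card {u :: bit list. length u = h}" using card_bit_lists(1) by (intro card_mono) auto
  then have c: "card ?U \<le> 2 ^ h" by (simp add: card_bit_lists)
  have "unknown z = (\<Sum>u\<in>?U. gap n (card (knows h u z)))" by (simp add: unknown_def h_def Let_def)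
  also have "\<dots> \<le> (\<Sum>u\<in>?U. 2 ^ n)" by (intro sum_mono gap_le)
  also have "\<dots> = of_nat (card ?U * 2 ^ n)" by simp
  also have "\<dots> \<le> of_nat (2 ^ (3 * N))"
  proof (rule of_nat_mono)
    have "card ?U * 2 ^ n \<le> 2 ^ h * 2 ^ n" using c by (rule mult_right_mono) simp
    also have "\<dots> = 2 ^ (h + n)" by (simp add: power_add)
    also have "\<dots> \<le> 2 ^ (3 * N)" using \<open>h \<le> 2 * N\<close> n_le_N by (intro power_increasing) auto
    finally show "card ?U * 2 ^ n \<le> 2 ^ (3 * N)" .
  qed
  finally show ?thesis by simp
qed

lemma unknown_full:
  assumes "base z" "generation z M" "v \<in> V" "\<not> full (st z v)"
  shows "1 \<le> unknown z"
proof -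
  define h where "h = length (gens N M)"
  let ?P = "pks (st z v)"
  have h: "gen_size (st z v) = h" using generation_gen_size[OF assms(1-3)] by (simp add: GB_def h_def)
  obtain i where i: "i < h" "\<And>p. (unit_vec h i, p) \<notin> span h (msize * d) ?P"
    using assms(4) unfolding full_def h by blast
  have len: "\<And>c. c \<in> set (map fst ?P) \<Longrightarrow> length c = h"
    using assms(2,3) by (fastforce simp: generation_def is_combination_def GB_def h_def)
  have "\<not> (\<exists>w. length w = length (map fst ?P) \<and> lincomb h w (map fst ?P) = unit_vec h i)"
    using i(2) by (auto simp: span_def)
  then obtain u where u: "length u = h" "\<forall>c\<in>set (map fst ?P). dot h c u = 0" "dot h (unit_vec h i) u = 1"
    using separation[of "map fst ?P" h "unit_vec h i"] len by auto
  have "u ! i = 1" using u(3) i(1) by (simp add: dot_unit_vec)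
  then have uU: "u \<in> {u. length u = h \<and> (\<exists>i<h. u ! i = 1)}" using u(1) i(1) by auto
  have "v \<notin> knows h u z" using u(2) by (auto simp: knows_def)
  then have "knows h u z \<subset> V" using assms(3) by (auto simp: knows_def)
  then have "card (knows h u z) < n" using fin_V card_V psubset_card_mono by metis
  then have "1 \<le> gap n (card (knows h u z))" by (rule gap_ge_1)
  also have "\<dots> \<le> unknown z"
    unfolding unknown_def GM_generation[OF assms(2)] h_def[symmetric] Let_def
    by (rule sum_nonneg_leq_bound[OF fin_vectors _ refl uU]) simp
  finally show ?thesis .
qed

text \<open>A node that knows \<open>u\<close> sends a header seen by \<open>u\<close> with
  probability 1/2, by \<open>prob_lincomb\<close>; so \<open>spread_step\<close> yields 3/4 for each
  \<open>u\<close> separately. The set of such nodes is never empty: if \<open>u ! i = 1\<close>,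
  the owner of block \<open>i\<close> holds the \<open>i\<close>-th unit header.\<close>

lemma code_drift:
  assumes "reach z" "base z" "N \<le> time z" "gph (time z) = 2" "generation z M"
  shows "(\<integral>\<^sup>+z'. unknown z' \<partial>kern z) \<le> ennreal (3 / 4) * unknown z"
proof -
  define h where "h = length (gens N M)"
  let ?U = "{u :: bit list. length u = h \<and> (\<exists>i<h. u ! i = 1)}"
  have gz: "GM z = M" using GM_generation assms(5) .
  have gn: "GM (nxt z y) = M" if "y \<in> set_pmf (moves z)" for y
    using GM_generation code_step(2)[OF assms(2-5) that] by blast
  have "(\<integral>\<^sup>+z'. unknown z' \<partial>kern z) = (\<integral>\<^sup>+y. unknown (nxt z y) \<partial>moves z)"
    by (simp add: kern_running[OF base_running[OF assms(2)]])
  also have "\<dots> \<le> (\<integral>\<^sup>+y. (\<Sum>u\<in>?U. gap n (card (knows h u (nxt z y)))) \<partial>moves z)"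
    by (intro nn_integral_mono_pmf) (simp add: unknown_def gn h_def Let_def)
  also have "\<dots> = (\<Sum>u\<in>?U. \<integral>\<^sup>+y. gap n (card (knows h u (nxt z y))) \<partial>moves z)"
    by (rule nn_integral_sum) simp
  also have "\<dots> \<le> (\<Sum>u\<in>?U. ennreal (3 / 4) * gap n (card (knows h u z)))"
  proof (rule sum_mono)
    fix u assume u: "u \<in> ?U"
    then obtain i where i: "i < h" "u ! i = 1" by blast
    have gs: "gen_size (st z v) = h" if "v \<in> V" for v
      using generation_gen_size[OF assms(2,5) that] by (simp add: GB_def h_def)
    have "(\<integral>\<^sup>+y. gap n (card (knows h u (nxt z y))) \<partial>moves z) \<le> ennreal (1 - (1 / 2) / 2) * gap n (card (knows h u z))"
      unfolding moves_def
    proof (rule spread_step[OF fin_V net[of z], where good = "\<lambda>v. {y. \<exists>c p g. coded (fst y) = [Packet g c p] \<and> dot h c u = 1}"])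
      show "knows h u z \<subseteq> V" by (auto simp: knows_def)
      obtain v x where vx: "gens N M ! i = (v, x)" by (cases "gens N M ! i")
      then have "(v, x) \<in> set (gens N M)" using i(1) h_def nth_mem by metis
      then have v: "v \<in> V" using gens_ok assms(5) by (auto simp: generation_def)
      then have "(unit_vec h i, concat (block msize (act (st z v)) x)) \<in> own_packets (st z v)"
        using gs[OF v] i vx baseD[OF assms(2) v] assms(5) by (auto simp: own_packets_def generation_def)
      then have "(unit_vec h i, concat (block msize (act (st z v)) x)) \<in> set (pks (st z v))"
        using assms(5) v by (auto simp: generation_def)
      then have "v \<in> knows h u z" using v i by (force simp: knows_def dot_unit_vec)
      then show "knows h u z \<noteq> {}" by blast
      show "n \<le> card V" using card_V by simp
    next
      fix v assume v: "v \<in> knows h u z"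
      then have vV: "v \<in> V" by (simp add: knows_def)
      obtain c p where cp: "(c, p) \<in> set (pks (st z v))" "dot h c u = 1" using v by (auto simp: knows_def)
      let ?cs = "map fst (pks (st z v))"
      have s: "node_send (st z v) = map_pmf (\<lambda>w. (combination (st z v) w, st z v)) (pmf_of_set {w. length w = length ?cs})"
        using base_position[OF assms(2,3) vV] baseD(3)[OF assms(2) vV] assms(4)
            by (simp add: node_send_def)
      have "c \<in> set ?cs" using cp(1) by force
      then have "1 / 2 = measure_pmf.prob (pmf_of_set {w. length w = length ?cs}) {w. dot h (lincomb h w ?cs) u = 1}"
        using prob_lincomb cp(2) by metis
      then show "1 / 2 \<le> measure_pmf.prob (node_send (st z v)) {y. \<exists>c p g. coded (fst y) = [Packet g c p] \<and> dot h c u = 1}"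
        unfolding s by (simp add: vimage_def combination_def gs[OF vV])
    next
      fix y assume y: "y \<in> set_pmf (Pi_pmf V undefined (\<lambda>v. node_send (st z v)))"
      then have y': "y \<in> set_pmf (moves z)" by (simp add: moves_def)
      note cs = code_step[OF assms(2-5) y']
      show "knows h u z \<subseteq> knows h u (nxt z y) \<and> finite (knows h u (nxt z y))"
        using cs(4) fin_V by (fastforce simp: knows_def)
      fix v w assume vw: "v \<in> knows h u z" "w \<in> V" "(v, w) \<in> net z"
        "y v \<in> {y. \<exists>c p g. coded (fst y) = [Packet g c p] \<and> dot h c u = 1}"
      then obtain c p g where c: "coded (fst (y v)) = [Packet g c p]" "dot h c u = 1" by blast
      then have "(c, p) \<in> packets (inb z y w)" using inb_I[OF vw(3), of y] by (force simp: packets_def)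
      then show "w \<in> knows h u (nxt z y)" using cs(4)[OF vw(2)] vw(2) c(2) by (auto simp: knows_def)
    qed auto
    then show "(\<integral>\<^sup>+y. gap n (card (knows h u (nxt z y))) \<partial>moves z) \<le> ennreal (3 / 4) * gap n (card (knows h u z))"
      by simp
  qed
  also have "\<dots> = ennreal (3 / 4) * unknown z"
    by (simp add: unknown_def gz h_def Let_def sum_distrib_left)
  finally show ?thesis .
qed

lemma finished_run: "reach z \<Longrightarrow> N \<le> time z \<Longrightarrow> finished z \<Longrightarrow> z' \<in> set_pmf (run kern j z) \<Longrightarrow> finished z'"
proof -
  assume "finished z" and z': "z' \<in> set_pmf (run kern j z)"
  then show ?thesis
    by (intro run_invariant[OF z', where P = "\<lambda>_. finished"]) (auto dest: finished_kern intro: st_cong)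
qed

definition eps :: ennreal where "eps = ennreal (3 / 4) ^ T * 2 ^ (3 * N)"

lemma gmax_cong: "(\<And>v. v \<in> V \<Longrightarrow> r' v = r v) \<Longrightarrow> gmax r' = gmax r"
  using some_V by (simp add: gmax_def cong: image_cong_simp)

text \<open>If all nodes can decode, the generation is removed; if not, \<open>unknown z\<close> is
  at least 1 and pays for keeping everything. Only monotonicity of \<open>F\<close> is used, so that
  \<open>Zpot\<close> and \<open>Hpot\<close> can share the analysis.\<close>

lemma verify_phase:
  assumes F: "\<And>f g. (\<And>v. f v \<subseteq> g v) \<Longrightarrow> F f \<le> (F g :: ennreal)"
    and z: "reach z" "time z = N + c * (4 * T) + 3 * T" "active_run z" and z': "z' \<in> set_pmf (run kern T z)"
  shows "F (av z') \<le> F (cut (av z) (GT z)) + F (av z) * unknown z"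
proof -
  have pos0: "gph (time z) = 3" "goff (time z) = 0" using position_at[of 3 0 c] T_pos z(2) by auto
  obtain M where M: "generation z M" using z(3) pos0 by (auto simp: active_run_def)
  let ?b = "F (cut (av z) (GT z)) + F (av z) * unknown z"
  let ?P = "\<lambda>j x. reach x \<and> time x = time z + j \<and> (if j < T then active_run x \<and> generation x M \<and>
     (\<forall>v\<in>V. acts x v = acts z v \<and> pks (st x v) = pks (st z v)) else F (av x) \<le> ?b)"
  have "?P T z'"
  proof (rule run_invariant[OF z', where P = ?P])
    show "?P 0 z" using z M T_pos by simp
  next
    fix j x x'
    assume j: "j < T" and P: "?P j x" and x': "x' \<in> set_pmf (kern x)"
    have tx: "time x = N + c * (4 * T) + 3 * T + j" using P z(2) by simp
    have pos: "gph (time x) = 3" "goff (time x) = j" using position_at[of 3 j c] j tx by auto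
    have Nx: "N \<le> time x" using tx by simp
    have a: "active_run x" and g: "generation x M" and eq: "\<forall>v\<in>V. acts x v = acts z v \<and> pks (st x v) = pks (st z v)"
      using P j by auto
    have b: "base x" and ver: "verifying x" using a pos by (auto simp: active_run_def)
    obtain y where y: "y \<in> set_pmf (moves x)" "x' = nxt x y" using running_kern[OF base_running[OF b] x']
        by blast
    note vs = verify_step[OF b Nx pos(1) g ver y(1)]
    have rt: "reach x'" "time x' = time z + Suc j" using reach_kern[OF _ x'] time_kern[OF x'] P by auto
    show "?P (Suc j) x'"
    proof (cases "Suc j < T")
      case True
      then show ?thesis using rt vs(1-3) eq pos y(2) by simp
    next
      case False
      then have e: "Suc (goff (time x)) = T" using j pos by simp
      obtain D where D: "\<forall>v\<in>V. actv x' v = actv x v - D" "(\<forall>v\<in>V. full (st x v)) \<longrightarrow> \<Union>(set ` set (GB (acts x) M)) \<subseteq> D"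
        using vs(4)[OF e] y(2) by blast
      have avx: "av x = av z" using eq by (intro av_cong) (simp add: actv_def)
      have avx': "av x' v = av z v - D" for v
        using D(1) fun_cong[OF avx, of v] unfolding av_def by (cases "v \<in> V") auto
      have "F (av x') \<le> ?b"
      proof (cases "\<forall>v\<in>V. full (st x v)")
        case True
        have "GB (acts x) M = GB (acts z) M"
          using M eq by (intro GB_cong) (auto simp: generation_def)
        then have "GT z \<subseteq> D" using True D(2) by (simp add: GT_def GM_generation[OF M])
        then have "F (av x') \<le> F (cut (av z) (GT z))" by (intro F) (auto simp: avx' cut_def)
        then show ?thesis by (meson add_increasing2 zero_le)
      next
        case False
        then obtain v where v: "v \<in> V" "\<not> full (st x v)" by blast
        have "knows h u x = knows h u z" for h u using eq by (auto simp: knows_def)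
        then have "unknown x = unknown z" using g M by (simp add: unknown_def GM_generation)
        then have "1 \<le> unknown z" using unknown_full[OF b g v] by simp
        then have "F (av z) * 1 \<le> F (av z) * unknown z" by (intro mult_left_mono) auto
        moreover have "F (av x') \<le> F (av z)" by (intro F) (auto simp: avx')
        ultimately have "F (av x') \<le> F (av z) * unknown z" by simp
        then show ?thesis by (meson add_increasing zero_le)
      qed
      then show ?thesis using rt False by simp
    qed
  qed
  then show ?thesis by simp
qed

lemma code_phase:
  assumes z: "reach z" "time z = N + c * (4 * T) + 2 * T" "active_run z"
  shows "(\<integral>\<^sup>+z'. unknown z' \<partial>run kern T z) \<le> ennreal (3 / 4) ^ T * unknown z"
    "z' \<in> set_pmf (run kern T z) \<Longrightarrow> active_run z' \<and> av z' = av z \<and> GT z' = GT z"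
proof -
  have pos0: "gph (time z) = 2" using position_at[of 2 0 c] T_pos z(2) by auto
  obtain M where M: "generation z M" using z(3) pos0 by (auto simp: active_run_def)
  let ?P = "\<lambda>j x. reach x \<and> time x = time z + j \<and> active_run x \<and> generation x M \<and> (\<forall>v\<in>V. acts x v = acts z v)"
  have P: "?P j x" if x: "x \<in> set_pmf (run kern j z)" "j \<le> T" for j x
  proof (rule run_invariant[OF x(1), where P = ?P])
    fix i x x'
    assume i: "i < j" and P: "?P i x" and x': "x' \<in> set_pmf (kern x)"
    have tx: "time x = N + c * (4 * T) + 2 * T + i" using P z(2) by simp
    have pos: "gph (time x) = 2" using position_at[of 2 i c] i x(2) tx by auto
    have b: "base x" using P by (simp add: active_run_def)
    obtain y where y: "y \<in> set_pmf (moves x)" "x' = nxt x y" using running_kern[OF base_running[OF b] x']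
        by blast
    have Nx: "N \<le> time x" using tx by simp
    have g: "generation x M" using P by blast
    note cs = code_step[OF b Nx pos g y(1)]
    show "?P (Suc i) x'" using cs(1-3) P y(2) reach_kern[OF _ x'] time_kern[OF x'] by simp
  qed (use z M in simp)
  show "(\<integral>\<^sup>+z'. unknown z' \<partial>run kern T z) \<le> ennreal (3 / 4) ^ T * unknown z"
  proof (rule drift)
    fix j x assume j: "j < T" and x: "x \<in> set_pmf (run kern j z)"
    note Px = P[OF x less_imp_le[OF j]]
    have tx: "time x = N + c * (4 * T) + 2 * T + j" using Px z(2) by simp
    have pos: "gph (time x) = 2" using position_at[of 2 j c] j tx by auto
    show "(\<integral>\<^sup>+z''. unknown z'' \<partial>kern x) \<le> ennreal (3 / 4) * unknown x"
      using Px pos tx by (intro code_drift[where M = M]) (auto simp: active_run_def)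
  qed
  assume "z' \<in> set_pmf (run kern T z)"
  note Pz = P[OF this order_refl]
  have "GB (acts z') M = GB (acts z) M" using Pz M by (intro GB_cong) (auto simp: generation_def)
  then show "active_run z' \<and> av z' = av z \<and> GT z' = GT z"
    using Pz M by (auto simp: GT_def GM_generation actv_def intro!: av_cong)
qed

lemma nominate_phase:
  assumes z: "reach z" "time z = N + c * (4 * T) + T + 1" "active_run z"
    and z': "z' \<in> set_pmf (run kern (T - 1) z)"
  shows "finished z' \<or> active_run z' \<and> av z' = av z \<and> GT z' = GT z"
proof -
  let ?P = "\<lambda>j x. reach x \<and> time x = time z + j \<and> (finished x \<or> active_run x \<and> av x = av z \<and> GT x = GT z)"
  have "?P (T - 1) z'"
  proof (rule run_invariant[OF z', where P = ?P])
    fix j x x'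
    assume j: "j < T - 1" and P: "?P j x" and x': "x' \<in> set_pmf (kern x)"
    have tx: "time x = N + c * (4 * T) + 1 * T + (Suc j)" using P z(2) by simp
    have pos: "gph (time x) = 1" "goff (time x) = Suc j" unfolding tx using j
        by (intro position_at; simp)+
    have Nx: "N \<le> time x" using tx by simp
    have rt: "reach x'" "time x' = time z + Suc j" using reach_kern[OF _ x'] time_kern[OF x'] P by auto
    show "?P (Suc j) x'"
    proof (cases "finished x")
      case True
      then show ?thesis using late_step[OF _ Nx x'] P finished_kern[OF True x'] st_cong rt by blast
    next
      case False
      then have a: "active_run x" "av x = av z" "GT x = GT z" using P by auto
      then have b: "base x" and nm: "goff (time x) \<noteq> 0 \<longrightarrow> nominating x" using pos
          by (auto simp: active_run_def)
      obtain y where y: "y \<in> set_pmf (moves x)" "x' = nxt x y"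
          using running_kern[OF base_running[OF b] x'] by blast
      note ns = nominate_step[OF b Nx pos(1) nm y(1)]
      have "reg (snd (y v)) = reg (st x v)" if "v \<in> V" for v
        using st_nominate(3)[OF b Nx pos(1) y(1) that] pos by fastforce
      then have r: "gmax (\<lambda>v. reg (snd (y v))) = GM x" unfolding GM_def by (rule gmax_cong)
      then have gm: "GM x' = GM x" using ns(3) y(2) by (simp add: GM_def)
      have "regs_ok (acts x) (GM x)" using nominate_spreads(3)[OF b Nx pos(1) nm y(1)] r by simp
      then have "GB (acts x') (GM x) = GB (acts x) (GM x)" using ns(2) y(2) by (intro GB_cong) auto
      then have "GT x' = GT x" by (simp add: GT_def gm)
      moreover have "av x' = av x" using ns(2) y(2) by (intro av_cong) (simp add: actv_def)
      ultimately show ?thesis using ns(1) a rt y(2) by auto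
    qed
  qed (use z in simp)
  then show ?thesis by blast
qed

text \<open>The generation nominated in the first round of the second phase of a cycle is removed from the
  active sets at the end of the cycle, unless coding fails.\<close>

lemma selection:
  assumes F: "\<And>f g. (\<And>v. f v \<subseteq> g v) \<Longrightarrow> F f \<le> (F g :: ennreal)"
    and z: "reach z" "time z = N + c * (4 * T) + T"
  shows "(\<integral>\<^sup>+z'. F (av z') \<partial>run kern (3 * T) z) \<le> (\<integral>\<^sup>+z1. F (cut (av z) (GT z1)) \<partial>kern z) + F (av z) * eps"
proof -
  have e: "3 * T = Suc 0 + ((T - 1) + (T + T))" using T_pos by simp
  have split: "run kern (3 * T) z = bind_pmf (kern z) (\<lambda>z1. bind_pmf (run kern (T - 1) z1)
      (\<lambda>z2. bind_pmf (run kern T z2) (run kern T)))"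
    unfolding e by (simp only: run_add[abs_def] run.simps bind_return_pmf)
  have N0: "N \<le> time z" using z(2) by simp
  have "(\<integral>\<^sup>+z2. (\<integral>\<^sup>+z3. (\<integral>\<^sup>+z4. F (av z4) \<partial>run kern T z3) \<partial>run kern T z2) \<partial>run kern (T - 1) z1) \<le> F (cut (av z) (GT z1)) + F (av z) * eps"
    if z1: "z1 \<in> set_pmf (kern z)" for z1
  proof -
    have r1: "reach z1" "time z1 = N + c * (4 * T) + T + 1"
        using reach_kern[OF z(1) z1] time_kern[OF z1] z(2) by auto
    have pos: "gph (time z) = 1" using position_at[of 1 0 c] T_pos z(2) by auto
    have av1: "av z1 = av z" using quiet_step[OF z(1) N0 z1] pos by simp
    let ?b = "F (cut (av z) (GT z1)) + F (av z) * eps"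
    have fin: "(\<integral>\<^sup>+z3. (\<integral>\<^sup>+z4. F (av z4) \<partial>run kern T z3) \<partial>run kern T z2) \<le> ?b"
        if f: "finished z2" and r2: "reach z2" "N \<le> time z2" for z2
    proof -
      have "F (av z4) \<le> ?b" if z3: "z3 \<in> set_pmf (run kern T z2)" and z4: "z4 \<in> set_pmf (run kern T z3)"
          for z3 z4
      proof -
        have "finished z3" using finished_run[OF r2 f z3] .
        moreover have "reach z3" "N \<le> time z3" using reach_run[OF r2(1) z3] time_run[OF z3] r2(2) by auto
        ultimately have "finished z4" using finished_run z4 by blast
        then have "F (av z4) \<le> F (cut (av z) (GT z1))" by (intro F) (simp add: finished_av)
        then show ?thesis by (meson add_increasing2 zero_le)
      qed
      then have "(\<integral>\<^sup>+z3. (\<integral>\<^sup>+z4. F (av z4) \<partial>run kern T z3) \<partial>run kern T z2) \<le> (\<integral>\<^sup>+z3. (\<integral>\<^sup>+z4. ?b \<partial>run kern T z3) \<partial>run kern T z2)"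
        by (intro nn_integral_mono_pmf) auto
      then show ?thesis by simp
    qed
    have "(\<integral>\<^sup>+z3. (\<integral>\<^sup>+z4. F (av z4) \<partial>run kern T z3) \<partial>run kern T z2) \<le> ?b"
      if z2: "z2 \<in> set_pmf (run kern (T - 1) z1)" for z2
    proof -
      have r2: "reach z2" "time z2 = N + c * (4 * T) + 2 * T"
        using reach_run[OF r1(1) z2] time_run[OF z2] r1(2) T_pos by auto
      have "finished z2 \<or> active_run z2 \<and> av z2 = av z1 \<and> GT z2 = GT z1"
      proof (cases "finished z1")
        case True
        then show ?thesis using finished_run[OF r1(1) _ True z2] r1(2) by simp
      next
        case False
        then have "active_run z1" using late_cases[OF r1(1)] r1(2) by auto
        then show ?thesis using nominate_phase[OF r1 _ z2] by blast
      qed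
      then show ?thesis
      proof
        assume "finished z2"
        then show ?thesis using fin r2 by simp
      next
        assume a: "active_run z2 \<and> av z2 = av z1 \<and> GT z2 = GT z1"
        have "(\<integral>\<^sup>+z3. (\<integral>\<^sup>+z4. F (av z4) \<partial>run kern T z3) \<partial>run kern T z2)
            \<le> (\<integral>\<^sup>+z3. F (cut (av z) (GT z1)) + F (av z) * unknown z3 \<partial>run kern T z2)"
        proof (rule nn_integral_mono_pmf)
          fix z3 assume z3: "z3 \<in> set_pmf (run kern T z2)"
          have c3: "active_run z3 \<and> av z3 = av z \<and> GT z3 = GT z1" using code_phase(2)[OF r2 _ z3] a av1
              by simp
          have r3: "reach z3" "time z3 = N + c * (4 * T) + 3 * T"
              using reach_run[OF r2(1) z3] time_run[OF z3] r2(2) by auto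
          have "(\<integral>\<^sup>+z4. F (av z4) \<partial>run kern T z3) \<le> (\<integral>\<^sup>+z4. F (cut (av z) (GT z1)) + F (av z) * unknown z3 \<partial>run kern T z3)"
            using verify_phase[where F = F, OF F r3] c3 by (intro nn_integral_mono_pmf) auto
          then show "(\<integral>\<^sup>+z4. F (av z4) \<partial>run kern T z3) \<le> F (cut (av z) (GT z1)) + F (av z) * unknown z3"
              by simp
        qed
        also have "\<dots> = F (cut (av z) (GT z1)) + F (av z) * (\<integral>\<^sup>+z3. unknown z3 \<partial>run kern T z2)"
          by (simp add: nn_integral_add nn_integral_cmult)
        also have "\<dots> \<le> F (cut (av z) (GT z1)) + F (av z) * (ennreal (3 / 4) ^ T * unknown z2)"
          using code_phase(1)[OF r2] a by (intro add_left_mono mult_left_mono) auto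
        also have "\<dots> \<le> ?b"
          unfolding eps_def using unknown_le by (intro add_left_mono mult_left_mono) auto
        finally show ?thesis .
      qed
    qed
    then have "(\<integral>\<^sup>+z2. (\<integral>\<^sup>+z3. (\<integral>\<^sup>+z4. F (av z4) \<partial>run kern T z3) \<partial>run kern T z2) \<partial>run kern (T - 1) z1) \<le> (\<integral>\<^sup>+z2. ?b \<partial>run kern (T - 1) z1)"
      by (intro nn_integral_mono_pmf)
    then show ?thesis by simp
  qed
  then have "(\<integral>\<^sup>+z'. F (av z') \<partial>run kern (3 * T) z) \<le> (\<integral>\<^sup>+z1. F (cut (av z) (GT z1)) + F (av z) * eps \<partial>kern z)"
    unfolding split by (simp add: nn_integral_mono_pmf)
  also have "\<dots> = (\<integral>\<^sup>+z1. F (cut (av z) (GT z1)) \<partial>kern z) + F (av z) * eps"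
    by (simp add: nn_integral_add)
  finally show ?thesis .
qed

text \<open>The error has to fit into the slack of the later drift estimates, the smallest of which
  is 1/144 - 1/150 = 1/3600.\<close>

lemma eps_le: "eps \<le> ennreal (1 / 2 ^ 18)"
proof -
  have "(3 / 4 :: real) ^ T = ((3 / 4) ^ 64) ^ N" by (simp add: rounds_def power_mult)
  also have "\<dots> \<le> ((1 / 2) ^ 21) ^ N"
    by (intro power_mono) (simp_all add: power_divide)
  also have "\<dots> = 1 / 2 ^ (21 * N)" by (simp add: power_divide power_mult)
  finally have "(3 / 4) ^ T * 2 ^ (3 * N) \<le> 1 / 2 ^ (21 * N) * (2 ^ (3 * N) :: real)"
      by (intro mult_right_mono) auto
  also have "\<dots> = 1 / 2 ^ (18 * N)"
  proof -
    have "(2::real) ^ (21 * N) = 2 ^ (18 * N) * 2 ^ (3 * N)" by (simp add: power_add[symmetric])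
    then show ?thesis by simp
  qed
  also have "\<dots> \<le> 1 / 2 ^ 18" using N_pos by (intro divide_left_mono power_increasing) auto
  finally have "ennreal ((3 / 4) ^ T * 2 ^ (3 * N)) \<le> ennreal (1 / 2 ^ 18)" by (rule ennreal_leI)
  moreover have "ennreal ((3 / 4) ^ T * 2 ^ (3 * N)) = eps"
    by (simp add: eps_def ennreal_mult ennreal_power[symmetric])
  ultimately show ?thesis by simp
qed

section \<open>Gathering\<close>

text \<open>A token without holders has been retired and needs no spreading; counting it as zero
  makes the potential insensitive to removals.\<close>

definition spot :: "nat \<Rightarrow> token \<Rightarrow> state \<Rightarrow> ennreal" where
  "spot n0 x z = (if holders z x = {} then 0 else gap n0 (card (holders z x)))"

text \<open>A holder with at most \<open>\<beta>\<close> blocks sends a block containing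
  \<open>x\<close> with probability at least \<open>1 / \<beta>\<close>, whatever its other tokens
  are. The rest is \<open>spread_step\<close>.\<close>

lemma gather_drift:
  assumes z: "reach z" "N \<le> time z" "gph (time z) = 0" "gathering N (gcyc (time z))"
    and n0: "n0 \<le> n" and \<beta>: "0 < (\<beta>::nat)" "\<And>v. v \<in> V \<Longrightarrow> nblocks msize (card (av z v)) \<le> \<beta>"
  shows "(\<integral>\<^sup>+z'. spot n0 x z' \<partial>kern z) \<le> ennreal (1 - 1 / (2 * real \<beta>)) * spot n0 x z"
  using z(1,2)
proof (cases rule: late_cases)
  case 1
  have "spot n0 x z' = 0" if z': "z' \<in> set_pmf (kern z)" for z'
  proof -
    have "finished z'" using finished_kern[OF 1 z'] st_cong 1 by blast
    then show ?thesis by (auto simp: spot_def holders_def finished_def actv_def)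
  qed
  then have "(\<integral>\<^sup>+z'. spot n0 x z' \<partial>kern z) \<le> (\<integral>\<^sup>+z'. 0 \<partial>kern z)" by (intro nn_integral_mono_pmf) simp
  then show ?thesis by simp
next
  case 2
  note b = 2(2)
  show ?thesis
  proof (cases "holders z x = {}")
    case True
    have "spot n0 x z' = 0" if z': "z' \<in> set_pmf (kern z)" for z'
      using growth_step(2)[OF z(1,2) z' z(3)] True holders_ne by (simp add: spot_def) (metis)
    then have "(\<integral>\<^sup>+z'. spot n0 x z' \<partial>kern z) \<le> (\<integral>\<^sup>+z'. 0 \<partial>kern z)" by (intro nn_integral_mono_pmf) simp
    then show ?thesis by simp
  next
    case False
    have "(\<integral>\<^sup>+z'. spot n0 x z' \<partial>kern z) = (\<integral>\<^sup>+y. spot n0 x (nxt z y) \<partial>moves z)"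
      by (simp add: kern_running[OF base_running[OF b]])
    also have "\<dots> \<le> (\<integral>\<^sup>+y. gap n0 (card (holders (nxt z y) x)) \<partial>moves z)"
      by (intro nn_integral_mono_pmf) (simp add: spot_def)
    also have "\<dots> \<le> ennreal (1 - (1 / real \<beta>) / 2) * gap n0 (card (holders z x))"
      unfolding moves_def
    proof (rule spread_step[OF fin_V net[of z], where good = "\<lambda>v. {y. x \<in> set (plain (fst y))}"])
      show "holders z x \<subseteq> V" "holders z x \<noteq> {}" using False by (auto simp: holders_def)
      show "n0 \<le> card V" using n0 card_V by simp
    next
      fix v assume "v \<in> holders z x"
      then have v: "v \<in> V" "x \<in> set (acts z v)" by (auto simp: holders_def actv_def)
      then have ne: "acts z v \<noteq> []" by auto
      obtain pos where pos: "pos < length (acts z v)" "acts z v ! pos = x" using v(2)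
          by (auto simp: in_set_conv_nth)
      let ?nb = "nblocks msize (length (acts z v))"
      have s: "node_send (st z v) = map_pmf (\<lambda>i. (Message [] (block msize (acts z v) i) [], st z v)) (pmf_of_set {..<?nb})"
        using base_position[OF b z(2) v(1)] baseD[OF b v(1)] z(3,4) ne
            by (simp add: node_send_def acts_def)
      have "0 < length (acts z v)" using ne by simp
      then have nb: "0 < ?nb" "?nb \<le> \<beta>"
        using nblocks_pos[OF msize_pos, of "length (acts z v)"] \<beta>(2)[OF v(1)] length_acts[OF b v(1)] v(1)
            by (auto simp: av_def)
      have i: "pos div msize < ?nb" "x \<in> set (block msize (acts z v) (pos div msize))"
        using in_block[OF msize_pos pos(1)] pos(2) by auto
      have "1 / real \<beta> \<le> 1 / ?nb" using nb by (intro divide_left_mono) auto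
      also have "\<dots> \<le> real (card ({..<?nb} \<inter> {i. x \<in> set (block msize (acts z v) i)})) / ?nb"
      proof (intro divide_right_mono)
        have "{pos div msize} \<subseteq> {..<?nb} \<inter> {i. x \<in> set (block msize (acts z v) i)}" using i by auto
        then have "card {pos div msize} \<le> card ({..<?nb} \<inter> {i. x \<in> set (block msize (acts z v) i)})"
          by (intro card_mono) auto
        then show "1 \<le> real (card ({..<?nb} \<inter> {i. x \<in> set (block msize (acts z v) i)}))" by simp
      qed simp
      also have "\<dots> = measure_pmf.prob (pmf_of_set {..<?nb}) {i. x \<in> set (block msize (acts z v) i)}"
        using nb i(1) by (subst measure_pmf_of_set) auto
      also have "\<dots> = measure_pmf.prob (node_send (st z v)) {y. x \<in> set (plain (fst y))}"
        unfolding s by (simp add: vimage_def)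
      finally show "1 / real \<beta> \<le> measure_pmf.prob (node_send (st z v)) {y. x \<in> set (plain (fst y))}" .
    next
      fix y assume y: "y \<in> set_pmf (Pi_pmf V undefined (\<lambda>v. node_send (st z v)))"
      then have y': "y \<in> set_pmf (moves z)" by (simp add: moves_def)
      note gs = gather_step(2)[OF b z(2,3) y']
      have "holders z x \<subseteq> holders (nxt z y) x" using gs unfolding holders_def by blast
      then show "holders z x \<subseteq> holders (nxt z y) x \<and> finite (holders (nxt z y) x)" using fin_holders
          by blast
      fix v w assume "v \<in> holders z x" and w: "w \<in> V" "(v, w) \<in> net z" and x: "y v \<in> {y. x \<in> set (plain (fst y))}"
      have "x \<in> hear (inb z y w)" using inb_I[OF w(2), of y] x by (auto simp: hear_def)
      then show "w \<in> holders (nxt z y) x" using gs[OF w(1)] w(1) by (simp add: holders_def)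
    qed (use \<beta>(1) in auto)
    also have "\<dots> = ennreal (1 - 1 / (2 * real \<beta>)) * spot n0 x z" using False
        by (simp add: spot_def mult.commute)
    finally show ?thesis .
  qed
qed

lemma holders_cong: "av z' = av z \<Longrightarrow> holders z' x = holders z x"
  by (simp add: holders_av)

text \<open>Outside the gathering phase a token is removed at all nodes at once or at none, so its
  set of holders disappears or stays the same.\<close>

lemma spot_other:
  assumes "reach z" "N \<le> time z" "z' \<in> set_pmf (kern z)" "gph (time z) \<noteq> 0"
  shows "spot n0 x z' \<le> spot n0 x z"
proof (cases "gph (time z) = 3")
  case True
  then obtain D where "av z' = (\<lambda>v. av z v - D)" using removal_step[OF assms(1-3)] by blast
  then have "holders z' x = (if x \<in> D then {} else holders z x)" by (auto simp: holders_av)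
  then show ?thesis by (simp add: spot_def)
next
  case False
  then have "gph (time z) \<in> {1, 2}" using gph_less[of "time z"] assms(4) by force
  then have "av z' = av z" using quiet_step[OF assms(1-3)] by blast
  then have "holders z' x = holders z x" by (rule holders_cong)
  then show ?thesis by (simp add: spot_def)
qed

end

section \<open>Coverage by a nominated generation\<close>

lemma one_minus_power_le:
  assumes "0 \<le> p" "p \<le> (1::real)"
  shows "(1 - p) ^ q \<le> 1 / (1 + q * p)"
proof -
  have "(1 - p) ^ q \<le> exp (- p) ^ q" using assms exp_ge_add_one_self[of "- p"] by (intro power_mono) auto
  also have "\<dots> = exp (- (q * p))" by (simp only: exp_of_nat_mult[symmetric] mult_minus_right)
  also have "\<dots> = 1 / exp (q * p)" by (simp add: exp_minus inverse_eq_divide)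
  also have "\<dots> \<le> 1 / (1 + q * p)"
    using assms exp_ge_add_one_self[of "q * p"]
        by (intro divide_left_mono) (auto intro!: mult_pos_pos add_pos_nonneg)
  finally show ?thesis .
qed

context dynamic
begin

text \<open>The share of the random slots in the generation. The leader's blocks are ignored in this
  part of the analysis.\<close>

definition Cov :: "(uid \<Rightarrow> token list) \<Rightarrow> nat list \<Rightarrow> token set" where
  "Cov ac M = (\<Union>j<slots N. \<Union>(u, i)\<in>set (slot_block N (M ! Suc j)). set (block msize (ac u) i))"

lemma Cov_GB: "Cov ac M \<subseteq> \<Union>(set ` set (GB ac M))"
  by (auto simp: Cov_def GB_def gens_def)

lemma card_Cov: "card (Cov ac M) \<le> slots N * msize"
proof -
  have "card (\<Union>(u, i)\<in>set (slot_block N x). set (block msize (ac u) i)) \<le> msize" for x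
    using card_length[of "block msize (ac (inv code (x mod idbase N))) (x div idbase N mod N)"]
    by (simp add: slot_block_def)
  then have "(\<Sum>j<slots N. card (\<Union>(u, i)\<in>set (slot_block N (M ! Suc j)). set (block msize (ac u) i))) \<le> (\<Sum>j<slots N. msize)"
    by (intro sum_mono)
  moreover have "card (Cov ac M) \<le> (\<Sum>j<slots N. card (\<Union>(u, i)\<in>set (slot_block N (M ! Suc j)). set (block msize (ac u) i)))"
    unfolding Cov_def by (rule card_UN_le) simp
  ultimately have "card (Cov ac M) \<le> (\<Sum>j<slots N. msize)" by (rule order.trans[rotated])
  then show ?thesis by simp
qed

definition starts :: "state \<Rightarrow> bool" where
  "starts z \<longleftrightarrow> reach z \<and> N \<le> time z \<and> base z \<and> gph (time z) = 1 \<and> goff (time z) = 0"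

definition load :: "state \<Rightarrow> uid \<Rightarrow> nat" where "load z v = nblocks msize (length (acts z v))"

lemma load_le: "base z \<Longrightarrow> v \<in> V \<Longrightarrow> load z v \<le> N"
  using nblocks_le[OF msize_pos, of "length (acts z v)"] length_acts card_actv_le n_le_N
  by (simp add: load_def) (metis le_trans)

definition priorities :: "(uid \<Rightarrow> nat \<Rightarrow> nat \<times> nat) pmf" where
  "priorities = Pi_pmf V (\<lambda>_. (0, 0)) (\<lambda>_. draws N)"

definition elected :: "state \<Rightarrow> (uid \<Rightarrow> nat \<Rightarrow> nat \<times> nat) \<Rightarrow> nat list" where
  "elected z g = gmax (\<lambda>v. nominate (st z v) (g v))"

text \<open>In the first nominating round the priorities are the only randomness, so the next state
  is a function of them; active lists are not affected.\<close>

lemma kern_starts: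
  assumes "starts z"
  shows "\<exists>h. kern z = map_pmf h priorities \<and> (\<forall>g\<in>set_pmf priorities. GM (h g) = elected z g \<and>
     (\<forall>v\<in>V. acts (h g) v = acts z v) \<and> regs_ok (acts z) (elected z g))"
proof -
  have z: "base z" "N \<le> time z" "gph (time z) = 1" "goff (time z) = 0" "reach z" using assms
      by (auto simp: starts_def)
  let ?f = "\<lambda>v g. (put_reg N (nominate (st z v) g), (st z v)\<lparr>reg := nominate (st z v) g\<rparr>)"
  have s: "node_send (st z v) = map_pmf (?f v) (draws N)" if v: "v \<in> V" for v
    using base_position[OF z(1,2) v] baseD(3)[OF z(1) v] z(3,4) by (simp add: node_send_def)
  let ?h = "\<lambda>g v. if v \<in> V then ?f v (g v) else undefined"
  have m: "moves z = map_pmf ?h priorities"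
  proof (rule pmf_eqI)
    fix y
    have "moves z = Pi_pmf V undefined (\<lambda>v. map_pmf (\<lambda>(v, g). ?f v g) (map_pmf (Pair v) (draws N)))"
      unfolding moves_def by (intro Pi_pmf_cong) (use s in \<open>auto simp: pmf.map_comp o_def\<close>)
    also have "\<dots> = map_pmf (\<lambda>y v. if v \<in> V then (\<lambda>(v, g). ?f v g) (y v) else undefined)
        (Pi_pmf V undefined (\<lambda>v. map_pmf (Pair v) (draws N)))"
      using fin_V by (rule map_Pi_pmf_dflt)
    also have "Pi_pmf V undefined (\<lambda>v. map_pmf (Pair v) (draws N)) =
        map_pmf (\<lambda>y v. if v \<in> V then (v, y v) else undefined) priorities"
    proof -
      have "Pi_pmf V (undefined :: uid \<times> (nat \<Rightarrow> nat \<times> nat)) (\<lambda>v. map_pmf (Pair v) (draws N)) =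
        Pi_pmf V undefined (\<lambda>v. bind_pmf (draws N) (\<lambda>x. return_pmf (v, x)))"
        by (simp add: map_pmf_def)
      also have "\<dots> = bind_pmf (Pi_pmf V (\<lambda>_. (0, 0)) (\<lambda>_. draws N)) (\<lambda>f. Pi_pmf V undefined (\<lambda>v. return_pmf (v, f v)))"
        using fin_V by (rule Pi_pmf_bind)
      finally show ?thesis using fin_V by (simp add: Pi_pmf_return_pmf map_pmf_def priorities_def)
    qed
    finally show "pmf (moves z) y = pmf (map_pmf ?h priorities) y"
      by (simp add: pmf.map_comp o_def if_distrib cong: if_cong)
  qed
  have k: "kern z = map_pmf (\<lambda>g. nxt z (?h g)) priorities"
    by (simp add: kern_running[OF base_running[OF z(1)]] m pmf.map_comp o_def)
  show ?thesis
  proof (intro exI[of _ "\<lambda>g. nxt z (?h g)"] conjI ballI k refl)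
    fix g assume "g \<in> set_pmf priorities"
    then have y: "?h g \<in> set_pmf (moves z)" by (simp add: m)
    have nm: "goff (time z) \<noteq> 0 \<longrightarrow> nominating z" using z(4) by simp
    note ns = nominate_step[OF z(1-3) nm y] and sp = nominate_spreads[OF z(1-3) nm y]
    have e: "gmax (\<lambda>v. reg (snd (?h g v))) = elected z g" unfolding elected_def by (rule gmax_cong) simp
    show "GM (nxt z (?h g)) = elected z g" using ns(3) e by (simp add: GM_def)
    show "acts (nxt z (?h g)) v = acts z v" if "v \<in> V" for v using ns(2)[OF that] .
    show "regs_ok (acts z) (elected z g)" using sp(3) e by simp
  qed
qed

lemma slot_winner:
  assumes z: "base z" and g: "\<And>v. v \<in> V \<Longrightarrow> snd (g v j) < N" and j: "j < slots N" and u: "u \<in> V" "snd (g u j) < load z u"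
    and win: "\<forall>v\<in>V - {u}. snd (g v j) < load z v \<longrightarrow> fst (g v j) < fst (g u j)"
  shows "slot_block N (elected z g ! Suc j) = [(u, snd (g u j))]"
proof -
  let ?r = "\<lambda>v. nominate (st z v) (g v)"
  have nthS: "?r v ! Suc j = (if snd (g v j) < load z v then (fst (g v j) * N + snd (g v j)) * idbase N + code v else 0)"
    if "v \<in> V" for v
    using baseD[OF z that] j by (simp add: nominate_def Let_def load_def acts_def)
  have le: "?r v ! Suc j \<le> ?r u ! Suc j" if v: "v \<in> V" for v
  proof (cases "v = u \<or> \<not> snd (g v j) < load z v")
    case False
    then have lt: "fst (g v j) < fst (g u j)" using win v by blast
    have "fst (g v j) * N + snd (g v j) < Suc (fst (g v j)) * N" using g[OF v] by simp
    also have "\<dots> \<le> fst (g u j) * N" using lt by (intro mult_right_mono) auto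
    finally have "Suc (fst (g v j) * N + snd (g v j)) \<le> fst (g u j) * N + snd (g u j)" by simp
    then have "Suc (fst (g v j) * N + snd (g v j)) * idbase N \<le> (fst (g u j) * N + snd (g u j)) * idbase N"
      by (rule mult_right_mono) simp
    then show ?thesis using nthS[OF v] nthS[OF u(1)] u(2) False code_V[OF v] by simp
  qed (use nthS[OF v] nthS[OF u(1)] u(2) in auto)
  have "length (?r (SOME v. v \<in> V)) = Suc (slots N)"
    using baseD(3)[OF z some_V] by (simp add: nominate_def Let_def)
  then have "elected z g ! Suc j = Max ((\<lambda>v. ?r v ! Suc j) ` V)"
    using j unfolding elected_def gmax_def by (subst nth_map) (simp_all del: upt_Suc)
  also have "\<dots> = ?r u ! Suc j" using le u fin_V by (intro Max_eqI) auto
  finally show ?thesis using nthS[OF u(1)] u g[OF u(1)] slot_block_code[OF u(1)] by simp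
qed

text \<open>Each slot selects a block containing \<open>x\<close> with probability at least
  \<open>p\<close>, and the slots are independent. The rational form of the bound combines well with
  the weights in \<open>selection_drift\<close>.\<close>

lemma prob_covered:
  fixes p :: real and x :: token
  assumes z: "starts z"
  defines "p \<equiv> real (card (holders z x)) / (8 * (real N + (\<Sum>v\<in>V. load z v)))"
  shows "slots N * p / (1 + slots N * p) \<le> measure_pmf.prob priorities {g. x \<in> Cov (acts z) (elected z g)}"
proof -
  let ?q = "slots N" and ?P = "prios N"
  have b: "base z" using z by (simp add: starts_def)
  define idx where "idx u = (SOME pos. pos < length (acts z u) \<and> acts z u ! pos = x) div msize" for u
  have idx: "idx u < load z u" "x \<in> set (block msize (acts z u) (idx u))" if u: "u \<in> holders z x" for u
  proof -
    have "\<exists>pos. pos < length (acts z u) \<and> acts z u ! pos = x"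
      using u by (auto simp: holders_def actv_def in_set_conv_nth)
    then have "(SOME pos. pos < length (acts z u) \<and> acts z u ! pos = x) < length (acts z u) \<and>
        acts z u ! (SOME pos. pos < length (acts z u) \<and> acts z u ! pos = x) = x" by (rule someI_ex)
    then show "idx u < load z u" "x \<in> set (block msize (acts z u) (idx u))"
      using in_block[OF msize_pos, of "SOME pos. pos < length (acts z u) \<and> acts z u ! pos = x" "acts z u"]
      by (simp_all add: idx_def load_def)
  qed
  define E where "E = {y :: uid \<Rightarrow> nat \<times> nat. \<exists>u\<in>holders z x. snd (y u) = idx u \<and>
      (\<forall>v\<in>V - {u}. snd (y v) < load z v \<longrightarrow> fst (y v) < fst (y u))}"
  let ?U = "pmf_of_set ({..<?P} \<times> {..<N})"
  have suml: "(\<Sum>v\<in>V. load z v) \<le> N * N"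
  proof -
    have "(\<Sum>v\<in>V. load z v) \<le> (\<Sum>v\<in>V. N)" using load_le[OF b] by (intro sum_mono) auto
    also have "\<dots> = n * N" using card_V by simp
    also have "\<dots> \<le> N * N" using n_le_N by (rule mult_right_mono) simp
    finally show ?thesis .
  qed
  have big: "2 * (N + (\<Sum>v\<in>V. load z v)) \<le> ?P * N"
  proof -
    have "2 * (x + y) \<le> 4 * w" if "x \<le> w" "y \<le> w" for x y w :: nat using that by simp
    from this[OF le_square suml] have "2 * (N + (\<Sum>v\<in>V. load z v)) \<le> 4 * (N * N)" .
    also have "\<dots> \<le> 4 * (2 ^ lg N * N)" using lg_N(3) by (intro mult_left_mono mult_right_mono) auto
    also have "\<dots> = (2 ^ (lg N + 2)) * N" by (simp add: power_add)
    also have "\<dots> \<le> ?P * N" unfolding prios_def by (intro mult_right_mono power_increasing) auto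
    finally show ?thesis .
  qed
  have pE: "p \<le> measure_pmf.prob (Pi_pmf V (0, 0) (\<lambda>_. ?U)) E"
    unfolding p_def E_def
    using prob_winner[of V "holders z x" "load z" N idx "prios N" "(0, 0)"] fin_V load_le[OF b] idx(1) N_pos big
    by (auto simp: holders_def)
  have p: "0 \<le> p" "p \<le> 1"
  proof -
    show "0 \<le> p" unfolding p_def by (intro divide_nonneg_nonneg) (simp_all add: sum_nonneg)
    show "p \<le> 1" using pE measure_pmf.prob_le_1 by (rule order.trans)
  qed
  have rng: "snd (g v j) < N" if "g \<in> set_pmf priorities" "v \<in> V" "j < ?q" for g v j
  proof -
    have "(0, 0) \<in> {..<?P} \<times> {..<N}" using N_pos by (simp add: prios_def)
    then have ne: "{..<?P} \<times> {..<N} \<noteq> {}" by blast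
    have "g v \<in> set_pmf (draws N)"
      using set_Pi_pmf_D[OF fin_V that(1)[unfolded priorities_def] that(2)] .
    then have "g v j \<in> set_pmf ?U" using that(3) set_Pi_pmf_D[of "{..<?q}" "g v"] unfolding draws_def
        by blast
    then have "g v j \<in> {..<?P} \<times> {..<N}" by (simp only: set_pmf_of_set[OF ne] finite_cartesian_product finite_lessThan)
    then show ?thesis by (simp add: mem_Times_iff)
  qed
  let ?B = "{g. \<forall>j<?q. (\<lambda>v. g v j) \<notin> E}"
  have sub: "set_pmf priorities \<inter> - ?B \<subseteq> {g. x \<in> Cov (acts z) (elected z g)}"
  proof
    fix g assume "g \<in> set_pmf priorities \<inter> - ?B"
    then obtain j where g: "g \<in> set_pmf priorities" and j: "j < ?q" and "(\<lambda>v. g v j) \<in> E" by auto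
    then obtain u where u: "u \<in> holders z x" "snd (g u j) = idx u"
      "\<forall>v\<in>V - {u}. snd (g v j) < load z v \<longrightarrow> fst (g v j) < fst (g u j)" by (auto simp: E_def)
    then have uV: "u \<in> V" by (simp add: holders_def)
    have "slot_block N (elected z g ! Suc j) = [(u, snd (g u j))]"
      using rng[OF g _ j] u idx(1)[OF u(1)] by (intro slot_winner[OF b _ j uV]) auto
    then have "(u, idx u) \<in> set (slot_block N (elected z g ! Suc j))" using u(2) by simp
    then have "x \<in> Cov (acts z) (elected z g)"
      unfolding Cov_def using j idx(2)[OF u(1)] by (intro UN_I[of j] UN_I[of "(u, idx u)"]) auto
    then show "g \<in> {g. x \<in> Cov (acts z) (elected z g)}" by simp
  qed
  \<comment> \<open>Transposing the priorities turns failure in all slots into an intersection of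
    independent events.\<close>
  have "measure_pmf.prob priorities ?B = measure_pmf.prob (map_pmf (\<lambda>f j v. f v j) priorities) (Pi {..<?q} (\<lambda>_. - E))"
    by (simp add: vimage_def Pi_def)
  also have "map_pmf (\<lambda>f j v. f v j) priorities = Pi_pmf {..<?q} (\<lambda>_. (0, 0)) (\<lambda>j. Pi_pmf V (0, 0) (\<lambda>v. ?U))"
    unfolding priorities_def draws_def using fin_V by (intro map_Pi_pmf_swap) auto
  also have "measure_pmf.prob \<dots> (Pi {..<?q} (\<lambda>_. - E)) = (\<Prod>j<?q. measure_pmf.prob (Pi_pmf V (0, 0) (\<lambda>v. ?U)) (- E))"
    by (rule measure_Pi_pmf_Pi) simp
  also have "\<dots> = (1 - measure_pmf.prob (Pi_pmf V (0, 0) (\<lambda>v. ?U)) E) ^ ?q"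
    using measure_pmf.prob_compl[of E "Pi_pmf V (0, 0) (\<lambda>v. ?U)"] by (simp add: Compl_eq_Diff_UNIV)
  also have "\<dots> \<le> (1 - p) ^ ?q" using pE by (intro power_mono) auto
  also have "\<dots> \<le> 1 / (1 + ?q * p)" using p by (rule one_minus_power_le)
  finally have B: "measure_pmf.prob priorities ?B \<le> 1 / (1 + ?q * p)" .
  have "1 + ?q * p > 0" using p by (simp add: add_pos_nonneg)
  then have "?q * p / (1 + ?q * p) = 1 - 1 / (1 + ?q * p)" by (simp add: field_simps)
  also have "\<dots> \<le> measure_pmf.prob priorities (- ?B)"
    using B measure_pmf.prob_compl[of ?B priorities] by (simp add: Compl_eq_Diff_UNIV)
  also have "\<dots> = measure_pmf.prob priorities (set_pmf priorities \<inter> - ?B)"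
    by (rule measure_pmf.finite_measure_eq_AE) (auto simp: AE_measure_pmf_iff)
  also have "\<dots> \<le> measure_pmf.prob priorities {g. x \<in> Cov (acts z) (elected z g)}"
    using sub by (intro measure_pmf.finite_measure_mono) auto
  finally show ?thesis .
qed

text \<open>The node with the largest active set contributes \<open>lead N\<close> blocks.\<close>

lemma leader_tokens:
  assumes "base z" "regs_ok (acts z) M" "v \<in> V"
  shows "min (lead N * msize) (card (actv z v)) \<le> card (\<Union>(set ` set (GB (acts z) M)) \<inter> active z)"
proof (cases "acts z v = []")
  case True
  then show ?thesis by (simp add: actv_def)
next
  case False
  then have "M ! 0 \<noteq> 0" using assms by (auto simp: regs_ok_def)
  then obtain u where u: "u \<in> V" "acts z u \<noteq> []" "\<forall>v\<in>V. length (acts z v) \<le> length (acts z u)"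
    "M ! 0 = length (acts z u) * idbase N + code u" using assms(2) by (auto simp: regs_ok_def)
  let ?xs = "acts z u" and ?m = "msize"
  let ?l = "min (lead N * ?m) (length ?xs)"
  have "set (take ?l ?xs) \<subseteq> \<Union>(set ` set (GB (acts z) M)) \<inter> active z"
  proof
    fix x assume x: "x \<in> set (take ?l ?xs)"
    then have "x \<in> set ?xs" by (rule in_set_takeD)
    then have a: "x \<in> active z" using u(1) by (auto simp: active_def actv_def)
    obtain pos where pos: "pos < ?l" "?xs ! pos = x" using x by (auto simp: in_set_conv_nth)
    let ?i = "pos div ?m"
    have "?i < lead N" using pos by (simp add: less_mult_imp_div_less)
    moreover have i: "?i < nblocks ?m (length ?xs)" "x \<in> set (block ?m ?xs ?i)"
      using in_block[OF msize_pos, of pos ?xs] pos by auto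
    ultimately have "(u, ?i) \<in> set (gens N M)" using u(1,4) by (auto simp: gens_def lead_block_code)
    then have "block ?m ?xs ?i \<in> set (GB (acts z) M)" by (force simp: GB_def)
    then show "x \<in> \<Union>(set ` set (GB (acts z) M)) \<inter> active z" using i(2) a by blast
  qed
  then have "card (set (take ?l ?xs)) \<le> card (\<Union>(set ` set (GB (acts z) M)) \<inter> active z)"
    using fin_active' by (intro card_mono) auto
  moreover have "card (set (take ?l ?xs)) = ?l"
    using baseD(4)[OF assms(1) u(1)] by (subst distinct_card) auto
  moreover have "card (actv z v) \<le> length ?xs" using u(3) assms(3) length_acts[OF assms(1,3)] by auto
  ultimately show ?thesis by linarith
qed

end

section \<open>Random blocks\<close>

text \<open>The potential \<open>\<Phi> * exp (k / c0)\<close>, where \<open>\<Phi>\<close> is the sum of the weights \<open>y\<close> of \<open>k\<close> tokens, under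
  removal of a random set \<open>C\<close>. With \<open>s\<close> and \<open>t\<close> the fractions of \<open>\<Phi>\<close> and \<open>c0\<close> removed, the factor
  is \<open>(1 - s) * exp (- t) \<le> 1 - (s + t) / 2\<close>.\<close>

lemma removal_factor:
  fixes s t :: real
  assumes "0 \<le> s" "s \<le> 1" "0 \<le> t" "t \<le> 1"
  shows "(1 - s) * exp (- t) \<le> 1 - (s + t) / 2"
proof -
  have "exp (- t) \<le> 1 / (1 + t)"
    using exp_ge_add_one_self[of t] assms by (simp add: exp_minus inverse_eq_divide frac_le)
  also have "\<dots> \<le> 1 - t / 2"
  proof -
    have "1 \<le> (1 - t / 2) * (1 + t)" using assms by (simp add: algebra_simps mult_left_le)
    then show ?thesis using assms by (simp add: field_simps)
  qed
  finally have "(1 - s) * exp (- t) \<le> (1 - s) * (1 - t / 2)" using assms by (intro mult_left_mono) auto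
  also have "\<dots> \<le> 1 - (s + t) / 2"
  proof -
    have "1 - (s + t) / 2 - (1 - s) * (1 - t / 2) = s * (1 - t) / 2" by (simp add: field_simps)
    moreover have "0 \<le> s * (1 - t) / 2" using assms by simp
    ultimately show ?thesis by (metis diff_ge_0_iff_ge)
  qed
  finally show ?thesis .
qed

text \<open>The sum of the removed fractions \<open>s\<close> and \<open>t\<close> is additive over
  the removed tokens, with weight \<open>y x / \<Phi> + 1 / c0\<close> for a token \<open>x\<close>.
  Its expectation thus depends only on the single probabilities \<open>a x\<close>, not on
  correlations, and the last assumption makes it at least \<open>c\<close>.\<close>

lemma removal_drift:
  fixes y :: "'t \<Rightarrow> real" and C :: "'g \<Rightarrow> 't set" and M :: "'g pmf"
  assumes R: "finite R" and y: "\<And>x. x \<in> R \<Longrightarrow> 0 < y x" and \<Phi>: "\<Phi> = (\<Sum>x\<in>R. y x)" "0 < \<Phi>"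
    and c0: "0 < c0" "\<And>g. real (card (C g \<inter> R)) \<le> c0"
    and a: "\<And>x. x \<in> R \<Longrightarrow> a x \<le> measure_pmf.prob M {g. x \<in> C g}"
    and c: "\<And>x. x \<in> R \<Longrightarrow> c * (y x / \<Phi>) \<le> a x * (y x / \<Phi> + 1 / c0)"
  shows "(\<integral>\<^sup>+g. ennreal ((\<Sum>x\<in>R - C g. y x) * exp (real (card (R - C g)) / c0)) \<partial>M)
    \<le> ennreal (1 - c / 2) * ennreal (\<Phi> * exp (real (card R) / c0))"
proof -
  define w where "w x = y x / \<Phi> + 1 / c0" for x
  define S where "S g = (\<Sum>x\<in>R. indicat_real {g. x \<in> C g} g * w x)" for g
  let ?Z = "\<Phi> * exp (real (card R) / c0)"
  have w0: "0 \<le> w x" if "x \<in> R" for x using y[OF that] \<Phi> c0 by (simp add: w_def)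
  have S: "S g = (\<Sum>x\<in>C g \<inter> R. y x) / \<Phi> + card (C g \<inter> R) / c0" for g
  proof -
    have "S g = (\<Sum>x\<in>R. if x \<in> C g then w x else 0)" unfolding S_def by (intro sum.cong) auto
    also have "\<dots> = (\<Sum>x\<in>C g \<inter> R. w x)" using R by (simp add: sum.inter_restrict Int_commute)
    finally show ?thesis by (simp add: w_def sum.distrib sum_divide_distrib)
  qed
  have point: "(\<Sum>x\<in>R - C g. y x) * exp (real (card (R - C g)) / c0) \<le> ?Z * (1 - S g / 2)" "S g \<le> 2" "0 \<le> S g" for g
  proof -
    let ?D = "C g \<inter> R"
    let ?s = "(\<Sum>x\<in>?D. y x) / \<Phi>" and ?t = "card ?D / c0"
    have sD: "(\<Sum>x\<in>?D. y x) \<le> \<Phi>" unfolding \<Phi>(1) using R y by (intro sum_mono2) (auto intro: less_imp_le)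
    have "0 \<le> (\<Sum>x\<in>?D. y x)" using y by (intro sum_nonneg) (auto intro: less_imp_le)
    then have s: "0 \<le> ?s" "?s \<le> 1" using sD \<Phi>(2) by auto
    have t: "0 \<le> ?t" "?t \<le> 1" using c0 by auto
    have RD: "R - C g = R - ?D" by blast
    have e1: "(\<Sum>x\<in>R - C g. y x) = \<Phi> * (1 - ?s)"
      unfolding RD using R \<Phi> by (subst sum_diff) (auto simp: field_simps)
    have cD: "card (R - C g) = card R - card ?D" unfolding RD using R by (intro card_Diff_subset) auto
    have cle: "card ?D \<le> card R" using R by (intro card_mono) auto
    have e2: "exp (real (card (R - C g)) / c0) = exp (real (card R) / c0) * exp (- ?t)"
      using cD cle by (simp add: exp_add[symmetric] of_nat_diff diff_divide_distrib)
    have "(\<Sum>x\<in>R - C g. y x) * exp (real (card (R - C g)) / c0) = ?Z * ((1 - ?s) * exp (- ?t))"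
      unfolding e1 e2 by simp
    also have "\<dots> \<le> ?Z * (1 - (?s + ?t) / 2)" using removal_factor[OF s t] \<Phi> by (intro mult_left_mono) auto
    finally show "(\<Sum>x\<in>R - C g. y x) * exp (real (card (R - C g)) / c0) \<le> ?Z * (1 - S g / 2)"
        by (simp add: S)
    show "S g \<le> 2" "0 \<le> S g" using s t by (auto simp: S)
  qed
  have int: "integrable (measure_pmf M) (\<lambda>g. indicat_real {g. x \<in> C g} g * w x)" for x
    by (rule measure_pmf.integrable_const_bound[where B = "\<bar>w x\<bar>"]) (auto split: split_indicator)
  have intS: "integrable (measure_pmf M) S" unfolding S_def
      by (intro Bochner_Integration.integrable_sum int)
  have ES: "measure_pmf.expectation M S = (\<Sum>x\<in>R. measure_pmf.prob M {g. x \<in> C g} * w x)"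
    unfolding S_def by (subst Bochner_Integration.integral_sum[OF int]) simp
  have "c = (\<Sum>x\<in>R. c * (y x / \<Phi>))" using \<Phi> by (simp add: sum_distrib_left[symmetric] sum_divide_distrib[symmetric])
  also have "\<dots> \<le> (\<Sum>x\<in>R. a x * w x)" using c by (intro sum_mono) (simp add: w_def)
  also have "\<dots> \<le> measure_pmf.expectation M S" unfolding ES using a w0
      by (intro sum_mono mult_right_mono) auto
  finally have cS: "c \<le> measure_pmf.expectation M S" .
  have "(\<integral>\<^sup>+g. ennreal ((\<Sum>x\<in>R - C g. y x) * exp (real (card (R - C g)) / c0)) \<partial>M) \<le> (\<integral>\<^sup>+g. ennreal (?Z * (1 - S g / 2)) \<partial>M)"
    by (intro nn_integral_mono ennreal_leI point)
  also have "\<dots> = ennreal (measure_pmf.expectation M (\<lambda>g. ?Z * (1 - S g / 2)))"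
    using \<Phi> point intS by (intro nn_integral_eq_integral) (auto intro!: mult_nonneg_nonneg)
  also have "measure_pmf.expectation M (\<lambda>g. ?Z * (1 - S g / 2)) = ?Z * (1 - measure_pmf.expectation M S / 2)"
    using intS by simp
  also have "\<dots> \<le> ?Z * (1 - c / 2)" using cS \<Phi> by (intro mult_left_mono) auto
  finally have fin: "(\<integral>\<^sup>+g. ennreal ((\<Sum>x\<in>R - C g. y x) * exp (real (card (R - C g)) / c0)) \<partial>M) \<le> ennreal (?Z * (1 - c / 2))"
    by (simp add: ennreal_leI)
  have "measure_pmf.expectation M S \<le> 2"
    using intS point(2) by (intro measure_pmf.integral_le_const) auto
  then have "0 \<le> 1 - c / 2" using cS by simp
  then show ?thesis using fin \<Phi> by (simp add: ennreal_mult[symmetric] mult.commute)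
qed

context dynamic
begin

text \<open>The largest number of tokens that the random slots can retire in one cycle.\<close>

definition c0 :: real where "c0 = slots N * msize"

text \<open>Coverage of a token is proportional to its number of holders over \<open>N\<close> plus
  the total number of blocks. If the blocks dominate, covering frequent tokens shrinks the first
  factor, the total number of copies; if \<open>N\<close> dominates, well-spread tokens are covered
  often enough to shrink the second factor. The product decreases in both cases.\<close>

definition Zpot :: "(uid \<Rightarrow> token set) \<Rightarrow> ennreal" where
  "Zpot f = ennreal ((\<Sum>v\<in>V. real (card (f v \<inter> toks))) * exp (real (card ((\<Union>v\<in>V. f v) \<inter> toks)) / c0))"

lemma c0_pos: "0 < c0"
  using slots_le msize_pos by (simp add: c0_def)

lemma Zpot_mono:
  assumes "\<And>v. f v \<subseteq> g v"
  shows "Zpot f \<le> Zpot g"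
proof -
  have "card (f v \<inter> toks) \<le> card (g v \<inter> toks)" for v using assms fin_toks by (intro card_mono) blast+
  moreover have "card ((\<Union>v\<in>V. f v) \<inter> toks) \<le> card ((\<Union>v\<in>V. g v) \<inter> toks)"
    using assms fin_toks by (intro card_mono) blast+
  ultimately show ?thesis
    unfolding Zpot_def using c0_pos by (intro ennreal_leI mult_mono sum_mono) (auto intro!: sum_nonneg divide_right_mono)
qed

lemma sum_card_holders:
  assumes "finite S" "\<And>v. v \<in> V \<Longrightarrow> f v \<subseteq> S"
  shows "(\<Sum>v\<in>V. real (card (f v))) = (\<Sum>x\<in>S. real (card {v\<in>V. x \<in> f v}))"
proof -
  have "card (f v) = (\<Sum>x\<in>S. of_bool (x \<in> f v))" if "v \<in> V" for v
    using assms that by (simp add: sum.If_cases of_bool_def Int_absorb1 Int_absorb2)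
  then have "(\<Sum>v\<in>V. real (card (f v))) = (\<Sum>v\<in>V. \<Sum>x\<in>S. real (of_bool (x \<in> f v)))" by simp
  also have "\<dots> = (\<Sum>x\<in>S. \<Sum>v\<in>V. real (of_bool (x \<in> f v)))" by (rule sum.swap)
  also have "\<dots> = (\<Sum>x\<in>S. real (card {v\<in>V. x \<in> f v}))"
    using fin_V by (intro sum.cong refl)
      (simp only: of_nat_sum[symmetric], simp add: of_bool_def sum.If_cases Collect_conj_eq)
  finally show ?thesis .
qed

lemma Zpot_cut:
  assumes "reach z" "N \<le> time z"
  shows "Zpot (cut (av z) C) = ennreal ((\<Sum>x\<in>active z - C. real (card (holders z x))) * exp (real (card (active z - C)) / c0))"
proof -
  have a: "av z v \<subseteq> toks" for v using active_toks[OF assms] by (auto simp: active_def av_def)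
  have u: "(\<Union>v\<in>V. cut (av z) C v) \<inter> toks = active z - C"
    using active_toks[OF assms] by (auto simp: cut_def active_av)
  have "cut (av z) C v \<inter> toks = cut (av z) C v" for v using a by (auto simp: cut_def)
  then have "(\<Sum>v\<in>V. real (card (cut (av z) C v \<inter> toks))) = (\<Sum>v\<in>V. real (card (cut (av z) C v)))" by simp
  also have "\<dots> = (\<Sum>x\<in>active z - C. real (card {v\<in>V. x \<in> cut (av z) C v}))"
    using fin_active' by (intro sum_card_holders) (auto simp: cut_def active_av)
  also have "\<dots> = (\<Sum>x\<in>active z - C. real (card (holders z x)))"
    by (intro sum.cong refl arg_cong[where f = real] arg_cong[where f = card]) (auto simp: cut_def holders_av)
  finally show ?thesis by (simp add: Zpot_def u)
qed

lemma Zpot_av: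
  assumes "reach z" "N \<le> time z"
  shows "Zpot (av z) = ennreal ((\<Sum>x\<in>active z. real (card (holders z x))) * exp (real (card (active z)) / c0))"
proof -
  have "cut (av z) {} = av z" by (simp add: cut_def fun_eq_iff)
  then show ?thesis using Zpot_cut[OF assms, of "{}"] by simp
qed

text \<open>The assumption \<open>big\<close> says that \<open>n0\<close> copies per token are
  enough to compete with \<open>N\<close>: either the slots are many or the blocks are.\<close>

lemma selection_drift:
  assumes z: "starts z" and n0: "\<And>x. x \<in> active z \<Longrightarrow> n0 \<le> card (holders z x)"
    and big: "real N / 4 \<le> (real (slots N) + real (card (active z)) / real msize) * real n0"
  shows "(\<integral>\<^sup>+z1. Zpot (cut (av z) (GT z1)) \<partial>kern z) \<le> ennreal (1 - 1 / 144) * Zpot (av z)"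
proof -
  have zz: "reach z" "N \<le> time z" "base z" using z by (auto simp: starts_def)
  obtain h where h: "kern z = map_pmf h priorities" "\<And>g. g \<in> set_pmf priorities \<Longrightarrow> GM (h g) = elected z g \<and>
     (\<forall>v\<in>V. acts (h g) v = acts z v) \<and> regs_ok (acts z) (elected z g)"
    using kern_starts[OF z] by blast
  have sub: "Cov (acts z) (elected z g) \<subseteq> GT (h g)" if g: "g \<in> set_pmf priorities" for g
  proof -
    have "GB (acts (h g)) (elected z g) = GB (acts z) (elected z g)" using h(2)[OF g]
        by (intro GB_cong) auto
    then show ?thesis using Cov_GB h(2)[OF g] by (simp add: GT_def)
  qed
  let ?R = "active z" and ?y = "\<lambda>x. real (card (holders z x))" and ?C = "\<lambda>g. Cov (acts z) (elected z g)"
  have "(\<integral>\<^sup>+z1. Zpot (cut (av z) (GT z1)) \<partial>kern z) = (\<integral>\<^sup>+g. Zpot (cut (av z) (GT (h g))) \<partial>priorities)"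
    by (simp add: h(1))
  also have "\<dots> \<le> (\<integral>\<^sup>+g. Zpot (cut (av z) (?C g)) \<partial>priorities)"
    using sub by (intro nn_integral_mono_pmf Zpot_mono) (auto simp: cut_def)
  also have "\<dots> \<le> ennreal (1 - (1 / 72) / 2) * Zpot (av z)"
  proof (cases "?R = {}")
    case True
    then show ?thesis using zz by (simp add: Zpot_cut)
  next
    case False
    define \<Phi> where "\<Phi> = (\<Sum>x\<in>?R. ?y x)"
    have yp: "0 < ?y x" if "x \<in> ?R" for x using that holders_ne[of z x] fin_holders
        by (simp add: card_gt_0_iff)
    have \<Phi>: "0 < \<Phi>" unfolding \<Phi>_def using False fin_active' yp by (intro sum_pos) auto
    define B where "B = (\<Sum>v\<in>V. load z v)"
    let ?a = "\<lambda>x. let p = ?y x / (8 * (real N + B)) in slots N * p / (1 + slots N * p)"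
    have m: "0 < real msize" using msize_pos by simp
    have q: "0 < real (slots N)" using slots_le by simp
    have \<Phi>v: "\<Phi> = (\<Sum>v\<in>V. real (card (actv z v)))"
    proof -
      have "(\<Sum>v\<in>V. real (card (actv z v))) = (\<Sum>x\<in>?R. real (card {v\<in>V. x \<in> actv z v}))"
        using fin_active' by (intro sum_card_holders) (auto simp: active_def)
      then show ?thesis by (simp add: \<Phi>_def holders_def)
    qed
    have Ble: "real B \<le> real N + \<Phi> / msize"
    proof -
      have "real B = (\<Sum>v\<in>V. real (load z v))" by (simp add: B_def)
      also have "\<dots> \<le> (\<Sum>v\<in>V. real (card (actv z v)) / msize + 1)"
        using nblocks_real[OF msize_pos] length_acts[OF zz(3)] by (intro sum_mono) (simp add: load_def)
      also have "\<dots> = \<Phi> / msize + n" using card_V by (simp add: sum.distrib \<Phi>v sum_divide_distrib)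
      also have "\<dots> \<le> real N + \<Phi> / msize" using n_le_N by simp
      finally show ?thesis .
    qed
    have "(\<integral>\<^sup>+g. ennreal ((\<Sum>x\<in>?R - ?C g. ?y x) * exp (real (card (?R - ?C g)) / c0)) \<partial>priorities)
        \<le> ennreal (1 - (1 / 72) / 2) * ennreal (\<Phi> * exp (real (card ?R) / c0))"
    proof (rule removal_drift[where y = ?y and a = ?a])
      show "real (card (?C g \<inter> ?R)) \<le> c0" for g
      proof -
        have "finite (?C g)" unfolding Cov_def by auto
        then have "card (?C g \<inter> ?R) \<le> card (?C g)" by (intro card_mono) auto
        also have "\<dots> \<le> slots N * msize" by (rule card_Cov)
        finally have "real (card (?C g \<inter> ?R)) \<le> real (slots N * msize)" by (rule of_nat_mono)
        then show ?thesis by (simp add: c0_def)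
      qed
      show "?a x \<le> measure_pmf.prob priorities {g. x \<in> ?C g}" for x
        using prob_covered[OF z, of x] by (simp add: B_def Let_def)
      show "1 / 72 * (?y x / \<Phi>) \<le> ?a x * (?y x / \<Phi> + 1 / c0)" if x: "x \<in> ?R" for x
      proof -
        let ?m = "real msize" and ?q = "real (slots N)"
        define W where "W = 8 * (real N + B)"
        \<comment> \<open>With this \<open>Q\<close> the claim for \<open>x\<close> becomes
          \<open>W + ?q * ?y x \<le> 72 * Q\<close>. The part \<open>16 * N\<close> of
          \<open>W\<close> costs \<open>64 * Q\<close> because of \<open>N / 4 \<le> Q\<close>, and
          the remaining terms cost at most \<open>8 * Q\<close>.\<close>
        define Q where "Q = ?q * ?y x + \<Phi> / ?m"
        have W: "0 < W" using N_pos by (simp add: W_def)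
        have qy: "0 \<le> ?q * ?y x" by simp
        have "u * (y / W) / (1 + u * (y / W)) = u * y / (W + u * y)" for u y :: real
          using W by (simp add: field_simps)
        then have a: "?a x = ?q * ?y x / (W + ?q * ?y x)" by (simp only: W_def Let_def)
        have w: "?y x / \<Phi> + 1 / c0 = (?y x / \<Phi>) * (Q / (?q * ?y x))"
          using yp[OF x] \<Phi> m q by (simp add: Q_def c0_def field_simps)
        have n0y: "real n0 \<le> ?y x" using n0[OF x] by simp
        have "real (card ?R) * n0 \<le> \<Phi>"
        proof -
          have "real (card ?R) * n0 = (\<Sum>x\<in>?R. real n0)" by simp
          also have "\<dots> \<le> \<Phi>" unfolding \<Phi>_def using n0 by (intro sum_mono) simp
          finally show ?thesis .
        qed
        then have "card ?R / ?m * n0 \<le> \<Phi> / ?m" using m by (simp add: divide_right_mono)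
        moreover have "?q * n0 \<le> ?q * ?y x" using n0y by (intro mult_left_mono) auto
        moreover have "real N / 4 \<le> ?q * n0 + card ?R / ?m * n0" using big unfolding distrib_right .
        ultimately have "real N / 4 \<le> Q" unfolding Q_def by linarith
        moreover have "W \<le> 16 * real N + 8 * (\<Phi> / ?m)" using Ble by (simp add: W_def)
        moreover have "0 \<le> \<Phi> / ?m" using \<Phi> by simp
        moreover have "w + u \<le> 72 * (u + f)" if "l / 4 \<le> u + f" "w \<le> 16 * l + 8 * f" "0 \<le> f" "0 \<le> u"
            for w u f l :: real
          using that by (simp add: field_simps)
        ultimately have "W + ?q * ?y x \<le> 72 * Q" using qy unfolding Q_def by blast
        then have "1 / 72 \<le> Q / (W + ?q * ?y x)" using W qy by (simp add: field_simps add_pos_nonneg)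
        then have "1 / 72 * (?y x / \<Phi>) \<le> Q / (W + ?q * ?y x) * (?y x / \<Phi>)"
          using yp[OF x] \<Phi> by (intro mult_right_mono) auto
        also have "\<dots> = ?a x * (?y x / \<Phi> + 1 / c0)"
          unfolding a w using yp[OF x] q by (simp add: field_simps)
        finally show ?thesis .
      qed
    qed (use fin_active' yp \<Phi> c0_pos \<Phi>_def in auto)
    then show ?thesis using zz by (simp add: Zpot_cut Zpot_av \<Phi>_def)
  qed
  finally show ?thesis by simp
qed

end

section \<open>Cycles and epochs\<close>

lemma run_run: "run (run K m) j z = run K (j * m) z"
proof (induction j)
  case (Suc j)
  have "run K (Suc j * m) z = bind_pmf (run K (j * m) z) (run K m)"
    by (subst run_add[symmetric]) (simp add: add.commute)
  then show ?case using Suc by simp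
qed simp

lemma one_minus_le_exp: "1 - x \<le> exp (- x :: real)"
  using exp_ge_add_one_self[of "- x"] by simp

context dynamic
begin

abbreviation cyc_kern :: "state \<Rightarrow> state pmf" where "cyc_kern \<equiv> run kern (4 * T)"

definition at_cycle :: "nat \<Rightarrow> state \<Rightarrow> bool" where
  "at_cycle c z \<longleftrightarrow> reach z \<and> time z = N + c * (4 * T)"

lemma at_cycle_step: "at_cycle c z \<Longrightarrow> z' \<in> set_pmf (cyc_kern z) \<Longrightarrow> at_cycle (Suc c) z'"
  using reach_run time_run unfolding at_cycle_def by (fastforce simp: algebra_simps)

lemma at_cycle_run: "at_cycle c z \<Longrightarrow> z' \<in> set_pmf (run cyc_kern j z) \<Longrightarrow> at_cycle (c + j) z'"
  by (induction j arbitrary: z') (auto dest: at_cycle_step)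

lemma cyc_split: "cyc_kern z = bind_pmf (run kern T z) (run kern (3 * T))"
proof -
  have "4 * T = T + 3 * T" by simp
  then show ?thesis by (simp only: run_add)
qed

lemma active_run_subset: "reach z \<Longrightarrow> N \<le> time z \<Longrightarrow> z' \<in> set_pmf (run kern j z) \<Longrightarrow> active z' \<subseteq> active z"
proof -
  assume z: "reach z" "N \<le> time z" and z': "z' \<in> set_pmf (run kern j z)"
  let ?P = "\<lambda>j x. reach x \<and> N \<le> time x \<and> active x \<subseteq> active z"
  have "?P j z'"
    by (rule run_invariant[OF z', where P = ?P])
      (use z active_decreasing reach_kern time_kern in \<open>auto, blast\<close>)
  then show ?thesis by blast
qed

lemma active_run_cycles: "at_cycle c z \<Longrightarrow> z' \<in> set_pmf (run cyc_kern j z) \<Longrightarrow> active z' \<subseteq> active z"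
  unfolding run_run by (rule active_run_subset[rotated 2]) (auto simp: at_cycle_def)

lemma gather_phase_run:
  assumes "at_cycle c z" "z' \<in> set_pmf (run kern j z)" "j \<le> T"
  shows "reach z' \<and> time z' = N + c * (4 * T) + j \<and> active z' = active z"
proof -
  let ?P = "\<lambda>j x. reach x \<and> time x = N + c * (4 * T) + j \<and> active x = active z"
  show ?thesis
  proof (rule run_invariant[OF assms(2), where P = ?P])
    show "?P 0 z" using assms(1) by (simp add: at_cycle_def)
    fix i x x' assume i: "i < j" and P: "?P i x" and x': "x' \<in> set_pmf (kern x)"
    have "gph (time x) = 0" using position_at[of 0 i c] P i assms(3) by simp
    then show "?P (Suc i) x'"
      using growth_step(2)[OF _ _ x'] reach_kern[OF _ x'] time_kern[OF x'] P by simp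
  qed
qed

lemma gather_phase_drift:
  assumes z: "at_cycle c z" "gathering N c" and n0: "n0 \<le> n" and \<beta>: "0 < (\<beta>::nat)" "nblocks msize (card (active z)) \<le> \<beta>"
  shows "(\<integral>\<^sup>+z'. spot n0 x z' \<partial>cyc_kern z) \<le> ennreal (1 - 1 / (2 * real \<beta>)) ^ T * spot n0 x z"
proof -
  have z0: "reach z" "time z = N + c * (4 * T)" using z(1) by (auto simp: at_cycle_def)
  have G: "reach y \<and> time y = time z + j \<and> active y = active z" if "y \<in> set_pmf (run kern j z)" "j \<le> T"
      for y j
    using gather_phase_run[OF z(1) that] z0(2) by simp
  have later: "spot n0 x z2 \<le> spot n0 x z1" if z1: "z1 \<in> set_pmf (run kern T z)" and z2: "z2 \<in> set_pmf (run kern (3 * T) z1)" for z1 z2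
  proof -
    have t1: "reach z1" "time z1 = N + c * (4 * T) + T" using G[OF z1] z0(2) by auto
    have "reach z2 \<and> time z2 = time z1 + 3 * T \<and> spot n0 x z2 \<le> spot n0 x z1"
    proof (rule run_invariant[OF z2, where P = "\<lambda>j y. reach y \<and> time y = time z1 + j \<and> spot n0 x y \<le> spot n0 x z1"])
      fix i y y' assume i: "i < 3 * T" and P: "reach y \<and> time y = time z1 + i \<and> spot n0 x y \<le> spot n0 x z1" and y': "y' \<in> set_pmf (kern y)"
      have "time y = N + c * (4 * T) + (i div T + 1) * T + i mod T" using P t1(2)
          by (simp add: algebra_simps)
      moreover have "i div T < 3" using i T_pos by (simp add: less_mult_imp_div_less)
      ultimately have "gph (time y) = i div T + 1" using position_at[of "i div T + 1" "i mod T" c] T_pos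
          by simp
      then have "spot n0 x y' \<le> spot n0 x y" using P t1(2) by (intro spot_other[OF _ _ y']) auto
      then show "reach y' \<and> time y' = time z1 + Suc i \<and> spot n0 x y' \<le> spot n0 x z1"
        using P reach_kern[OF _ y'] time_kern[OF y'] by auto
    qed (use t1 in simp)
    then show ?thesis by blast
  qed
  have "(\<integral>\<^sup>+z'. spot n0 x z' \<partial>cyc_kern z) = (\<integral>\<^sup>+z1. (\<integral>\<^sup>+z2. spot n0 x z2 \<partial>run kern (3 * T) z1) \<partial>run kern T z)"
    unfolding cyc_split by simp
  also have "\<dots> \<le> (\<integral>\<^sup>+z1. spot n0 x z1 \<partial>run kern T z)"
  proof (rule nn_integral_mono_pmf)
    fix z1 assume z1: "z1 \<in> set_pmf (run kern T z)"
    have "(\<integral>\<^sup>+z2. spot n0 x z2 \<partial>run kern (3 * T) z1) \<le> (\<integral>\<^sup>+z2. spot n0 x z1 \<partial>run kern (3 * T) z1)"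
      using later[OF z1] by (intro nn_integral_mono_pmf)
    then show "(\<integral>\<^sup>+z2. spot n0 x z2 \<partial>run kern (3 * T) z1) \<le> spot n0 x z1" by simp
  qed
  also have "\<dots> \<le> ennreal (1 - 1 / (2 * real \<beta>)) ^ T * spot n0 x z"
  proof (rule drift)
    fix j y assume j: "j < T" and y: "y \<in> set_pmf (run kern j z)"
    have P: "reach y" "time y = N + c * (4 * T) + 0 * T + j" "active y = active z" using G[OF y] j z0(2)
        by auto
    have pos: "gph (time y) = 0" "gcyc (time y) = c" unfolding P(2) using j by (intro position_at; simp)+
    have "nblocks msize (card (av y v)) \<le> \<beta>" if "v \<in> V" for v
    proof -
      have "card (av y v) \<le> card (active y)" using fin_active' that
          by (intro card_mono) (auto simp: active_av)
      then have "nblocks msize (card (av y v)) \<le> nblocks msize (card (active y))" by (rule nblocks_mono)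
      then show ?thesis using \<beta>(2) P(3) by simp
    qed
    then show "(\<integral>\<^sup>+z''. spot n0 x z'' \<partial>kern y) \<le> ennreal (1 - 1 / (2 * real \<beta>)) * spot n0 x y"
      using P pos z(2) n0 \<beta>(1) by (intro gather_drift) auto
  qed
  finally show ?thesis .
qed

lemma quiet_gather:
  assumes "at_cycle c z" "\<not> gathering N c" "z' \<in> set_pmf (run kern T z)"
  shows "reach z' \<and> time z' = N + c * (4 * T) + T \<and> av z' = av z"
proof -
  have z0: "reach z" "time z = N + c * (4 * T)" using assms(1) by (auto simp: at_cycle_def)
  have "reach z' \<and> time z' = time z + T \<and> av z' = av z"
  proof (rule run_invariant[OF assms(3), where P = "\<lambda>j x. reach x \<and> time x = time z + j \<and> av x = av z"])
    fix i x x' assume i: "i < T" and P: "reach x \<and> time x = time z + i \<and> av x = av z" and x': "x' \<in> set_pmf (kern x)"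
    have tx: "time x = N + c * (4 * T) + 0 * T + i" using P z0(2) by simp
    have pos: "gph (time x) = 0" "gcyc (time x) = c" unfolding tx using i by (intro position_at; simp)+
    then have "av x' = av x" using quiet_step[OF _ _ x'] P z0(2) assms(2) by simp
    then show "reach x' \<and> time x' = time z + Suc i \<and> av x' = av z"
      using reach_kern[OF _ x'] time_kern[OF x'] P by simp
  qed (use z0 in simp)
  then show ?thesis using z0 by simp
qed

lemma quiet_cycle:
  assumes z: "at_cycle c z" "\<not> gathering N c" and z': "z' \<in> set_pmf (cyc_kern z)"
  shows "\<exists>D. av z' = (\<lambda>v. av z v - D)"
proof -
  have z0: "reach z" "time z = N + c * (4 * T)" using z(1) by (auto simp: at_cycle_def)
  have "reach z' \<and> time z' = time z + 4 * T \<and> (\<exists>D. av z' = (\<lambda>v. av z v - D))"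
  proof (rule run_invariant[OF z', where P = "\<lambda>j x. reach x \<and> time x = time z + j \<and> (\<exists>D. av x = (\<lambda>v. av z v - D))"])
    show "reach z \<and> time z = time z + 0 \<and> (\<exists>D. av z = (\<lambda>v. av z v - D))"
      using z0 by (intro conjI exI[of _ "{}"]) auto
  next
    fix i x x' assume i: "i < 4 * T" and P: "reach x \<and> time x = time z + i \<and> (\<exists>D. av x = (\<lambda>v. av z v - D))"
      and x': "x' \<in> set_pmf (kern x)"
    have tx: "time x = N + c * (4 * T) + (i div T) * T + i mod T" using P z0(2) by simp
    have "i div T < 4" using i T_pos by (simp add: less_mult_imp_div_less)
    then have pos: "gph (time x) = i div T" "gcyc (time x) = c" unfolding tx using T_pos
        by (intro position_at; simp)+
    have Nx: "N \<le> time x" using P z0(2) by simp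
    have "\<exists>D. av x' = (\<lambda>v. av x v - D)"
    proof (cases "gph (time x) = 3")
      case True
      then show ?thesis using removal_step[OF _ Nx x'] P by blast
    next
      case False
      then have "av x' = av x" using quiet_step[OF _ Nx x'] P pos z(2) gph_less[of "time x"] by force
      then show ?thesis by (intro exI[of _ "{}"]) simp
    qed
    then obtain D' where D': "av x' = (\<lambda>v. av x v - D')" by blast
    obtain D where "av x = (\<lambda>v. av z v - D)" using P by blast
    then have "av x' = (\<lambda>v. av z v - (D \<union> D'))" using D' by (auto simp: fun_eq_iff)
    then show "reach x' \<and> time x' = time z + Suc i \<and> (\<exists>D. av x' = (\<lambda>v. av z v - D))"
      using reach_kern[OF _ x'] time_kern[OF x'] P by auto
  qed
  then show ?thesis by blast
qed

definition spread_out :: "nat \<Rightarrow> state \<Rightarrow> bool" where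
  "spread_out n0 z \<longleftrightarrow> (\<forall>x\<in>active z. n0 \<le> card (holders z x))"

text \<open>Without gathering, tokens are only removed, and from all nodes together; the survivors
  keep their holders.\<close>

lemma spread_out_cycle:
  assumes "at_cycle c z" "\<not> gathering N c" "z' \<in> set_pmf (cyc_kern z)" "spread_out n0 z"
  shows "spread_out n0 z'"
proof -
  obtain D where D: "av z' = (\<lambda>v. av z v - D)" using quiet_cycle[OF assms(1-3)] by blast
  have "holders z' x = holders z x \<and> x \<in> active z" if "x \<in> active z'" for x
    using that unfolding holders_av active_av D by auto
  then show ?thesis using assms(4) by (simp add: spread_out_def)
qed

text \<open>The constant 149/150 absorbs 1 - 1/144 from the selection and the failure probability of
  coding.\<close>

lemma quiet_cycle_drift:
  assumes z: "at_cycle c z" "\<not> gathering N c" and n0: "spread_out n0 z"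
    and big: "real N / 4 \<le> (real (slots N) + real (card (active z)) / real msize) * real n0"
  shows "(\<integral>\<^sup>+z'. Zpot (av z') \<partial>cyc_kern z) \<le> ennreal (149 / 150) * Zpot (av z)"
proof -
  have "(\<integral>\<^sup>+z2. Zpot (av z2) \<partial>run kern (3 * T) z1) \<le> ennreal (149 / 150) * Zpot (av z)"
    if z1: "z1 \<in> set_pmf (run kern T z)" for z1
  proof -
    note q = quiet_gather[OF z z1]
    have r1: "reach z1" "time z1 = N + c * (4 * T) + T" and av1: "av z1 = av z" using q by auto
    have same: "active z1 = active z" "holders z1 x = holders z x" for x using av1
        by (simp_all add: active_av holders_av)
    have N1: "N \<le> time z1" using r1 by simp
    have "(\<integral>\<^sup>+z2. Zpot (cut (av z1) (GT z2)) \<partial>kern z1) \<le> ennreal (1 - 1 / 144) * Zpot (av z1)"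
      using r1(1) N1
    proof (cases rule: late_cases)
      case 1
      then have "active z1 = {}" by (auto simp: active_av finished_av)
      then have "Zpot (cut (av z1) D) = 0" for D using Zpot_cut[OF r1(1) N1] by simp
      then show ?thesis by simp
    next
      case 2
      have "gph (time z1) = 1" "goff (time z1) = 0" using position_at[of 1 0 c] T_pos r1(2) by auto
      then have "starts z1" using r1 N1 2 by (simp add: starts_def)
      then show ?thesis using n0 big same by (intro selection_drift) (auto simp: spread_out_def)
    qed
    then have "(\<integral>\<^sup>+z2. Zpot (av z2) \<partial>run kern (3 * T) z1) \<le> ennreal (1 - 1 / 144) * Zpot (av z1) + Zpot (av z1) * eps"
      using selection[OF Zpot_mono r1] by (meson add_right_mono order.trans)
    also have "\<dots> \<le> ennreal (1 - 1 / 144) * Zpot (av z1) + Zpot (av z1) * ennreal (1 / 2 ^ 18)"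
      by (intro add_left_mono mult_left_mono eps_le) simp
    also have "\<dots> = (ennreal (1 - 1 / 144) + ennreal (1 / 2 ^ 18)) * Zpot (av z1)"
      by (simp only: distrib_right mult.commute[of "Zpot (av z1)"])
    also have "ennreal (1 - 1 / 144) + ennreal (1 / 2 ^ 18) = ennreal (1 - 1 / 144 + 1 / 2 ^ 18)"
      by (rule ennreal_plus[symmetric]) auto
    also have "ennreal (1 - 1 / 144 + 1 / 2 ^ 18) * Zpot (av z1) \<le> ennreal (149 / 150) * Zpot (av z1)"
      by (intro mult_right_mono ennreal_leI) auto
    finally show ?thesis by (simp add: av1)
  qed
  then have "(\<integral>\<^sup>+z'. Zpot (av z') \<partial>cyc_kern z) \<le> (\<integral>\<^sup>+z1. ennreal (149 / 150) * Zpot (av z) \<partial>run kern T z)"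
    unfolding cyc_split nn_integral_bind_pmf by (intro nn_integral_mono_pmf)
  then show ?thesis by simp
qed

section \<open>Epochs: a gathering half and a quiet half, \<open>R\<close> cycles each\<close>

abbreviation R where "R \<equiv> reps N"
text \<open>The capacity of a leader in one cycle. It also serves as the progress demanded from a
  whole epoch of random blocks.\<close>

definition L :: nat where "L = lead N * msize"

lemma R_eq: "R = 2000 * lg N" and L_pos: "0 < L"
  using lead_le msize_pos by (auto simp: reps_def L_def)

lemma epoch_gathering:
  "i < R \<Longrightarrow> gathering N (e * (2 * R) + i)" "i < R \<Longrightarrow> \<not> gathering N (e * (2 * R) + R + i)"
proof -
  assume i: "i < R"
  have "(e * (2 * R) + i) mod (2 * R) = i" using i by simp
  then show "gathering N (e * (2 * R) + i)" using i by (simp add: gathering_def)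
  have "(R + i + e * (2 * R)) mod (2 * R) = (R + i) mod (2 * R)" by (rule mod_mult_self1)
  then have "(e * (2 * R) + R + i) mod (2 * R) = R + i" using i by (simp add: add.assoc add.commute)
  then show "\<not> gathering N (e * (2 * R) + R + i)" by (simp add: gathering_def)
qed

lemma slots_lg_ge: "lead N \<le> 2 * (slots N * lg N)"
proof -
  have "lead N < (lead N div lg N + 1) * lg N" using lg_pos dividend_less_div_times[of "lg N" "lead N"]
      by simp
  also have "\<dots> \<le> (2 * slots N) * lg N" by (intro mult_right_mono) (auto simp: slots_def)
  finally show ?thesis by simp
qed

text \<open>Retiring \<open>L\<close> tokens changes the exponent in \<open>Zpot\<close> by O(lg N)
  only. This is what O(lg N) cycles with a constant drift can pay for.\<close>

lemma L_c0: "real L / c0 \<le> 2 * lg N"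
proof -
  have "real L / c0 = real (lead N) / real (slots N)" using msize_pos by (simp add: L_def c0_def)
  moreover have "real (lead N) \<le> real (2 * (slots N * lg N))" using slots_lg_ge by (rule of_nat_mono)
  ultimately show ?thesis using slots_le by (simp add: divide_le_eq mult.commute mult.left_commute)
qed

lemma N_exp: "real N \<le> exp (lg N)"
proof -
  have "real N \<le> 2 ^ lg N" using lg_N(3) by (metis less_imp_le of_nat_le_iff of_nat_numeral of_nat_power)
  also have "\<dots> \<le> exp 1 ^ lg N" using exp_ge_add_one_self[of 1] by (intro power_mono) auto
  also have "\<dots> = exp (lg N)" by (simp add: exp_of_nat_mult[symmetric])
  finally show ?thesis .
qed

definition stuck :: "state \<Rightarrow> state \<Rightarrow> bool" where
  "stuck z z' \<longleftrightarrow> active z' \<noteq> {} \<and> card (active z) < card (active z') + L"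

lemma Zpot_ge:
  assumes "reach z" "N \<le> time z" "active z \<noteq> {}"
  shows "ennreal (exp (real (card (active z)) / c0)) \<le> Zpot (av z)"
proof -
  have "0 < card (holders z x)" if "x \<in> active z" for x
    using that holders_ne[of z x] fin_holders by (simp add: card_gt_0_iff)
  then have "(\<Sum>x\<in>active z. 1) \<le> (\<Sum>x\<in>active z. real (card (holders z x)))"
    by (intro sum_mono) (simp add: Suc_le_eq)
  moreover have "1 \<le> (\<Sum>x\<in>active z. 1::real)" using assms(3) fin_active'
      by (simp add: Suc_le_eq card_gt_0_iff)
  ultimately have "1 \<le> (\<Sum>x\<in>active z. real (card (holders z x)))" by linarith
  then show ?thesis
    unfolding Zpot_av[OF assms(1,2)] by (intro ennreal_leI) (simp add: mult_le_cancel_right1)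
qed

lemma Zpot_le:
  assumes "reach z" "N \<le> time z"
  shows "Zpot (av z) \<le> ennreal (real N * real N * exp (real (card (active z)) / c0))"
proof -
  have a: "card (active z) \<le> N"
    using card_mono[OF fin_toks active_toks[OF assms]] card_toks k_le n_le_N by linarith
  have "(\<Sum>x\<in>active z. real (card (holders z x))) \<le> (\<Sum>x\<in>active z. real N)"
    using holders_le n_le_N by (intro sum_mono) (meson le_trans of_nat_le_iff)
  also have "\<dots> \<le> real N * real N" using a by (simp add: mult_right_mono)
  finally show ?thesis unfolding Zpot_av[OF assms] by (intro ennreal_leI mult_right_mono) auto
qed

text \<open>The drift gains exp (-13 lg N) in the quiet half. The copies account for
  \<open>N * N\<close> and the exponent of \<open>L\<close> tokens for exp (2 lg N), which leaves
  exp (-9 lg N).\<close>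

lemma second_half:
  assumes z0: "k0 = card (active z0)" and z: "at_cycle (e * (2 * R) + R) z" "spread_out n0 z" "card (active z) \<le> k0"
    and big: "\<And>k. k0 < k + L \<Longrightarrow> real N / 4 \<le> (real (slots N) + real k / real msize) * real n0"
  shows "(\<integral>\<^sup>+z'. indicator {z'. stuck z0 z'} z' \<partial>run cyc_kern R z) \<le> ennreal (exp (- 9 * real (lg N)))"
proof -
  let ?E = "exp ((real L - real k0) / c0)"
  \<comment> \<open>The potential is dropped once \<open>L\<close> tokens are retired, since
    \<open>big\<close> is available only before. As active sets only shrink, it then stays
    zero.\<close>
  define f where "f z = (if k0 < card (active z) + L then Zpot (av z) else 0)" for z
  have P: "at_cycle (e * (2 * R) + R + j) y \<and> spread_out n0 y"
      if y: "y \<in> set_pmf (run cyc_kern j z)" "j \<le> R" for j y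
  proof (rule run_invariant[OF y(1), where P = "\<lambda>j y. at_cycle (e * (2 * R) + R + j) y \<and> spread_out n0 y"])
    fix i x x' assume i: "i < j" and P: "at_cycle (e * (2 * R) + R + i) x \<and> spread_out n0 x" and x': "x' \<in> set_pmf (cyc_kern x)"
    have "\<not> gathering N (e * (2 * R) + R + i)" using epoch_gathering(2) i y(2) by simp
    then show "at_cycle (e * (2 * R) + R + Suc i) x' \<and> spread_out n0 x'"
      using P at_cycle_step[OF _ x'] spread_out_cycle[OF _ _ x'] by (metis add_Suc_right)
  qed (use z in simp)
  have "(\<integral>\<^sup>+z'. f z' \<partial>run cyc_kern R z) \<le> ennreal (149 / 150) ^ R * f z"
  proof (rule drift)
    fix j y assume j: "j < R" and y: "y \<in> set_pmf (run cyc_kern j z)"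
    have Py: "at_cycle (e * (2 * R) + R + j) y" "spread_out n0 y" using P[OF y] j by auto
    have dec: "card (active y') \<le> card (active y)" if "y' \<in> set_pmf (cyc_kern y)" for y'
      using active_run_subset[OF _ _ that] Py(1) fin_active'
          by (intro card_mono) (auto simp: at_cycle_def)
    show "(\<integral>\<^sup>+y'. f y' \<partial>cyc_kern y) \<le> ennreal (149 / 150) * f y"
    proof (cases "k0 < card (active y) + L")
      case True
      have "(\<integral>\<^sup>+y'. f y' \<partial>cyc_kern y) \<le> (\<integral>\<^sup>+y'. Zpot (av y') \<partial>cyc_kern y)"
        by (intro nn_integral_mono_pmf) (simp add: f_def)
      also have "\<dots> \<le> ennreal (149 / 150) * Zpot (av y)"
        using epoch_gathering(2)[OF j] big[OF True] Py by (intro quiet_cycle_drift)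
      finally show ?thesis using True by (simp add: f_def)
    next
      case False
      then have "f y' = 0" if "y' \<in> set_pmf (cyc_kern y)" for y' using dec[OF that] by (simp add: f_def)
      then have "(\<integral>\<^sup>+y'. f y' \<partial>cyc_kern y) \<le> (\<integral>\<^sup>+y'. 0 \<partial>cyc_kern y)" by (intro nn_integral_mono_pmf) simp
      then show ?thesis by simp
    qed
  qed
  also have "\<dots> \<le> ennreal (149 / 150) ^ R * ennreal (real N * real N * exp (real k0 / c0))"
  proof (intro mult_left_mono)
    have zt: "reach z" "N \<le> time z" using z(1) by (auto simp: at_cycle_def)
    have "f z \<le> Zpot (av z)" by (simp add: f_def)
    also have "\<dots> \<le> ennreal (real N * real N * exp (real (card (active z)) / c0))" by (rule Zpot_le[OF zt])
    also have "\<dots> \<le> ennreal (real N * real N * exp (real k0 / c0))"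
      using z(3) c0_pos by (intro ennreal_leI mult_left_mono) (auto intro!: divide_right_mono)
    finally show "f z \<le> ennreal (real N * real N * exp (real k0 / c0))" .
  qed simp
  finally have Ef: "(\<integral>\<^sup>+z'. f z' \<partial>run cyc_kern R z) \<le> ennreal ((149 / 150) ^ R * (real N * real N * exp (real k0 / c0)))"
    by (simp add: ennreal_mult ennreal_power)
  have "(\<integral>\<^sup>+z'. indicator {z'. stuck z0 z'} z' \<partial>run cyc_kern R z) \<le> (\<integral>\<^sup>+z'. ennreal ?E * f z' \<partial>run cyc_kern R z)"
  proof (rule nn_integral_mono_pmf)
    fix z' assume z': "z' \<in> set_pmf (run cyc_kern R z)"
    show "indicator {z'. stuck z0 z'} z' \<le> ennreal ?E * f z'"
    proof (cases "stuck z0 z'")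
      case True
      then have s: "active z' \<noteq> {}" "k0 < card (active z') + L" by (auto simp: stuck_def z0)
      have r: "reach z'" "N \<le> time z'" using P[OF z'] by (auto simp: at_cycle_def)
      have "1 \<le> ?E * exp (real (card (active z')) / c0)"
      proof -
        have "0 \<le> (real L - real k0) / c0 + real (card (active z')) / c0"
          using s(2) c0_pos by (simp add: add_divide_distrib[symmetric])
        then show ?thesis by (simp add: exp_add[symmetric])
      qed
      then have "1 \<le> ennreal (?E * exp (real (card (active z')) / c0))" by simp
      also have "\<dots> = ennreal ?E * ennreal (exp (real (card (active z')) / c0))"
          by (simp add: ennreal_mult)
      also have "\<dots> \<le> ennreal ?E * Zpot (av z')" by (intro mult_left_mono Zpot_ge r s(1)) simp
      finally show ?thesis using True s by (simp add: f_def)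
    qed simp
  qed
  also have "\<dots> = ennreal ?E * (\<integral>\<^sup>+z'. f z' \<partial>run cyc_kern R z)" by (simp add: nn_integral_cmult)
  also have "\<dots> \<le> ennreal ?E * ennreal ((149 / 150) ^ R * (real N * real N * exp (real k0 / c0)))"
    using Ef by (rule mult_left_mono) simp
  also have "\<dots> = ennreal (?E * ((149 / 150) ^ R * (real N * real N * exp (real k0 / c0))))"
    by (rule ennreal_mult[symmetric]) auto
  also have "\<dots> \<le> ennreal (exp (- 9 * real (lg N)))"
  proof (rule ennreal_leI)
    have e: "?E * exp (real k0 / c0) = exp (real L / c0)" using c0_pos
        by (simp add: exp_add[symmetric] diff_divide_distrib)
    \<comment> \<open>Here 2000 / 150 > 13 is used.\<close>
    have r: "(149 / 150 :: real) ^ R \<le> exp (- 13 * real (lg N))"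
    proof -
      have "(149 / 150 :: real) ^ R \<le> exp (- 1 / 150) ^ R" using one_minus_le_exp[of "1 / 150"]
          by (intro power_mono) auto
      also have "\<dots> = exp (real R * (- 1 / 150))" by (simp only: exp_of_nat_mult)
      also have "\<dots> \<le> exp (- 13 * real (lg N))" unfolding R_eq by simp
      finally show ?thesis .
    qed
    have "?E * ((149 / 150) ^ R * (real N * real N * exp (real k0 / c0))) = (149 / 150) ^ R * (real N * real N) * (?E * exp (real k0 / c0))"
      by simp
    also have "\<dots> \<le> exp (- 13 * real (lg N)) * (exp (lg N) * exp (lg N)) * exp (2 * lg N)"
      unfolding e using r N_exp L_c0 by (intro mult_mono) auto
    also have "\<dots> = exp (- 9 * real (lg N))" by (simp add: exp_add[symmetric])
    finally show "?E * ((149 / 150) ^ R * (real N * real N * exp (real k0 / c0))) \<le> exp (- 9 * real (lg N))" .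
  qed
  finally show ?thesis .
qed

text \<open>The sum over all tokens is a union bound. One \<open>\<beta>\<close> serves for the
  whole half, since a node's load never exceeds the number of active tokens, which only
  decreases.\<close>

lemma first_half:
  assumes z: "at_cycle (e * (2 * R)) z" and n0: "n0 \<le> n" and \<beta>: "0 < (\<beta>::nat)" "nblocks msize (card (active z)) \<le> \<beta>"
  shows "(\<integral>\<^sup>+z'. (\<Sum>x\<in>active z. spot n0 x z') \<partial>run cyc_kern R z)
    \<le> ennreal (real (card (active z)) * (2 ^ n0 * (1 - 1 / (2 * real \<beta>)) ^ (T * R)))"
proof -
  let ?\<rho> = "1 - 1 / (2 * real \<beta>)"
  have \<rho>: "0 \<le> ?\<rho>" using \<beta>(1) by simp
  have "(\<integral>\<^sup>+z'. (\<Sum>x\<in>active z. spot n0 x z') \<partial>run cyc_kern R z) \<le> (ennreal ?\<rho> ^ T) ^ R * (\<Sum>x\<in>active z. spot n0 x z)"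
  proof (rule drift)
    fix j y assume j: "j < R" and y: "y \<in> set_pmf (run cyc_kern j z)"
    have c: "at_cycle (e * (2 * R) + j) y" using at_cycle_run[OF z y] .
    have "card (active y) \<le> card (active z)" using active_run_cycles[OF z y] fin_active'
        by (intro card_mono) auto
    then have nb: "nblocks msize (card (active y)) \<le> \<beta>" using \<beta>(2) nblocks_mono le_trans by blast
    have "(\<integral>\<^sup>+y'. (\<Sum>x\<in>active z. spot n0 x y') \<partial>cyc_kern y) = (\<Sum>x\<in>active z. \<integral>\<^sup>+y'. spot n0 x y' \<partial>cyc_kern y)"
      by (rule nn_integral_sum) simp
    also have "\<dots> \<le> (\<Sum>x\<in>active z. ennreal ?\<rho> ^ T * spot n0 x y)"
      using gather_phase_drift[OF c epoch_gathering(1)[OF j] n0 \<beta>(1) nb] by (intro sum_mono)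
    also have "\<dots> = ennreal ?\<rho> ^ T * (\<Sum>x\<in>active z. spot n0 x y)" by (simp add: sum_distrib_left)
    finally show "(\<integral>\<^sup>+y'. (\<Sum>x\<in>active z. spot n0 x y') \<partial>cyc_kern y) \<le> ennreal ?\<rho> ^ T * (\<Sum>x\<in>active z. spot n0 x y)" .
  qed
  also have "\<dots> \<le> (ennreal ?\<rho> ^ T) ^ R * (\<Sum>x\<in>active z. 2 ^ n0)"
    by (intro mult_left_mono sum_mono) (auto simp: spot_def gap_le)
  also have "\<dots> = (ennreal ?\<rho> ^ T) ^ R * (of_nat (card (active z)) * 2 ^ n0)" by simp
  also have "\<dots> = ennreal (?\<rho> ^ (T * R)) * (ennreal (real (card (active z))) * ennreal (2 ^ n0))"
    using \<rho> by (simp add: ennreal_power power_mult ennreal_of_nat_eq_real_of_nat flip: ennreal_numeral)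
  also have "\<dots> = ennreal (real (card (active z)) * (2 ^ n0 * ?\<rho> ^ (T * R)))"
    using \<rho> by (simp add: ennreal_mult[symmetric] mult_ac)
  finally show ?thesis .
qed

lemma epoch:
  assumes z: "at_cycle (e * (2 * R)) z"
  shows "(\<integral>\<^sup>+z'. indicator {z'. stuck z z'} z' \<partial>run cyc_kern (2 * R) z) \<le> ennreal (1 / (2 * real N))"
proof (cases "active z = {}")
  case True
  have "\<not> stuck z z'" if "z' \<in> set_pmf (run cyc_kern (2 * R) z)" for z'
    using active_run_cycles[OF z that] True by (simp add: stuck_def)
  then have "(\<integral>\<^sup>+z'. indicator {z'. stuck z z'} z' \<partial>run cyc_kern (2 * R) z) \<le> (\<integral>\<^sup>+z'. 0 \<partial>run cyc_kern (2 * R) z)"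
    by (intro nn_integral_mono_pmf) simp
  then show ?thesis by simp
next
  case False
  define k0 where "k0 = card (active z)"
  define \<beta> where "\<beta> = nblocks msize k0"
  \<comment> \<open>As many holders as \<open>T * R\<close> rounds guarantee: the bound from
    \<open>first_half\<close> is at most exp (n0 - T R / (2 \<beta>)) per token, and half of the
    exponent is reserved for the error probability.\<close>
  define n0 where "n0 = min n (T * R div (4 * \<beta>))"
  have zt: "reach z" "N \<le> time z" using z by (auto simp: at_cycle_def)
  have k0: "0 < k0" "k0 \<le> N"
    using False fin_active' card_mono[OF fin_toks active_toks[OF zt]] card_toks k_le n_le_N
    by (auto simp: k0_def card_gt_0_iff)
  have \<beta>: "0 < \<beta>" "\<beta> \<le> N" "real \<beta> \<le> k0 / msize + 1"
    using nblocks_pos[OF msize_pos k0(1)] nblocks_le[OF msize_pos, of k0] nblocks_real[OF msize_pos, of k0] k0(2)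
    by (auto simp: \<beta>_def)
  have TR: "real (T * R) = 128000 * (real N * real (lg N))" by (simp add: rounds_def R_eq)
  have big0: "32000 * real (lg N) \<le> real (T * R) / (4 * \<beta>)"
  proof -
    have "real \<beta> * real (lg N) \<le> real N * real (lg N)" using \<beta>(2) by (intro mult_right_mono) auto
    then show ?thesis unfolding TR using \<beta>(1) by (simp add: field_simps)
  qed
  have lg1: "1 \<le> real (lg N)" using lg_pos by simp
  \<comment> \<open>If \<open>n0 < n\<close>, then \<open>n0\<close> is of order
    \<open>N * lg N / \<beta>\<close>. Before \<open>L\<close> tokens are gone,
    \<open>\<beta> \<le> 3 * lg N * ?S\<close>: the tokens still missing fill
    \<open>k' / msize\<close> blocks and those retired at most \<open>lead N\<close>, which is at
    most \<open>2 * slots N * lg N\<close>. The logarithms cancel.\<close>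
  have big: "real N / 4 \<le> (real (slots N) + real k' / real msize) * real n0" if k': "k0 < k' + L" for k'
  proof -
    let ?S = "real (slots N) + real k' / real msize"
    have S1: "1 \<le> ?S" using slots_le by (simp add: add_increasing2)
    show ?thesis
    proof (cases "n \<le> T * R div (4 * \<beta>)")
      case True
      have "real N / 4 \<le> 1 * real n" using N_le by simp
      also have "\<dots> \<le> ?S * real n" using S1 by (intro mult_right_mono) auto
      finally show ?thesis using True by (simp add: n0_def)
    next
      case False
      then have n0e: "n0 = T * R div (4 * \<beta>)" by (simp add: n0_def)
      have "T * R < (n0 + 1) * (4 * \<beta>)" unfolding n0e
          using \<beta>(1) dividend_less_div_times[of "4 * \<beta>" "T * R"] by simp
      then have "real (T * R) < real ((n0 + 1) * (4 * \<beta>))" by (rule of_nat_less_iff[THEN iffD2])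
      then have "real (T * R) / (4 * \<beta>) < real n0 + 1" using \<beta>(1) by (simp add: field_simps)
      then have n0g: "real (T * R) / (8 * \<beta>) \<le> real n0"
        using big0 lg1 by (simp add: field_simps)
      have "\<beta> \<le> 3 * real (lg N) * ?S"
      proof -
        have m: "0 < real msize" using msize_pos by simp
        have "real k0 \<le> real k' + real L" using k' by linarith
        then have "real k0 / msize \<le> real k' / msize + real L / msize" using m
            by (simp add: divide_right_mono flip: add_divide_distrib)
        also have "real L / msize = real (lead N)" using m by (simp add: L_def)
        also have "real (lead N) \<le> 2 * (real (slots N) * real (lg N))" using slots_lg_ge
            by (metis of_nat_le_iff of_nat_mult of_nat_numeral)
        finally have "real k0 / msize \<le> real k' / msize + 2 * (real (slots N) * real (lg N))" by simp
        also have "real k' / msize \<le> 2 * real (lg N) * (real k' / msize)"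
          using lg1 mult_right_mono[of 1 "2 * real (lg N)" "real k' / real msize"] by simp
        finally have 1: "real k0 / msize \<le> 2 * real (lg N) * ?S" by (simp add: algebra_simps)
        have "1 * 1 \<le> real (lg N) * ?S" using lg1 S1 by (intro mult_mono) auto
        moreover have "x \<le> 3 * w * u" if "1 * 1 \<le> w * u" "y \<le> 2 * w * u" "x \<le> y + 1" for x y w u :: real
          using that by (simp add: mult.assoc)
        ultimately show ?thesis using 1 \<beta>(3) by blast
      qed
      then have "real N / 4 * \<beta> \<le> real N / 4 * (3 * real (lg N) * ?S)" by (intro mult_left_mono) auto
      also have "\<dots> \<le> 16000 * (real N * real (lg N)) * ?S" using S1 by (simp add: mult_mono)
      finally have "real N / 4 \<le> 16000 * (real N * real (lg N)) / \<beta> * ?S" using \<beta>(1)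
          by (simp add: field_simps)
      also have "16000 * (real N * real (lg N)) / \<beta> = real (T * R) / (8 * \<beta>)" unfolding TR by simp
      also have "\<dots> * ?S \<le> real n0 * ?S" using n0g S1 by (intro mult_right_mono) auto
      finally show ?thesis by (simp add: mult.commute)
    qed
  qed
  let ?\<delta> = "ennreal (exp (- 9 * real (lg N)))"
  have mid: "(\<integral>\<^sup>+z'. indicator {z'. stuck z z'} z' \<partial>run cyc_kern R z1) \<le> (\<Sum>x\<in>active z. spot n0 x z1) + ?\<delta>"
    if z1: "z1 \<in> set_pmf (run cyc_kern R z)" for z1
  proof -
    have c1: "at_cycle (e * (2 * R) + R) z1" using at_cycle_run[OF z z1] .
    have sub: "active z1 \<subseteq> active z" using active_run_cycles[OF z z1] .
    show ?thesis
    proof (cases "spread_out n0 z1")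
      case True
      have "card (active z1) \<le> k0" unfolding k0_def using sub fin_active' by (intro card_mono) auto
      from second_half[OF k0_def c1 True this big]
      have "(\<integral>\<^sup>+z'. indicator {z'. stuck z z'} z' \<partial>run cyc_kern R z1) \<le> ?\<delta>" .
      then show ?thesis by (meson add_increasing zero_le)
    next
      case f: False
      then obtain x where x: "x \<in> active z1" "card (holders z1 x) < n0"
          by (auto simp: spread_out_def not_le)
      have "1 \<le> spot n0 x z1" using x holders_ne[of z1 x] gap_ge_1 by (simp add: spot_def)
      also have "\<dots> \<le> (\<Sum>x\<in>active z. spot n0 x z1)"
        using x sub fin_active' by (intro sum_nonneg_leq_bound[OF _ _ refl]) auto
      finally have 1: "1 \<le> (\<Sum>x\<in>active z. spot n0 x z1)" .
      have "(\<integral>\<^sup>+z'. indicator {z'. stuck z z'} z' \<partial>run cyc_kern R z1) \<le> (\<integral>\<^sup>+z'. 1 \<partial>run cyc_kern R z1)"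
        by (intro nn_integral_mono) (simp split: split_indicator)
      also have "\<dots> \<le> (\<Sum>x\<in>active z. spot n0 x z1)" using 1 by simp
      finally show ?thesis by (meson add_increasing2 zero_le)
    qed
  qed
  have "2 * R = R + R" by simp
  then have "(\<integral>\<^sup>+z'. indicator {z'. stuck z z'} z' \<partial>run cyc_kern (2 * R) z) =
     (\<integral>\<^sup>+z1. (\<integral>\<^sup>+z'. indicator {z'. stuck z z'} z' \<partial>run cyc_kern R z1) \<partial>run cyc_kern R z)"
    by (simp only: run_add nn_integral_bind_pmf)
  also have "\<dots> \<le> (\<integral>\<^sup>+z1. (\<Sum>x\<in>active z. spot n0 x z1) + ?\<delta> \<partial>run cyc_kern R z)"
    using mid by (rule nn_integral_mono_pmf)
  also have "\<dots> = (\<integral>\<^sup>+z1. (\<Sum>x\<in>active z. spot n0 x z1) \<partial>run cyc_kern R z) + ?\<delta>"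
    by (simp add: nn_integral_add)
  also have "\<dots> \<le> ennreal (real k0 * (2 ^ n0 * (1 - 1 / (2 * real \<beta>)) ^ (T * R))) + ?\<delta>"
    using first_half[OF z _ \<beta>(1), of n0] by (intro add_right_mono) (simp add: k0_def n0_def \<beta>_def)
  also have "\<dots> \<le> ?\<delta> + ?\<delta>"
  proof (intro add_right_mono ennreal_leI)
    have "(2::real) ^ n0 \<le> exp 1 ^ n0" using exp_ge_add_one_self[of 1] by (intro power_mono) auto
    also have "\<dots> = exp (real n0)" by (simp add: exp_of_nat_mult[symmetric])
    also have "real n0 \<le> real (T * R) / (4 * \<beta>)"
    proof -
      have "n0 * (4 * \<beta>) \<le> T * R" by (simp add: n0_def min_def mult.commute) (meson div_times_less_eq_dividend le_trans mult_le_mono1 nat_le_linear)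
      then have "real (n0 * (4 * \<beta>)) \<le> real (T * R)" by (rule of_nat_mono)
      then show ?thesis using \<beta>(1) by (simp add: field_simps)
    qed
    finally have a: "(2::real) ^ n0 \<le> exp (real (T * R) / (4 * \<beta>))" by simp
    have "(1 - 1 / (2 * real \<beta>)) ^ (T * R) \<le> exp (- (1 / (2 * real \<beta>))) ^ (T * R)"
      using one_minus_le_exp[of "1 / (2 * real \<beta>)"] \<beta>(1) by (intro power_mono) auto
    also have "\<dots> = exp (real (T * R) * - (1 / (2 * real \<beta>)))" by (simp only: exp_of_nat_mult)
    finally have b: "(1 - 1 / (2 * real \<beta>)) ^ (T * R) \<le> exp (- 2 * (real (T * R) / (4 * \<beta>)))"
        by (simp add: mult.commute)
    have "real k0 \<le> exp (lg N)" using k0(2) N_exp by (meson le_trans of_nat_le_iff order.trans)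
    then have "real k0 * (2 ^ n0 * (1 - 1 / (2 * real \<beta>)) ^ (T * R))
        \<le> exp (lg N) * (exp (real (T * R) / (4 * \<beta>)) * exp (- 2 * (real (T * R) / (4 * \<beta>))))"
      using a b \<beta>(1) by (intro mult_mono) auto
    also have "\<dots> = exp (real (lg N) - real (T * R) / (4 * \<beta>))" by (simp add: exp_add[symmetric])
    also have "\<dots> \<le> exp (- 9 * real (lg N))" using big0 lg1 by simp
    finally show "real k0 * (2 ^ n0 * (1 - 1 / (2 * real \<beta>)) ^ (T * R)) \<le> exp (- 9 * real (lg N))" .
  qed
  also have "?\<delta> + ?\<delta> = ennreal (2 * exp (- 9 * real (lg N)))"
      by (simp add: ennreal_plus[symmetric] del: ennreal_plus)
  also have "\<dots> \<le> ennreal (1 / (2 * real N))"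
  proof (rule ennreal_leI)
    have "4 * real N * exp (- 9 * real (lg N)) \<le> 4 * exp (lg N) * exp (- 9 * real (lg N))"
      using N_exp by (intro mult_right_mono) auto
    also have "\<dots> = 4 * exp (- 8 * real (lg N))" by (simp add: exp_add[symmetric])
    also have "\<dots> \<le> 4 * exp (- 8)" using lg1 by simp
    also have "\<dots> \<le> 1" using exp_ge_add_one_self[of "8::real"] by (simp add: exp_minus inverse_eq_divide)
    finally show "2 * exp (- 9 * real (lg N)) \<le> 1 / (2 * real N)" using N_pos by (simp add: field_simps)
  qed
  finally show ?thesis .
qed

text \<open>The exponent counts batches of \<open>L\<close> tokens. The base \<open>2 * N\<close>
  matches the failure probability \<open>1 / (2 * N)\<close> of an epoch: success and failure
  contribute equally, for a total factor \<open>1 / N\<close>.\<close>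

definition Wpot :: "state \<Rightarrow> ennreal" where
  "Wpot z = (if active z = {} then 0 else ennreal ((2 * real N) ^ nblocks L (card (active z))))"

lemma epoch_drift:
  assumes z: "at_cycle (e * (2 * R)) z"
  shows "(\<integral>\<^sup>+z'. Wpot z' \<partial>run cyc_kern (2 * R) z) \<le> ennreal (1 / real N) * Wpot z"
proof -
  let ?c = "ennreal (1 / (2 * real N))"
  have N1: "1 \<le> 2 * real N" using N_pos by simp
  have "Wpot z' \<le> Wpot z * ?c + Wpot z * indicator {z'. stuck z z'} z'"
      if z': "z' \<in> set_pmf (run cyc_kern (2 * R) z)" for z'
  proof (cases "active z' = {}")
    case True
    then show ?thesis by (simp add: Wpot_def)
  next
    case False
    have sub: "active z' \<subseteq> active z" using active_run_cycles[OF z z'] .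
    then have ne: "active z \<noteq> {}" using False by blast
    have le: "card (active z') \<le> card (active z)" using sub fin_active' by (intro card_mono) auto
    show ?thesis
    proof (cases "stuck z z'")
      case True
      have "(2 * real N) ^ nblocks L (card (active z')) \<le> (2 * real N) ^ nblocks L (card (active z))"
        by (rule power_increasing[OF nblocks_mono[OF le] N1])
      then have "Wpot z' \<le> Wpot z" unfolding Wpot_def if_not_P[OF False] if_not_P[OF ne]
          by (rule ennreal_leI)
      then show ?thesis using True by (simp add: add_increasing)
    next
      case st: False
      then have "card (active z') + L \<le> card (active z)" using False by (simp add: stuck_def not_less)
      then have "nblocks L (card (active z') + L) \<le> nblocks L (card (active z))" by (rule nblocks_mono)
      moreover have "nblocks L (card (active z') + L) = Suc (nblocks L (card (active z')))"
      proof -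
        have "card (active z') + L + L - 1 = (card (active z') + L - 1) + L" using L_pos by simp
        moreover have "(card (active z') + L - 1 + L) div L = (card (active z') + L - 1) div L + 1"
          using L_pos by (intro div_add_self2) simp
        ultimately show ?thesis by (simp only: nblocks_def Suc_eq_plus1)
      qed
      ultimately have "(2 * real N) ^ Suc (nblocks L (card (active z'))) \<le> (2 * real N) ^ nblocks L (card (active z))"
        using N1 by (intro power_increasing) auto
      then have "(2 * real N) ^ nblocks L (card (active z')) \<le> (2 * real N) ^ nblocks L (card (active z)) * (1 / (2 * real N))"
        using N_pos by (simp add: field_simps)
      then have "Wpot z' \<le> Wpot z * ?c"
        using False ne by (simp add: Wpot_def ennreal_mult[symmetric] ennreal_leI)
      then show ?thesis by (simp add: add_increasing2)
    qed
  qed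
  then have "(\<integral>\<^sup>+z'. Wpot z' \<partial>run cyc_kern (2 * R) z)
      \<le> (\<integral>\<^sup>+z'. Wpot z * ?c + Wpot z * indicator {z'. stuck z z'} z' \<partial>run cyc_kern (2 * R) z)"
    by (rule nn_integral_mono_pmf)
  also have "\<dots> = Wpot z * ?c + Wpot z * (\<integral>\<^sup>+z'. indicator {z'. stuck z z'} z' \<partial>run cyc_kern (2 * R) z)"
    by (simp add: nn_integral_add nn_integral_cmult)
  also have "\<dots> \<le> Wpot z * ?c + Wpot z * ?c" using epoch[OF z] by (intro add_left_mono mult_left_mono) auto
  also have "\<dots> = Wpot z * (?c + ?c)" by (simp only: distrib_left)
  also have "?c + ?c = ennreal (1 / real N)" by (simp add: ennreal_plus[symmetric] del: ennreal_plus)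
  finally show ?thesis by (simp add: mult.commute)
qed

text \<open>Since \<open>2 * N \<le> N ^ 2\<close>, two epochs per batch outweigh the initial
  potential, and the additional epoch provides the probability \<open>1 / N\<close>.\<close>

lemma remaining_random_blocks:
  assumes z: "at_cycle 0 z" and J: "2 * nblocks L k + 1 \<le> J"
  shows "(\<integral>\<^sup>+z'. indicator {z'. active z' \<noteq> {}} z' \<partial>run cyc_kern (J * (2 * R)) z) \<le> ennreal (1 / real N)"
proof -
  let ?K = "run cyc_kern (2 * R)"
  have c: "at_cycle (j * (2 * R)) y" if "y \<in> set_pmf (run ?K j z)" for j y
    using at_cycle_run[OF z, of y "j * (2 * R)"] that by (simp add: run_run)
  have zt: "reach z" "N \<le> time z" using z by (auto simp: at_cycle_def)
  have ck: "card (active z) \<le> k" using card_mono[OF fin_toks active_toks[OF zt]] card_toks by simp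
  have "(\<integral>\<^sup>+z'. indicator {z'. active z' \<noteq> {}} z' \<partial>run cyc_kern (J * (2 * R)) z) \<le> (\<integral>\<^sup>+z'. Wpot z' \<partial>run ?K J z)"
    unfolding run_run[of cyc_kern "2 * R" J z]
  proof (intro nn_integral_mono)
    fix z' show "indicator {z'. active z' \<noteq> {}} z' \<le> Wpot z'"
    proof (cases "active z' = {}")
      case False
      have "(1::real) \<le> (2 * real N) ^ nblocks L (card (active z'))" using N_pos
          by (intro one_le_power) simp
      then show ?thesis using False by (simp add: Wpot_def)
    qed simp
  qed
  also have "\<dots> \<le> ennreal (1 / real N) ^ J * Wpot z"
    using c by (intro drift epoch_drift)
  also have "\<dots> \<le> ennreal (1 / real N) ^ J * ennreal ((2 * real N) ^ nblocks L k)"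
  proof (intro mult_left_mono)
    have "(2 * real N) ^ nblocks L (card (active z)) \<le> (2 * real N) ^ nblocks L k"
      using ck N_pos nblocks_mono by (intro power_increasing) auto
    then show "Wpot z \<le> ennreal ((2 * real N) ^ nblocks L k)" by (simp add: Wpot_def ennreal_leI)
  qed simp
  also have "\<dots> = ennreal ((1 / real N) ^ J * (2 * real N) ^ nblocks L k)"
    by (simp add: ennreal_mult ennreal_power)
  also have "\<dots> \<le> ennreal (1 / real N)"
  proof (rule ennreal_leI)
    let ?\<kappa> = "nblocks L k"
    have N1: "0 < real N" "2 \<le> real N" using N_pos by auto
    have "(1 / real N) ^ J \<le> (1 / real N) ^ (2 * ?\<kappa> + 1)" using J N1 by (intro power_decreasing) auto
    moreover have "(2 * real N) ^ ?\<kappa> \<le> (real N ^ 2) ^ ?\<kappa>" using N1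
        by (intro power_mono) (auto simp: power2_eq_square)
    ultimately have "(1 / real N) ^ J * (2 * real N) ^ ?\<kappa> \<le> (1 / real N) ^ (2 * ?\<kappa> + 1) * (real N ^ 2) ^ ?\<kappa>"
      using N1 by (intro mult_mono) auto
    also have "\<dots> = 1 / real N" using N1 by (simp add: power_mult[symmetric] power_add power_divide)
    finally show "(1 / real N) ^ J * (2 * real N) ^ ?\<kappa> \<le> 1 / real N" .
  qed
  finally show ?thesis .
qed

end

section \<open>The leader\<close>

lemma sum_inverse_sqrt: "(\<Sum>j=1..n. 1 / sqrt (real j)) \<le> 2 * sqrt (real n)"
proof (induction n)
  case (Suc n)
  let ?x = "sqrt (real n)" and ?y = "sqrt (real (Suc n))"
  have "(?y - ?x) * (?y + ?x) = 1" by (simp add: algebra_simps)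
  moreover have "(?y - ?x) * (?y + ?x) \<le> (?y - ?x) * (2 * ?y)" by (intro mult_left_mono) auto
  moreover have "0 < ?y" by simp
  ultimately have "1 / ?y \<le> 2 * (?y - ?x)" by (simp add: field_simps)
  then show ?case using Suc by (simp add: sum.cl_ivl_Suc)
qed simp

lemma sum_inverse_le_ln: "0 < n \<Longrightarrow> (\<Sum>j=1..n. 1 / real j) \<le> 1 + ln (real n)"
proof (induction n rule: nat_induct_non_zero)
  case (Suc n)
  have p: "0 < 1 + 1 / real n" by (simp add: add_pos_nonneg)
  then have "ln (inverse (1 + 1 / real n)) \<le> inverse (1 + 1 / real n) - 1" by (intro ln_le_minus_one) simp
  then have "1 - 1 / (1 + 1 / real n) \<le> ln (1 + 1 / real n)" unfolding ln_inverse
      by (simp add: inverse_eq_divide)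
  moreover have "1 - 1 / (1 + 1 / real n) = 1 / real (Suc n)" using Suc.hyps by (simp add: field_simps)
  moreover have "ln (1 + 1 / real n) = ln (real (Suc n)) - ln (real n)"
  proof -
    have "1 + 1 / real n = real (Suc n) / real n" using Suc.hyps by (simp add: field_simps)
    then show ?thesis using Suc.hyps by (simp add: ln_div del: of_nat_Suc)
  qed
  ultimately show ?case using Suc.IH by (simp add: sum.cl_ivl_Suc)
qed simp

context dynamic
begin

lemma gather_phase_growth:
  assumes z: "at_cycle c z" "z' \<in> set_pmf (run kern j z)" "Suc j \<le> T" and z'': "z'' \<in> set_pmf (kern z')" and v: "v \<in> V"
  shows "card (av z' v) \<le> card (av z'' v)"
proof -
  have P: "reach z'" "time z' = N + c * (4 * T) + 0 * T + j" using gather_phase_run[OF z(1,2)] z(3)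
      by auto
  have "gph (time z') = 0" unfolding P(2) using z(3) by (intro position_at) auto
  then have "av z' v \<subseteq> av z'' v" using growth_step(1)[OF P(1) _ z''] P(2) by simp
  moreover have "av z'' v \<subseteq> active z''" using v by (auto simp: active_av)
  ultimately show ?thesis using fin_active' finite_subset by (metis card_mono)
qed

definition light :: "nat \<Rightarrow> state \<Rightarrow> bool" where
  "light M z \<longleftrightarrow> (\<forall>v\<in>V. card (av z v) \<le> M)"

text \<open>Double counting: the numbers of holders sum up to the total load, at most
  \<open>n * M\<close>. Fewer than half of the tokens can have \<open>n0\<close> holders or
  more.\<close>

lemma few_holders:
  assumes "light M z" "0 < card (active z)" "2 * n * M < n0 * card (active z)"
  shows "real (card (active z)) / 2 \<le> real (card {x\<in>active z. card (holders z x) < n0})"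
proof -
  let ?A = "active z" and ?B = "{x\<in>active z. card (holders z x) < n0}"
  have "real n0 * real (card (?A - ?B)) = (\<Sum>x\<in>?A - ?B. real n0)" by simp
  also have "\<dots> \<le> (\<Sum>x\<in>?A - ?B. real (card (holders z x)))" by (intro sum_mono) auto
  also have "\<dots> \<le> (\<Sum>x\<in>?A. real (card (holders z x)))" using fin_active' by (intro sum_mono2) auto
  also have "\<dots> = (\<Sum>v\<in>V. real (card (av z v)))"
    unfolding holders_av by (intro sum_card_holders[symmetric] fin_active') (auto simp: active_av)
  also have "\<dots> \<le> (\<Sum>v\<in>V. real M)" using assms(1) by (intro sum_mono) (simp add: light_def)
  also have "\<dots> = real n * real M" using card_V by simp
  finally have "real (n0 * card (?A - ?B)) \<le> real (n * M)" by simp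
  then have "n0 * card (?A - ?B) \<le> n * M" unfolding of_nat_le_iff .
  then have "2 * (n0 * card (?A - ?B)) \<le> 2 * (n * M)" by simp
  then have "n0 * (2 * card (?A - ?B)) < n0 * card ?A" using assms(3)
      by (simp only: mult.left_commute[of n0 2] mult.assoc)
  then have "2 * card (?A - ?B) < card ?A" by simp
  moreover have "card (?A - ?B) = card ?A - card ?B" using fin_active' by (intro card_Diff_subset) auto
  moreover have "card ?B \<le> card ?A" using fin_active' by (intro card_mono) auto
  ultimately have "card ?A \<le> 2 * card ?B" by simp
  then have "real (card ?A) \<le> real (2 * card ?B)" by (rule of_nat_mono)
  then show ?thesis by simp
qed

text \<open>As long as no node has more than \<open>M\<close> tokens, each holder of a token sends it with probability at
  least \<open>1 / nblocks msize M\<close>. If this lasted for the whole phase, half of the tokens would have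
  more than \<open>2 n M / k\<close> holders, which is too much.\<close>

lemma gather_fills:
  assumes z: "at_cycle c z" "gathering N c" and ne: "active z \<noteq> {}"
    and M: "16 * (M * M) \<le> card (active z) * msize" "4 * M \<le> card (active z)"
  shows "(\<integral>\<^sup>+z'. indicator {z'. light M z'} z' \<partial>run kern T z) \<le> ennreal (1 / 4)"
proof (cases "M = 0")
  case True
  have "\<not> light M z'" if "z' \<in> set_pmf (run kern T z)" for z'
  proof -
    have "active z' \<noteq> {}" using gather_phase_run[OF z(1) that] ne by simp
    then obtain v x where "v \<in> V" "x \<in> av z' v" by (auto simp: active_av)
    moreover have "av z' v \<subseteq> active z'" using calculation(1) by (auto simp: active_av)
    then have "finite (av z' v)" using fin_active' finite_subset by blast
    ultimately have "0 < card (av z' v)" by (auto simp: card_gt_0_iff)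
    then show ?thesis using True \<open>v \<in> V\<close> by (auto simp: light_def)
  qed
  then have "(\<integral>\<^sup>+z'. indicator {z'. light M z'} z' \<partial>run kern T z) \<le> (\<integral>\<^sup>+z'. 0 \<partial>run kern T z)"
    by (intro nn_integral_mono_pmf) simp
  then show ?thesis by simp
next
  case False
  define A where "A = active z"
  define kk where "kk = card A"
  \<comment> \<open>The least number with \<open>2 * n * M < n0 * kk\<close>, as required by
    \<open>few_holders\<close>.\<close>
  define n0 where "n0 = 2 * n * M div kk + 1"
  define \<beta> where "\<beta> = nblocks msize M"
  have z0: "reach z" "N \<le> time z" using z(1) by (auto simp: at_cycle_def)
  have kk: "0 < kk" "kk \<le> N" "16 * (M * M) \<le> kk * msize" "4 * M \<le> kk"
    using ne fin_active' card_mono[OF fin_toks active_toks[OF z0]] card_toks k_le n_le_N M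
    by (auto simp: kk_def A_def card_gt_0_iff)
  have n0: "n0 \<le> n" "2 * n * M < n0 * kk"
  proof -
    have "2 * n * M < n * kk" using kk False n_pos by (simp add: mult.left_commute)
    then have "2 * n * M div kk < n" using kk(1) by (simp add: div_less_iff_less_mult)
    then show "n0 \<le> n" by (simp add: n0_def)
    show "2 * n * M < n0 * kk" unfolding n0_def using kk(1) dividend_less_div_times[of kk "2 * n * M"]
        by simp
  qed
  have \<beta>: "0 < \<beta>" "real \<beta> \<le> real M / real msize + 1"
    using False nblocks_pos[OF msize_pos] nblocks_real[OF msize_pos] by (auto simp: \<beta>_def)
  let ?\<rho> = "1 - 1 / (2 * real \<beta>)"
  have \<rho>: "0 \<le> ?\<rho>" using \<beta>(1) by simp
  \<comment> \<open>Loads do not decrease during gathering. So once a node exceeds \<open>M\<close>,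
    the potential is zero for good, and the block count \<open>\<beta>\<close> for load
    \<open>M\<close> may be used until then.\<close>
  define Y where "Y y = (if light M y then (\<Sum>x\<in>A. spot n0 x y) else 0)" for y
  have "(\<integral>\<^sup>+z'. Y z' \<partial>run kern T z) \<le> ennreal ?\<rho> ^ T * Y z"
  proof (rule drift)
    fix j y assume j: "j < T" and y: "y \<in> set_pmf (run kern j z)"
    have P: "reach y" "time y = N + c * (4 * T) + 0 * T + j" using gather_phase_run[OF z(1) y] j by auto
    have pos: "gph (time y) = 0" "gcyc (time y) = c" unfolding P(2) using j by (intro position_at; simp)+
    show "(\<integral>\<^sup>+y'. Y y' \<partial>kern y) \<le> ennreal ?\<rho> * Y y"
    proof (cases "light M y")
      case True
      have "(\<integral>\<^sup>+y'. Y y' \<partial>kern y) \<le> (\<integral>\<^sup>+y'. (\<Sum>x\<in>A. spot n0 x y') \<partial>kern y)"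
        by (intro nn_integral_mono) (simp add: Y_def)
      also have "\<dots> = (\<Sum>x\<in>A. \<integral>\<^sup>+y'. spot n0 x y' \<partial>kern y)" by (rule nn_integral_sum) simp
      also have "\<dots> \<le> (\<Sum>x\<in>A. ennreal ?\<rho> * spot n0 x y)"
        using P pos z(2) n0 \<beta>(1) True
        by (intro sum_mono gather_drift) (auto simp: \<beta>_def light_def nblocks_mono)
      also have "\<dots> = ennreal ?\<rho> * Y y" using True by (simp add: Y_def sum_distrib_left)
      finally show ?thesis .
    next
      case f: False
      have "Y y' = 0" if y': "y' \<in> set_pmf (kern y)" for y'
      proof -
        obtain v where v: "v \<in> V" "M < card (av y v)" using f by (auto simp: light_def not_le)
        then have "M < card (av y' v)" using gather_phase_growth[OF z(1) y _ y' v(1)] j by simp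
        then show ?thesis using v(1) by (auto simp: Y_def light_def)
      qed
      then have "(\<integral>\<^sup>+y'. Y y' \<partial>kern y) \<le> (\<integral>\<^sup>+y'. 0 \<partial>kern y)" by (intro nn_integral_mono_pmf) simp
      then show ?thesis by simp
    qed
  qed
  also have "\<dots> \<le> ennreal ?\<rho> ^ T * (\<Sum>x\<in>A. 2 ^ n0)"
  proof (intro mult_left_mono)
    have "Y z \<le> (\<Sum>x\<in>A. spot n0 x z)" by (simp add: Y_def)
    also have "\<dots> \<le> (\<Sum>x\<in>A. 2 ^ n0)" by (intro sum_mono) (auto simp: spot_def gap_le)
    finally show "Y z \<le> (\<Sum>x\<in>A. 2 ^ n0)" .
  qed simp
  also have "\<dots> = ennreal ?\<rho> ^ T * (of_nat kk * 2 ^ n0)" by (simp add: kk_def)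
  also have "\<dots> = ennreal (?\<rho> ^ T * (real kk * 2 ^ n0))"
    using \<rho> by (simp add: ennreal_power ennreal_mult ennreal_of_nat_eq_real_of_nat flip: ennreal_numeral)
  finally have Y: "(\<integral>\<^sup>+z'. Y z' \<partial>run kern T z) \<le> ennreal (?\<rho> ^ T * (real kk * 2 ^ n0))" .
  have "(\<integral>\<^sup>+z'. indicator {z'. light M z'} z' \<partial>run kern T z) \<le> (\<integral>\<^sup>+z'. ennreal (2 / real kk) * Y z' \<partial>run kern T z)"
  proof (rule nn_integral_mono_pmf)
    fix z' assume z': "z' \<in> set_pmf (run kern T z)"
    have A': "active z' = A" using gather_phase_run[OF z(1) z'] by (simp add: A_def)
    show "indicator {z'. light M z'} z' \<le> ennreal (2 / real kk) * Y z'"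
    proof (cases "light M z'")
      case True
      let ?B = "{x\<in>A. card (holders z' x) < n0}"
      have fA: "finite A" using fin_active' by (simp add: A_def)
      have "real kk / 2 \<le> real (card ?B)"
        using few_holders[OF True, of n0] kk(1) n0(2) by (simp add: A' kk_def)
      then have "ennreal (real kk / 2) \<le> ennreal (real (card ?B))" by (rule ennreal_leI)
      also have "\<dots> = (\<Sum>x\<in>?B. 1)" by (simp add: ennreal_of_nat_eq_real_of_nat)
      also have "\<dots> \<le> (\<Sum>x\<in>?B. spot n0 x z')"
      proof (intro sum_mono)
        fix x assume "x \<in> ?B"
        then show "1 \<le> spot n0 x z'" using holders_ne[of z' x] A' gap_ge_1 by (simp add: spot_def)
      qed
      also have "\<dots> \<le> (\<Sum>x\<in>A. spot n0 x z')" using fA by (intro sum_mono2) auto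
      also have "\<dots> = Y z'" using True by (simp add: Y_def)
      finally have "ennreal (2 / real kk) * ennreal (real kk / 2) \<le> ennreal (2 / real kk) * Y z'"
          by (intro mult_left_mono) auto
      then show ?thesis using True kk(1) by (simp add: ennreal_mult[symmetric])
    qed simp
  qed
  also have "\<dots> = ennreal (2 / real kk) * (\<integral>\<^sup>+z'. Y z' \<partial>run kern T z)" by (simp add: nn_integral_cmult)
  also have "\<dots> \<le> ennreal (2 / real kk) * ennreal (?\<rho> ^ T * (real kk * 2 ^ n0))" using Y
      by (intro mult_left_mono) auto
  also have "\<dots> = ennreal (2 * (?\<rho> ^ T * 2 ^ n0))" using kk(1) \<rho> by (simp add: ennreal_mult[symmetric])
  also have "\<dots> \<le> ennreal (1 / 4)"
  proof (rule ennreal_leI)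
    \<comment> \<open>This is \<open>T / (2 * \<beta>)\<close>, the exponent gained in the phase.
      The two conditions on \<open>M\<close> bound \<open>(n0 + 1) * \<beta>\<close> by
      \<open>16 * N\<close>, so \<open>n0 + 1\<close> is at most half of it.\<close>
    define s where "s = 32 * real N / real \<beta>"
    have "(real n0 + 1) * real \<beta> \<le> (2 * real n * real M / real kk + 2) * (real M / real msize + 1)"
    proof (intro mult_mono)
      have "real (2 * n * M div kk) \<le> real (2 * n * M) / real kk" by (rule of_nat_div_le_of_nat)
      then show "real n0 + 1 \<le> 2 * real n * real M / real kk + 2" by (simp add: n0_def)
    qed (use \<beta> in auto)
    also have "\<dots> = real n * (2 * (real M * real M) / (real kk * real msize)) + real n * (2 * real M / real kk) + 2 * real M / real msize + 2"
      using kk(1) msize_pos by (simp add: field_simps)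
    also have "\<dots> \<le> real n * (1 / 8) + real n * (1 / 2) + real N + real N"
    proof (intro add_mono mult_left_mono)
      have "real (16 * (M * M)) \<le> real (kk * msize)" using kk(3) by (rule of_nat_mono)
      then show "2 * (real M * real M) / (real kk * real msize) \<le> 1 / 8" using kk(1) msize_pos
          by (simp add: field_simps)
      have M4: "4 * real M \<le> real kk" using of_nat_mono[OF kk(4), where 'a = real] by simp
      then show "2 * real M / real kk \<le> 1 / 2" using kk(1) by (simp add: field_simps)
      have "2 * real M / real msize \<le> 2 * real M / 1" using msize_pos by (intro divide_left_mono) auto
      also have "\<dots> \<le> real N" using M4 of_nat_mono[OF kk(2), where 'a = real] by simp
      finally show "2 * real M / real msize \<le> real N" .
      show "2 \<le> real N" using N_pos by simp
    qed auto
    also have "\<dots> \<le> 16 * real N" using n_le_N by simp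
    finally have s: "real n0 + 1 \<le> s / 2" using \<beta>(1) by (simp add: s_def field_simps)
    have "(2::real) ^ Suc n0 \<le> exp 1 ^ Suc n0" using exp_ge_add_one_self[of 1] by (intro power_mono) auto
    also have "\<dots> = exp (real n0 + 1)" by (simp only: exp_of_nat_mult[symmetric]) (simp add: add.commute)
    finally have a: "2 * 2 ^ n0 \<le> exp (real n0 + 1)" by simp
    have "?\<rho> ^ T \<le> exp (- (1 / (2 * real \<beta>))) ^ T" using one_minus_le_exp[of "1 / (2 * real \<beta>)"] \<rho>
        by (intro power_mono) auto
    also have "\<dots> = exp (real T * - (1 / (2 * real \<beta>)))" by (simp only: exp_of_nat_mult)
    also have "\<dots> = exp (- s)" by (simp add: s_def rounds_def)
    finally have b: "?\<rho> ^ T \<le> exp (- s)" .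
    have "2 * (?\<rho> ^ T * 2 ^ n0) = ?\<rho> ^ T * (2 * 2 ^ n0)" by simp
    also have "\<dots> \<le> exp (- s) * exp (real n0 + 1)" using a b \<rho> by (intro mult_mono) auto
    also have "\<dots> = exp (real n0 + 1 - s)" by (simp add: exp_add[symmetric])
    also have "\<dots> \<le> exp (- 2)"
    proof -
      have "1 \<le> real n0" by (simp add: n0_def)
      then show ?thesis using s by simp
    qed
    also have "\<dots> = inverse (exp 1 * exp 1)" by (simp add: exp_minus exp_add[symmetric])
    also have "\<dots> \<le> inverse (2 * 2)"
      using exp_ge_add_one_self[of 1] by (intro le_imp_inverse_le mult_mono) auto
    finally show "2 * (?\<rho> ^ T * 2 ^ n0) \<le> 1 / 4" by simp
  qed
  finally show ?thesis .
qed

section \<open>Drift with the progress of the leader as its rate\<close>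

definition rate :: "nat \<Rightarrow> real" where
  "rate j = min (real L) (min (sqrt (real j * real msize) / 4) (real j / 4))"

text \<open>\<open>rate j\<close> is the progress guaranteed with \<open>j\<close> active tokens, so
  this discrete integral of its reciprocal estimates the number of successful cycles needed. In this
  scale every successful cycle gains at least 1.\<close>

definition level :: "nat \<Rightarrow> real" where "level i = (\<Sum>j=1..i. 1 / rate j)"

lemma rate_pos: "0 < j \<Longrightarrow> 0 < rate j"
  using L_pos msize_pos by (simp add: rate_def)

lemma rate_mono: "i \<le> j \<Longrightarrow> rate i \<le> rate j"
  unfolding rate_def by (intro min.mono divide_right_mono real_sqrt_le_mono mult_right_mono) auto

lemma level_mono: "i \<le> j \<Longrightarrow> level i \<le> level j"
  unfolding level_def using rate_pos by (intro sum_mono2) (auto simp: less_imp_le)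

text \<open>The rate is monotone, so each of the removed tokens contributes at least
  \<open>1 / rate j\<close>, and there are at least \<open>rate j\<close> of them.\<close>

lemma level_drop:
  assumes "i \<le> j" "0 < j" "rate j \<le> real (j - i)"
  shows "level i + 1 \<le> level j"
proof -
  have p: "0 < rate j" using assms(2) by (rule rate_pos)
  have "level j = level i + (\<Sum>l=i + 1..j. 1 / rate l)"
    using sum.ub_add_nat[of 1 i "\<lambda>l. 1 / rate l" "j - i"] assms(1) by (simp add: level_def)
  moreover have "(\<Sum>l=i + 1..j. 1 / rate j) \<le> (\<Sum>l=i + 1..j. 1 / rate l)"
    by (intro sum_mono divide_left_mono rate_mono mult_pos_pos rate_pos p) auto
  moreover have "(\<Sum>l=i + 1..j. 1 / rate j) = real (j - i) / rate j" by simp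
  moreover have "1 \<le> real (j - i) / rate j" using assms(3) p by simp
  ultimately show ?thesis by linarith
qed

lemma level_le:
  assumes "0 < i"
  shows "level i \<le> 5 * (real i / real L) + 4 * real (lead N) + 4 * (1 + ln (real i))"
proof -
  let ?m = "sqrt (real msize)"
  have m: "0 < ?m" using msize_pos by simp
  have Lp: "0 < real L" using L_pos by simp
  have e: "t \<le> x + 8 * ((x + y) / 2) + w \<Longrightarrow> t \<le> 5 * x + 4 * y + w" for t x y w :: real by argo
  have "1 / rate j \<le> 1 / real L + 4 / ?m * (1 / sqrt (real j)) + 4 * (1 / real j)" if "j \<in> {1..i}" for j
  proof -
    have "1 / min x (min y w) \<le> 1 / x + 1 / y + 1 / w" if "0 < x" "0 < y" "0 < w" for x y w :: real
      using that by (auto simp: min_def add_nonneg_nonneg less_imp_le)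
    from this[of "real L" "sqrt (real j * real msize) / 4" "real j / 4"]
    show ?thesis using that m Lp by (simp add: rate_def real_sqrt_mult field_simps)
  qed
  then have "level i \<le> (\<Sum>j=1..i. 1 / real L + 4 / ?m * (1 / sqrt (real j)) + 4 * (1 / real j))"
    unfolding level_def by (rule sum_mono)
  also have "\<dots> = real i / real L + 4 / ?m * (\<Sum>j=1..i. 1 / sqrt (real j)) + 4 * (\<Sum>j=1..i. 1 / real j)"
    by (simp add: sum.distrib sum_distrib_left)
  also have "\<dots> \<le> real i / real L + 4 / ?m * (2 * sqrt (real i)) + 4 * (1 + ln (real i))"
    using sum_inverse_sqrt[of i] sum_inverse_le_ln[OF assms] m by (intro add_mono mult_left_mono) auto
  also have "4 / ?m * (2 * sqrt (real i)) = 8 * sqrt (real i / real msize)"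
      by (simp add: real_sqrt_divide)
  \<comment> \<open>The square root is that of a product of \<open>i / L\<close> and
    \<open>lead N\<close>; the arithmetic-geometric mean splits it into the two terms of the running
    time.\<close>
  also have "real i / real msize = real i / real L * real (lead N)"
    using lead_le by (simp add: L_def)
  also have "real i / real L + 8 * sqrt (real i / real L * real (lead N)) + 4 * (1 + ln (real i))
      \<le> real i / real L + 8 * ((real i / real L + real (lead N)) / 2) + 4 * (1 + ln (real i))"
    using arith_geo_mean_sqrt[of "real i / real L" "real (lead N)"] by simp
  finally show ?thesis by (rule e)
qed

definition depth :: "nat \<Rightarrow> ennreal" where
  "depth j = (if j = 0 then 0 else ennreal (exp (level j)))"

definition Hpot :: "(uid \<Rightarrow> token set) \<Rightarrow> ennreal" where
  "Hpot f = depth (card ((\<Union>v\<in>V. f v) \<inter> toks))"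

lemma depth_mono: "i \<le> j \<Longrightarrow> depth i \<le> depth j"
  by (simp add: depth_def level_mono ennreal_leI)

lemma Hpot_mono: "(\<And>v. f v \<subseteq> g v) \<Longrightarrow> Hpot f \<le> Hpot g"
  unfolding Hpot_def using fin_toks by (intro depth_mono card_mono) auto

lemma Hpot_av: "reach z \<Longrightarrow> N \<le> time z \<Longrightarrow> Hpot (av z) = depth (card (active z))"
  using active_toks[of z] by (simp add: Hpot_def active_av[symmetric] Int_absorb2)

lemma depth_drop:
  assumes "i \<le> j" "0 < j" "rate j \<le> real (j - i)"
  shows "depth i \<le> ennreal (3 / 8) * depth j"
proof (cases "i = 0")
  case False
  have "exp (level i) \<le> exp (- 1) * exp (level j)"
    using level_drop[OF assms] by (simp add: exp_add[symmetric])
  also have "\<dots> \<le> 3 / 8 * exp (level j)"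
  proof (intro mult_right_mono)
    \<comment> \<open>Four terms of the exponential series give e \<ge> 8/3, hence 1/e \<le>
      3/8.\<close>
    have "8 / 3 \<le> 1 + 1 + (1::real)\<^sup>2 / 2 + 1 / 6" by simp
    also have "\<dots> = (\<Sum>n<4. 1 / fact n)" by (simp add: eval_nat_numeral fact_numeral)
    also have "\<dots> \<le> exp 1"
      using sum_le_suminf[OF summable_exp[of "1::real"], of "{..<4}"]
          by (simp add: exp_def divide_inverse)
    finally show "exp (- 1) \<le> (3 / 8 :: real)" by (simp add: exp_minus inverse_eq_divide field_simps)
  qed simp
  finally show ?thesis using False assms(2) by (simp add: depth_def ennreal_mult[symmetric] ennreal_leI)
qed (simp add: depth_def)

text \<open>\<open>M\<close> is the rounded-down threshold of gathering. A node exceeding it has at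
  least \<open>M + 1\<close> tokens, which makes up for the rounding.\<close>

lemma rate_le_leader:
  assumes "0 < j"
  shows "\<exists>M. 16 * (M * M) \<le> j * msize \<and> 4 * M \<le> j \<and> rate j \<le> real (min L (M + 1))"
proof -
  define x where "x = min (sqrt (real j * real msize) / 4) (real j / 4)"
  define M where "M = nat \<lfloor>x\<rfloor>"
  have x: "0 \<le> x" by (simp add: x_def)
  then have "real M \<le> x" "x < real M + 1" by (simp_all add: M_def)
  note M = this[unfolded x_def]
  have "4 * real M \<le> real j" using M(1) by simp
  then have 1: "4 * M \<le> j" by linarith
  have "(4 * real M)\<^sup>2 \<le> (sqrt (real j * real msize))\<^sup>2" using M(1) by (intro power_mono) auto
  then have "real (16 * (M * M)) \<le> real (j * msize)" by (simp add: power2_eq_square)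
  then have 2: "16 * (M * M) \<le> j * msize" unfolding of_nat_le_iff .
  have "rate j \<le> real (min L (M + 1))" unfolding rate_def of_nat_min using M(2) by (intro min.mono) auto
  then show ?thesis using 1 2 by blast
qed

lemma leader_removal:
  assumes z: "starts z" and v: "v \<in> V" "M < card (av z v)" and r: "rate (card (active z)) \<le> real (min L (M + 1))"
    and z': "z' \<in> set_pmf (kern z)"
  shows "Hpot (cut (av z) (GT z')) \<le> ennreal (3 / 8) * Hpot (av z)"
proof -
  have b: "base z" "reach z" "N \<le> time z" using z by (auto simp: starts_def)
  obtain h where h: "kern z = map_pmf h priorities" "\<forall>g\<in>set_pmf priorities. GM (h g) = elected z g \<and>
     (\<forall>v\<in>V. acts (h g) v = acts z v) \<and> regs_ok (acts z) (elected z g)"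
    using kern_starts[OF z] by blast
  obtain g where g: "g \<in> set_pmf priorities" "z' = h g" using z' h(1) by auto
  have ok: "regs_ok (acts z) (elected z g)" and same: "\<forall>v\<in>V. acts z' v = acts z v" "GM z' = elected z g"
    using h(2) g by auto
  have "GB (acts z') (elected z g) = GB (acts z) (elected z g)" using same by (intro GB_cong[OF ok]) auto
  then have "GT z' = \<Union>(set ` set (GB (acts z) (elected z g)))" by (simp add: GT_def same(2))
  then have "min L (card (actv z v)) \<le> card (GT z' \<inter> active z)"
    using leader_tokens[OF b(1) ok v(1)] by (simp add: L_def)
  moreover have "card (actv z v) = card (av z v)" using v(1) by (simp add: av_def)
  ultimately have c: "min L (M + 1) \<le> card (GT z' \<inter> active z)" using v(2) by linarith
  let ?j = "card (active z)"
  have D: "card (active z - GT z') = ?j - card (GT z' \<inter> active z)"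
    using card_Diff_subset_Int[of "active z" "GT z'"] fin_active' by (simp add: Int_commute)
  have le: "card (GT z' \<inter> active z) \<le> ?j" using fin_active' by (intro card_mono) auto
  have "1 \<le> min L (M + 1)" using L_pos by simp
  then have pos: "0 < ?j" using c le by linarith
  have "(\<Union>v\<in>V. cut (av z) (GT z') v) \<inter> toks = active z - GT z'"
    using active_toks[OF b(2,3)] by (auto simp: cut_def active_av)
  then have "Hpot (cut (av z) (GT z')) = depth (card (active z - GT z'))" by (simp add: Hpot_def)
  also have "\<dots> \<le> ennreal (3 / 8) * depth ?j"
  proof (rule depth_drop[OF _ pos])
    have "real (min L (M + 1)) \<le> real (?j - card (active z - GT z'))" unfolding D using c le
        by (intro of_nat_mono) simp
    then show "rate ?j \<le> real (?j - card (active z - GT z'))" using r by linarith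
  qed (simp add: D)
  finally show ?thesis by (simp add: Hpot_av[OF b(2,3)])
qed

text \<open>With probability at most 1/4 no node fills up and the potential is merely kept;
  otherwise the leader reduces it by the factor 3/8. Together with the coding error this is at most
  3/4.\<close>

lemma leader_drift:
  assumes z: "at_cycle c z" "gathering N c"
  shows "(\<integral>\<^sup>+z'. Hpot (av z') \<partial>cyc_kern z) \<le> ennreal (3 / 4) * Hpot (av z)"
proof (cases "active z = {}")
  case True
  have "Hpot (av z') = 0" if z': "z' \<in> set_pmf (cyc_kern z)" for z'
  proof -
    have "active z' = {}" using active_run_subset[OF _ _ z'] z(1) True by (auto simp: at_cycle_def)
    moreover have "at_cycle (Suc c) z'" using at_cycle_step[OF z(1) z'] .
    ultimately show ?thesis using Hpot_av[of z'] by (simp add: at_cycle_def depth_def)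
  qed
  then have "(\<integral>\<^sup>+z'. Hpot (av z') \<partial>cyc_kern z) \<le> (\<integral>\<^sup>+z'. 0 \<partial>cyc_kern z)"
      by (intro nn_integral_mono_pmf) simp
  then show ?thesis by simp
next
  case False
  have zt: "reach z" "N \<le> time z" using z(1) by (auto simp: at_cycle_def)
  have "0 < card (active z)" using False fin_active' by (simp add: card_gt_0_iff)
  then obtain M where M: "16 * (M * M) \<le> card (active z) * msize" "4 * M \<le> card (active z)"
      "rate (card (active z)) \<le> real (min L (M + 1))" using rate_le_leader by blast
  let ?h = "Hpot (av z)"
  let ?i = "\<lambda>z1. indicator {z1. light M z1} z1 :: ennreal"
  have "(\<integral>\<^sup>+z2. Hpot (av z2) \<partial>run kern (3 * T) z1) \<le> ?h * ?i z1 + ?h * (ennreal (3 / 8) + eps)"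
    if z1: "z1 \<in> set_pmf (run kern T z)" for z1
  proof -
    have r1: "reach z1" "time z1 = N + c * (4 * T) + T" and a1: "active z1 = active z"
      using gather_phase_run[OF z(1) z1] by auto
    have N1: "N \<le> time z1" using r1 by simp
    have h1: "Hpot (av z1) = ?h" using Hpot_av r1(1) N1 a1 zt by simp
    have "(\<integral>\<^sup>+z2. Hpot (cut (av z1) (GT z2)) \<partial>kern z1) \<le> ?h * ?i z1 + ?h * ennreal (3 / 8)"
    proof (cases "light M z1")
      case True
      have "(\<integral>\<^sup>+z2. Hpot (cut (av z1) (GT z2)) \<partial>kern z1) \<le> (\<integral>\<^sup>+z2. ?h \<partial>kern z1)"
        unfolding h1[symmetric] by (intro nn_integral_mono Hpot_mono) (simp add: cut_def)
      then show ?thesis using True by (simp add: add_increasing2)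
    next
      case f: False
      then obtain v where v: "v \<in> V" "M < card (av z1 v)" by (auto simp: light_def not_le)
      have "\<not> finished z1" using False a1 by (auto simp: active_av finished_av)
      then have "base z1" using late_cases[OF r1(1) N1] by blast
      moreover have "gph (time z1) = 1" "goff (time z1) = 0" using position_at[of 1 0 c] T_pos r1(2)
          by auto
      ultimately have s: "starts z1" using r1(1) N1 by (simp add: starts_def)
      have "(\<integral>\<^sup>+z2. Hpot (cut (av z1) (GT z2)) \<partial>kern z1) \<le> (\<integral>\<^sup>+z2. ennreal (3 / 8) * ?h \<partial>kern z1)"
        using leader_removal[OF s v] M(3) by (intro nn_integral_mono_pmf) (simp add: a1 h1)
      then show ?thesis using f by (simp add: mult.commute)
    qed
    then have "(\<integral>\<^sup>+z2. Hpot (cut (av z1) (GT z2)) \<partial>kern z1) + Hpot (av z1) * eps \<le> ?h * ?i z1 + ?h * ennreal (3 / 8) + ?h * eps"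
      unfolding h1 by (rule add_right_mono)
    with selection[OF Hpot_mono r1] have "(\<integral>\<^sup>+z2. Hpot (av z2) \<partial>run kern (3 * T) z1) \<le> ?h * ?i z1 + ?h * ennreal (3 / 8) + ?h * eps"
      by (rule order.trans)
    then show ?thesis by (simp only: distrib_left add.assoc)
  qed
  then have "(\<integral>\<^sup>+z'. Hpot (av z') \<partial>cyc_kern z) \<le> (\<integral>\<^sup>+z1. ?h * ?i z1 + ?h * (ennreal (3 / 8) + eps) \<partial>run kern T z)"
    unfolding cyc_split nn_integral_bind_pmf by (intro nn_integral_mono_pmf)
  also have "\<dots> = ?h * (\<integral>\<^sup>+z1. ?i z1 \<partial>run kern T z) + ?h * (ennreal (3 / 8) + eps)"
    by (simp add: nn_integral_add nn_integral_cmult)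
  also have "\<dots> \<le> ?h * ennreal (1 / 4) + ?h * (ennreal (3 / 8) + ennreal (1 / 2 ^ 18))"
    using gather_fills[OF z False M(1,2)] eps_le by (intro add_mono mult_left_mono order_refl) auto
  also have "\<dots> = ?h * (ennreal (1 / 4) + (ennreal (3 / 8) + ennreal (1 / 2 ^ 18)))"
      by (simp only: distrib_left)
  also have "ennreal (1 / 4) + (ennreal (3 / 8) + ennreal (1 / 2 ^ 18)) = ennreal (1 / 4 + (3 / 8 + 1 / 2 ^ 18))"
    by (simp add: ennreal_plus[symmetric] del: ennreal_plus)
  also have "?h * \<dots> \<le> ?h * ennreal (3 / 4)" by (intro mult_left_mono ennreal_leI) auto
  finally show ?thesis by (simp add: mult.commute)
qed

text \<open>Only the gathering half is credited. In the quiet half the potential cannot increase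
  because active sets shrink.\<close>

lemma leader_epoch:
  assumes z: "at_cycle (e * (2 * R)) z"
  shows "(\<integral>\<^sup>+z'. Hpot (av z') \<partial>run cyc_kern (2 * R) z) \<le> ennreal (3 / 4) ^ R * Hpot (av z)"
proof -
  have "2 * R = R + R" by simp
  then have "(\<integral>\<^sup>+z'. Hpot (av z') \<partial>run cyc_kern (2 * R) z) =
     (\<integral>\<^sup>+z1. (\<integral>\<^sup>+z'. Hpot (av z') \<partial>run cyc_kern R z1) \<partial>run cyc_kern R z)"
    by (simp only: run_add nn_integral_bind_pmf)
  also have "\<dots> \<le> (\<integral>\<^sup>+z1. Hpot (av z1) \<partial>run cyc_kern R z)"
  proof (rule nn_integral_mono_pmf)
    fix z1 assume z1: "z1 \<in> set_pmf (run cyc_kern R z)"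
    have c1: "at_cycle (e * (2 * R) + R) z1" using at_cycle_run[OF z z1] .
    have "Hpot (av z') \<le> Hpot (av z1)" if z': "z' \<in> set_pmf (run cyc_kern R z1)" for z'
    proof -
      have "card (active z') \<le> card (active z1)"
        using active_run_cycles[OF c1 z'] fin_active' by (intro card_mono) auto
      then show ?thesis
        using c1 at_cycle_run[OF c1 z'] by (simp add: Hpot_av at_cycle_def depth_mono)
    qed
    then have "(\<integral>\<^sup>+z'. Hpot (av z') \<partial>run cyc_kern R z1) \<le> (\<integral>\<^sup>+z'. Hpot (av z1) \<partial>run cyc_kern R z1)"
      by (intro nn_integral_mono_pmf)
    then show "(\<integral>\<^sup>+z'. Hpot (av z') \<partial>run cyc_kern R z1) \<le> Hpot (av z1)" by simp
  qed
  also have "\<dots> \<le> ennreal (3 / 4) ^ R * Hpot (av z)"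
  proof (rule drift)
    fix j y assume j: "j < R" and y: "y \<in> set_pmf (run cyc_kern j z)"
    show "(\<integral>\<^sup>+y'. Hpot (av y') \<partial>cyc_kern y) \<le> ennreal (3 / 4) * Hpot (av y)"
      by (rule leader_drift[OF at_cycle_run[OF z y] epoch_gathering(1)[OF j]])
  qed
  finally show ?thesis .
qed

text \<open>As (3/4)^q \<le> exp (-q/4), four gathering cycles pay for one unit of
  \<open>level\<close>; the term \<open>lg N\<close> buys the probability
  \<open>1 / N\<close>.\<close>

lemma remaining_leader_blocks:
  assumes z: "at_cycle 0 z" and J: "4 * (level k + real (lg N)) \<le> real (J * R)"
  shows "(\<integral>\<^sup>+z'. indicator {z'. active z' \<noteq> {}} z' \<partial>run cyc_kern (J * (2 * R)) z) \<le> ennreal (1 / real N)"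
proof -
  let ?K = "run cyc_kern (2 * R)"
  have c: "at_cycle (j * (2 * R)) y" if "y \<in> set_pmf (run ?K j z)" for j y
    using at_cycle_run[OF z, of y "j * (2 * R)"] that by (simp add: run_run)
  have zt: "reach z" "N \<le> time z" using z by (auto simp: at_cycle_def)
  have ck: "card (active z) \<le> k" using card_mono[OF fin_toks active_toks[OF zt]] card_toks by simp
  have level0: "0 \<le> level j" for j using level_mono[of 0 j] by (simp add: level_def)
  have "(\<integral>\<^sup>+z'. indicator {z'. active z' \<noteq> {}} z' \<partial>run cyc_kern (J * (2 * R)) z) \<le> (\<integral>\<^sup>+z'. Hpot (av z') \<partial>run ?K J z)"
    unfolding run_run[of cyc_kern "2 * R" J z]
  proof (intro nn_integral_mono_pmf)
    fix z' assume z': "z' \<in> set_pmf (run cyc_kern (J * (2 * R)) z)"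
    have "at_cycle (J * (2 * R)) z'" using at_cycle_run[OF z z'] by simp
    then have "Hpot (av z') = depth (card (active z'))" by (simp add: Hpot_av at_cycle_def)
    moreover have "active z' \<noteq> {} \<Longrightarrow> card (active z') \<noteq> 0" using fin_active' by simp
    moreover have "1 \<le> ennreal (exp (level j))" for j using level0[of j] by simp
    ultimately show "indicator {z'. active z' \<noteq> {}} z' \<le> Hpot (av z')"
      by (auto simp: depth_def split: split_indicator)
  qed
  also have "\<dots> \<le> (ennreal (3 / 4) ^ R) ^ J * Hpot (av z)" using c by (intro drift leader_epoch)
  also have "\<dots> \<le> (ennreal (3 / 4) ^ R) ^ J * ennreal (exp (level k))"
    using level_mono[OF ck] by (intro mult_left_mono) (auto simp: Hpot_av[OF zt] depth_def ennreal_leI)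
  also have "(ennreal (3 / 4) ^ R) ^ J = ennreal ((3 / 4) ^ (J * R))"
      by (simp add: ennreal_power mult.commute flip: power_mult)
  also have "\<dots> * ennreal (exp (level k)) = ennreal ((3 / 4) ^ (J * R) * exp (level k))"
      by (simp add: ennreal_mult)
  also have "\<dots> \<le> ennreal (1 / real N)"
  proof (rule ennreal_leI)
    have "(3 / 4 :: real) ^ (J * R) \<le> exp (- (1 / 4)) ^ (J * R)" using one_minus_le_exp[of "1 / 4"]
        by (intro power_mono) auto
    also have "\<dots> = exp (real (J * R) * - (1 / 4))" by (simp only: exp_of_nat_mult)
    finally have "(3 / 4) ^ (J * R) * exp (level k) \<le> exp (real (J * R) * - (1 / 4)) * exp (level k)"
      by (rule mult_right_mono) simp
    also have "\<dots> = exp (level k - real (J * R) / 4)" by (simp add: exp_add[symmetric])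
    also have "\<dots> \<le> exp (- real (lg N))"
    proof -
      have "level k - real (J * R) / 4 \<le> - real (lg N)" using J by argo
      then show ?thesis by (rule exp_le_cancel_iff[THEN iffD2])
    qed
    also have "\<dots> = inverse (exp (lg N))" by (rule exp_minus)
    also have "\<dots> \<le> inverse (real N)" using N_exp N_pos by (intro le_imp_inverse_le) auto
    finally show "(3 / 4) ^ (J * R) * exp (level k) \<le> 1 / real N" by (simp add: inverse_eq_divide)
  qed
  finally show ?thesis .
qed

section \<open>Running time\<close>

text \<open>The clock in \<open>base\<close> gives a deterministic bound on the number of cycles,
  whatever the random choices are. This yields almost sure termination.\<close>

lemma active_eventually_empty:
  assumes z: "at_cycle 0 z" and z': "z' \<in> set_pmf (run cyc_kern (Suc k) z)"
  shows "active z' = {}"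
proof (rule ccontr)
  assume ne: "active z' \<noteq> {}"
  have "at_cycle (Suc k) z'" using at_cycle_run[OF z z'] by simp
  then have r: "reach z'" "time z' = N + Suc k * (4 * T) + 0 * T + 0" by (simp_all add: at_cycle_def)
  have "\<not> finished z'" using ne by (auto simp: active_av finished_av)
  then have "base z'" using late_cases[OF r(1)] r(2) by auto
  then have "gcyc (time z') \<le> k" using base_countD by fastforce
  moreover have "gcyc (time z') = Suc k" unfolding r(2) using T_pos by (intro position_at) auto
  ultimately show False by simp
qed

text \<open>The additional cycle in \<open>Suc j\<close> is the one whose nomination discovers that
  no active token is left.\<close>

lemma prob_halted:
  assumes p: "\<And>z. at_cycle 0 z \<Longrightarrow> (\<integral>\<^sup>+z'. indicator {z'. active z' \<noteq> {}} z' \<partial>run cyc_kern j z) \<le> ennreal p" "0 \<le> p"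
    and t: "N + Suc j * (4 * T) \<le> t"
  shows "1 - p \<le> measure_pmf.prob (execution alg V adv (initial alg est I) t) {(h, s). all_halted alg V s}"
proof -
  let ?S = "{(h, s). all_halted alg V s}"
  let ?i = "indicator (- ?S) :: state \<Rightarrow> ennreal"
  let ?M = "run kern t ([], s0)"
  define m where "m = t - (N + j * (4 * T))"
  have m: "t = N + (j * (4 * T) + m)" "m = 4 * T + (m - 4 * T)" using t by (simp_all add: m_def)
  have late: "(\<integral>\<^sup>+z'. ?i z' \<partial>run kern m z) \<le> indicator {z. active z \<noteq> {}} z" if c: "at_cycle j z" for z
  proof (cases "active z = {}")
    case True
    have zt: "reach z" "time z = N + j * (4 * T)" using c by (auto simp: at_cycle_def)
    have "z' \<in> ?S" if z': "z' \<in> set_pmf (run kern m z)" for z'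
    proof -
      have "set_pmf (run kern m z) = (\<Union>z1\<in>set_pmf (run kern (4 * T) z). set_pmf (run kern (m - 4 * T) z1))"
        by (subst m(2)) (simp only: run_add set_bind_pmf)
      then obtain z1 where z1: "z1 \<in> set_pmf (run kern (4 * T) z)" "z' \<in> set_pmf (run kern (m - 4 * T) z1)"
        using z' by blast
      have "reach z1" "N \<le> time z1" using reach_run[OF zt(1) z1(1)] time_run[OF z1(1)] zt(2) by auto
      then have "finished z'" using finished_run[OF _ _ finish[OF zt True z1(1)] z1(2)] by blast
      then show ?thesis by (auto simp: finished_def all_halted_def halted_alg[symmetric])
    qed
    then have "(\<integral>\<^sup>+z'. ?i z' \<partial>run kern m z) \<le> (\<integral>\<^sup>+z'. 0 \<partial>run kern m z)"
      by (intro nn_integral_mono_pmf) simp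
    then show ?thesis by simp
  next
    case False
    have "(\<integral>\<^sup>+z'. ?i z' \<partial>run kern m z) \<le> (\<integral>\<^sup>+z'. 1 \<partial>run kern m z)"
      by (intro nn_integral_mono) (simp split: split_indicator)
    then show ?thesis using False by simp
  qed
  have "emeasure ?M (- ?S) = (\<integral>\<^sup>+z'. ?i z' \<partial>?M)" by simp
  also have "\<dots> = (\<integral>\<^sup>+z0. (\<integral>\<^sup>+z1. (\<integral>\<^sup>+z'. ?i z' \<partial>run kern m z1) \<partial>run cyc_kern j z0) \<partial>run kern N ([], s0))"
    unfolding m(1) by (simp only: run_add run_run nn_integral_bind_pmf)
  also have "\<dots> \<le> (\<integral>\<^sup>+z0. ennreal p \<partial>run kern N ([], s0))"
  proof (rule nn_integral_mono_pmf)
    fix z0 assume "z0 \<in> set_pmf (run kern N ([], s0))"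
    then have c0: "at_cycle 0 z0" by (simp add: reach_iff at_cycle_def)
    have "(\<integral>\<^sup>+z1. (\<integral>\<^sup>+z'. ?i z' \<partial>run kern m z1) \<partial>run cyc_kern j z0) \<le> (\<integral>\<^sup>+z1. indicator {z. active z \<noteq> {}} z1 \<partial>run cyc_kern j z0)"
      using late at_cycle_run[OF c0] by (intro nn_integral_mono_pmf) simp
    also have "\<dots> \<le> ennreal p" by (rule p(1)[OF c0])
    finally show "(\<integral>\<^sup>+z1. (\<integral>\<^sup>+z'. ?i z' \<partial>run kern m z1) \<partial>run cyc_kern j z0) \<le> ennreal p" .
  qed
  finally have "emeasure ?M (- ?S) \<le> ennreal p" by simp
  then have "measure_pmf.prob ?M (- ?S) \<le> p" using p(2) by (simp add: measure_pmf.emeasure_eq_measure)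
  then have "1 - p \<le> measure_pmf.prob ?M ?S"
    using measure_pmf.prob_compl[of ?S ?M] by (simp add: Compl_eq_Diff_UNIV)
  then show ?thesis by (simp add: execution_eq s0_def[symmetric])
qed

lemma solves_dissemination_alg: "solves_dissemination alg V est I adv"
  unfolding solves_dissemination_def
proof (intro conjI allI ballI)
  fix t y assume y: "y \<in> set_pmf (execution alg V adv (initial alg est I) t)"
  obtain h s where hs: "y = (h, s)" by (cases y)
  have r: "reach (h, s)" using y by (simp add: hs execution_eq s0_def[symmetric] reach_iff)
  show "case y of (h, s) \<Rightarrow> \<forall>v\<in>V. \<forall>S. result alg (s v) = Some S \<longrightarrow> S = (\<Union>u\<in>V. I u)"
    using reach_result(1)[OF r] by (auto simp: hs toks_def)
next
  let ?p = "\<lambda>t. measure_pmf.prob (execution alg V adv (initial alg est I) t) {(h, s). all_halted alg V s}"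
  let ?t = "N + Suc (Suc k) * (4 * T)"
  have "?p t = 1" if "?t \<le> t" for t
  proof -
    have "(\<integral>\<^sup>+z'. indicator {z'. active z' \<noteq> {}} z' \<partial>run cyc_kern (Suc k) z) \<le> ennreal 0"
        if z: "at_cycle 0 z" for z
    proof -
      have "(\<integral>\<^sup>+z'. indicator {z'. active z' \<noteq> {}} z' \<partial>run cyc_kern (Suc k) z) \<le> (\<integral>\<^sup>+z'. 0 \<partial>run cyc_kern (Suc k) z)"
        using active_eventually_empty[OF z] by (intro nn_integral_mono_pmf) simp
      then show ?thesis by simp
    qed
    from prob_halted[OF this order_refl that] show ?thesis
      using measure_pmf.prob_le_1 by (intro antisym) auto
  qed
  then have "eventually (\<lambda>t. ?p t = 1) sequentially" by (auto simp: eventually_sequentially)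
  then show "?p \<longlonglongrightarrow> 1" by (rule tendsto_eventually)
qed

text \<open>Only \<open>k > L\<close> needs an argument. Then the cap in \<open>lead N\<close> is
  not attained, since \<open>N\<close> blocks would exceed \<open>k\<close>; there are two distinct
  tokens, so \<open>d \<noteq> 0\<close>; and rounding down in \<open>msize\<close> loses at most a
  factor 2.\<close>

lemma blocks_ratio: "real k / real L \<le> 1 + 2 * (real k * real d / (real b * real b))" (is "_ \<le> 1 + 2 * ?X")
proof -
  have X: "0 \<le> ?X" by simp
  have Lp: "0 < real L" using L_pos by simp
  show ?thesis
  proof (cases "k \<le> L")
    case True
    then have "real k / real L \<le> 1" using Lp by simp
    then show ?thesis using X by linarith
  next
    case False
    have "d \<noteq> 0"
    proof
      assume "d = 0"
      then have "toks \<subseteq> {[]}" using length_toks by auto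
      then have "k \<le> 1" using card_mono[of "{[] :: token}" toks] card_toks by simp
      then show False using False L_pos by simp
    qed
    moreover have "lead N = b"
    proof (rule ccontr)
      assume "lead N \<noteq> b"
      then have "N \<le> lead N * msize" using msize_pos by (auto simp: lead_def min_def split: if_splits)
      then show False using False k_le n_le_N by (simp add: L_def)
    qed
    moreover have "b < 2 * (msize * d)"
    proof -
      have "b < (b div d + 1) * d" using \<open>d \<noteq> 0\<close> dividend_less_div_times[of d b] by simp
      also have "\<dots> \<le> (2 * msize) * d" by (intro mult_right_mono) (auto simp: msize_def)
      finally show ?thesis by simp
    qed
    then have "real b \<le> 2 * (real msize * real d)"
        by (metis less_imp_le of_nat_le_iff of_nat_mult of_nat_numeral)
    ultimately have "real k * real b \<le> real k * (2 * (real msize * real d))" "L = b * msize"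
        by (auto simp: L_def mult_left_mono)
    then have "real k / real L \<le> 2 * ?X" using b_pos msize_pos by (simp add: field_simps)
    then show ?thesis by simp
  qed
qed

lemma rounds_le: "real (N + Suc (J * (2 * R)) * (4 * T)) \<le> 1028 * (real n * (2 * real (J * R) + 1))"
proof -
  have "N + Suc (J * (2 * R)) * (4 * T) = N * (1 + 256 * (2 * (J * R) + 1))"
      by (simp add: rounds_def algebra_simps)
  also have "\<dots> \<le> (4 * n) * (257 * (2 * (J * R) + 1))" using N_le by (intro mult_mono) auto
  also have "\<dots> = 1028 * (n * (2 * (J * R) + 1))" by (simp add: algebra_simps)
  finally have "real (N + Suc (J * (2 * R)) * (4 * T)) \<le> real (1028 * (n * (2 * (J * R) + 1)))"
      by (rule of_nat_mono)
  then show ?thesis by (simp add: algebra_simps)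
qed

text \<open>For \<open>n \<ge> 2\<close> the logarithm is at least 1 and absorbs additive constants.
  The strict inequality up to \<open>t + 1\<close> is what rounding the time bound down
  provides.\<close>

lemma prob_halted_blocks:
  assumes "n \<noteq> 1"
    and t: "10 ^ 8 * (log 2 (real n) / real b * (real n * real k * real d / real b) + real n * log 2 (real n)) < real t + 1"
  shows "1 - 1 / real N \<le> measure_pmf.prob (execution alg V adv (initial alg est I) t) {(h, s). all_halted alg V s}"
proof (rule prob_halted)
  let ?\<kappa> = "nblocks L k" and ?X = "real k * real d / (real b * real b)" and ?l = "log 2 (real n)"
  let ?J = "2 * ?\<kappa> + 1"
  have n2: "2 \<le> n" using assms(1) n_pos by simp
  have l1: "1 \<le> ?l" using n2 by simp
  have lg: "real (lg N) \<le> 4 * ?l"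
  proof -
    have "log 2 (real N) \<le> log 2 (4 * real n)" using N_le N_pos by simp
    also have "\<dots> = 2 + ?l" using n2 log_pow_cancel[of 2 2] by (simp add: log_mult)
    finally have "log 2 (real N) \<le> 2 + ?l" .
    moreover have "real (lg N) \<le> log 2 (real N) + 1" using N_pos by (simp add: floorlog_def)
    ultimately show ?thesis using l1 by linarith
  qed
  have X: "0 \<le> ?X" by simp
  have \<kappa>: "2 * real ?\<kappa> + 1 \<le> 5 * (1 + ?X)"
  proof -
    have "2 * y + 1 \<le> 5 * (1 + x)" if "y \<le> w + 1" "w \<le> 1 + 2 * x" "0 \<le> x" for x y w :: real using that
        by simp
    from this[OF nblocks_real[OF L_pos] blocks_ratio X] show ?thesis .
  qed
  have "real (N + Suc (?J * (2 * R)) * (4 * T)) \<le> 1028 * (real n * (2 * real (?J * R) + 1))"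
      by (rule rounds_le)
  also have "\<dots> \<le> 1028 * (real n * (80020 * (?l * (1 + ?X))))"
  proof (intro mult_left_mono)
    have "1 * 1 \<le> real (lg N) * (2 * real ?\<kappa> + 1)" using lg_pos by (intro mult_mono) auto
    then have "2 * real (?J * R) + 1 \<le> 4001 * (real (lg N) * (2 * real ?\<kappa> + 1))"
        by (simp add: R_eq algebra_simps)
    also have "\<dots> \<le> 4001 * ((4 * ?l) * (5 * (1 + ?X)))" using lg \<kappa> l1
        by (intro mult_left_mono mult_mono) auto
    also have "\<dots> = 80020 * (?l * (1 + ?X))"
    proof -
      have "4001 * ((4 * x) * (5 * y)) = 80020 * (x * y)" for x y :: real by simp
      then show ?thesis .
    qed
    finally show "2 * real (?J * R) + 1 \<le> 80020 * (?l * (1 + ?X))" .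
  qed auto
  also have "\<dots> = 82260560 * (real n * (?l * (1 + ?X)))" by simp
  also have "\<dots> \<le> 10 ^ 8 * (real n * (?l * (1 + ?X)))" using l1 X by (intro mult_right_mono) auto
  also have "\<dots> = 10 ^ 8 * (?l / real b * (real n * real k * real d / real b) + real n * ?l)"
    using b_pos by (simp add: field_simps)
  also have "\<dots> < real t + 1" by (rule t)
  finally show "N + Suc (?J * (2 * R)) * (4 * T) \<le> t" by linarith
  show "(\<integral>\<^sup>+z'. indicator {z'. active z' \<noteq> {}} z' \<partial>run cyc_kern (?J * (2 * R)) z) \<le> ennreal (1 / real N)"
    if "at_cycle 0 z" for z
    using that by (rule remaining_random_blocks) simp
qed simp

lemma prob_halted_leaders:
  assumes t: "10 ^ 8 * (1 / real b * (real n * real k * real d / real b) + real n * real b) < real t + 1"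
  shows "1 - 1 / real N \<le> measure_pmf.prob (execution alg V adv (initial alg est I) t) {(h, s). all_halted alg V s}"
proof (rule prob_halted)
  let ?X = "real k * real d / (real b * real b)"
  have X: "0 \<le> ?X" by simp
  define x where "x = 4 * (level k + real (lg N))"
  have level: "0 \<le> level k" "level k \<le> 9 + 10 * ?X + 4 * real b + 4 * real (lg N)"
  proof -
    show "0 \<le> level k" using level_mono[of 0 k] by (simp add: level_def)
    show "level k \<le> 9 + 10 * ?X + 4 * real b + 4 * real (lg N)"
    proof (cases "k = 0")
      case False
      have "real k \<le> exp (lg N)" using k_le n_le_N N_exp by (meson le_trans of_nat_le_iff order.trans)
      then have "ln (real k) \<le> ln (exp (real (lg N)))" using False by (subst ln_le_cancel_iff) auto
      then have "ln (real k) \<le> real (lg N)" by simp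
      moreover have "real (lead N) \<le> real b" by (simp add: lead_def)
      ultimately show ?thesis using level_le[of k] False blocks_ratio by simp
    next
      case True
      then have "level k = 0" by (simp add: level_def)
      then show ?thesis using X by simp
    qed
  qed
  \<comment> \<open>Only whole epochs are counted. Rounding up adds at most \<open>R\<close>
    gathering cycles, which is O(b) and vanishes in the term \<open>n * b\<close>.\<close>
  define J where "J = nat \<lceil>x / real R\<rceil>"
  have Rp: "0 < real R" using lg_pos by (simp add: R_eq)
  have x0: "0 \<le> x / real R" using level(1) Rp by (simp add: x_def)
  have J: "x \<le> real (J * R)" "real (J * R) \<le> x + real R"
  proof -
    have "x / real R \<le> real J" "real J \<le> x / real R + 1" using x0 by (simp_all add: J_def)
    then show "x \<le> real (J * R)" "real (J * R) \<le> x + real R" using Rp by (simp_all add: field_simps)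
  qed
  have b1: "1 \<le> real b" using b_pos by simp
  have "real (N + Suc (J * (2 * R)) * (4 * T)) \<le> 1028 * (real n * (2 * real (J * R) + 1))"
      by (rule rounds_le)
  also have "\<dots> \<le> 1028 * (real n * (17000 * (?X + real b)))"
  proof (intro mult_left_mono)
    have "real (lg N) \<le> 4 * real b" using lg_le(2) by (metis of_nat_le_iff of_nat_mult of_nat_numeral)
    moreover have "real R = 2000 * real (lg N)" by (simp add: R_eq)
    ultimately show "2 * real (J * R) + 1 \<le> 17000 * (?X + real b)"
      using J(2) level(2) b1 X unfolding x_def by argo
  qed auto
  also have "\<dots> = 17476000 * (real n * (?X + real b))" by simp
  also have "\<dots> \<le> 10 ^ 8 * (real n * (?X + real b))" using X by (intro mult_right_mono) auto
  also have "\<dots> = 10 ^ 8 * (1 / real b * (real n * real k * real d / real b) + real n * real b)"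
    using b_pos by (simp add: field_simps)
  also have "\<dots> < real t + 1" by (rule t)
  finally show "N + Suc (J * (2 * R)) * (4 * T) \<le> t" by linarith
  show "(\<integral>\<^sup>+z'. indicator {z'. active z' \<noteq> {}} z' \<partial>run cyc_kern (J * (2 * R)) z) \<le> ennreal (1 / real N)"
    if "at_cycle 0 z" for z
    using that J(1) unfolding x_def by (rule remaining_leader_blocks)
qed simp

lemma prob_halted_alg:
  "1 - real n powr (- 1) \<le> measure_pmf.prob (execution alg V adv (initial alg est I)
     (nat \<lfloor>10 ^ 8 * min (1 / real b * (real n * real k * real d / real b) + real n * real b)
        (log 2 (real n) / real b * (real n * real k * real d / real b) + real n * log 2 (real n))\<rfloor>))
     {(h, s). all_halted alg V s}"
    (is "_ \<le> measure_pmf.prob (_ (nat \<lfloor>10 ^ 8 * min ?x ?y\<rfloor>)) _")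
proof (cases "n = 1")
  case True
  then show ?thesis by simp
next
  case False
  let ?t = "nat \<lfloor>10 ^ 8 * min ?x ?y\<rfloor>"
  have t: "10 ^ 8 * min ?x ?y < real ?t + 1" by linarith
  have "1 / real N \<le> 1 / real n" using n_pos n_le_N by (intro divide_left_mono) auto
  moreover have "real n powr (- 1) = 1 / real n" using n_pos by (simp add: powr_minus_divide)
  moreover have "1 - 1 / real N \<le> measure_pmf.prob (execution alg V adv (initial alg est I) ?t) {(h, s). all_halted alg V s}"
  proof (cases "?x \<le> ?y")
    case True
    then show ?thesis using t by (intro prob_halted_leaders) (simp only: min_absorb1)
  next
    case f: False
    then show ?thesis using t by (intro prob_halted_blocks False) (simp only: min_absorb2 linear not_le less_imp_le)
  qed
  ultimately show ?thesis by linarith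
qed

end

section \<open>The degenerate case of a node that has halted at the start\<close>

lemma halted_execution:
  assumes "finite V" "\<forall>v\<in>V. halted Al (s v)" "(h, s') \<in> set_pmf (execution Al V adv s t)"
  shows "s' = s \<and> (\<forall>(s1, x, E)\<in>set h. \<forall>v\<in>V. fst (x v) = None)"
  using assms(3)
proof (induction t arbitrary: h s')
  case (Suc t)
  obtain h0 s1 x where 1: "(h0, s1) \<in> set_pmf (execution Al V adv s t)" "x \<in> set_pmf (choices Al V s1)"
    "h = h0 @ [(s1, x, adv h0 s1)]" "s' = deliver Al V s1 x (adv h0 s1)" using Suc.prems by auto
  note IH = Suc.IH[OF 1(1)]
  have "fst (x v) = None" if v: "v \<in> V" for v
    using set_Pi_pmf_D[OF assms(1) 1(2)[unfolded choices_def] v] IH assms(2) v by simp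
  moreover have "s' = s" using IH assms(2) 1(4) by (auto simp: deliver_def fun_eq_iff)
  ultimately show ?case using IH 1(3) by auto
qed simp

lemma halted_instance:
  assumes r: "result Al (start Al v (est v) (I v)) = Some (I v)" and V: "V = {v}"
  shows "network_coding Al V est I adv" "0 \<le> B \<Longrightarrow> messages_bounded Al V est I adv B"
    "solves_dissemination Al V est I adv"
    "measure_pmf.prob (execution Al V adv (initial Al est I) t) {(h, s). all_halted Al V s} = 1"
proof -
  let ?s = "initial Al est I"
  have res: "result Al (?s v) = Some (I v)" using r by (simp add: initial_def)
  have E: "s = ?s" "\<forall>(s1, x, E)\<in>set h. \<forall>v\<in>V. fst (x v) = None"
    if "(h, s) \<in> set_pmf (execution Al V adv ?s t)" for h s t
    using halted_execution[of V Al ?s h s adv t] that res V by (auto simp: halted_def)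
  show "network_coding Al V est I adv"
    unfolding network_coding_def
  proof (intro allI ballI, clarify)
    fix t h s assume hs: "(h, s) \<in> set_pmf (execution Al V adv ?s t)"
    have "fst (fst (snd (h ! r)) u) = None" if "r < length h" "u \<in> V" for r u
      using E(2)[OF hs] nth_mem[OF that(1)] that(2) by (auto simp: split_beta)
    moreover have "S \<subseteq> learned src (I u) (heard h u)" if "u \<in> V" "result Al (s u) = Some S" for u S src
      using that E(1)[OF hs] res V by (auto intro: learned.own)
    ultimately show "\<exists>src. (\<forall>g. \<forall>B\<in>set (src g). set B \<subseteq> (\<Union>u\<in>V. I u)) \<and>
        (\<forall>r<length h. \<forall>v\<in>V. \<forall>m. fst (fst (snd (h ! r)) v) = Some m \<longrightarrow>
           set (plain m) \<subseteq> learned src (I v) (heard (take r h) v) \<and>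
           (\<forall>g c p. Packet g c p \<in> set (coded m) \<longrightarrow>
              is_combination (src g) c p \<and> can_combine src (I v) (heard (take r h) v) g c)) \<and>
        (\<forall>v\<in>V. \<forall>S. result Al (s v) = Some S \<longrightarrow> S \<subseteq> learned src (I v) (heard h v))"
      by (intro exI[of _ "\<lambda>_. []"]) simp
  qed
  show "0 \<le> B \<Longrightarrow> messages_bounded Al V est I adv B"
    unfolding messages_bounded_def using E(2) by fastforce
  have "all_halted Al V s" if "(h, s) \<in> set_pmf (execution Al V adv ?s t)" for h s t
    using res V unfolding E(1)[OF that] by (simp add: all_halted_def halted_def)
  then have one: "measure_pmf.prob (execution Al V adv ?s t) {(h, s). all_halted Al V s} = 1" for t
    by (subst measure_pmf.prob_eq_1) (auto simp: AE_measure_pmf_iff)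
  then show "measure_pmf.prob (execution Al V adv ?s t) {(h, s). all_halted Al V s} = 1" .
  show "solves_dissemination Al V est I adv"
    unfolding solves_dissemination_def
  proof (intro conjI allI ballI)
    fix t y assume "y \<in> set_pmf (execution Al V adv ?s t)"
    then have "snd y = ?s" using E(1)[of "fst y" "snd y"] by simp
    then show "case y of (h, s) \<Rightarrow> \<forall>v\<in>V. \<forall>S. result Al (s v) = Some S \<longrightarrow> S = (\<Union>u\<in>V. I u)"
      using res V by (auto simp: split_beta)
  qed (simp add: one)
qed

theorem theorem3:
  fixes a :: real
  assumes "a > 0"
  shows "\<exists>(A :: nat \<Rightarrow> nat \<Rightarrow> algorithm) (C\<^sub>m :: real) (C :: real) (c :: real).
    C\<^sub>m > 0 \<and> C > 0 \<and> c > 0 \<and>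
    (\<forall>(n :: nat) (k :: nat) (b :: nat) (d :: nat) V est I adv.
       dissemination_instance a n k b d V est I \<longrightarrow> is_adversary V adv \<longrightarrow>
         network_coding (A b d) V est I adv \<and>
         messages_bounded (A b d) V est I adv (C\<^sub>m * real b) \<and>
         solves_dissemination (A b d) V est I adv \<and>
         measure_pmf.prob
           (execution (A b d) V adv (initial (A b d) est I)
             (nat \<lfloor>C * min (1 / real b * (real n * real k * real d / real b) + real n * real b)
                          (log 2 (real n) / real b * (real n * real k * real d / real b)
                             + real n * log 2 (real n))\<rfloor>))
           {(h, s). all_halted (A b d) V s}
         \<ge> 1 - real n powr (- c))"
proof -
  define A0 where "A0 = nat \<lceil>a\<rceil>"
  let ?A = "protocol.alg A0" and ?C = "real (8 * (A0 + 8))"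
  have "network_coding (?A b d) V est I adv \<and> messages_bounded (?A b d) V est I adv (?C * real b) \<and>
      solves_dissemination (?A b d) V est I adv \<and>
      1 - real n powr (- 1) \<le> measure_pmf.prob (execution (?A b d) V adv (initial (?A b d) est I)
        (nat \<lfloor>10 ^ 8 * min (1 / real b * (real n * real k * real d / real b) + real n * real b)
          (log 2 (real n) / real b * (real n * real k * real d / real b) + real n * log 2 (real n))\<rfloor>))
        {(h, s). all_halted (?A b d) V s}"
    if inst: "dissemination_instance a n k b d V est I" and adv: "is_adversary V adv"
        for n k b d V est I adv
  proof (cases "b = 0")
    case False
    interpret dynamic A0 b d a n k V est I adv
      using inst adv False by unfold_locales (auto simp: A0_def of_nat_ceiling)
    show ?thesis using network_coding_alg messages_bounded_alg solves_dissemination_alg prob_halted_alg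
        by blast
  next
    case True
    \<comment> \<open>Messages of size zero permit no communication, but
      \<open>log 2 n \<le> b\<close> excludes a second node.\<close>
    have "n = 1"
    proof (rule ccontr)
      assume "n \<noteq> 1"
      then have "1 < n" using inst by (auto simp: dissemination_instance_def)
      then have "0 < log 2 (real n)" by simp
      then show False using inst True by (simp add: dissemination_instance_def)
    qed
    then obtain v where V: "V = {v}" using inst by (auto simp: dissemination_instance_def card_Suc_eq)
    have "I v \<subseteq> {[]}" using inst True V by (auto simp: dissemination_instance_def)
    then have "finite (I v)" using finite_subset by blast
    then have r: "result (?A b d) (start (?A b d) v (est v) (I v)) = Some (I v)"
      using True by (simp add: protocol.alg_def protocol.node_start_def)
    note h = halted_instance[where Al = "?A b d" and V = V and est = est and I = I, OF r V]
    show ?thesis using h(1,3) h(2)[of "?C * real b"] h(4) by simp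
  qed
  then show ?thesis by (intro exI[of _ ?A] exI[of _ ?C] exI[of _ "10 ^ 8"] exI[of _ "1 :: real"]) simp
qed

end
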